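(* Let $d<p\le\infty$, $p\ge2$, $1/p+1/q=1$, $h>0$, $N\in\mathbb Z_+$, and let $M$ be a $d\times d$ dilation matrix. Let $$a_\beta=\frac1{\beta!\,V_h}\int_{B_h}t^\beta\,dt\quad(\beta\in\Delta_{N+1}),\qquad \widetilde\varphi=\sum_{\beta\in\Delta_{N+1}}\overline{a_\beta}(-1)^{[\beta]}D^\beta\delta_0,$$ where $\delta_0$ is the Dirac delta at the origin. Suppose: (i) $\varphi\in\mathcal L_p$, the function $\sum_{k\in\mathbb Z^d}|\widehat\varphi(\xi+k)|^q$ is bounded, and there exists $\delta\in(0,1/2)$ such that $\overline{\widehat\varphi(\xi)}\,\widehat{\widetilde\varphi}(\xi)=1$ a.e. on $\{|\xi|<\delta\}$ and $\widehat\varphi(\xi)=0$ a.e. on $\{|l-\xi|<\delta\}$ for all $l\in\mathbb Z^d\setminus\{\mathbf 0\}$; (ii) $f(x)=\widehat g(-x)$, where $g\in L_q(\mathbb R^d)$ and $g(\xi)=O(|\xi|^{-N-d-\varepsilon})$ as $|\xi|\to\infty$, $\varepsilon>1$. Then for every positive number $\theta$ which is smaller than the modulus of every eigenvalue of $M$ there is a constant $C$ not depending on $j$ such that for all $j\in\mathbb Z_+$ $$\Big\|f-m^{-j/2}\sum_{k\in\mathbb Z^d}\mathrm{Av}_h(f,-M^{-j}k)\,\varphi_{jk}\Big\|_p\le C\,\theta^{-j(N+1)}.$$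
   Context: A dilation matrix is an integer $d\times d$ matrix $M$ all of whose eigenvalues are greater than $1$ in modulus; $m=|\det M|$. $\mathbb Z_+=\{0,1,2,\dots\}$, $\mathbb T^d=[-\frac12,\frac12]^d$, $B_h=\{x\in\mathbb R^d:|x|\le h\}$, $V_h$ is the volume of $B_h$. For $\beta\in\mathbb Z_+^d$, $[\beta]=\beta_1+\dots+\beta_d$, $\beta!=\prod_i\beta_i!$, $t^\beta=\prod_it_i^{\beta_i}$, $D^\beta$ is the corresponding partial derivative; $\Delta_n=\{\beta\in\mathbb Z_+^d:[\beta]<n\}$. The average near a point $y$ of the form $M^{-j}k$, $k\in\mathbb Z^d$ (the dependence on $j$ being implicit), is $$\mathrm{Av}_h(f,y)=\frac{m^j}{V_h}\int_{M^{-j}B_h}f(y+t)\,dt .$$ Fourier transform: $\widehat f(\xi)=\int_{\mathbb R^d}f(x)e^{-2\pi i(x,\xi)}dx$, extended to tempered distributions as usual; thus $\widehat{\widetilde\varphi}(\xi)=\sum_{\beta\in\Delta_{N+1}}\overline{a_\beta}(-1)^{[\beta]}(2\pi i\xi)^\beta$. $\mathcal L_p$ is the space of $f\in L_p(\mathbb R^d)$ with $\big\|\sum_{k\in\mathbb Z^d}|f(\cdot+k)|\big\|_{L_p(\mathbb T^d)}<\infty$. $\varphi_{jk}(x)=m^{j/2}\varphi(M^jx+k)$. *)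

theory Defs
  imports "HOL-Probability.Probability" "HOL-Real_Asymp.Real_Asymp"
begin

section \<open>Multi-indices\<close>

definition mi_abs :: "('n::finite \<Rightarrow> nat) \<Rightarrow> nat" where
  "mi_abs \<beta> = (\<Sum>i\<in>UNIV. \<beta> i)"

definition mi_fact :: "('n::finite \<Rightarrow> nat) \<Rightarrow> real" where
  "mi_fact \<beta> = (\<Prod>i\<in>UNIV. fact (\<beta> i))"

definition mi_pow :: "real ^ 'n::finite \<Rightarrow> ('n \<Rightarrow> nat) \<Rightarrow> real" where
  "mi_pow t \<beta> = (\<Prod>i\<in>UNIV. (t $ i) ^ \<beta> i)"

definition Delta :: "nat \<Rightarrow> ('n::finite \<Rightarrow> nat) set" where
  "Delta n = {\<beta>. mi_abs \<beta> < n}"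

section \<open>Dilation matrices, the integer lattice, averages\<close>

definition complex_eigenvalue :: "real ^ 'n ^ 'n::finite \<Rightarrow> complex \<Rightarrow> bool" where
  "complex_eigenvalue M \<mu> \<longleftrightarrow>
     (\<exists>v. v \<noteq> 0 \<and> (\<chi> i j. complex_of_real (M $ i $ j)) *v v = \<mu> *s v)"

definition dilation_matrix :: "real ^ 'n ^ 'n::finite \<Rightarrow> bool" where
  "dilation_matrix M \<longleftrightarrow>
     (\<forall>i j. M $ i $ j \<in> \<int>) \<and> (\<forall>\<mu>. complex_eigenvalue M \<mu> \<longrightarrow> 1 < cmod \<mu>)"

(* The library's power on vectors is componentwise, hence not the matrix power. *)
primrec matpow :: "real ^ 'n ^ 'n::finite \<Rightarrow> nat \<Rightarrow> real ^ 'n ^ 'n" where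
  "matpow A 0 = mat 1"
| "matpow A (Suc j) = A ** matpow A j"

definition Zd :: "(real ^ 'n::finite) set" where
  "Zd = {k. \<forall>i. k $ i \<in> \<int>}"

definition torus :: "(real ^ 'n::finite) set" where
  "torus = {x. \<forall>i. - 1 / 2 \<le> x $ i \<and> x $ i \<le> 1 / 2}"

definition Av :: "real ^ 'n ^ 'n::finite \<Rightarrow> real \<Rightarrow> nat \<Rightarrow> (real ^ 'n \<Rightarrow> complex) \<Rightarrow> real ^ 'n \<Rightarrow> complex" where
  "Av M h j f y =
     of_real (\<bar>det M\<bar> ^ j / measure lebesgue (cball (0 :: real ^ 'n) h)) *
     (LINT t : ((\<lambda>x. matpow (matrix_inv M) j *v x) ` cball 0 h) | lebesgue. f (y + t))"

definition dil_shift :: "real ^ 'n ^ 'n::finite \<Rightarrow> nat \<Rightarrow> real ^ 'n \<Rightarrow> (real ^ 'n \<Rightarrow> complex) \<Rightarrow> real ^ 'n \<Rightarrow> complex" where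
  "dil_shift M j k \<phi> x = of_real (\<bar>det M\<bar> powr (real j / 2)) * \<phi> (matpow M j *v x + k)"

section \<open>Lebesgue spaces with exponents up to infinity\<close>

(* Power of an extended nonnegative number, used only with exponents r > 0. *)
definition epowr :: "ennreal \<Rightarrow> real \<Rightarrow> ennreal" where
  "epowr x r = (if x = \<infinity> then \<infinity> else ennreal (enn2real x powr r))"

definition eLp_norm :: "'a measure \<Rightarrow> ennreal \<Rightarrow> ('a \<Rightarrow> ennreal) \<Rightarrow> ennreal" where
  "eLp_norm M p F =
     (if p = \<infinity> then esssup M F
      else epowr (\<integral>\<^sup>+x. epowr (F x) (enn2real p) \<partial>M) (1 / enn2real p))"

definition Lp_norm :: "ennreal \<Rightarrow> (real ^ 'n::finite \<Rightarrow> complex) \<Rightarrow> ennreal" where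
  "Lp_norm p f = eLp_norm lebesgue p (\<lambda>x. ennreal (cmod (f x)))"

definition Lp :: "ennreal \<Rightarrow> (real ^ 'n::finite \<Rightarrow> complex) set" where
  "Lp p = {f \<in> borel_measurable lebesgue. Lp_norm p f < \<infinity>}"

definition calLp :: "ennreal \<Rightarrow> (real ^ 'n::finite \<Rightarrow> complex) set" where
  "calLp p = {f \<in> Lp p.
     eLp_norm (lebesgue_on torus) p (\<lambda>x. \<Sum>\<^sub>\<infinity>k\<in>Zd. ennreal (cmod (f (x + k)))) < \<infinity>}"

section \<open>Fourier transform of functions and of tempered distributions\<close>

(* An absolutely convergent integral for the functions it is applied to: calLp p is contained in
   L1 because the torus has measure 1, and a locally q-integrable function decaying faster than
   |xi|^(-d) is integrable. *)
definition fourier :: "(real ^ 'n::finite \<Rightarrow> complex) \<Rightarrow> real ^ 'n \<Rightarrow> complex" where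
  "fourier f \<xi> = (LINT x|lebesgue. f x * exp (- 2 * of_real pi * \<i> * of_real (x \<bullet> \<xi>)))"

definition pderiv1 :: "'n::finite \<Rightarrow> (real ^ 'n \<Rightarrow> complex) \<Rightarrow> real ^ 'n \<Rightarrow> complex" where
  "pderiv1 i u x = vector_derivative (\<lambda>s. u (x + s *\<^sub>R axis i 1)) (at 0)"

primrec pderivs :: "'n::finite list \<Rightarrow> (real ^ 'n \<Rightarrow> complex) \<Rightarrow> real ^ 'n \<Rightarrow> complex" where
  "pderivs [] u = u"
| "pderivs (i # is) u = pderiv1 i (pderivs is u)"

(* The order of differentiation is picked arbitrarily; it is immaterial on smooth functions. *)
definition mi_deriv :: "('n::finite \<Rightarrow> nat) \<Rightarrow> (real ^ 'n \<Rightarrow> complex) \<Rightarrow> real ^ 'n \<Rightarrow> complex" where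
  "mi_deriv \<beta> = pderivs (SOME is. \<forall>i. count_list is i = \<beta> i)"

definition schwartz :: "(real ^ 'n::finite \<Rightarrow> complex) \<Rightarrow> bool" where
  "schwartz u \<longleftrightarrow>
     (\<forall>is. pderivs is u differentiable_on UNIV) \<and>
     (\<forall>is n. bounded (range (\<lambda>x. norm x ^ n * cmod (pderivs is u x))))"

(* Distributions are functionals on functions; only their values on Schwartz functions matter. *)
type_synonym 'n distribution = "(real ^ 'n \<Rightarrow> complex) \<Rightarrow> complex"

definition dirac0 :: "'n::finite distribution" where
  "dirac0 u = u 0"

definition dist_deriv :: "('n::finite \<Rightarrow> nat) \<Rightarrow> 'n distribution \<Rightarrow> 'n distribution" where
  "dist_deriv \<beta> T u = (- 1) ^ mi_abs \<beta> * T (mi_deriv \<beta> u)"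

definition dist_fourier :: "'n::finite distribution \<Rightarrow> 'n distribution" where
  "dist_fourier T u = T (fourier u)"

definition represents :: "(real ^ 'n::finite \<Rightarrow> complex) \<Rightarrow> 'n distribution \<Rightarrow> bool" where
  "represents \<Phi> T \<longleftrightarrow>
     (\<forall>u. schwartz u \<longrightarrow> integrable lebesgue (\<lambda>x. \<Phi> x * u x) \<and> T u = (LINT x|lebesgue. \<Phi> x * u x))"

(* The Fourier transform of T as a function, when it is a continuous function; the latter is then
   unique (represents_unique below). *)
definition dist_fourier_fun :: "'n::finite distribution \<Rightarrow> real ^ 'n \<Rightarrow> complex" where
  "dist_fourier_fun T = (THE \<Phi>. continuous_on UNIV \<Phi> \<and> represents \<Phi> (dist_fourier T))"

definition a_coeff :: "real \<Rightarrow> ('n::finite \<Rightarrow> nat) \<Rightarrow> complex" where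
  "a_coeff h \<beta> = of_real (1 / (mi_fact \<beta> * measure lebesgue (cball (0 :: real ^ 'n) h)) *
     (LINT t : cball (0 :: real ^ 'n) h | lebesgue. mi_pow t \<beta>))"

definition phi_tilde :: "real \<Rightarrow> nat \<Rightarrow> 'n::finite distribution" where
  "phi_tilde h N u =
     (\<Sum>\<beta>\<in>Delta (N + 1). cnj (a_coeff h \<beta>) * (- 1) ^ mi_abs \<beta> * dist_deriv \<beta> dirac0 u)"

section \<open>The Fourier transform of phi tilde in closed form\<close>

(* This section shows that the definite description in dist_fourier_fun is well defined at
   phi_tilde, and evaluates it in dist_fourier_fun_phi_tilde. *)

lemma borel_lebesgue: "f \<in> borel_measurable borel \<Longrightarrow> f \<in> borel_measurable lebesgue"
  by (rule measurable_completion) simp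

lemma integrable_bracket:
  "integrable lebesgue (\<lambda>x :: real ^ 'n::finite. inverse ((1 + (norm x)\<^sup>2) ^ CARD('n)))"
proof -
  have i1: "(\<integral>\<^sup>+x. ennreal (inverse (1 + (x::real)\<^sup>2)) \<partial>lborel) < \<infinity>"
  proof -
    have "integrable lborel (\<lambda>x::real. inverse (1 + x\<^sup>2))"
      using integrable_inverse_1_plus_square by (simp add: set_integrable_def)
    then show ?thesis by (simp add: integrable_iff_bounded add_nonneg_nonneg)
  qed
  have bd: "inverse ((1 + (norm x)\<^sup>2) ^ CARD('n)) \<le> (\<Prod>b\<in>Basis. inverse (1 + (x \<bullet> b)\<^sup>2))" for x :: "real ^ 'n"
  proof -
    have "(\<Prod>b\<in>(Basis::(real^'n) set). 1 + (x \<bullet> b)\<^sup>2) \<le> (\<Prod>b\<in>(Basis::(real^'n) set). 1 + (norm x)\<^sup>2)"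
      by (intro prod_mono) (auto simp: Basis_le_norm abs_le_square_iff[symmetric])
    also have "\<dots> = (1 + (norm x)\<^sup>2) ^ CARD('n)" by simp
    finally have "(\<Prod>b\<in>(Basis::(real^'n) set). 1 + (x \<bullet> b)\<^sup>2) \<le> (1 + (norm x)\<^sup>2) ^ CARD('n)" .
    moreover have "0 < (\<Prod>b\<in>(Basis::(real^'n) set). 1 + (x \<bullet> b)\<^sup>2)"
      by (intro prod_pos) (auto simp: add_pos_nonneg)
    ultimately show ?thesis
      by (simp add: prod_inversef[unfolded o_def] le_imp_inverse_le)
  qed
  have "(\<integral>\<^sup>+x. (\<Prod>b\<in>(Basis::(real^'n) set). ennreal (inverse (1 + (x \<bullet> b)\<^sup>2))) \<partial>lborel)
      = (\<Prod>b\<in>(Basis::(real^'n) set). (\<integral>\<^sup>+x. ennreal (inverse (1 + x\<^sup>2)) \<partial>lborel))"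
    by (rule nn_integral_lborel_prod) auto
  also have "\<dots> < \<infinity>" using i1 by (simp add: power_less_top_ennreal)
  finally have fin: "(\<integral>\<^sup>+x. (\<Prod>b\<in>(Basis::(real^'n) set). ennreal (inverse (1 + (x \<bullet> b)\<^sup>2))) \<partial>lborel) < \<infinity>" .
  have "(\<integral>\<^sup>+x. ennreal (norm (inverse ((1 + (norm (x::real^'n))\<^sup>2) ^ CARD('n)))) \<partial>lborel)
     \<le> (\<integral>\<^sup>+x. (\<Prod>b\<in>(Basis::(real^'n) set). ennreal (inverse (1 + (x \<bullet> b)\<^sup>2))) \<partial>lborel)"
  proof (intro nn_integral_mono)
    fix x :: "real ^ 'n"
    have "norm (inverse ((1 + (norm x)\<^sup>2) ^ CARD('n))) = inverse ((1 + (norm x)\<^sup>2) ^ CARD('n))"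
      by (simp add: add_nonneg_nonneg)
    with bd[of x] show "ennreal (norm (inverse ((1 + (norm x)\<^sup>2) ^ CARD('n)))) \<le> (\<Prod>b\<in>Basis. ennreal (inverse (1 + (x \<bullet> b)\<^sup>2)))"
      by (subst prod_ennreal) (auto intro!: ennreal_leI)
  qed
  with fin have "integrable lborel (\<lambda>x :: real ^ 'n. inverse ((1 + (norm x)\<^sup>2) ^ CARD('n)))"
    by (intro integrableI_bounded) (auto)
  then show ?thesis by (simp add: integrable_completion)
qed

lemma bounded_rangeD: "bounded (range f) \<Longrightarrow> \<exists>B. \<forall>x. f x \<le> (B::real)"
  by (auto simp: bounded_iff dest: abs_le_D1)

lemma integrable_decay:
  fixes v :: "real ^ 'n::finite \<Rightarrow> complex"
  assumes c: "v \<in> borel_measurable lebesgue" and b: "\<And>n. bounded (range (\<lambda>x. norm x ^ n * cmod (v x)))"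
  shows "integrable lebesgue v"
proof -
  obtain C where C: "\<And>n x. norm x ^ n * cmod (v x) \<le> C n"
  proof -
    have "\<forall>n. \<exists>C. \<forall>x. norm x ^ n * cmod (v x) \<le> C"
      using b by (blast dest: bounded_rangeD)
    then show ?thesis using that by (auto dest!: choice)
  qed
  define K where "K = (\<Sum>k\<le>CARD('n). of_nat (CARD('n) choose k) * C (2 * k))"
  have "cmod (v x) \<le> K * inverse ((1 + (norm x)\<^sup>2) ^ CARD('n))" for x
  proof -
    have "(1 + (norm x)\<^sup>2) ^ CARD('n) * cmod (v x) = (\<Sum>k\<le>CARD('n). of_nat (CARD('n) choose k) * ((norm x ^ (2 * k)) * cmod (v x)))"
      using binomial_ring[of "(norm x)\<^sup>2" 1 "CARD('n)"]
      by (simp add: add.commute sum_distrib_right power_mult mult.assoc)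
    also have "\<dots> \<le> K" unfolding K_def by (intro sum_mono mult_left_mono C) auto
    finally have "(1 + (norm x)\<^sup>2) ^ CARD('n) * cmod (v x) \<le> K" .
    moreover have "0 < (1 + (norm x)\<^sup>2) ^ CARD('n)" by (simp add: add_pos_nonneg)
    ultimately have "cmod (v x) \<le> K / (1 + (norm x)\<^sup>2) ^ CARD('n)"
      by (simp only: pos_le_divide_eq mult.commute)
    then show ?thesis by (simp only: divide_inverse)
  qed
  then show ?thesis
    by (intro Bochner_Integration.integrable_bound[OF integrable_mult_right[OF integrable_bracket, of K] c] AE_I2)
       (metis order_trans abs_ge_self real_norm_def)
qed

lemma fourier_kernel_bound:
  "cmod (exp (- 2 * of_real pi * \<i> * of_real (a + s * b)) - exp (- 2 * of_real pi * \<i> * of_real a)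
      - of_real s * (exp (- 2 * of_real pi * \<i> * of_real a) * (- 2 * of_real pi * \<i> * of_real b)))
    \<le> 2 * pi\<^sup>2 * b\<^sup>2 * s\<^sup>2" (is "cmod ?L \<le> _")
proof -
  define y where "y = - 2 * pi * s * b"
  have e: "exp (- 2 * of_real pi * \<i> * of_real (a + s * b))
      = exp (- 2 * of_real pi * \<i> * of_real a) * iexp y"
    by (simp add: y_def mult_exp_exp algebra_simps)
  have "?L = exp (- 2 * of_real pi * \<i> * of_real a) * (iexp y - (\<Sum>k\<le>1. (\<i> * y) ^ k / fact k))"
    unfolding e by (simp add: y_def algebra_simps)
  then have "cmod ?L = cmod (iexp y - (\<Sum>k\<le>1. (\<i> * y) ^ k / fact k))"
    by (simp add: norm_mult)
  also have "\<dots> \<le> \<bar>y\<bar> ^ Suc 1 / fact (Suc 1)" by (rule iexp_approx1)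
  also have "\<dots> = 2 * pi\<^sup>2 * b\<^sup>2 * s\<^sup>2" by (simp add: y_def power2_eq_square abs_mult)
  finally show ?thesis .
qed

lemma fourier_integrable:
  fixes v :: "real ^ 'n::finite \<Rightarrow> complex"
  assumes "integrable lebesgue v"
  shows "integrable lebesgue (\<lambda>x. v x * exp (- 2 * of_real pi * \<i> * of_real (x \<bullet> \<xi>)))"
proof (rule Bochner_Integration.integrable_bound[OF assms])
  have "(\<lambda>x. exp (- 2 * of_real pi * \<i> * of_real (x \<bullet> \<xi>))) \<in> borel_measurable borel"
    by (intro borel_measurable_continuous_onI continuous_intros)
  then have "(\<lambda>x. exp (- 2 * of_real pi * \<i> * of_real (x \<bullet> \<xi>))) \<in> borel_measurable lebesgue"
    by (rule borel_lebesgue)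
  then show "(\<lambda>x. v x * exp (- 2 * of_real pi * \<i> * of_real (x \<bullet> \<xi>))) \<in> borel_measurable lebesgue"
    using assms by (intro borel_measurable_times) auto
qed (simp add: norm_mult)

lemma pderiv1_fourier:
  fixes v :: "real ^ 'n::finite \<Rightarrow> complex"
  assumes v: "integrable lebesgue v" and v1: "integrable lebesgue (\<lambda>x. of_real (x $ i) * v x)"
    and v2: "integrable lebesgue (\<lambda>x. of_real (x $ i) * (of_real (x $ i) * v x))"
  shows "pderiv1 i (fourier v) = fourier (\<lambda>x. - 2 * of_real pi * \<i> * of_real (x $ i) * v x)"
proof
  fix \<xi> :: "real ^ 'n"
  define e where "e = (\<lambda>(x::real^'n) \<eta>. exp (- 2 * of_real pi * \<i> * of_real (x \<bullet> \<eta>)))"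
  define F where "F s = fourier v (\<xi> + s *\<^sub>R axis i 1)" for s
  define w where "w = (\<lambda>x. - 2 * of_real pi * \<i> * of_real (x $ i) * v x)"
  define K where "K = 2 * pi\<^sup>2 * (LINT x|lebesgue. cmod (of_real (x $ i) * (of_real (x $ i) * v x)))"
  have w: "integrable lebesgue w"
    using integrable_mult_right[OF v1, of "- 2 * of_real pi * \<i>"] by (simp add: w_def mult.assoc)
  have i1: "integrable lebesgue (\<lambda>x. v x * e x \<eta>)" for \<eta>
    unfolding e_def by (rule fourier_integrable[OF v])
  have i2: "integrable lebesgue (\<lambda>x. of_real s * (w x * e x \<eta>))" for \<eta> and s :: real
    unfolding e_def by (intro integrable_mult_right fourier_integrable[OF w])
  have bd: "cmod (F s - F 0 - s *\<^sub>R fourier w \<xi>) \<le> K * s\<^sup>2" for s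
  proof -
    have "F s - F 0 - s *\<^sub>R fourier w \<xi> =
       (LINT x|lebesgue. v x * e x (\<xi> + s *\<^sub>R axis i 1)) - (LINT x|lebesgue. v x * e x \<xi>)
        - (LINT x|lebesgue. of_real s * (w x * e x \<xi>))"
      unfolding F_def fourier_def e_def by (simp add: scaleR_conv_of_real)
    also have "\<dots> = (LINT x|lebesgue. v x * e x (\<xi> + s *\<^sub>R axis i 1) - v x * e x \<xi> - of_real s * (w x * e x \<xi>))"
      by (simp only: Bochner_Integration.integral_diff Bochner_Integration.integrable_diff i1 i2)
    also have "cmod \<dots> \<le> (LINT x|lebesgue. 2 * pi\<^sup>2 * s\<^sup>2 * cmod (of_real (x $ i) * (of_real (x $ i) * v x)))"
    proof (rule Bochner_Integration.integral_norm_bound_integral)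
      show "integrable lebesgue (\<lambda>x. v x * e x (\<xi> + s *\<^sub>R axis i 1) - v x * e x \<xi> - of_real s * (w x * e x \<xi>))"
        by (intro Bochner_Integration.integrable_diff i1 i2)
      show "integrable lebesgue (\<lambda>x. 2 * pi\<^sup>2 * s\<^sup>2 * cmod (of_real (x $ i) * (of_real (x $ i) * v x)))"
        using v2 by (intro integrable_mult_right) auto
      fix x :: "real ^ 'n"
      have "v x * e x (\<xi> + s *\<^sub>R axis i 1) - v x * e x \<xi> - of_real s * (w x * e x \<xi>)
        = v x * (e x (\<xi> + s *\<^sub>R axis i 1) - e x \<xi> - of_real s * (e x \<xi> * (- 2 * of_real pi * \<i> * of_real (x $ i))))"
        by (simp add: w_def algebra_simps)
      also have "cmod \<dots> \<le> cmod (v x) * (2 * pi\<^sup>2 * (x $ i)\<^sup>2 * s\<^sup>2)"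
        using fourier_kernel_bound[of "x \<bullet> \<xi>" s "x $ i"]
        unfolding norm_mult[of "v x"] e_def
        by (intro mult_left_mono) (auto simp: inner_add_right inner_axis)
      finally show "cmod (v x * e x (\<xi> + s *\<^sub>R axis i 1) - v x * e x \<xi> - of_real s * (w x * e x \<xi>))
          \<le> 2 * pi\<^sup>2 * s\<^sup>2 * cmod (of_real (x $ i) * (of_real (x $ i) * v x))"
        by (simp add: norm_mult power2_eq_square mult_ac)
    qed
    also have "\<dots> = K * s\<^sup>2" by (simp add: K_def)
    finally show ?thesis .
  qed
  have "(F has_vector_derivative fourier w \<xi>) (at 0)"
    unfolding has_vector_derivative_def has_derivative_at_within
  proof (intro conjI)
    show "bounded_linear (\<lambda>x. x *\<^sub>R fourier w \<xi>)" by (rule bounded_linear_scaleR_left)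
    show "((\<lambda>y. (F y - F 0 - (y - 0) *\<^sub>R fourier w \<xi>) /\<^sub>R norm (y - 0)) \<longlongrightarrow> 0) (at 0)"
    proof (rule Lim_null_comparison[where g="\<lambda>y. K * \<bar>y\<bar>"])
      show "\<forall>\<^sub>F y in at 0. norm ((F y - F 0 - (y - 0) *\<^sub>R fourier w \<xi>) /\<^sub>R norm (y - 0)) \<le> K * \<bar>y\<bar>"
      proof (rule always_eventually, rule allI)
        fix y :: real
        show "norm ((F y - F 0 - (y - 0) *\<^sub>R fourier w \<xi>) /\<^sub>R norm (y - 0)) \<le> K * \<bar>y\<bar>"
        proof (cases "y = 0")
          case False
          have "norm ((F y - F 0 - (y - 0) *\<^sub>R fourier w \<xi>) /\<^sub>R norm (y - 0)) =
              cmod (F y - F 0 - y *\<^sub>R fourier w \<xi>) / \<bar>y\<bar>"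
            by (simp add: divide_inverse_commute)
          also have "\<dots> \<le> K * y\<^sup>2 / \<bar>y\<bar>" by (intro divide_right_mono bd) auto
          also have "\<dots> = K * \<bar>y\<bar>" using False by (simp add: power2_eq_square field_simps abs_if)
          finally show ?thesis .
        qed simp
      qed
      show "((\<lambda>y. K * \<bar>y\<bar>) \<longlongrightarrow> 0) (at 0)" by (auto intro!: tendsto_eq_intros)
    qed
  qed
  then show "pderiv1 i (fourier v) \<xi> = fourier (\<lambda>x. - 2 * of_real pi * \<i> * of_real (x $ i) * v x) \<xi>"
    unfolding pderiv1_def F_def w_def by (intro vector_derivative_at)
qed

definition rapid :: "(real ^ 'n::finite \<Rightarrow> complex) \<Rightarrow> bool" where
  "rapid v \<longleftrightarrow> v \<in> borel_measurable lebesgue \<and> (\<forall>n. bounded (range (\<lambda>x. norm x ^ n * cmod (v x))))"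

lemma rapid_mult:
  fixes v :: "real ^ 'n::finite \<Rightarrow> complex"
  assumes "rapid v"
  shows "rapid (\<lambda>x. of_real (x $ i) * v x)" "rapid (\<lambda>x. c * of_real (x $ i) * v x)"
proof -
  have "rapid (\<lambda>x. c * of_real (x $ i) * v x)" for c
    unfolding rapid_def
  proof (intro conjI allI)
    have "(\<lambda>x. c * of_real (x $ i)) \<in> borel_measurable borel"
      by (intro borel_measurable_continuous_onI continuous_intros)
    then have "(\<lambda>x. c * of_real (x $ i)) \<in> borel_measurable lebesgue"
      by (rule borel_lebesgue)
    then show "(\<lambda>x. c * of_real (x $ i) * v x) \<in> borel_measurable lebesgue"
      using assms unfolding rapid_def by (intro borel_measurable_times[of "\<lambda>x. c * of_real (x $ i)"]) auto
    fix n
    have "bounded (range (\<lambda>x. norm x ^ Suc n * cmod (v x)))" using assms unfolding rapid_def by blast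
    then obtain B where B: "\<And>x. norm x ^ Suc n * cmod (v x) \<le> B"
      by (blast dest: bounded_rangeD)
    have "norm (norm x ^ n * cmod (c * of_real (x $ i) * v x)) \<le> cmod c * B" for x
    proof -
      have "norm (norm x ^ n * cmod (c * of_real (x $ i) * v x)) = cmod c * (norm x ^ n * \<bar>x $ i\<bar> * cmod (v x))"
        by (simp add: norm_mult abs_mult)
      also have "\<dots> \<le> cmod c * (norm x ^ n * norm x * cmod (v x))"
        by (intro mult_left_mono mult_right_mono component_le_norm_cart) auto
      also have "\<dots> \<le> cmod c * B" using B[of x] by (intro mult_left_mono) (auto simp: mult_ac)
      finally show ?thesis .
    qed
    then show "bounded (range (\<lambda>x. norm x ^ n * cmod (c * of_real (x $ i) * v x)))"
      unfolding bounded_iff by blast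
  qed
  from this[of 1] this[of c] show "rapid (\<lambda>x. of_real (x $ i) * v x)" "rapid (\<lambda>x. c * of_real (x $ i) * v x)"
    by auto
qed

lemma rapid_integrable: "rapid v \<Longrightarrow> integrable lebesgue v"
  unfolding rapid_def by (blast intro: integrable_decay)

lemma pderivs_fourier:
  fixes v :: "real ^ 'n::finite \<Rightarrow> complex"
  assumes "rapid v"
  shows "pderivs is (fourier v) = fourier (\<lambda>x. (\<Prod>i\<leftarrow>is. - 2 * of_real pi * \<i> * of_real (x $ i)) * v x)
     \<and> rapid (\<lambda>x. (\<Prod>i\<leftarrow>is. - 2 * of_real pi * \<i> * of_real (x $ i)) * v x)"
proof (induction "is")
  case Nil
  then show ?case using assms by simp
next
  case (Cons i "is")
  let ?w = "\<lambda>x. (\<Prod>i\<leftarrow>is. - 2 * of_real pi * \<i> * of_real (x $ i)) * v x"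
  have r: "rapid ?w" using Cons by blast
  have "pderivs (i # is) (fourier v) = pderiv1 i (fourier ?w)" using Cons by simp
  also have "\<dots> = fourier (\<lambda>x. - 2 * of_real pi * \<i> * of_real (x $ i) * ?w x)"
    by (intro pderiv1_fourier rapid_integrable rapid_mult r)
  finally show ?case using rapid_mult(2)[OF r, of "- 2 * of_real pi * \<i>" i] by (simp add: mult.assoc)
qed

lemma schwartz_rapid: "schwartz u \<Longrightarrow> rapid u"
proof -
  assume u: "schwartz u"
  have "pderivs [] u differentiable_on UNIV" "\<forall>n. bounded (range (\<lambda>x. norm x ^ n * cmod (pderivs [] u x)))"
    using u unfolding schwartz_def by blast+
  then have "continuous_on UNIV u" "\<forall>n. bounded (range (\<lambda>x. norm x ^ n * cmod (u x)))"
    using differentiable_imp_continuous_on by auto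
  moreover from this have "u \<in> borel_measurable lebesgue"
    by (intro borel_lebesgue borel_measurable_continuous_onI)
  ultimately show "rapid u" unfolding rapid_def by auto
qed

lemma ex_count_list: "\<exists>is. \<forall>i::'n::finite. count_list is i = \<beta> i"
proof -
  have "\<exists>is. mset is = Abs_multiset \<beta>" by (rule ex_mset)
  then obtain "is" where "mset is = Abs_multiset \<beta>" by blast
  then have "count (mset is) = \<beta>" by (simp add: Abs_multiset_inverse)
  then show ?thesis by (metis count_mset)
qed

lemma prod_list_count_UNIV:
  fixes f :: "'n::finite \<Rightarrow> 'b::comm_monoid_mult"
  shows "(\<Prod>i\<leftarrow>is. f i) = (\<Prod>i\<in>UNIV. f i ^ count_list is i)"
proof (induction "is")
  case Nil
  then show ?case by simp
next
  case (Cons j "is")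
  have "(\<Prod>i\<in>UNIV. f i ^ count_list (j # is) i) = (\<Prod>i\<in>UNIV. (if j = i then f i else 1) * f i ^ count_list is i)"
    by (intro prod.cong) auto
  also have "\<dots> = f j * (\<Prod>i\<in>UNIV. f i ^ count_list is i)"
    by (simp add: prod.distrib prod.delta)
  finally show ?case using Cons by simp
qed

lemma mi_deriv_fourier:
  fixes v :: "real ^ 'n::finite \<Rightarrow> complex"
  assumes "rapid v"
  shows "mi_deriv \<beta> (fourier v) 0 = (LINT x|lebesgue. (- 2 * of_real pi * \<i>) ^ mi_abs \<beta> * of_real (mi_pow x \<beta>) * v x)"
    and "rapid (\<lambda>x. (- 2 * of_real pi * \<i>) ^ mi_abs \<beta> * of_real (mi_pow x \<beta>) * v x)"
proof -
  define "is" where "is = (SOME is. \<forall>i. count_list is i = \<beta> i)"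
  have c: "count_list is i = \<beta> i" for i
    using someI_ex[OF ex_count_list[of \<beta>]] unfolding is_def by blast
  have *: "(\<Prod>i\<leftarrow>is. - 2 * of_real pi * \<i> * of_real (x $ i)) = (- 2 * of_real pi * \<i>) ^ mi_abs \<beta> * of_real (mi_pow x \<beta>)"
    for x :: "real ^ 'n"
    unfolding prod_list_count_UNIV c mi_abs_def mi_pow_def
    by (simp only: power_mult_distrib prod.distrib power_sum of_real_prod of_real_power)
  show "mi_deriv \<beta> (fourier v) 0 = (LINT x|lebesgue. (- 2 * of_real pi * \<i>) ^ mi_abs \<beta> * of_real (mi_pow x \<beta>) * v x)"
    using pderivs_fourier[OF assms, of "is"] unfolding mi_deriv_def is_def[symmetric] *
    by (simp add: fourier_def)
  show "rapid (\<lambda>x. (- 2 * of_real pi * \<i>) ^ mi_abs \<beta> * of_real (mi_pow x \<beta>) * v x)"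
    using pderivs_fourier[OF assms, of "is"] unfolding * by blast
qed

lemma finite_Delta: "finite (Delta n :: ('n::finite \<Rightarrow> nat) set)"
proof (rule finite_subset)
  show "Delta n \<subseteq> (PiE UNIV (\<lambda>_. {..<n}) :: ('n \<Rightarrow> nat) set)"
  proof
    fix \<beta> :: "'n \<Rightarrow> nat"
    assume "\<beta> \<in> Delta n"
    then have "\<beta> i < n" for i
      unfolding Delta_def mi_abs_def using member_le_sum[of i UNIV \<beta>] by auto
    then show "\<beta> \<in> PiE UNIV (\<lambda>_. {..<n})" by auto
  qed
qed (auto intro: finite_PiE)

lemma represents_phi_tilde_hat:
  "represents (\<lambda>\<xi> :: real ^ 'n::finite. \<Sum>\<beta>\<in>Delta (N + 1).
      cnj (a_coeff h \<beta>) * (- 1) ^ mi_abs \<beta> * (2 * of_real pi * \<i>) ^ mi_abs \<beta> * of_real (mi_pow \<xi> \<beta>))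
    (dist_fourier (phi_tilde h N))"
  unfolding represents_def
proof (intro allI impI)
  fix u :: "real ^ 'n \<Rightarrow> complex"
  assume "schwartz u"
  then have r: "rapid u" by (rule schwartz_rapid)
  define G where "G \<beta> x = (- 2 * of_real pi * \<i>) ^ mi_abs \<beta> * of_real (mi_pow x \<beta>) * u x" for \<beta> and x :: "real ^ 'n"
  have iG: "integrable lebesgue (G \<beta>)" for \<beta>
    unfolding G_def by (intro rapid_integrable mi_deriv_fourier r)
  let ?P = "\<lambda>\<xi> :: real ^ 'n. \<Sum>\<beta>\<in>Delta (N + 1).
      cnj (a_coeff h \<beta>) * (- 1) ^ mi_abs \<beta> * (2 * of_real pi * \<i>) ^ mi_abs \<beta> * of_real (mi_pow \<xi> \<beta>)"
  have m: "(- 2 * of_real pi * \<i>) ^ k = (- 1) ^ k * (2 * of_real pi * \<i> :: complex) ^ k" for k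
    by (simp only: power_mult_distrib[symmetric]) simp
  have sgn: "c * (- 1) ^ k * (- 1) ^ k = c" for c :: complex and k :: nat
    by (simp add: mult.assoc power_mult_distrib[symmetric])
  have P: "?P x * u x = (\<Sum>\<beta>\<in>Delta (N + 1). cnj (a_coeff h \<beta>) * G \<beta> x)" for x
    unfolding sum_distrib_right G_def m by (simp only: mult.assoc)
  have "dist_fourier (phi_tilde h N) u = (\<Sum>\<beta>\<in>Delta (N + 1). cnj (a_coeff h \<beta>) * (LINT x|lebesgue. G \<beta> x))"
    unfolding dist_fourier_def phi_tilde_def dist_deriv_def dirac0_def G_def
    unfolding mi_deriv_fourier[OF r] by (intro sum.cong refl) (simp add: sgn flip: mult.assoc)
  also have "\<dots> = (LINT x|lebesgue. ?P x * u x)"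
    unfolding P using iG by (subst Bochner_Integration.integral_sum) auto
  finally show "integrable lebesgue (\<lambda>x. ?P x * u x) \<and> dist_fourier (phi_tilde h N) u = (LINT x|lebesgue. ?P x * u x)"
    unfolding P using iG by auto
qed


definition gauss :: "real ^ 'n::finite \<Rightarrow> real \<Rightarrow> real ^ 'n \<Rightarrow> real" where
  "gauss a c x = exp (- c * ((x - a) \<bullet> (x - a)))"

lemma poly_dir_deriv:
  assumes "real_polynomial_function p"
  shows "\<exists>p'. real_polynomial_function p' \<and> (\<forall>x. ((\<lambda>s. p (x + s *\<^sub>R e)) has_real_derivative p' x) (at 0))"
  using assms
proof induction
  case (linear f)
  have "((\<lambda>s. f (x + s *\<^sub>R e)) has_real_derivative f e) (at 0)" for x
  proof -
    interpret bounded_linear f by fact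
    have "(\<lambda>s. f (x + s *\<^sub>R e)) = (\<lambda>s. f x + s * f e)" by (simp add: add scaleR)
    then show ?thesis by (auto intro!: derivative_eq_intros)
  qed
  then show ?case by (intro exI[of _ "\<lambda>_. f e"]) auto
next
  case (const c)
  show ?case by (intro exI[of _ "\<lambda>_. 0"]) auto
next
  case (add f g)
  then obtain f' g' where *: "real_polynomial_function f'" "real_polynomial_function g'"
    "\<And>x. ((\<lambda>s. f (x + s *\<^sub>R e)) has_real_derivative f' x) (at 0)"
    "\<And>x. ((\<lambda>s. g (x + s *\<^sub>R e)) has_real_derivative g' x) (at 0)" by blast
  show ?case
    by (intro exI[of _ "\<lambda>x. f' x + g' x"] conjI allI real_polynomial_function.intros(3) DERIV_add *)
next
  case (mult f g)
  then obtain f' g' where *: "real_polynomial_function f'" "real_polynomial_function g'"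
    "\<And>x. ((\<lambda>s. f (x + s *\<^sub>R e)) has_real_derivative f' x) (at 0)"
    "\<And>x. ((\<lambda>s. g (x + s *\<^sub>R e)) has_real_derivative g' x) (at 0)" by blast
  have "((\<lambda>s. f (x + s *\<^sub>R e) * g (x + s *\<^sub>R e)) has_real_derivative f' x * g x + g' x * f x) (at 0)" for x
    using DERIV_mult[OF *(3,4)[of x]] by simp
  then show ?case
    using * mult by (intro exI[of _ "\<lambda>x. f' x * g x + g' x * f x"] conjI allI real_polynomial_function.intros(3,4)) auto
qed

lemma poly_growth:
  assumes "real_polynomial_function p"
  shows "\<exists>C m. 0 \<le> C \<and> (\<forall>x. \<bar>p x\<bar> \<le> C * (1 + norm x) ^ m)"
  using assms
proof induction
  case (linear f)
  then obtain K where K: "0 < K" "\<And>x. norm (f x) \<le> norm x * K" using bounded_linear.pos_bounded by blast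
  have "\<bar>f x\<bar> \<le> K * (1 + norm x) ^ 1" for x
    using K(2)[of x] K(1) by (simp add: algebra_simps)
  then show ?case using K(1) by (intro exI[of _ K] exI[of _ 1]) auto
next
  case (const c)
  show ?case by (intro exI[of _ "\<bar>c\<bar>"] exI[of _ 0]) auto
next
  case (add f g)
  then obtain C m D k where *: "0 \<le> C" "\<And>x. \<bar>f x\<bar> \<le> C * (1 + norm x) ^ m" "0 \<le> D" "\<And>x. \<bar>g x\<bar> \<le> D * (1 + norm x) ^ k"
    by blast
  have "\<bar>f x + g x\<bar> \<le> (C + D) * (1 + norm x) ^ (m + k)" for x
  proof -
    have "\<bar>f x\<bar> \<le> C * (1 + norm x) ^ (m + k)" "\<bar>g x\<bar> \<le> D * (1 + norm x) ^ (m + k)"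
      by (rule order_trans[OF *(2)] order_trans[OF *(4)], intro mult_left_mono power_increasing *, auto)+
    then show ?thesis by (simp add: distrib_right)
  qed
  then show ?case using * by (intro exI[of _ "C + D"] exI[of _ "m + k"]) auto
next
  case (mult f g)
  then obtain C m D k where *: "0 \<le> C" "\<And>x. \<bar>f x\<bar> \<le> C * (1 + norm x) ^ m" "0 \<le> D" "\<And>x. \<bar>g x\<bar> \<le> D * (1 + norm x) ^ k"
    by blast
  have "\<bar>f x * g x\<bar> \<le> (C * D) * (1 + norm x) ^ (m + k)" for x
  proof -
    have "\<bar>f x * g x\<bar> \<le> (C * (1 + norm x) ^ m) * (D * (1 + norm x) ^ k)"
      unfolding abs_mult by (intro mult_mono *) (auto intro!: mult_nonneg_nonneg *)
    then show ?thesis by (simp add: power_add mult_ac)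
  qed
  then show ?case using * by (intro exI[of _ "C * D"] exI[of _ "m + k"]) auto
qed

lemma pderiv1_poly_gauss:
  fixes a :: "real ^ 'n::finite"
  assumes p: "real_polynomial_function p"
  shows "\<exists>p'. real_polynomial_function p' \<and>
    pderiv1 i (\<lambda>x. of_real (p x * gauss a c x)) = (\<lambda>x. of_real (p' x * gauss a c x))"
proof -
  obtain p' where p': "real_polynomial_function p'"
    "\<And>x. ((\<lambda>s. p (x + s *\<^sub>R axis i 1)) has_real_derivative p' x) (at 0)"
    using poly_dir_deriv[OF p] by blast
  define r where "r x = p' x + p x * (- 2 * c * (x $ i + - (a $ i)))" for x
  have "real_polynomial_function r"
    unfolding r_def
    by (intro p' p real_polynomial_function.intros bounded_linear_vec_nth)
  moreover have "pderiv1 i (\<lambda>x. of_real (p x * gauss a c x)) x = of_real (r x * gauss a c x)" for x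
  proof -
    have e: "(y + s *\<^sub>R axis i 1) \<bullet> (y + s *\<^sub>R axis i 1) = y \<bullet> y + 2 * s * y $ i + s * s" for y :: "real ^ 'n" and s
      by (simp add: inner_add_left inner_add_right inner_axis inner_axis' algebra_simps)
    have g: "gauss a c (x + s *\<^sub>R axis i 1) = exp (- c * ((x - a) \<bullet> (x - a) + 2 * s * (x $ i - a $ i) + s * s))" for s
    proof -
      have "(x + s *\<^sub>R axis i 1 - a) \<bullet> (x + s *\<^sub>R axis i 1 - a) = (x - a) \<bullet> (x - a) + 2 * s * (x $ i - a $ i) + s * s"
        using e[of "x - a"] by (simp add: algebra_simps)
      then show ?thesis by (simp add: gauss_def)
    qed
    have "((\<lambda>s. exp (- c * ((x - a) \<bullet> (x - a) + 2 * s * (x $ i - a $ i) + s * s))) has_real_derivative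
        gauss a c x * (- 2 * c * (x $ i - a $ i))) (at 0)"
      by (auto intro!: derivative_eq_intros simp: gauss_def)
    then have "((\<lambda>s. gauss a c (x + s *\<^sub>R axis i 1)) has_real_derivative
        gauss a c x * (- 2 * c * (x $ i - a $ i))) (at 0)" unfolding g .
    from DERIV_mult[OF p'(2)[of x] this]
    have "((\<lambda>s. p (x + s *\<^sub>R axis i 1) * gauss a c (x + s *\<^sub>R axis i 1)) has_real_derivative r x * gauss a c x) (at 0)"
      by (simp add: r_def algebra_simps)
    then have "((\<lambda>s. complex_of_real (p (x + s *\<^sub>R axis i 1) * gauss a c (x + s *\<^sub>R axis i 1)))
        has_vector_derivative of_real (r x * gauss a c x)) (at 0)"
      by (intro has_vector_derivative_of_real) (simp add: has_real_derivative_iff_has_vector_derivative)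
    then show ?thesis unfolding pderiv1_def by (rule vector_derivative_at)
  qed
  ultimately show ?thesis by blast
qed

lemma pderivs_poly_gauss:
  fixes a :: "real ^ 'n::finite"
  shows "\<exists>p. real_polynomial_function p \<and>
    pderivs is (\<lambda>x. of_real (gauss a c x)) = (\<lambda>x. of_real (p x * gauss a c x))"
proof (induction "is")
  case Nil
  show ?case by (intro exI[of _ "\<lambda>_. 1"]) auto
next
  case (Cons i "is")
  then obtain p where "real_polynomial_function p"
    "pderivs is (\<lambda>x. of_real (gauss a c x)) = (\<lambda>x. of_real (p x * gauss a c x))" by blast
  then show ?case using pderiv1_poly_gauss[of p i a c] by simp
qed

lemma gauss_decay:
  fixes a :: "real ^ 'n::finite"
  assumes "1 \<le> c"
  shows "\<exists>B. \<forall>x. (1 + norm x) ^ m * gauss a c x \<le> B"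
proof (intro exI allI)
  fix x :: "real ^ 'n"
  define r where "r = norm (x - a)"
  have r: "0 \<le> r" by (simp add: r_def)
  have "1 + norm x \<le> 1 + (norm a + r)"
    using norm_triangle_ineq[of a "x - a"] by (simp add: r_def)
  also have "\<dots> \<le> (1 + norm a) * (1 + r)" using r by (simp add: algebra_simps)
  finally have 1: "(1 + norm x) ^ m \<le> ((1 + norm a) * (1 + r)) ^ m" by (intro power_mono) auto
  have "(1 + r) ^ m / fact m \<le> exp (1 + r)"
  proof -
    have "(1 + r) ^ m / fact m \<le> (\<Sum>k\<le>m. (1 + r) ^ k / fact k)"
      using r by (intro member_le_sum) auto
    also have "\<dots> \<le> exp (1 + r)"
      unfolding exp_def using r summable_exp_generic[of "1 + r"]
      by (simp add: divide_inverse_commute) (intro sum_le_suminf, auto)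
    finally show ?thesis .
  qed
  then have 2: "(1 + r) ^ m \<le> fact m * exp (1 + r)" by (simp add: field_simps)
  have "1 * (r * r) \<le> c * (r * r)" using assms by (intro mult_right_mono) auto
  moreover have "0 \<le> (r - 1 / 2)\<^sup>2" by simp
  ultimately have 3: "1 + r + - c * (r * r) \<le> 2" by (simp add: power2_eq_square algebra_simps)
  have g: "gauss a c x = exp (- c * (r * r))"
    by (simp add: gauss_def r_def dot_square_norm power2_eq_square)
  have "(1 + norm x) ^ m * gauss a c x \<le> (1 + norm a) ^ m * (fact m * exp (1 + r)) * exp (- c * (r * r))"
    unfolding g
  proof (intro mult_right_mono)
    have "(1 + norm x) ^ m \<le> (1 + norm a) ^ m * (1 + r) ^ m" using 1 by (simp add: power_mult_distrib)
    also have "\<dots> \<le> (1 + norm a) ^ m * (fact m * exp (1 + r))" using 2 by (intro mult_left_mono) auto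
    finally show "(1 + norm x) ^ m \<le> (1 + norm a) ^ m * (fact m * exp (1 + r))" .
  qed auto
  also have "\<dots> = (1 + norm a) ^ m * fact m * exp (1 + r + - c * (r * r))"
    by (simp only: exp_add mult.assoc)
  also have "\<dots> \<le> (1 + norm a) ^ m * fact m * exp 2" using 3 by (intro mult_left_mono) auto
  finally show "(1 + norm x) ^ m * gauss a c x \<le> (1 + norm a) ^ m * fact m * exp 2" .
qed

lemma schwartz_gauss:
  fixes a :: "real ^ 'n::finite"
  assumes c: "1 \<le> c"
  shows "schwartz (\<lambda>x. of_real (gauss a c x))"
  unfolding schwartz_def
proof (intro conjI allI)
  fix "is" :: "'n list"
  obtain p where p: "real_polynomial_function p"
    "pderivs is (\<lambda>x. of_real (gauss a c x)) = (\<lambda>x. of_real (p x * gauss a c x))" using pderivs_poly_gauss by blast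
  have "(\<lambda>x. p x * gauss a c x) differentiable at x" for x
  proof -
    have "p differentiable at x" using p(1)
    proof induction
      case (linear f)
      then show ?case by (rule bounded_linear_imp_differentiable)
    qed auto
    moreover have "(\<lambda>x. exp (- c * ((x - a) \<bullet> (x - a)))) differentiable at x"
      unfolding differentiable_def by (intro exI) (rule derivative_eq_intros refl)+
    ultimately show ?thesis unfolding gauss_def by (rule differentiable_mult)
  qed
  then have "(\<lambda>x. complex_of_real (p x * gauss a c x)) differentiable at x" for x
    unfolding differentiable_def by (metis has_derivative_of_real)
  then show "pderivs is (\<lambda>x. complex_of_real (gauss a c x)) differentiable_on UNIV"
    unfolding p(2) by (auto simp: differentiable_on_def)
  fix n
  obtain C m where C: "0 \<le> C" "\<And>x. \<bar>p x\<bar> \<le> C * (1 + norm x) ^ m" using poly_growth[OF p(1)] by blast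
  obtain B where B: "\<And>x. (1 + norm x) ^ (n + m) * gauss a c x \<le> B" using gauss_decay[OF c] by blast
  have "norm (norm x ^ n * cmod (pderivs is (\<lambda>x. of_real (gauss a c x)) x)) \<le> C * B" for x
  proof -
    have g: "0 \<le> gauss a c x" by (simp add: gauss_def)
    have "norm (norm x ^ n * cmod (pderivs is (\<lambda>x. of_real (gauss a c x)) x)) = norm x ^ n * \<bar>p x\<bar> * gauss a c x"
      unfolding p(2) using g by (simp add: abs_mult norm_mult)
    also have "\<dots> \<le> (1 + norm x) ^ n * (C * (1 + norm x) ^ m) * gauss a c x"
      using g by (intro mult_right_mono mult_mono C power_mono) auto
    also have "\<dots> = C * ((1 + norm x) ^ (n + m) * gauss a c x)" by (simp add: power_add mult_ac)
    also have "\<dots> \<le> C * B" by (intro mult_left_mono B C)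
    finally show ?thesis .
  qed
  then show "bounded (range (\<lambda>x. norm x ^ n * cmod (pderivs is (\<lambda>x. of_real (gauss a c x)) x)))"
    unfolding bounded_iff by blast
qed

lemma gauss_test_zero:
  fixes \<Psi> :: "real ^ 'n::finite \<Rightarrow> complex"
  assumes cont: "continuous_on UNIV \<Psi>"
    and int: "\<And>u. schwartz u \<Longrightarrow> integrable lebesgue (\<lambda>x. \<Psi> x * u x) \<and> (LINT x|lebesgue. \<Psi> x * u x) = 0"
  shows "\<Psi> a = 0"
proof (rule ccontr)
  assume nz: "\<Psi> a \<noteq> 0"
  define r where "r x = Re (cnj (\<Psi> a) * \<Psi> x)" for x
  define c where "c = r a / 2"
  have "r a = (cmod (\<Psi> a))\<^sup>2" unfolding r_def
    by (metis Re_complex_of_real complex_norm_square mult.commute)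
  then have c: "0 < c" using nz by (simp add: c_def)
  have "continuous_on UNIV r" unfolding r_def by (intro continuous_intros cont)
  then have "isCont r a" by (simp add: continuous_on_eq_continuous_at)
  then obtain d where d: "0 < d" "\<And>x. dist x a < d \<Longrightarrow> dist (r x) (r a) < c"
    using c unfolding continuous_at_eps_delta by (metis dist_commute)
  have rc: "c \<le> r x" if "norm (x - a) < d" for x
    using d(2)[of x] that unfolding dist_norm real_norm_def c_def by (simp add: abs_if split: if_splits)
  have ri: "integrable lebesgue (\<lambda>x. r x * gauss a k x)" "(LINT x|lebesgue. r x * gauss a k x) = 0" if "1 \<le> k" for k
  proof -
    have i: "integrable lebesgue (\<lambda>x. \<Psi> x * of_real (gauss a k x))" "(LINT x|lebesgue. \<Psi> x * of_real (gauss a k x)) = 0"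
      using int[OF schwartz_gauss[OF that]] by auto
    have e: "r x * gauss a k x = Re (cnj (\<Psi> a) * (\<Psi> x * of_real (gauss a k x)))" for x
      by (simp add: r_def algebra_simps)
    have i2: "integrable lebesgue (\<lambda>x. cnj (\<Psi> a) * (\<Psi> x * of_real (gauss a k x)))"
      by (intro integrable_mult_right i)
    show "integrable lebesgue (\<lambda>x. r x * gauss a k x)" unfolding e by (intro integrable_Re i2)
    show "(LINT x|lebesgue. r x * gauss a k x) = 0" unfolding e using integral_Re[OF i2] i(2) by simp
  qed
  define V where "V = measure lebesgue (cball a (d / 2))"
  have V: "0 < V" using d(1) unfolding V_def by (simp add: content_cball_pos)
  define K where "K = (LINT x|lebesgue. \<bar>r x * gauss a 1 x\<bar>)"
  have K: "0 \<le> K" unfolding K_def by (intro Bochner_Integration.integral_nonneg) auto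
  have main: "c * exp (- k * (d\<^sup>2 / 4)) * V \<le> exp (- (k - 1) * d\<^sup>2) * K" if k: "1 \<le> k" for k
  proof -
    have pt: "c * exp (- k * (d\<^sup>2 / 4)) * indicat_real (cball a (d / 2)) x
        - exp (- (k - 1) * d\<^sup>2) * \<bar>r x * gauss a 1 x\<bar> \<le> r x * gauss a k x" for x
    proof (cases "norm (x - a) < d")
      case True
      have "c * exp (- k * (d\<^sup>2 / 4)) * indicat_real (cball a (d / 2)) x \<le> r x * gauss a k x"
      proof (cases "x \<in> cball a (d / 2)")
        case True
        then have "norm (x - a) \<le> d / 2" by (simp add: dist_norm norm_minus_commute)
        then have "(norm (x - a))\<^sup>2 \<le> (d / 2)\<^sup>2" by (intro power_mono) auto
        then have "(x - a) \<bullet> (x - a) \<le> d\<^sup>2 / 4" by (simp add: dot_square_norm power_divide)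
        then have "exp (- k * (d\<^sup>2 / 4)) \<le> gauss a k x"
          using k unfolding gauss_def by (simp add: mult_left_mono)
        then have "c * exp (- k * (d\<^sup>2 / 4)) \<le> r x * gauss a k x"
          using rc[OF \<open>norm (x - a) < d\<close>] c by (intro mult_mono) auto
        then show ?thesis using True by simp
      next
        case False
        have "0 \<le> r x * gauss a k x" using rc[OF \<open>norm (x - a) < d\<close>] c by (simp add: gauss_def)
        then show ?thesis using False by simp
      qed
      moreover have "0 \<le> exp (- (k - 1) * d\<^sup>2) * \<bar>r x * gauss a 1 x\<bar>" by simp
      ultimately show ?thesis by linarith
    next
      case False
      then have "d\<^sup>2 \<le> (norm (x - a))\<^sup>2" using d(1) by (intro power_mono) auto
      then have dd: "d\<^sup>2 \<le> (x - a) \<bullet> (x - a)" by (simp add: dot_square_norm)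
      have "gauss a k x = exp (- (k - 1) * ((x - a) \<bullet> (x - a))) * gauss a 1 x"
        unfolding gauss_def by (simp add: algebra_simps flip: exp_add)
      also have "\<dots> \<le> exp (- (k - 1) * d\<^sup>2) * gauss a 1 x"
      proof (intro mult_right_mono)
        have "- (k - 1) * ((x - a) \<bullet> (x - a)) \<le> - (k - 1) * d\<^sup>2"
          using dd k by (intro mult_left_mono_neg) auto
        then show "exp (- (k - 1) * ((x - a) \<bullet> (x - a))) \<le> exp (- (k - 1) * d\<^sup>2)" by (simp only: exp_le_cancel_iff)
      qed (simp add: gauss_def)
      finally have "\<bar>r x\<bar> * gauss a k x \<le> \<bar>r x\<bar> * (exp (- (k - 1) * d\<^sup>2) * gauss a 1 x)"
        by (rule mult_left_mono) (rule abs_ge_zero)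
      moreover have "- (r x * gauss a k x) \<le> \<bar>r x\<bar> * gauss a k x"
        using abs_ge_minus_self[of "r x * gauss a k x"] by (simp add: gauss_def abs_mult)
      moreover have "indicat_real (cball a (d / 2)) x = 0"
        using False d(1) by (auto simp: indicator_def dist_norm norm_minus_commute)
      moreover have "\<bar>r x * gauss a 1 x\<bar> = \<bar>r x\<bar> * gauss a 1 x" by (simp add: gauss_def abs_mult)
      ultimately show ?thesis by (simp add: algebra_simps)
    qed
    have iI: "integrable lebesgue (\<lambda>x. c * exp (- k * (d\<^sup>2 / 4)) * indicat_real (cball a (d / 2)) x)"
      by (intro integrable_mult_right integrable_real_indicator) (use emeasure_bounded_finite[OF bounded_cball] in \<open>auto simp: less_top\<close>)
    have iA: "integrable lebesgue (\<lambda>x. exp (- (k - 1) * d\<^sup>2) * \<bar>r x * gauss a 1 x\<bar>)"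
      by (intro integrable_mult_right integrable_abs ri) auto
    have "(LINT x|lebesgue. c * exp (- k * (d\<^sup>2 / 4)) * indicat_real (cball a (d / 2)) x
        - exp (- (k - 1) * d\<^sup>2) * \<bar>r x * gauss a 1 x\<bar>) \<le> (LINT x|lebesgue. r x * gauss a k x)"
      by (intro integral_mono Bochner_Integration.integrable_diff iI iA ri k pt)
    also have "\<dots> = 0" by (rule ri(2)[OF k])
    finally have "(LINT x|lebesgue. c * exp (- k * (d\<^sup>2 / 4)) * indicat_real (cball a (d / 2)) x)
        - (LINT x|lebesgue. exp (- (k - 1) * d\<^sup>2) * \<bar>r x * gauss a 1 x\<bar>) \<le> 0"
      by (simp only: Bochner_Integration.integral_diff[OF iI iA])
    then show ?thesis by (simp add: V_def K_def)
  qed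
  have "c * V \<le> exp (d\<^sup>2) * K * exp (- k * (3 * d\<^sup>2 / 4))" if "1 \<le> k" for k
  proof -
    have "c * V = exp (k * (d\<^sup>2 / 4)) * (c * exp (- k * (d\<^sup>2 / 4)) * V)"
      by (simp add: exp_minus)
    also have "\<dots> \<le> exp (k * (d\<^sup>2 / 4)) * (exp (- (k - 1) * d\<^sup>2) * K)"
      by (intro mult_left_mono main that) auto
    also have "\<dots> = exp (k * (d\<^sup>2 / 4) + - (k - 1) * d\<^sup>2) * K" by (simp only: exp_add mult.assoc)
    also have "k * (d\<^sup>2 / 4) + - (k - 1) * d\<^sup>2 = d\<^sup>2 + - k * (3 * d\<^sup>2 / 4)" by (simp add: field_simps)
    finally show ?thesis by (simp only: exp_add mult_ac)
  qed
  then have ev: "\<forall>\<^sub>F k in at_top. c * V \<le> exp (d\<^sup>2) * K * exp (- k * (3 * d\<^sup>2 / 4))"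
    by (rule eventually_mono[OF eventually_ge_at_top[of 1]])
  have "((\<lambda>k. exp (d\<^sup>2) * K * exp (- k * (3 * d\<^sup>2 / 4))) \<longlongrightarrow> exp (d\<^sup>2) * K * 0) at_top"
  proof (intro tendsto_mult tendsto_const)
    have "0 < 3 * d\<^sup>2 / 4" using d(1) by simp
    then show "((\<lambda>k. exp (- k * (3 * d\<^sup>2 / 4))) \<longlongrightarrow> 0) at_top"
      by real_asymp
  qed
  from tendsto_lowerbound[OF this ev] have "c * V \<le> 0" by simp
  then show False using c V by (simp add: mult_le_0_iff)
qed

lemma represents_unique:
  assumes "continuous_on UNIV \<Phi>" "continuous_on UNIV \<Phi>'" "represents \<Phi> T" "represents \<Phi>' T"
  shows "\<Phi> = \<Phi>'"
proof
  fix a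
  have "integrable lebesgue (\<lambda>x. (\<Phi> x - \<Phi>' x) * u x) \<and> (LINT x|lebesgue. (\<Phi> x - \<Phi>' x) * u x) = 0"
    if u: "schwartz u" for u
  proof -
    have *: "integrable lebesgue (\<lambda>x. \<Phi> x * u x)" "integrable lebesgue (\<lambda>x. \<Phi>' x * u x)"
      "(LINT x|lebesgue. \<Phi> x * u x) = (LINT x|lebesgue. \<Phi>' x * u x)"
      using assms(3,4) u unfolding represents_def by metis+
    show ?thesis unfolding left_diff_distrib
      using * by (simp add: Bochner_Integration.integral_diff Bochner_Integration.integrable_diff)
  qed
  from gauss_test_zero[OF continuous_on_diff[OF assms(1,2)] this, of a] show "\<Phi> a = \<Phi>' a" by simp
qed

lemma dist_fourier_fun_phi_tilde:
  fixes \<xi> :: "real ^ 'n::finite"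
  shows "dist_fourier_fun (phi_tilde h N) \<xi> =
    (\<Sum>\<beta>\<in>Delta (N + 1).
      cnj (a_coeff h \<beta>) * (- 1) ^ mi_abs \<beta> * (2 * of_real pi * \<i>) ^ mi_abs \<beta> * of_real (mi_pow \<xi> \<beta>))"
    (is "_ = ?P \<xi>")
proof -
  have "continuous_on UNIV ?P"
    unfolding mi_pow_def by (intro continuous_intros)
  then have "dist_fourier_fun (phi_tilde h N) = ?P"
    unfolding dist_fourier_fun_def
    using represents_phi_tilde_hat[of h N] by (blast intro!: the_equality dest: represents_unique)
  then show ?thesis by (rule fun_cong)
qed

end

theory Submission
  imports Defs "HOL-Computational_Algebra.Fundamental_Theorem_Algebra"
begin

text \<open>
  Dilating by \<open>M\<^sup>j\<close> turns the claim into an estimate for integer shifts of \<open>\<phi>\<close>, applied to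
  \<open>G \<eta> = m\<^sup>j g (M\<^sup>T\<^sup>j \<eta>)\<close>; since \<open>M\<close> expands lengths by \<open>\<theta>\<^sup>j\<close> up to a constant, the moment
  \<open>\<parallel>|\<eta>|\<^sup>N\<^sup>+\<^sup>1 G\<parallel>\<^sub>q\<close> carries the rate. There the averages of \<open>f\<close> become Fourier coefficients of \<open>G\<close> times the
  ball mean, the transform of the normalised indicator of the ball. Pair the error with a continuous compactly
  supported \<open>\<psi>\<close>: by Poisson summation the pairing equals the integral of \<open>G\<close> times the transform of \<open>\<psi>\<close> minus
  the ball mean times the periodization of the transform of \<open>\<phi>\<close> times that of \<open>\<psi>\<close>. On \<open>|\<xi>| < \<delta>\<close> only the
  central lattice point contributes, and since \<open>\<phi>\<close> inverts the Taylor polynomial of the ball mean of degree \<open>N\<close> there,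
  the error is \<open>O(|\<xi>|\<^sup>N\<^sup>+\<^sup>1)\<close>. Elsewhere \<open>1 \<le> (|\<xi>| / \<delta>)\<^sup>N\<^sup>+\<^sup>1\<close>, and Hoelder's inequality
  over the lattice, where \<open>p > d\<close> makes the weights \<open>|\<xi> + k|\<^sup>-\<^sup>p\<^sup>(\<^sup>N\<^sup>+\<^sup>1\<^sup>)\<close> summable, controls the periodization. Both
  parts are bounded by \<open>\<parallel>\<psi>\<parallel>\<^sub>q\<close> through the Hausdorff-Young inequality, so duality bounds the \<open>L\<^sub>p\<close> norm of the error.
\<close>

section \<open>Fourier integrals and Gaussian summability\<close>

text \<open>The transform of \<open>\<phi>\<close> is only known to lie in \<open>L_q\<close>, and
  the series of shifts is only locally integrable. Pairing with a test function repairs both: the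
  product \<open>hat_product\<close> of the two transforms is integrable by Hoelder's inequality and
  the Hausdorff-Young inequality (this is where \<open>p \<ge> 2\<close> enters), and its lattice
  Fourier coefficients equal integrals of shifts of \<open>\<phi>\<close> over a compact set, hence
  are absolutely summable. Those two facts are what an almost everywhere Poisson formula asks for.
  The condition \<open>\<epsilon> > 1\<close> leaves \<open>|\<xi>|^(N+1) g\<close> with decay of
  order \<open>d + \<epsilon> - 1 > d\<close>, so that \<open>g\<close> is integrable and the moment
  is finite. Strictness of \<open>\<theta> < |\<mu>|\<close> leaves room for the polynomial factors
  which Jordan blocks contribute to the powers of \<open>M\<close>. The two determinant factors,
  \<open>m^(j(1-1/q))\<close> from the dilation of \<open>g\<close> and \<open>m^(-j/p)\<close> from
  the change of variables in the \<open>L_p\<close> norm, cancel; only the contraction rate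
  survives.\<close>

definition ek :: "'a::euclidean_space \<Rightarrow> 'a \<Rightarrow> complex" where
  "ek x \<xi> = cis (2 * pi * (x \<bullet> \<xi>))"

(* The kernel has the sign opposite to that of fourier: fourier f x = fi f (- x), see fourier_eq_fi. *)
definition fi :: "('a::euclidean_space \<Rightarrow> complex) \<Rightarrow> 'a \<Rightarrow> complex" where
  "fi f \<xi> = (LINT x|lborel. f x * ek x \<xi>)"

lemma norm_ek [simp]: "cmod (ek x \<xi>) = 1"
  by (simp add: ek_def)

lemma ek_zero [simp]: "ek 0 \<xi> = 1" "ek x 0 = 1"
  by (simp_all add: ek_def)

lemma ek_add: "ek (x + y) \<xi> = ek x \<xi> * ek y \<xi>"
  by (simp add: ek_def inner_add_left distrib_left cis_mult)

lemma ek_add_right: "ek x (\<xi> + \<eta>) = ek x \<xi> * ek x \<eta>"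
  by (simp add: ek_def inner_add_right distrib_left cis_mult)

lemma ek_minus_right: "ek x (- \<xi>) = ek (- x) \<xi>"
  by (simp add: ek_def)

lemma ek_commute: "ek x \<xi> = ek \<xi> x"
  by (simp add: ek_def inner_commute)

lemma cnj_ek: "cnj (ek x \<xi>) = ek (- x) \<xi>"
  by (simp add: ek_def flip: cis_cnj)

lemma ek_minus_cancel: "ek (- x) \<xi> * ek x \<xi> = 1" "ek x \<xi> * ek (- x) \<xi> = 1"
  by (simp_all add: ek_def cis_mult)

lemma continuous_on_ek [continuous_intros]:
  "continuous_on S f \<Longrightarrow> continuous_on S g \<Longrightarrow> continuous_on S (\<lambda>x. ek (f x) (g x))"
  unfolding ek_def cis_conv_exp by (intro continuous_intros)

lemma measurable_ek [measurable (raw)]: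
  fixes f g :: "'b \<Rightarrow> 'a::euclidean_space"
  assumes [measurable]: "f \<in> borel_measurable M" "g \<in> borel_measurable M"
  shows "(\<lambda>x. ek (f x) (g x)) \<in> borel_measurable M"
proof -
  have "continuous_on UNIV (\<lambda>z::'a \<times> 'a. ek (fst z) (snd z))"
    by (intro continuous_intros)
  from borel_measurable_continuous_on[OF this, of "\<lambda>x. (f x, g x)" M] show ?thesis by simp
qed

lemma fi_measurable [measurable (raw)]:
  assumes [measurable]: "f \<in> borel_measurable borel" "g \<in> borel_measurable M"
  shows "(\<lambda>x. fi f (g x)) \<in> borel_measurable M"
proof -
  have "fi f \<in> borel_measurable borel" unfolding fi_def by measurable
  then show ?thesis using assms(2) by measurable
qed

text \<open>A non-integrable function has Bochner integral 0 by convention, so the estimate covers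
  that case too.\<close>

lemma norm_integral_le_nn_integral:
  fixes f :: "'a \<Rightarrow> 'b::{banach, second_countable_topology}"
  shows "ennreal (norm (integral\<^sup>L M f)) \<le> (\<integral>\<^sup>+x. ennreal (norm (f x)) \<partial>M)"
  by (cases "integrable M f") (auto intro: integral_norm_bound_ennreal simp: not_integrable_integral_eq)

lemma integrable_times_bounded:
  assumes f: "integrable lborel f" and [measurable]: "h \<in> borel_measurable borel" and h: "\<And>x. cmod (h x) \<le> B"
  shows "integrable lborel (\<lambda>x. f x * h x)"
proof (rule Bochner_Integration.integrable_bound)
  show "integrable lborel (\<lambda>x. B * cmod (f x))" using f by auto
  have [measurable]: "f \<in> borel_measurable borel" using f by auto
  show "(\<lambda>x. f x * h x) \<in> borel_measurable lborel" by measurable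
  show "AE x in lborel. cmod (f x * h x) \<le> norm (B * cmod (f x))"
  proof (rule AE_I2)
    fix x show "cmod (f x * h x) \<le> norm (B * cmod (f x))"
      using mult_right_mono[OF order_trans[OF h[of x] abs_ge_self], of "cmod (f x)"] by (simp add: norm_mult abs_mult mult_ac)
  qed
qed

lemma integrable_ek:
  assumes f: "integrable lborel f"
  shows "integrable lborel (\<lambda>x. f x * ek x \<xi>)"
  by (rule integrable_times_bounded[OF f, where B=1]) auto

lemma norm_fi_le: "cmod (fi f \<xi>) \<le> (LINT x|lborel. cmod (f x))"
  unfolding fi_def using integral_norm_bound[of lborel "\<lambda>x. f x * ek x \<xi>"] by (simp add: norm_mult)

lemma fi_diff:
  assumes "integrable lborel f" "integrable lborel g"
  shows "fi (\<lambda>x. f x - g x) \<xi> = fi f \<xi> - fi g \<xi>"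
  unfolding fi_def by (simp add: left_diff_distrib integrable_ek assms Bochner_Integration.integral_diff)

lemma fi_cong_AE:
  assumes "AE x in lborel. f x = g x" "f \<in> borel_measurable borel" "g \<in> borel_measurable borel"
  shows "fi f \<xi> = fi g \<xi>"
  unfolding fi_def using assms by (intro integral_cong_AE) auto

lemma continuous_fi:
  fixes f :: "'a::euclidean_space \<Rightarrow> complex"
  assumes f: "integrable lborel f"
  shows "continuous_on UNIV (fi f)"
proof -
  have [measurable]: "f \<in> borel_measurable borel" using f by auto
  have "(\<lambda>n. fi f (x n)) \<longlonglongrightarrow> fi f a" if x: "x \<longlonglongrightarrow> a" for x and a :: 'a
    unfolding fi_def
  proof (rule integral_dominated_convergence[where w="\<lambda>x. cmod (f x)"])
    show "AE y in lborel. (\<lambda>n. f y * ek y (x n)) \<longlonglongrightarrow> f y * ek y a"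
    proof (intro AE_I2 tendsto_mult tendsto_const)
      fix y :: 'a
      have "continuous_on UNIV (ek y)" by (intro continuous_intros)
      then show "(\<lambda>n. ek y (x n)) \<longlonglongrightarrow> ek y a" using x
        by (simp add: continuous_on_eq_continuous_at isCont_tendsto_compose)
    qed
  qed (use f in \<open>auto simp: norm_mult\<close>)
  then show ?thesis by (auto simp: continuous_on_sequentially o_def)
qed

text \<open>Fubini, because the kernel is symmetric in its two arguments. The scalar
  \<open>c\<close> allows both signs of the kernel, \<open>1\<close> and \<open>- 1\<close>, in
  \<open>gaussian_parseval\<close>.\<close>

lemma fi_multiplication:
  fixes w h :: "'a::euclidean_space \<Rightarrow> complex"
  assumes w: "integrable lborel w" and h: "integrable lborel h"
  shows "(LINT \<xi>|lborel. w \<xi> * fi h (c *\<^sub>R \<xi>)) = (LINT z|lborel. h z * fi w (c *\<^sub>R z))"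
proof -
  have [measurable]: "w \<in> borel_measurable borel" "h \<in> borel_measurable borel" using w h by auto
  define k where "k = (\<lambda>(\<xi>, z). w \<xi> * (h z * ek z (c *\<^sub>R \<xi>)))"
  have [measurable]: "k \<in> borel_measurable (lborel \<Otimes>\<^sub>M lborel)" unfolding k_def by measurable
  have i: "integrable (lborel \<Otimes>\<^sub>M lborel) k"
  proof (rule lborel_pair.Fubini_integrable)
    have "(\<lambda>x. LINT y|lborel. norm (k (x, y))) = (\<lambda>x. cmod (w x) * (LINT y|lborel. cmod (h y)))"
      by (simp add: k_def norm_mult)
    then show "integrable lborel (\<lambda>x. LINT y|lborel. norm (k (x, y)))" using w by simp
    show "AE x in lborel. integrable lborel (\<lambda>y. k (x, y))"
      unfolding k_def using integrable_ek[OF h] by auto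
  qed measurable
  have e: "ek x (c *\<^sub>R y) = ek y (c *\<^sub>R x)" for x y :: 'a by (simp add: ek_def inner_commute)
  have "(LINT \<xi>|lborel. w \<xi> * fi h (c *\<^sub>R \<xi>)) = (LINT \<xi>|lborel. LINT z|lborel. k (\<xi>, z))"
    unfolding k_def fi_def by simp
  also have "\<dots> = (LINT z|lborel. LINT \<xi>|lborel. k (\<xi>, z))"
    using lborel_pair.Fubini_integral[of "\<lambda>\<xi> z. k (\<xi>, z)"] i by simp
  also have "\<dots> = (LINT z|lborel. h z * fi w (c *\<^sub>R z))"
    unfolding k_def fi_def prod.case
    by (intro Bochner_Integration.integral_cong refl) (simp add: e mult.left_commute[of _ "h _"])
  finally show ?thesis .
qed

section \<open>Invariance of Lebesgue measure and integrals of products\<close>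

lemma lborel_distr_uminus_euclidean: "distr lborel borel uminus = (lborel :: 'a::euclidean_space measure)"
  by (subst lborel_affine[of "-1" 0]) (auto simp: density_1 one_ennreal_def[symmetric])

lemma nn_integral_lborel_translate:
  assumes [measurable]: "f \<in> borel_measurable borel"
  shows "(\<integral>\<^sup>+x. f (a + x) \<partial>lborel) = (\<integral>\<^sup>+x. f (x :: 'a::euclidean_space) \<partial>lborel)"
  by (subst (2) lborel_distr_plus[symmetric, of a], subst nn_integral_distr) auto

lemma nn_integral_lborel_uminus:
  assumes [measurable]: "f \<in> borel_measurable borel"
  shows "(\<integral>\<^sup>+x. f (- x) \<partial>lborel) = (\<integral>\<^sup>+x. f (x :: 'a::euclidean_space) \<partial>lborel)"
  by (subst (2) lborel_distr_uminus_euclidean[symmetric], subst nn_integral_distr) auto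

lemma integral_lborel_translate:
  fixes f :: "'a::euclidean_space \<Rightarrow> 'b::{banach, second_countable_topology}"
  assumes [measurable]: "f \<in> borel_measurable borel"
  shows "(LINT x|lborel. f (a + x)) = (LINT x|lborel. f x)"
  by (subst (2) lborel_distr_plus[symmetric, of a], subst integral_distr) auto

lemma integral_lborel_prod:
  fixes f :: "'a::euclidean_space \<Rightarrow> real \<Rightarrow> complex"
  assumes i: "\<And>b. b \<in> Basis \<Longrightarrow> integrable lborel (f b)"
  shows "(LINT x|lborel. (\<Prod>b\<in>Basis. f b (x \<bullet> b))) = (\<Prod>b\<in>Basis. LINT x|lborel. f b x)"
proof -
  interpret product_sigma_finite "\<lambda>_. lborel :: real measure" ..
  have [measurable]: "f b \<in> borel_measurable borel" if "b \<in> Basis" for b using i[OF that] by auto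
  show ?thesis
    by (subst lborel_eq, subst integral_distr) (auto simp: product_integral_prod i)
qed

text \<open>The centred Gaussian density with standard deviation \<open>s\<close> in every
  coordinate: an approximate identity as \<open>s\<close> tends to 0.\<close>

definition gauss_kernel :: "real \<Rightarrow> 'a::euclidean_space \<Rightarrow> real" where
  "gauss_kernel s z = (\<Prod>b\<in>Basis. normal_density 0 s (z \<bullet> b))"

text \<open>Chosen so that its transform is \<open>gauss_kernel s\<close>, see
  \<open>fi_gauss_weight\<close>. As \<open>s\<close> tends to 0 it increases to 1, which removes
  the damping.\<close>

definition gauss_weight :: "real \<Rightarrow> 'a::euclidean_space \<Rightarrow> real" where
  "gauss_weight s \<xi> = exp (- (2 * pi * s)\<^sup>2 * (\<xi> \<bullet> \<xi>) / 2)"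

lemma gauss_kernel_nonneg [simp]: "0 \<le> gauss_kernel s z"
  unfolding gauss_kernel_def by (intro prod_nonneg) auto

lemma gauss_kernel_measurable [measurable]: "gauss_kernel s \<in> borel_measurable borel"
  unfolding gauss_kernel_def by measurable

lemma gauss_kernel_minus: "gauss_kernel s (- z) = gauss_kernel s z"
  by (simp add: gauss_kernel_def normal_density_def)

lemma nn_integral_gauss_kernel:
  assumes "0 < s" shows "(\<integral>\<^sup>+z. ennreal (gauss_kernel s (z::'a::euclidean_space)) \<partial>lborel) = 1"
proof -
  have 1: "(\<integral>\<^sup>+x. ennreal (normal_density 0 s x) \<partial>lborel) = 1"
    using assms by (subst nn_integral_eq_integral) auto
  have "(\<integral>\<^sup>+z. ennreal (gauss_kernel s (z::'a)) \<partial>lborel) = (\<integral>\<^sup>+z. (\<Prod>b\<in>Basis. ennreal (normal_density 0 s ((z::'a) \<bullet> b))) \<partial>lborel)"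
    unfolding gauss_kernel_def by (subst prod_ennreal) auto
  also have "\<dots> = (\<Prod>b\<in>(Basis::'a set). (\<integral>\<^sup>+x. ennreal (normal_density 0 s x) \<partial>lborel))"
    by (rule nn_integral_lborel_prod) auto
  finally show ?thesis by (simp add: 1)
qed

lemma integrable_gauss_kernel: "0 < s \<Longrightarrow> integrable lborel (gauss_kernel s :: 'a::euclidean_space \<Rightarrow> real)"
  by (rule integrableI_nn_integral_finite[where x=1]) (auto simp: nn_integral_gauss_kernel)

lemma gauss_weight_prod: "gauss_weight s \<xi> = (\<Prod>b\<in>Basis. exp (- (2 * pi * s * (\<xi> \<bullet> b))\<^sup>2 / 2))"
proof -
  have "\<xi> \<bullet> \<xi> = (\<Sum>b\<in>Basis. (\<xi> \<bullet> b) * (\<xi> \<bullet> b))" by (rule euclidean_inner)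
  then show ?thesis
    unfolding gauss_weight_def by (simp add: exp_sum[symmetric] sum_distrib_left sum_divide_distrib power2_eq_square sum_negf mult_ac)
qed

lemma gauss_weight_measurable [measurable]: "gauss_weight s \<in> borel_measurable borel"
  unfolding gauss_weight_def by measurable

lemma gauss_weight_bounds: "0 \<le> gauss_weight s \<xi>" "gauss_weight s \<xi> \<le> 1"
  by (auto simp: gauss_weight_def)

text \<open>A Gaussian weight is a multiple of the kernel with reciprocal width. This serves to
  transfer integrability, so the factor stays unspecified.\<close>

lemma gauss_weight_eq_gauss_kernel:
  assumes "0 < s"
  shows "\<exists>c\<ge>0. \<forall>\<xi>::'a::euclidean_space. gauss_weight s \<xi> = c * gauss_kernel (1 / (2 * pi * s)) \<xi>"
proof (intro exI conjI allI)
  define t where "t = 1 / (2 * pi * s)"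
  have t: "0 < t" using assms by (simp add: t_def)
  have *: "exp (- (2 * pi * s * x)\<^sup>2 / 2) = sqrt (2 * pi * t\<^sup>2) * normal_density 0 t x" for x
    using t assms unfolding normal_density_def by (simp add: t_def field_simps)
  show "gauss_weight s \<xi> = sqrt (2 * pi * t\<^sup>2) ^ DIM('a) * gauss_kernel (1 / (2 * pi * s)) \<xi>" for \<xi> :: 'a
    unfolding gauss_weight_prod * gauss_kernel_def t_def[symmetric] by (simp add: prod.distrib)
  show "0 \<le> sqrt (2 * pi * t\<^sup>2) ^ DIM('a)" by simp
qed

lemma integrable_gauss_weight: "0 < s \<Longrightarrow> integrable lborel (gauss_weight s :: 'a::euclidean_space \<Rightarrow> real)"
proof -
  assume s: "0 < s"
  then obtain c where c: "\<And>\<xi>::'a. gauss_weight s \<xi> = c * gauss_kernel (1 / (2 * pi * s)) \<xi>" using gauss_weight_eq_gauss_kernel by blast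
  have "0 < 1 / (2 * pi * s)" using s by simp
  from integrable_gauss_kernel[OF this] show ?thesis unfolding c[abs_def] by (intro integrable_mult_right)
qed

text \<open>Rescaling by \<open>2 * pi * s\<close> turns the integral into the characteristic
  function of the standard normal distribution at \<open>y / s\<close>.\<close>

lemma fourier_gaussian_real:
  assumes s: "0 < s"
  shows "(LINT x|lborel. of_real (exp (- (2 * pi * s * x)\<^sup>2 / 2)) * cis (2 * pi * (y * x))) = of_real (normal_density 0 s y)"
proof -
  define c where "c = 2 * pi * s"
  have c: "c \<noteq> 0" "0 < c" using s by (auto simp: c_def)
  have "(LINT x|lborel. of_real (std_normal_density x) * iexp (y / s * x)) = of_real (exp (- (y / s)\<^sup>2 / 2))"
    using fun_cong[OF char_std_normal_distribution, of "y / s"] unfolding char_def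
    by (subst (asm) integral_density) (auto simp: scaleR_conv_of_real)
  then have "of_real (exp (- (y / s)\<^sup>2 / 2)) = \<bar>c\<bar> *\<^sub>R (LINT x|lborel. of_real (std_normal_density (0 + c * x)) * iexp (y / s * (0 + c * x)))"
    using lborel_integral_real_affine[OF c(1), of "\<lambda>x. of_real (std_normal_density x) * iexp (y / s * x)" 0] by simp
  also have "(\<lambda>x. of_real (std_normal_density (0 + c * x)) * iexp (y / s * (0 + c * x)))
     = (\<lambda>x. of_real (1 / sqrt (2 * pi)) * (of_real (exp (- (2 * pi * s * x)\<^sup>2 / 2)) * cis (2 * pi * (y * x))))"
    using s by (auto simp: fun_eq_iff c_def normal_density_def cis_conv_exp mult_ac)
  finally have "of_real (exp (- (y / s)\<^sup>2 / 2)) = of_real (c / sqrt (2 * pi)) *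
     (LINT x|lborel. of_real (exp (- (2 * pi * s * x)\<^sup>2 / 2)) * cis (2 * pi * (y * x)))"
    using c by (simp add: scaleR_conv_of_real)
  then have "(LINT x|lborel. of_real (exp (- (2 * pi * s * x)\<^sup>2 / 2)) * cis (2 * pi * (y * x)))
    = of_real (exp (- (y / s)\<^sup>2 / 2) / (c / sqrt (2 * pi)))" using c by (simp add: field_simps)
  also have "exp (- (y / s)\<^sup>2 / 2) / (c / sqrt (2 * pi)) = normal_density 0 s y"
  proof -
    have *: "sqrt (2 * pi) / c = 1 / sqrt (2 * pi * s\<^sup>2)"
      using s unfolding c_def by (simp add: real_sqrt_mult field_simps)
    have "exp (- (y / s)\<^sup>2 / 2) / (c / sqrt (2 * pi)) = sqrt (2 * pi) / c * exp (- (y / s)\<^sup>2 / 2)"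
      using c by (simp add: field_simps)
    then show ?thesis unfolding * by (simp add: normal_density_def power_divide mult.commute)
  qed
  finally show ?thesis .
qed

lemma fi_gauss_weight:
  assumes s: "0 < s"
  shows "fi (\<lambda>\<xi>. of_real (gauss_weight s \<xi>)) z = of_real (gauss_kernel s z)"
proof -
  have e: "ek \<xi> z = (\<Prod>b\<in>Basis. cis (2 * pi * ((z \<bullet> b) * (\<xi> \<bullet> b))))" for \<xi>
    unfolding ek_def cis_conv_exp
    by (subst euclidean_inner) (simp add: exp_sum[symmetric] sum_distrib_left sum_distrib_right mult_ac)
  have i: "integrable lborel (\<lambda>x. complex_of_real (exp (- (2 * pi * s * x)\<^sup>2 / 2)) * cis (2 * pi * ((z \<bullet> b) * x)))" for b
  proof -
    have "integrable lborel (\<lambda>x::real. complex_of_real (gauss_weight s x) * ek x (z \<bullet> b))"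
      by (intro integrable_ek integrable_of_real integrable_gauss_weight s)
    then show ?thesis by (simp add: gauss_weight_def ek_def power2_eq_square mult_ac)
  qed
  have "fi (\<lambda>\<xi>. of_real (gauss_weight s \<xi>)) z =
     (LINT \<xi>|lborel. (\<Prod>b\<in>Basis. of_real (exp (- (2 * pi * s * (\<xi> \<bullet> b))\<^sup>2 / 2)) * cis (2 * pi * ((z \<bullet> b) * (\<xi> \<bullet> b)))))"
    unfolding fi_def gauss_weight_prod e by (simp add: prod.distrib)
  also have "\<dots> = (\<Prod>b\<in>Basis. of_real (normal_density 0 s (z \<bullet> b)))"
    by (subst integral_lborel_prod[OF i]) (simp only: fourier_gaussian_real[OF s])
  finally show ?thesis by (simp add: gauss_kernel_def)
qed

text \<open>The weight makes the frequency integral absolutely convergent for any two integrable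
  functions. Two uses of the multiplication formula move the transforms away, the first off
  \<open>f\<close>, the second off \<open>h\<close>, and leave the transform of the weight at
  \<open>x - z\<close>.\<close>

lemma gaussian_parseval:
  fixes f h :: "'a::euclidean_space \<Rightarrow> complex"
  assumes f: "integrable lborel f" and h: "integrable lborel h" and s: "0 < s"
  shows "(LINT \<xi>|lborel. fi f \<xi> * fi h (- \<xi>) * of_real (gauss_weight s \<xi>)) =
    (LINT x|lborel. f x * (LINT z|lborel. h z * of_real (gauss_kernel s (x - z))))"
proof -
  have [measurable]: "f \<in> borel_measurable borel" "h \<in> borel_measurable borel" using f h by auto
  have ig: "integrable lborel (\<lambda>\<xi>. complex_of_real (gauss_weight s \<xi>))" by (intro integrable_of_real integrable_gauss_weight s)
  define v where "v \<xi> = of_real (gauss_weight s \<xi>) * fi h (- \<xi>)" for \<xi> :: 'a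
  have v: "integrable lborel v" unfolding v_def
    by (intro integrable_times_bounded[OF ig]) (auto intro: norm_fi_le)
  have "(LINT \<xi>|lborel. fi f \<xi> * fi h (- \<xi>) * of_real (gauss_weight s \<xi>)) = (LINT \<xi>|lborel. v \<xi> * fi f (1 *\<^sub>R \<xi>))"
    by (simp add: v_def mult_ac)
  also have "\<dots> = (LINT x|lborel. f x * fi v (1 *\<^sub>R x))" by (rule fi_multiplication[OF v f])
  also have "(\<lambda>x. fi v (1 *\<^sub>R x)) = (\<lambda>x. LINT z|lborel. h z * of_real (gauss_kernel s (x - z)))"
  proof
    fix x :: 'a
    have iw: "integrable lborel (\<lambda>\<xi>. of_real (gauss_weight s \<xi>) * ek \<xi> x)" by (rule integrable_ek[OF ig])
    have "fi v (1 *\<^sub>R x) = (LINT \<xi>|lborel. of_real (gauss_weight s \<xi>) * ek \<xi> x * fi h ((-1) *\<^sub>R \<xi>))"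
      by (simp add: fi_def[of v] v_def mult_ac)
    also have "\<dots> = (LINT z|lborel. h z * fi (\<lambda>\<xi>. of_real (gauss_weight s \<xi>) * ek \<xi> x) ((-1) *\<^sub>R z))"
      by (rule fi_multiplication[OF iw h])
    also have "(\<lambda>z. fi (\<lambda>\<xi>. of_real (gauss_weight s \<xi>) * ek \<xi> x) ((-1) *\<^sub>R z)) = (\<lambda>z. of_real (gauss_kernel s (x - z)))"
    proof
      fix z :: 'a
      have "fi (\<lambda>\<xi>. of_real (gauss_weight s \<xi>) * ek \<xi> x) ((-1) *\<^sub>R z) = fi (\<lambda>\<xi>. of_real (gauss_weight s \<xi>)) (x - z)"
        unfolding fi_def using ek_add_right[of _ x "- z"] by (simp add: mult.assoc)
      then show "fi (\<lambda>\<xi>. of_real (gauss_weight s \<xi>) * ek \<xi> x) ((-1) *\<^sub>R z) = of_real (gauss_kernel s (x - z))"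
        by (simp add: fi_gauss_weight s)
    qed
    finally show "fi v (1 *\<^sub>R x) = (LINT z|lborel. h z * of_real (gauss_kernel s (x - z)))" .
  qed
  finally show ?thesis .
qed

section \<open>Plancherel's inequality\<close>

lemma cnj_fi: "cnj (fi f \<xi>) = fi (\<lambda>x. cnj (f x)) (- \<xi>)"
proof -
  have "cnj (fi f \<xi>) = (LINT x|lborel. cnj (f x * ek x \<xi>))"
    unfolding fi_def by (rule integral_bounded_linear'[OF bounded_linear_cnj bounded_linear_cnj, symmetric]) simp
  then show ?thesis by (simp add: fi_def cnj_ek ek_minus_right)
qed

lemma nn_integral_gauss_kernel_diff:
  assumes "0 < s" shows "(\<integral>\<^sup>+z. ennreal (gauss_kernel s (x - z)) \<partial>lborel) = 1" "(\<integral>\<^sup>+z. ennreal (gauss_kernel s (z - x)) \<partial>lborel) = 1"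
proof -
  show 2: "(\<integral>\<^sup>+z. ennreal (gauss_kernel s (z - x)) \<partial>lborel) = 1"
    using nn_integral_lborel_translate[of "\<lambda>z. ennreal (gauss_kernel s z)" "- x"] nn_integral_gauss_kernel[OF assms] by simp
  show "(\<integral>\<^sup>+z. ennreal (gauss_kernel s (x - z)) \<partial>lborel) = 1"
    using 2 gauss_kernel_minus[of s "x - _"] by simp
qed

text \<open>\<open>gaussian_parseval\<close> with \<open>h\<close> the conjugate of \<open>f\<close>
  turns the weighted left side into a double integral against \<open>gauss_kernel s (x - z)\<close>.
  There \<open>2ab <= a^2 + b^2\<close> and the unit mass of the kernel in either variable give the
  bound, and Fatou's lemma lets \<open>s\<close> tend to 0.\<close>

lemma plancherel_le:
  fixes f :: "'a::euclidean_space \<Rightarrow> complex"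
  assumes f: "integrable lborel f"
  shows "(\<integral>\<^sup>+\<xi>. ennreal ((cmod (fi f \<xi>))\<^sup>2) \<partial>lborel) \<le> (\<integral>\<^sup>+x. ennreal ((cmod (f x))\<^sup>2) \<partial>lborel)"
proof -
  have [measurable]: "f \<in> borel_measurable borel" using f by auto
  define I where "I = (\<integral>\<^sup>+x. ennreal ((cmod (f x))\<^sup>2) \<partial>lborel)"
  have bound: "(\<integral>\<^sup>+\<xi>. ennreal ((cmod (fi f \<xi>))\<^sup>2 * gauss_weight s \<xi>) \<partial>lborel) \<le> I" if s: "0 < s" for s
  proof -
    have cf: "integrable lborel (\<lambda>x. cnj (f x))" using f by simp
    have il: "integrable lborel (\<lambda>\<xi>. (cmod (fi f \<xi>))\<^sup>2 * gauss_weight s \<xi>)"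
    proof (rule Bochner_Integration.integrable_bound)
      show "integrable lborel (\<lambda>\<xi>::'a. (LINT x|lborel. cmod (f x))\<^sup>2 * gauss_weight s \<xi>)"
        using integrable_gauss_weight[OF s, where 'a='a] by simp
      show "AE \<xi> in lborel. norm ((cmod (fi f \<xi>))\<^sup>2 * gauss_weight s \<xi>) \<le> norm ((LINT x|lborel. cmod (f x))\<^sup>2 * gauss_weight s \<xi>)"
        using norm_fi_le[of f] by (intro AE_I2) (auto simp: abs_mult gauss_weight_bounds intro!: mult_right_mono power_mono)
    qed measurable
    have "(\<integral>\<^sup>+\<xi>. ennreal ((cmod (fi f \<xi>))\<^sup>2 * gauss_weight s \<xi>) \<partial>lborel) = ennreal (LINT \<xi>|lborel. (cmod (fi f \<xi>))\<^sup>2 * gauss_weight s \<xi>)"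
      by (intro nn_integral_eq_integral il) (auto simp: gauss_weight_bounds)
    also have "(LINT \<xi>|lborel. (cmod (fi f \<xi>))\<^sup>2 * gauss_weight s \<xi>) = cmod (LINT \<xi>|lborel. fi f \<xi> * fi (\<lambda>x. cnj (f x)) (- \<xi>) * of_real (gauss_weight s \<xi>))"
    proof -
      have "complex_of_real (LINT \<xi>|lborel. (cmod (fi f \<xi>))\<^sup>2 * gauss_weight s \<xi>) = (LINT \<xi>|lborel. fi f \<xi> * fi (\<lambda>x. cnj (f x)) (- \<xi>) * of_real (gauss_weight s \<xi>))"
        unfolding cnj_fi[symmetric] complex_norm_square[symmetric] by (simp flip: of_real_mult of_real_power)
      moreover have "0 \<le> (LINT \<xi>|lborel. (cmod (fi f \<xi>))\<^sup>2 * gauss_weight s \<xi>)"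
        by (intro Bochner_Integration.integral_nonneg) (simp add: gauss_weight_bounds)
      ultimately show ?thesis by (metis norm_of_real abs_of_nonneg)
    qed
    also have "\<dots> = cmod (LINT x|lborel. f x * (LINT z|lborel. cnj (f z) * of_real (gauss_kernel s (x - z))))"
      by (simp only: gaussian_parseval[OF f cf s])
    also have "ennreal \<dots> \<le> (\<integral>\<^sup>+x. \<integral>\<^sup>+z. ennreal (cmod (f x) * cmod (f z) * gauss_kernel s (x - z)) \<partial>lborel \<partial>lborel)"
    proof -
      have "ennreal (cmod (LINT x|lborel. f x * (LINT z|lborel. cnj (f z) * of_real (gauss_kernel s (x - z)))))
        \<le> (\<integral>\<^sup>+x. ennreal (cmod (f x * (LINT z|lborel. cnj (f z) * of_real (gauss_kernel s (x - z))))) \<partial>lborel)"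
        by (rule norm_integral_le_nn_integral)
      also have "\<dots> \<le> (\<integral>\<^sup>+x. \<integral>\<^sup>+z. ennreal (cmod (f x) * cmod (f z) * gauss_kernel s (x - z)) \<partial>lborel \<partial>lborel)"
      proof (intro nn_integral_mono)
        fix x
        have "ennreal (cmod (LINT z|lborel. cnj (f z) * of_real (gauss_kernel s (x - z)))) \<le> (\<integral>\<^sup>+z. ennreal (cmod (cnj (f z) * of_real (gauss_kernel s (x - z)))) \<partial>lborel)"
          by (rule norm_integral_le_nn_integral)
        then have "ennreal (cmod (f x)) * ennreal (cmod (LINT z|lborel. cnj (f z) * of_real (gauss_kernel s (x - z))))
           \<le> ennreal (cmod (f x)) * (\<integral>\<^sup>+z. ennreal (cmod (cnj (f z) * of_real (gauss_kernel s (x - z)))) \<partial>lborel)"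
          by (rule mult_left_mono) simp
        also have "\<dots> = (\<integral>\<^sup>+z. ennreal (cmod (f x) * cmod (f z) * gauss_kernel s (x - z)) \<partial>lborel)"
          by (subst nn_integral_cmult[symmetric]) (auto simp: norm_mult ennreal_mult' mult.assoc)
        finally show "ennreal (cmod (f x * (LINT z|lborel. cnj (f z) * of_real (gauss_kernel s (x - z)))))
          \<le> (\<integral>\<^sup>+z. ennreal (cmod (f x) * cmod (f z) * gauss_kernel s (x - z)) \<partial>lborel)"
          by (simp add: norm_mult ennreal_mult')
      qed
      finally show ?thesis .
    qed
    also have "\<dots> \<le> (\<integral>\<^sup>+x. \<integral>\<^sup>+z. ennreal ((cmod (f x))\<^sup>2 / 2) * ennreal (gauss_kernel s (x - z)) + ennreal ((cmod (f z))\<^sup>2 / 2) * ennreal (gauss_kernel s (x - z)) \<partial>lborel \<partial>lborel)"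
    proof (intro nn_integral_mono)
      fix x z
      have "cmod (f x) * cmod (f z) \<le> (cmod (f x))\<^sup>2 / 2 + (cmod (f z))\<^sup>2 / 2"
        using sum_squares_bound[of "cmod (f x)" "cmod (f z)"] by simp
      then have "cmod (f x) * cmod (f z) * gauss_kernel s (x - z) \<le> ((cmod (f x))\<^sup>2 / 2 + (cmod (f z))\<^sup>2 / 2) * gauss_kernel s (x - z)"
        by (intro mult_right_mono) auto
      then show "ennreal (cmod (f x) * cmod (f z) * gauss_kernel s (x - z)) \<le> ennreal ((cmod (f x))\<^sup>2 / 2) * ennreal (gauss_kernel s (x - z)) + ennreal ((cmod (f z))\<^sup>2 / 2) * ennreal (gauss_kernel s (x - z))"
        by (simp add: ennreal_mult'[symmetric] ennreal_plus[symmetric] distrib_right ennreal_leI del: ennreal_plus)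
    qed
    also have "\<dots> = (\<integral>\<^sup>+x. \<integral>\<^sup>+z. ennreal ((cmod (f x))\<^sup>2 / 2) * ennreal (gauss_kernel s (x - z)) \<partial>lborel \<partial>lborel)
       + (\<integral>\<^sup>+x. \<integral>\<^sup>+z. ennreal ((cmod (f z))\<^sup>2 / 2) * ennreal (gauss_kernel s (x - z)) \<partial>lborel \<partial>lborel)"
      by (simp add: nn_integral_add)
    also have "(\<integral>\<^sup>+x. \<integral>\<^sup>+z. ennreal ((cmod (f z))\<^sup>2 / 2) * ennreal (gauss_kernel s (x - z)) \<partial>lborel \<partial>lborel)
       = (\<integral>\<^sup>+z. \<integral>\<^sup>+x. ennreal ((cmod (f z))\<^sup>2 / 2) * ennreal (gauss_kernel s (x - z)) \<partial>lborel \<partial>lborel)"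
      by (rule lborel_pair.Fubini') measurable
    also have "(\<integral>\<^sup>+x. \<integral>\<^sup>+z. ennreal ((cmod (f x))\<^sup>2 / 2) * ennreal (gauss_kernel s (x - z)) \<partial>lborel \<partial>lborel) = (\<integral>\<^sup>+x. ennreal ((cmod (f x))\<^sup>2 / 2) \<partial>lborel)"
      by (subst nn_integral_cmult) (auto simp: nn_integral_gauss_kernel_diff s)
    also have "(\<integral>\<^sup>+z. \<integral>\<^sup>+x. ennreal ((cmod (f z))\<^sup>2 / 2) * ennreal (gauss_kernel s (x - z)) \<partial>lborel \<partial>lborel) = (\<integral>\<^sup>+x. ennreal ((cmod (f x))\<^sup>2 / 2) \<partial>lborel)"
      by (subst nn_integral_cmult) (auto simp: nn_integral_gauss_kernel_diff s)
    also have "(\<integral>\<^sup>+x. ennreal ((cmod (f x))\<^sup>2 / 2) \<partial>lborel) + (\<integral>\<^sup>+x. ennreal ((cmod (f x))\<^sup>2 / 2) \<partial>lborel) = I"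
      unfolding I_def by (subst nn_integral_add[symmetric]) (auto simp flip: ennreal_plus)
    finally show ?thesis .
  qed
  have lim: "(\<lambda>n. ennreal ((cmod (fi f \<xi>))\<^sup>2 * gauss_weight (1 / real (Suc n)) \<xi>)) \<longlonglongrightarrow> ennreal ((cmod (fi f \<xi>))\<^sup>2)" for \<xi>
  proof -
    have "(\<lambda>n. gauss_weight (1 / real (Suc n)) \<xi>) \<longlonglongrightarrow> exp (- (2 * pi * 0)\<^sup>2 * (\<xi> \<bullet> \<xi>) / 2)"
      unfolding gauss_weight_def using LIMSEQ_inverse_real_of_nat by (intro tendsto_intros) (simp_all add: inverse_eq_divide)
    then have "(\<lambda>n. (cmod (fi f \<xi>))\<^sup>2 * gauss_weight (1 / real (Suc n)) \<xi>) \<longlonglongrightarrow> (cmod (fi f \<xi>))\<^sup>2 * 1"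
      by (intro tendsto_intros) simp
    then show ?thesis by (intro tendsto_ennrealI) simp
  qed
  have "(\<integral>\<^sup>+\<xi>. ennreal ((cmod (fi f \<xi>))\<^sup>2) \<partial>lborel) = (\<integral>\<^sup>+\<xi>. liminf (\<lambda>n. ennreal ((cmod (fi f \<xi>))\<^sup>2 * gauss_weight (1 / real (Suc n)) \<xi>)) \<partial>lborel)"
    by (intro nn_integral_cong lim_imp_Liminf[symmetric] lim) simp
  also have "\<dots> \<le> liminf (\<lambda>n. \<integral>\<^sup>+\<xi>. ennreal ((cmod (fi f \<xi>))\<^sup>2 * gauss_weight (1 / real (Suc n)) \<xi>) \<partial>lborel)"
    by (rule nn_integral_liminf) measurable
  also have "\<dots> \<le> liminf (\<lambda>n. I)"
    by (intro Liminf_mono always_eventually allI bound) auto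
  finally show ?thesis by (simp add: I_def Liminf_const)
qed

section \<open>The Hausdorff-Young inequality\<close>

text \<open>Stated with prescribed bounds \<open>A\<close> and \<open>B\<close> instead of norms, so
  that one form serves Lebesgue measure and counting measure on the lattice alike.\<close>

lemma nn_integral_Holder:
  fixes f g :: "'a \<Rightarrow> real"
  assumes pq: "1 < p" "1 < q" "1 / p + 1 / q = 1"
    and [measurable]: "f \<in> borel_measurable M" "g \<in> borel_measurable M"
    and nn: "\<And>x. 0 \<le> f x" "\<And>x. 0 \<le> g x" "0 \<le> A" "0 \<le> B"
    and f: "(\<integral>\<^sup>+x. ennreal (f x powr p) \<partial>M) \<le> ennreal (A powr p)"
    and g: "(\<integral>\<^sup>+x. ennreal (g x powr q) \<partial>M) \<le> ennreal (B powr q)"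
  shows "(\<integral>\<^sup>+x. ennreal (f x * g x) \<partial>M) \<le> ennreal (A * B)"
proof -
  have AE0: "AE x in M. u x = 0" if "(\<integral>\<^sup>+x. ennreal (u x powr r) \<partial>M) \<le> ennreal (0 powr r)" and [measurable]: "u \<in> borel_measurable M" for u :: "'a \<Rightarrow> real" and r
  proof -
    have "(\<integral>\<^sup>+x. ennreal (u x powr r) \<partial>M) = 0" using that(1) by simp
    then have "AE x in M. ennreal (u x powr r) = 0" by (subst (asm) nn_integral_0_iff_AE) auto
    then show ?thesis by (auto simp: ennreal_eq_0_iff)
  qed
  show ?thesis
  proof (cases "A = 0 \<or> B = 0")
    \<comment> \<open>A zero bound forces that factor to vanish almost everywhere; in the other case
      the normalisation divides by \<open>A\<close> and \<open>B\<close>.\<close>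
    case True
    then have "AE x in M. ennreal (f x * g x) = 0"
      using AE0[where u=f and r=p] AE0[where u=g and r=q] f g by auto
    then have "(\<integral>\<^sup>+x. ennreal (f x * g x) \<partial>M) = (\<integral>\<^sup>+x. 0 \<partial>M)" by (rule nn_integral_cong_AE)
    then show ?thesis by simp
  next
    case False
    then have AB: "0 < A" "0 < B" using nn by auto
    \<comment> \<open>Young's inequality for \<open>f / A\<close> and \<open>g / B\<close>,
      multiplied by \<open>A * B\<close>, has these coefficients; after integration they add up to
      \<open>A * B * (1 / p + 1 / q)\<close>.\<close>
    define a where "a = A * B / (A powr p * p)"
    define b where "b = A * B / (B powr q * q)"
    have ab: "0 \<le> a" "0 \<le> b" using AB pq by (auto simp: a_def b_def)
    have pt: "f x * g x \<le> a * f x powr p + b * g x powr q" for x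
    proof -
      have "f x / A * (g x / B) \<le> (f x / A) powr p / p + (g x / B) powr q / q"
        using nn(1)[of x] nn(2)[of x] AB pq by (intro Youngs_inequality) auto
      then have "A * B * (f x / A * (g x / B)) \<le> A * B * ((f x / A) powr p / p + (g x / B) powr q / q)"
        using AB by (intro mult_left_mono) auto
      moreover have "A * B * (f x / A * (g x / B)) = f x * g x" using AB by (simp add: field_simps)
      moreover have "A * B * ((f x / A) powr p / p + (g x / B) powr q / q) = a * f x powr p + b * g x powr q"
        using AB nn by (simp add: a_def b_def powr_divide field_simps)
      ultimately show ?thesis by simp
    qed
    have "(\<integral>\<^sup>+x. ennreal (f x * g x) \<partial>M) \<le> (\<integral>\<^sup>+x. ennreal a * ennreal (f x powr p) + ennreal b * ennreal (g x powr q) \<partial>M)"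
      using pt ab by (intro nn_integral_mono) (simp add: ennreal_mult'[symmetric] ennreal_plus[symmetric] ennreal_leI del: ennreal_plus)
    also have "\<dots> = ennreal a * (\<integral>\<^sup>+x. ennreal (f x powr p) \<partial>M) + ennreal b * (\<integral>\<^sup>+x. ennreal (g x powr q) \<partial>M)"
      by (subst nn_integral_add) (auto simp: nn_integral_cmult)
    also have "\<dots> \<le> ennreal a * ennreal (A powr p) + ennreal b * ennreal (B powr q)"
      by (intro add_mono mult_left_mono f g) auto
    also have "\<dots> = ennreal (a * A powr p + b * B powr q)"
      using ab by (simp add: ennreal_mult'[symmetric] ennreal_plus[symmetric] del: ennreal_plus)
    also have "a * A powr p + b * B powr q = A * B * (1 / p + 1 / q)"
      using AB pq by (simp add: a_def b_def field_simps)
    finally show ?thesis using pq by simp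
  qed
qed

text \<open>Layer cake weight: \<open>r\<close> times this integral over the levels recovers
  \<open>a powr r\<close>.\<close>

lemma nn_integral_powr_layer:
  assumes "0 < r" "0 \<le> a"
  shows "(\<integral>\<^sup>+l. indicator {0..a} l * ennreal (l powr (r - 1)) \<partial>lborel) = ennreal (a powr r / r)"
proof -
  have "((\<lambda>l. l powr (r - 1)) has_integral (a powr r / r)) {0..a}"
    using has_integral_powr_from_0[of "r - 1" a] assms by simp
  then have "(\<integral>\<^sup>+l. ennreal (indicator {0..a} l * l powr (r - 1)) \<partial>lborel) = ennreal (a powr r / r)"
    by (rule nn_integral_has_integral_lebesgue[rotated]) auto
  then show ?thesis by (simp add: ennreal_mult' ennreal_indicator)
qed

text \<open>One factor \<open>cmod (f x)\<close> is kept for integrability, the remaining power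
  \<open>q - 1\<close> is bounded by means of \<open>B\<close>.\<close>

lemma integrable_powr_bounded:
  fixes f :: "'a \<Rightarrow> complex"
  assumes f: "integrable M f" "\<And>x. cmod (f x) \<le> B" and q: "1 \<le> q"
  shows "integrable M (\<lambda>x. cmod (f x) powr q)"
proof (rule Bochner_Integration.integrable_bound)
  show "integrable M (\<lambda>x. B powr (q - 1) * cmod (f x))" using f by auto
  have [measurable]: "f \<in> borel_measurable M" using f by auto
  show "(\<lambda>x. cmod (f x) powr q) \<in> borel_measurable M" by measurable
  have "cmod (f x) powr q \<le> B powr (q - 1) * cmod (f x)" for x
  proof -
    have "cmod (f x) powr q = cmod (f x) powr (q - 1) * cmod (f x)"
      using q by (cases "f x = 0") (auto simp: powr_diff)
    also have "\<dots> \<le> B powr (q - 1) * cmod (f x)"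
      using f(2)[of x] q by (intro mult_right_mono powr_mono2) auto
    finally show ?thesis .
  qed
  then show "AE x in M. norm (cmod (f x) powr q) \<le> norm (B powr (q - 1) * cmod (f x))" by auto
qed

(* Marcinkiewicz interpolation between the (1,infinity) and the (2,2) bound; at height l the function
   is cut where |psi| exceeds the level at which the L1 norm of the upper part is l/2. *)
lemma hausdorff_young:
  fixes \<psi> :: "'a::euclidean_space \<Rightarrow> complex"
  assumes pq: "2 < p" "1 / p + 1 / q = 1"
    and psi: "integrable lborel \<psi>" "\<And>x. cmod (\<psi> x) \<le> B"
  shows "(\<integral>\<^sup>+\<xi>. ennreal (cmod (fi \<psi> \<xi>) powr p) \<partial>lborel)
    \<le> ennreal (4 * p / (p - 2) * 2 powr (p - 2) * (LINT x|lborel. cmod (\<psi> x) powr q) powr (p - 1))"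
proof -
  have "1 / q = (p - 1) / p" using pq by (simp add: diff_divide_distrib)
  then have "1 / (1 / q) = 1 / ((p - 1) / p)" by (rule arg_cong)
  then have qp: "q = p / (p - 1)" by simp
  then have q: "1 < q" "q = p / (p - 1)" using pq by auto
  have [measurable]: "\<psi> \<in> borel_measurable borel" using psi by auto
  define N where "N = (LINT x|lborel. cmod (\<psi> x) powr q)"
  have iN: "integrable lborel (\<lambda>x. cmod (\<psi> x) powr q)"
    using q by (intro integrable_powr_bounded[OF psi]) auto
  have N0: "0 \<le> N" unfolding N_def by (intro Bochner_Integration.integral_nonneg) auto
  show ?thesis
  proof (cases "N = 0")
    case True
    then have "AE x in lborel. cmod (\<psi> x) powr q = 0"
      using integral_nonneg_eq_0_iff_AE[OF iN] by (simp add: N_def)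
    then have "AE x in lborel. \<psi> x = 0" by auto
    then have "fi \<psi> \<xi> = fi (\<lambda>_. 0) \<xi>" for \<xi> by (intro fi_cong_AE) auto
    then have "fi \<psi> \<xi> = 0" for \<xi> by (simp add: fi_def)
    then show ?thesis using pq by simp
  next
    case False
    then have N: "0 < N" using N0 by simp
    \<comment> \<open>For \<open>l > 0\<close> and \<open>\<psi> x \<noteq> 0\<close> the condition
      \<open>l \<le> T x\<close> says \<open>cmod (\<psi> x) powr (q - 1) \<le> 2 * N / l\<close>,
      so \<open>cut l\<close> keeps the small values. At zeros of \<open>\<psi>\<close> the
      convention \<open>0 powr _ = 0\<close> gives \<open>T x = 0\<close>, which is harmless because
      both branches of \<open>cut\<close> are 0 there.\<close>
    define T where "T x = 2 * N * cmod (\<psi> x) powr (1 - q)" for x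
    have [measurable]: "T \<in> borel_measurable borel" unfolding T_def by measurable
    have T0: "0 \<le> T x" for x using N by (simp add: T_def)
    define cut where "cut l x = (if l \<le> T x then \<psi> x else 0)" for l x
    have [measurable]: "(\<lambda>z. cut (f z) (g z)) \<in> borel_measurable M" if "f \<in> borel_measurable M" "g \<in> borel_measurable M" for f g and M :: "'c measure"
      using that unfolding cut_def by measurable
    have icut: "integrable lborel (cut l)" for l
    proof (rule Bochner_Integration.integrable_bound[OF psi(1)])
      show "cut l \<in> borel_measurable lborel" unfolding cut_def by measurable
      show "AE x in lborel. cmod (cut l x) \<le> cmod (\<psi> x)" by (auto simp: cut_def)
    qed
    \<comment> \<open>The discarded part has \<open>L_1\<close> norm at most \<open>l / 2\<close>,
      so a transform of size \<open>l\<close> leaves at least \<open>l / 2\<close> to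
      \<open>cut l\<close>: Chebyshev's inequality in squared form.\<close>
    have cheb: "1 \<le> 4 / l\<^sup>2 * (cmod (fi (cut l) \<xi>))\<^sup>2" if l: "0 < l" "l \<le> cmod (fi \<psi> \<xi>)" for l \<xi>
    proof -
      have "fi \<psi> \<xi> - fi (cut l) \<xi> = fi (\<lambda>x. \<psi> x - cut l x) \<xi>" by (rule fi_diff[symmetric, OF psi(1) icut])
      then have "cmod (fi \<psi> \<xi> - fi (cut l) \<xi>) \<le> (LINT x|lborel. cmod (\<psi> x - cut l x))"
        using norm_fi_le[of "\<lambda>x. \<psi> x - cut l x" \<xi>] by simp
      also have "\<dots> \<le> (LINT x|lborel. l / (2 * N) * cmod (\<psi> x) powr q)"
      proof (intro integral_mono)
        show "integrable lborel (\<lambda>x. cmod (\<psi> x - cut l x))" using psi(1) icut by auto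
        show "integrable lborel (\<lambda>x. l / (2 * N) * cmod (\<psi> x) powr q)" using iN by auto
        fix x
        show "cmod (\<psi> x - cut l x) \<le> l / (2 * N) * cmod (\<psi> x) powr q"
        proof (cases "l \<le> T x \<or> \<psi> x = 0")
          case True
          then show ?thesis using l N by (auto simp: cut_def)
        next
          case False
          have "cmod (\<psi> x) = cmod (\<psi> x) powr (1 - q) * cmod (\<psi> x) powr q"
            using False by (simp add: powr_add[symmetric])
          also have "\<dots> \<le> l / (2 * N) * cmod (\<psi> x) powr q"
            using False N by (intro mult_right_mono) (auto simp: T_def field_simps)
          finally show ?thesis using False by (simp add: cut_def)
        qed
      qed
      also have "\<dots> = l / 2" using N by (simp add: N_def[symmetric])
      finally have "cmod (fi \<psi> \<xi> - fi (cut l) \<xi>) \<le> l / 2" .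
      then have "l / 2 \<le> cmod (fi (cut l) \<xi>)"
        using l norm_triangle_ineq2[of "fi \<psi> \<xi>" "fi (cut l) \<xi>"] by linarith
      then have "(l / 2)\<^sup>2 \<le> (cmod (fi (cut l) \<xi>))\<^sup>2" using l by (intro power_mono) auto
      then show ?thesis using l by (simp add: field_simps)
    qed
    \<comment> \<open>\<open>p\<close> comes from the layer cake formula, 4 from
      \<open>cheb\<close>.\<close>
    define c where "c = 4 * p"
    have c0: "0 \<le> c" using pq by (simp add: c_def)
    have "(\<integral>\<^sup>+\<xi>. ennreal (cmod (fi \<psi> \<xi>) powr p) \<partial>lborel) =
      (\<integral>\<^sup>+\<xi>. \<integral>\<^sup>+l. ennreal p * (indicator {0..cmod (fi \<psi> \<xi>)} l * ennreal (l powr (p - 1))) \<partial>lborel \<partial>lborel)"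
      using pq by (intro nn_integral_cong) (simp add: nn_integral_cmult nn_integral_powr_layer ennreal_mult'[symmetric])
    also have "\<dots> = (\<integral>\<^sup>+\<xi>. \<integral>\<^sup>+l. ennreal p * (if 0 \<le> l \<and> l \<le> cmod (fi \<psi> \<xi>) then ennreal (l powr (p - 1)) else 0) \<partial>lborel \<partial>lborel)"
      by (intro nn_integral_cong) (auto split: split_indicator)
    also have "\<dots> = (\<integral>\<^sup>+l. \<integral>\<^sup>+\<xi>. ennreal p * (if 0 \<le> l \<and> l \<le> cmod (fi \<psi> \<xi>) then ennreal (l powr (p - 1)) else 0) \<partial>lborel \<partial>lborel)"
      by (rule lborel_pair.Fubini') measurable
    also have "\<dots> \<le> (\<integral>\<^sup>+l. \<integral>\<^sup>+\<xi>. ennreal c * (indicator {0..} l * ennreal (l powr (p - 3))) * ennreal ((cmod (fi (cut l) \<xi>))\<^sup>2) \<partial>lborel \<partial>lborel)"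
    \<comment> \<open>The level 0 is removed as a null set, since \<open>cheb\<close> divides by
      \<open>l\<close>.\<close>
    proof (rule nn_integral_mono_AE, use AE_lborel_singleton[of "0::real"] in eventually_elim, rule nn_integral_mono)
      fix l :: real and \<xi> assume l: "l \<noteq> 0"
      show "ennreal p * (if 0 \<le> l \<and> l \<le> cmod (fi \<psi> \<xi>) then ennreal (l powr (p - 1)) else 0)
        \<le> ennreal c * (indicator {0..} l * ennreal (l powr (p - 3))) * ennreal ((cmod (fi (cut l) \<xi>))\<^sup>2)"
      proof (cases "0 < l \<and> l \<le> cmod (fi \<psi> \<xi>)")
        case True
        have "l powr (p - 1) = l powr (p - 3) * l\<^sup>2"
          using True by (simp add: powr_numeral[symmetric] powr_add[symmetric] del: powr_numeral)
        then have "p * l powr (p - 1) * 1 \<le> p * (l powr (p - 3) * l\<^sup>2) * (4 / l\<^sup>2 * (cmod (fi (cut l) \<xi>))\<^sup>2)"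
          using pq cheb[of l \<xi>] True by (intro mult_mono) auto
        also have "\<dots> = c * l powr (p - 3) * (cmod (fi (cut l) \<xi>))\<^sup>2" using True by (simp add: c_def)
        finally show ?thesis using True c0 pq
          by (simp add: ennreal_mult'[symmetric] ennreal_leI)
      qed (use l in \<open>auto split: split_indicator\<close>)
    qed
    also have "\<dots> \<le> (\<integral>\<^sup>+l. ennreal c * (indicator {0..} l * ennreal (l powr (p - 3))) * (\<integral>\<^sup>+x. ennreal ((cmod (cut l x))\<^sup>2) \<partial>lborel) \<partial>lborel)"
      by (intro nn_integral_mono, subst nn_integral_cmult) (auto intro!: mult_left_mono plancherel_le icut)
    also have "\<dots> = (\<integral>\<^sup>+l. \<integral>\<^sup>+x. ennreal c * (indicator {0..} l * ennreal (l powr (p - 3))) * ennreal ((cmod (cut l x))\<^sup>2) \<partial>lborel \<partial>lborel)"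
      by (intro nn_integral_cong, subst nn_integral_cmult) auto
    also have "\<dots> = (\<integral>\<^sup>+x. \<integral>\<^sup>+l. ennreal c * (indicator {0..} l * ennreal (l powr (p - 3))) * ennreal ((cmod (cut l x))\<^sup>2) \<partial>lborel \<partial>lborel)"
      by (rule lborel_pair.Fubini') measurable
    \<comment> \<open>\<open>cut l x\<close> vanishes for \<open>l > T x\<close>, so
      \<open>T x\<close> becomes the upper limit; \<open>p > 2\<close> makes
      \<open>l powr (p - 3)\<close> integrable at 0.\<close>
    also have "\<dots> = (\<integral>\<^sup>+x. ennreal (c * (cmod (\<psi> x))\<^sup>2) * (\<integral>\<^sup>+l. indicator {0..T x} l * ennreal (l powr ((p - 2) - 1)) \<partial>lborel) \<partial>lborel)"
      using c0 by (intro nn_integral_cong, subst nn_integral_cmult[symmetric])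
        (auto intro!: nn_integral_cong split: split_indicator simp: cut_def ennreal_mult' mult_ac)
    also have "\<dots> = (\<integral>\<^sup>+x. ennreal (c / (p - 2) * (2 * N) powr (p - 2) * cmod (\<psi> x) powr q) \<partial>lborel)"
    proof (intro nn_integral_cong)
      fix x
      have "(cmod (\<psi> x))\<^sup>2 * T x powr (p - 2) = (2 * N) powr (p - 2) * cmod (\<psi> x) powr q"
      proof (cases "\<psi> x = 0")
        case False
        \<comment> \<open>By \<open>q = p / (p - 1)\<close> the square and the power of
          \<open>T x\<close> combine to exactly the exponent \<open>q\<close>.\<close>
        have "(1 - q) * (p - 2) + 2 = q" using pq unfolding q(2) by (simp add: field_simps)
        then have "cmod (\<psi> x) powr q = cmod (\<psi> x) powr ((1 - q) * (p - 2)) * cmod (\<psi> x) powr 2"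
          by (simp add: powr_add[symmetric] del: powr_numeral)
        moreover have "T x powr (p - 2) = (2 * N) powr (p - 2) * cmod (\<psi> x) powr ((1 - q) * (p - 2))"
          using N by (simp add: T_def powr_mult powr_powr)
        ultimately show ?thesis using False by simp
      qed simp
      then have "c * (cmod (\<psi> x))\<^sup>2 * (T x powr (p - 2) / (p - 2)) = c / (p - 2) * (2 * N) powr (p - 2) * cmod (\<psi> x) powr q"
        by (simp add: mult_ac)
      then show "ennreal (c * (cmod (\<psi> x))\<^sup>2) * (\<integral>\<^sup>+l. indicator {0..T x} l * ennreal (l powr ((p - 2) - 1)) \<partial>lborel)
        = ennreal (c / (p - 2) * (2 * N) powr (p - 2) * cmod (\<psi> x) powr q)"
        using pq c0 T0[of x] by (subst nn_integral_powr_layer) (auto simp: ennreal_mult'[symmetric])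
    qed
    also have "\<dots> = ennreal (LINT x|lborel. c / (p - 2) * (2 * N) powr (p - 2) * cmod (\<psi> x) powr q)"
      using iN pq c0 by (intro nn_integral_eq_integral) auto
    also have "(LINT x|lborel. c / (p - 2) * (2 * N) powr (p - 2) * cmod (\<psi> x) powr q) = c / (p - 2) * (2 * N) powr (p - 2) * N"
      by (simp add: N_def)
    also have "\<dots> = 4 * p / (p - 2) * 2 powr (p - 2) * N powr (p - 1)"
    proof -
      have "N powr (p - 1) = N powr (p - 2) * N powr 1" by (subst powr_add[symmetric]) simp
      then show ?thesis using N by (simp add: powr_mult c_def)
    qed
    finally show ?thesis unfolding N_def .
  qed
qed

text \<open>The weighted form treats \<open>q = 1\<close>, where the dual exponent is infinite and
  the sup bound on the transform suffices, on the same footing as \<open>1 < q\<close>. The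
  interpolation constant has a pole at \<open>p = 2\<close>, so Plancherel takes over there.
  \<open>C\<close> is fixed before \<open>\<psi>\<close> and \<open>w\<close>.\<close>

lemma hausdorff_young_dual:
  assumes q: "1 \<le> q" "q \<le> 2"
  shows "\<exists>C\<ge>0. \<forall>(\<psi> :: 'a::euclidean_space \<Rightarrow> complex) w W B. integrable lborel \<psi> \<longrightarrow> (\<forall>x. cmod (\<psi> x) \<le> B) \<longrightarrow>
    w \<in> borel_measurable borel \<longrightarrow> (\<forall>\<xi>. 0 \<le> w \<xi>) \<longrightarrow> 0 \<le> W \<longrightarrow>
    (\<integral>\<^sup>+\<xi>. ennreal (w \<xi> powr q) \<partial>lborel) \<le> ennreal (W powr q) \<longrightarrow>
    (\<integral>\<^sup>+\<xi>. ennreal (w \<xi> * cmod (fi \<psi> \<xi>)) \<partial>lborel)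
      \<le> ennreal (C * W * (LINT x|lborel. cmod (\<psi> x) powr q) powr (1 / q))"
proof (cases "q = 1")
  case True
  show ?thesis
  proof (intro exI[of _ 1] conjI allI impI)
    fix \<psi> :: "'a \<Rightarrow> complex" and w :: "'a \<Rightarrow> real" and W :: real
    assume [measurable]: "w \<in> borel_measurable borel" and w: "\<forall>\<xi>. 0 \<le> w \<xi>" "0 \<le> W"
      "(\<integral>\<^sup>+\<xi>. ennreal (w \<xi> powr q) \<partial>lborel) \<le> ennreal (W powr q)"
    let ?I = "LINT x|lborel. cmod (\<psi> x)"
    have "(\<integral>\<^sup>+\<xi>. ennreal (w \<xi> * cmod (fi \<psi> \<xi>)) \<partial>lborel) \<le> (\<integral>\<^sup>+\<xi>. ennreal (w \<xi>) * ennreal ?I \<partial>lborel)"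
      using w by (intro nn_integral_mono) (auto simp: ennreal_mult'[symmetric] intro!: ennreal_leI mult_left_mono norm_fi_le)
    also have "\<dots> = (\<integral>\<^sup>+\<xi>. ennreal (w \<xi>) \<partial>lborel) * ennreal ?I" by (rule nn_integral_multc) simp
    also have "\<dots> \<le> ennreal W * ennreal ?I" using w True by (intro mult_right_mono) auto
    finally show "(\<integral>\<^sup>+\<xi>. ennreal (w \<xi> * cmod (fi \<psi> \<xi>)) \<partial>lborel)
      \<le> ennreal (1 * W * (LINT x|lborel. cmod (\<psi> x) powr q) powr (1 / q))"
      using True w(2) by (simp add: ennreal_mult'[symmetric])
  qed simp
next
  case False
  define p where "p = q / (q - 1)"
  have p: "2 \<le> p" "1 < q" "1 < p" "1 / p + 1 / q = 1" using q False by (auto simp: p_def field_simps)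
  have "\<exists>C\<ge>0. \<forall>(\<psi> :: 'a \<Rightarrow> complex) B. integrable lborel \<psi> \<longrightarrow> (\<forall>x. cmod (\<psi> x) \<le> B) \<longrightarrow>
    (\<integral>\<^sup>+\<xi>. ennreal (cmod (fi \<psi> \<xi>) powr p) \<partial>lborel) \<le> ennreal (C * (LINT x|lborel. cmod (\<psi> x) powr q) powr (p - 1))"
  proof (cases "p = 2")
    case True
    then have q2: "q = 2" using p by (simp add: field_simps)
    show ?thesis
    proof (intro exI[of _ 1] conjI allI impI)
      fix \<psi> :: "'a \<Rightarrow> complex" and B
      assume psi: "integrable lborel \<psi>" "\<forall>x. cmod (\<psi> x) \<le> B"
      have "(\<integral>\<^sup>+\<xi>. ennreal (cmod (fi \<psi> \<xi>) powr p) \<partial>lborel) \<le> (\<integral>\<^sup>+x. ennreal ((cmod (\<psi> x))\<^sup>2) \<partial>lborel)"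
        using plancherel_le[OF psi(1)] True by simp
      also have "\<dots> = ennreal (LINT x|lborel. cmod (\<psi> x) powr q)"
        using integrable_powr_bounded[of lborel \<psi> B 2] psi q2 by (subst nn_integral_eq_integral) auto
      finally show "(\<integral>\<^sup>+\<xi>. ennreal (cmod (fi \<psi> \<xi>) powr p) \<partial>lborel) \<le> ennreal (1 * (LINT x|lborel. cmod (\<psi> x) powr q) powr (p - 1))"
        using True by (simp add: Bochner_Integration.integral_nonneg)
    qed simp
  next
    case False
    then have "2 < p" using p by simp
    then show ?thesis
      using hausdorff_young[of p q] p by (intro exI[of _ "4 * p / (p - 2) * 2 powr (p - 2)"]) auto
  qed
  then obtain C where C: "0 \<le> C" "\<And>\<psi> :: 'a \<Rightarrow> complex. \<And>B. integrable lborel \<psi> \<Longrightarrow> (\<And>x. cmod (\<psi> x) \<le> B) \<Longrightarrow>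
    (\<integral>\<^sup>+\<xi>. ennreal (cmod (fi \<psi> \<xi>) powr p) \<partial>lborel) \<le> ennreal (C * (LINT x|lborel. cmod (\<psi> x) powr q) powr (p - 1))"
    by blast
  show ?thesis
  proof (intro exI[of _ "C powr (1 / p)"] conjI allI impI)
    fix \<psi> :: "'a \<Rightarrow> complex" and w :: "'a \<Rightarrow> real" and W B :: real
    assume psi: "integrable lborel \<psi>" "\<forall>x. cmod (\<psi> x) \<le> B"
      and [measurable]: "w \<in> borel_measurable borel" and w: "\<forall>\<xi>. 0 \<le> w \<xi>" "0 \<le> W"
      "(\<integral>\<^sup>+\<xi>. ennreal (w \<xi> powr q) \<partial>lborel) \<le> ennreal (W powr q)"
    have [measurable]: "\<psi> \<in> borel_measurable borel" using psi by auto
    define N where "N = (LINT x|lborel. cmod (\<psi> x) powr q)"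
    have N0: "0 \<le> N" unfolding N_def by (intro Bochner_Integration.integral_nonneg) auto
    have e: "(1 / q) * p = p - 1" using p by (simp add: field_simps)
    have "(C powr (1 / p) * N powr (1 / q)) powr p = C powr (1 / p * p) * N powr (1 / q * p)"
      by (simp only: powr_mult powr_powr)
    also have "\<dots> = C * N powr (p - 1)" unfolding e using p C(1) by simp
    finally have "(\<integral>\<^sup>+\<xi>. ennreal (cmod (fi \<psi> \<xi>) powr p) \<partial>lborel) \<le> ennreal ((C powr (1 / p) * N powr (1 / q)) powr p)"
      using C(2)[of \<psi> B] psi by (simp add: N_def)
    then have "(\<integral>\<^sup>+\<xi>. ennreal (cmod (fi \<psi> \<xi>) * w \<xi>) \<partial>lborel) \<le> ennreal (C powr (1 / p) * N powr (1 / q) * W)"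
      using w p by (intro nn_integral_Holder[OF p(3,2,4)]) auto
    then show "(\<integral>\<^sup>+\<xi>. ennreal (w \<xi> * cmod (fi \<psi> \<xi>)) \<partial>lborel) \<le> ennreal (C powr (1 / p) * W * N powr (1 / q))"
      by (simp add: mult_ac)
  qed simp
qed

section \<open>Duality against continuous test functions\<close>

lemma borel_measurable_cnj [measurable (raw)]:
  assumes "f \<in> borel_measurable M" shows "(\<lambda>x. cnj (f x)) \<in> borel_measurable M"
  by (rule borel_measurable_continuous_on[OF _ assms]) (intro continuous_intros)

lemma integrable_indicator_cball: "integrable lborel (indicat_real (cball (0::'a::euclidean_space) R))"
  using emeasure_bounded_finite[OF bounded_cball, of "0::'a" R]
  by (intro integrable_real_indicator) auto

text \<open>Lebesgue measurable functions are almost everywhere limits of continuous ones. The bound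
  is restored by projecting onto the disc of radius \<open>B\<close>, the support by a continuous
  cutoff equal to 1 on the ball of radius \<open>R\<close>; neither changes the limit.\<close>

lemma bounded_continuous_approximation:
  fixes f :: "'a::euclidean_space \<Rightarrow> complex"
  assumes f: "f \<in> borel_measurable borel" and B: "\<And>x. cmod (f x) \<le> B"
    and R: "\<And>x. R < norm x \<Longrightarrow> f x = 0"
  shows "\<exists>g. (\<forall>n. continuous_on UNIV (g n)) \<and> (\<forall>n x. cmod (g n x) \<le> B) \<and>
    (\<forall>n x. R + 1 < norm x \<longrightarrow> g n x = 0) \<and> (AE x in lborel. (\<lambda>n. g n x) \<longlonglongrightarrow> f x)"
proof -
  have B0: "0 \<le> B" using B[of 0] norm_ge_zero order_trans by blast
  have "f \<in> borel_measurable lebesgue" using f by (rule borel_lebesgue)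
  then have "f measurable_on UNIV" by (rule lebesgue_measurable_imp_measurable_on) simp
  then obtain N h where h: "negligible N" "\<And>n. continuous_on UNIV (h n)" "\<And>x. x \<notin> N \<Longrightarrow> (\<lambda>n. h n x) \<longlonglongrightarrow> f x"
    unfolding measurable_on_def by auto
  define P where "P = closest_point (cball (0::complex) B)"
  have P: "continuous_on UNIV P" "\<And>z. cmod (P z) \<le> B" "\<And>z. cmod z \<le> B \<Longrightarrow> P z = z"
  proof -
    show "continuous_on UNIV P" unfolding P_def using B0 by (intro continuous_on_closest_point) auto
    show "cmod (P z) \<le> B" for z
      using closest_point_in_set[of "cball (0::complex) B" z] B0 by (simp add: P_def)
    show "P z = z" if "cmod z \<le> B" for z using that by (simp add: P_def closest_point_self)
  qed
  define cut where "cut x = max 0 (min 1 (R + 1 - norm x))" for x :: 'a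
  have cut: "0 \<le> cut x" "cut x \<le> 1" for x by (auto simp: cut_def)
  define g where "g n x = of_real (cut x) * P (h n x)" for n x
  show ?thesis
  proof (intro exI[of _ g] conjI allI impI)
    show "continuous_on UNIV (g n)" for n
      unfolding g_def cut_def
      by (intro continuous_intros continuous_on_compose2[OF P(1) h(2)]) auto
    show "cmod (g n x) \<le> B" for n x
      using mult_mono[OF cut(2)[of x] P(2)[of "h n x"]] cut(1)[of x] by (simp add: g_def norm_mult)
    show "g n x = 0" if "R + 1 < norm x" for n x
      using that by (simp add: g_def cut_def)
    have "AE x in lebesgue. x \<notin> N"
      using h(1) by (intro AE_not_in) (simp add: negligible_iff_null_sets)
    then have "AE x in lborel. x \<notin> N" by (simp add: AE_completion_iff)
    then show "AE x in lborel. (\<lambda>n. g n x) \<longlonglongrightarrow> f x"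
    proof eventually_elim
      fix x assume x: "x \<notin> N"
      have "(\<lambda>n. P (h n x)) \<longlonglongrightarrow> P (f x)"
        by (rule continuous_on_tendsto_compose[OF P(1) h(3)[OF x]]) auto
      then have "(\<lambda>n. g n x) \<longlonglongrightarrow> of_real (cut x) * f x"
        unfolding g_def using P(3)[OF B] by (intro tendsto_intros) simp
      moreover have "of_real (cut x) * f x = f x"
        using R[of x] by (cases "R < norm x") (auto simp: cut_def)
      ultimately show "(\<lambda>n. g n x) \<longlonglongrightarrow> f x" by simp
    qed
  qed
qed

text \<open>An \<open>L_p\<close> bound on \<open>u\<close> in dual form, known only against
  continuous compactly supported functions. Local integrability of \<open>u\<close> permits passing
  to bounded measurable test functions. The constant \<open>K\<close> may be 0, which turns the
  locale into a uniqueness principle for locally integrable functions.\<close>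

locale continuous_test_bound =
  fixes u :: "'a::euclidean_space \<Rightarrow> complex" and K q :: real
  assumes u_measurable [measurable]: "u \<in> borel_measurable borel"
    and u_locally_integrable: "\<And>R. integrable lborel (\<lambda>x. indicat_real (cball 0 R) x * cmod (u x))"
    and K_nonneg: "0 \<le> K" and q_ge_1: "1 \<le> q"
    and continuous_bound: "\<And>\<psi> R. continuous_on UNIV \<psi> \<Longrightarrow> (\<And>x. R < norm x \<Longrightarrow> \<psi> x = 0) \<Longrightarrow>
      cmod (LINT x|lborel. u x * \<psi> x) \<le> K * (LINT x|lborel. cmod (\<psi> x) powr q) powr (1 / q)"
begin

text \<open>Dominated convergence on both sides along
  \<open>bounded_continuous_approximation\<close>; the uniform bound and the common ball supply the
  dominating functions.\<close>

lemma bounded_bound: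
  assumes [measurable]: "\<psi> \<in> borel_measurable borel" and B: "\<And>x. cmod (\<psi> x) \<le> B"
    and R: "\<And>x. R < norm x \<Longrightarrow> \<psi> x = 0"
  shows "cmod (LINT x|lborel. u x * \<psi> x) \<le> K * (LINT x|lborel. cmod (\<psi> x) powr q) powr (1 / q)"
proof -
  obtain g where g: "\<And>n. continuous_on UNIV (g n)" "\<And>n x. cmod (g n x) \<le> B"
    "\<And>n x. R + 1 < norm x \<Longrightarrow> g n x = 0" "AE x in lborel. (\<lambda>n. g n x) \<longlonglongrightarrow> \<psi> x"
    using bounded_continuous_approximation[OF assms] by blast
  have [measurable]: "g n \<in> borel_measurable borel" for n
    using g(1) by (intro borel_measurable_continuous_onI)
  have B0: "0 \<le> B" using B[of 0] norm_ge_zero order_trans by blast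
  have "(\<lambda>n. LINT x|lborel. u x * g n x) \<longlonglongrightarrow> (LINT x|lborel. u x * \<psi> x)"
  proof (rule integral_dominated_convergence[where w="\<lambda>x. B * (indicat_real (cball 0 (R + 1)) x * cmod (u x))"])
    show "integrable lborel (\<lambda>x. B * (indicat_real (cball 0 (R + 1)) x * cmod (u x)))"
      using u_locally_integrable by auto
    show "AE x in lborel. (\<lambda>n. u x * g n x) \<longlonglongrightarrow> u x * \<psi> x"
      using g(4) by eventually_elim (intro tendsto_intros)
    show "AE x in lborel. cmod (u x * g n x) \<le> B * (indicat_real (cball 0 (R + 1)) x * cmod (u x))" for n
      using g(2)[of n] g(3)[of _ n] by (intro AE_I2) (auto simp: norm_mult indicator_def mult.commute[of "cmod (u _)"] intro!: mult_right_mono)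
  qed measurable
  moreover have "(\<lambda>n. LINT x|lborel. cmod (g n x) powr q) \<longlonglongrightarrow> (LINT x|lborel. cmod (\<psi> x) powr q)"
  proof (rule integral_dominated_convergence[where w="\<lambda>x. B powr q * indicat_real (cball 0 (R + 1)) x"])
    show "integrable lborel (\<lambda>x::'a. B powr q * indicat_real (cball 0 (R + 1)) x)"
      by (intro integrable_mult_right integrable_indicator_cball)
    show "AE x in lborel. (\<lambda>n. cmod (g n x) powr q) \<longlonglongrightarrow> cmod (\<psi> x) powr q"
      using g(4)
    proof eventually_elim
      fix x assume "(\<lambda>n. g n x) \<longlonglongrightarrow> \<psi> x"
      then show "(\<lambda>n. cmod (g n x) powr q) \<longlonglongrightarrow> cmod (\<psi> x) powr q"
        using q_ge_1 by (auto intro!: tendsto_intros)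
    qed
    show "AE x in lborel. norm (cmod (g n x) powr q) \<le> B powr q * indicat_real (cball 0 (R + 1)) x" for n
      using g(2)[of n] g(3)[of _ n] q_ge_1 by (intro AE_I2) (auto simp: indicator_def intro!: powr_mono2)
  qed measurable
  then have "(\<lambda>n. K * (LINT x|lborel. cmod (g n x) powr q) powr (1 / q)) \<longlonglongrightarrow> K * (LINT x|lborel. cmod (\<psi> x) powr q) powr (1 / q)"
    using q_ge_1 by (intro tendsto_intros) (auto intro!: Bochner_Integration.integral_nonneg always_eventually)
  ultimately show ?thesis
    using continuous_bound[OF g(1) g(3)]
    by (intro LIMSEQ_le[OF tendsto_norm]) auto
qed

lemma u_sgn: "u x * cnj (sgn (u x)) = of_real (cmod (u x))"
proof (cases "u x = 0")
  case False
  have "u x * cnj (sgn (u x)) = (u x * cnj (u x)) / of_real (cmod (u x))"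
    by (simp add: sgn_div_norm scaleR_conv_of_real divide_inverse mult_ac)
  also have "\<dots> = of_real (cmod (u x))"
    using False by (simp add: complex_norm_square[symmetric] power2_eq_square)
  finally show ?thesis .
qed simp

text \<open>Test with the conjugate sign of \<open>u\<close> on the part of \<open>{|u| > K}\<close>
  inside a ball: the integral of \<open>|u| - K\<close> over it is at most 0 although the integrand
  is positive there, so the set is null.\<close>

lemma Linfty_bound:
  assumes "q = 1"
  shows "AE x in lborel. cmod (u x) \<le> K"
proof -
  have "AE x in lborel. norm x \<le> real n \<longrightarrow> cmod (u x) \<le> K" for n
  proof -
    define A where "A = {x. norm x \<le> real n \<and> K < cmod (u x)}"
    have [measurable]: "A \<in> sets borel" unfolding A_def by measurable
    define \<psi> where "\<psi> x = cnj (sgn (u x)) * indicator A x" for x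
    have iA: "integrable lborel (indicat_real A)"
    proof (rule Bochner_Integration.integrable_bound)
      show "integrable lborel (indicat_real (cball (0::'a) (real n)))"
        by (rule integrable_indicator_cball)
      show "AE x in lborel. norm (indicat_real A x) \<le> norm (indicat_real (cball 0 (real n)) x)"
        by (auto simp: A_def indicator_def)
    qed measurable
    have iu: "integrable lborel (\<lambda>x. indicator A x * cmod (u x))"
      by (rule Bochner_Integration.integrable_bound[OF u_locally_integrable[of "real n"]]) (auto simp: A_def indicator_def)
    have nsgn: "cmod (sgn (u x)) = (if u x = 0 then 0 else 1)" for x by (simp add: norm_sgn)
    have "cmod (LINT x|lborel. u x * \<psi> x) \<le> K * (LINT x|lborel. cmod (\<psi> x) powr q) powr (1 / q)"
    proof (rule bounded_bound[of _ 1 "real n"])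
      show "\<psi> \<in> borel_measurable borel" unfolding \<psi>_def sgn_div_norm by measurable
      show "cmod (\<psi> x) \<le> 1" for x by (simp add: \<psi>_def norm_mult nsgn indicator_def)
      show "\<psi> x = 0" if "real n < norm x" for x using that by (simp add: \<psi>_def A_def indicator_def)
    qed
    moreover have "(LINT x|lborel. u x * \<psi> x) = of_real (LINT x|lborel. indicator A x * cmod (u x))"
    proof -
      have "(LINT x|lborel. u x * \<psi> x) = (LINT x|lborel. of_real (indicator A x * cmod (u x)))"
        by (intro Bochner_Integration.integral_cong refl) (simp add: \<psi>_def mult.assoc[symmetric] u_sgn indicator_def)
      then show ?thesis by (simp del: of_real_mult)
    qed
    moreover have "(LINT x|lborel. cmod (\<psi> x) powr q) powr (1 / q) = (LINT x|lborel. indicat_real A x)"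
    proof -
      have "(LINT x|lborel. cmod (\<psi> x) powr q) = (LINT x|lborel. indicat_real A x)"
        using K_nonneg by (intro Bochner_Integration.integral_cong refl) (auto simp: \<psi>_def norm_mult nsgn A_def indicator_def assms)
      then show ?thesis using assms by (simp add: Bochner_Integration.integral_nonneg)
    qed
    ultimately have "(LINT x|lborel. indicator A x * cmod (u x)) \<le> K * (LINT x|lborel. indicat_real A x)"
      by (metis abs_ge_self norm_of_real order_trans)
    then have "(LINT x|lborel. indicator A x * cmod (u x) - K * indicat_real A x) \<le> 0"
      using iA iu by (subst Bochner_Integration.integral_diff) auto
    moreover have i: "integrable lborel (\<lambda>x. indicator A x * cmod (u x) - K * indicat_real A x)" using iA iu by auto
    moreover have nn: "AE x in lborel. 0 \<le> indicator A x * cmod (u x) - K * indicat_real A x"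
      by (auto simp: A_def indicator_def)
    ultimately have "(LINT x|lborel. indicator A x * cmod (u x) - K * indicat_real A x) = 0"
      using integral_nonneg_AE[OF nn] by linarith
    then have "AE x in lborel. indicator A x * cmod (u x) - K * indicat_real A x = 0"
      using integral_nonneg_eq_0_iff_AE[OF i nn] by blast
    then show ?thesis by eventually_elim (auto simp: A_def indicator_def split: if_splits)
  qed
  then have "AE x in lborel. \<forall>n. norm x \<le> real n \<longrightarrow> cmod (u x) \<le> K" unfolding AE_all_countable by blast
  then show ?thesis
  proof eventually_elim
    fix x assume "\<forall>n. norm x \<le> real n \<longrightarrow> cmod (u x) \<le> K"
    moreover obtain n where "norm x \<le> real n" using real_arch_simple by blast
    ultimately show "cmod (u x) \<le> K" by blast
  qed
qed

text \<open>Test with \<open>|u|^(p - 1)\<close> times the conjugate sign, cut off where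
  \<open>x\<close> or \<open>u x\<close> is large. The cutoff makes \<open>I\<close> finite, so
  \<open>I \<le> K * I powr (1 / q)\<close> may be divided by \<open>I powr (1 / q)\<close>;
  monotone convergence then removes the cutoff.\<close>

lemma Lp_bound:
  assumes p: "1 < q" "1 / p + 1 / q = 1" "1 < p"
  shows "(\<integral>\<^sup>+x. ennreal (cmod (u x) powr p) \<partial>lborel) \<le> ennreal (K powr p)"
proof -
  define A where "A n = {x. norm x \<le> real n \<and> cmod (u x) \<le> real n}" for n
  have [measurable]: "A n \<in> sets borel" for n unfolding A_def by measurable
  have "(\<integral>\<^sup>+x. ennreal (cmod (u x) powr p) * indicator (A n) x \<partial>lborel) \<le> ennreal (K powr p)" for n
  proof -
    define \<psi> where "\<psi> x = cnj (sgn (u x)) * of_real (cmod (u x) powr (p - 1) * indicator (A n) x)" for x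
    define I where "I = (LINT x|lborel. cmod (u x) powr p * indicator (A n) x)"
    have i: "integrable lborel (\<lambda>x. cmod (u x) powr p * indicator (A n) x)"
    proof (rule Bochner_Integration.integrable_bound)
      show "integrable lborel (\<lambda>x::'a. real n powr p * indicat_real (cball (0::'a) (real n)) x)"
        by (intro integrable_mult_right integrable_indicator_cball)
      show "AE x in lborel. norm (cmod (u x) powr p * indicator (A n) x) \<le> norm (real n powr p * indicat_real (cball (0::'a) (real n)) x)"
        using p by (intro AE_I2) (auto simp: A_def indicator_def intro!: powr_mono2)
    qed measurable
    have I0: "0 \<le> I" unfolding I_def by (intro Bochner_Integration.integral_nonneg) auto
    have nsgn: "cmod (sgn (u x)) = (if u x = 0 then 0 else 1)" for x by (simp add: norm_sgn)
    have n\<psi>: "cmod (\<psi> x) = cmod (u x) powr (p - 1) * indicator (A n) x" for x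
      by (simp add: \<psi>_def norm_mult nsgn indicator_def)
    have "cmod (LINT x|lborel. u x * \<psi> x) \<le> K * (LINT x|lborel. cmod (\<psi> x) powr q) powr (1 / q)"
    proof (rule bounded_bound[of _ "real n powr (p - 1)" "real n"])
      show "\<psi> \<in> borel_measurable borel" unfolding \<psi>_def sgn_div_norm by measurable
      show "cmod (\<psi> x) \<le> real n powr (p - 1)" for x
        using p by (auto simp: n\<psi> A_def indicator_def intro!: powr_mono2)
      show "\<psi> x = 0" if "real n < norm x" for x using that by (simp add: \<psi>_def A_def indicator_def)
    qed
    moreover have "(LINT x|lborel. u x * \<psi> x) = of_real I"
    proof -
      have "(LINT x|lborel. u x * \<psi> x) = (LINT x|lborel. of_real (cmod (u x) powr p * indicator (A n) x))"
      proof (intro Bochner_Integration.integral_cong refl)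
        fix x
        have "cmod (u x) * cmod (u x) powr (p - 1) = cmod (u x) powr p"
          using powr_add[of "cmod (u x)" 1 "p - 1"] by simp
        then show "u x * \<psi> x = of_real (cmod (u x) powr p * indicator (A n) x)"
          unfolding \<psi>_def mult.assoc[symmetric] u_sgn by (simp add: indicator_def flip: of_real_mult)
      qed
      then show ?thesis by (simp add: I_def del: of_real_mult)
    qed
    moreover have "(LINT x|lborel. cmod (\<psi> x) powr q) = I"
    proof -
      have e: "(p - 1) * q = p" using p by (simp add: field_simps)
      show ?thesis unfolding I_def n\<psi>
        by (intro Bochner_Integration.integral_cong refl) (auto simp: powr_powr e indicator_def)
    qed
    ultimately have "I \<le> K * I powr (1 / q)" using I0 by simp
    then have "I \<le> K powr p"
    proof (cases "I = 0")
      case False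
      then have I: "0 < I" using I0 by simp
      have "I = I powr (1 / p) * I powr (1 / q)" using I p by (simp add: powr_add[symmetric])
      then have "I powr (1 / p) * I powr (1 / q) \<le> K * I powr (1 / q)" using \<open>I \<le> K * I powr (1 / q)\<close> by simp
      then have "I powr (1 / p) \<le> K" using I by simp
      then have "(I powr (1 / p)) powr p \<le> K powr p" using p by (intro powr_mono2) auto
      then show ?thesis using I p by (simp add: powr_powr)
    qed simp
    moreover have "(\<integral>\<^sup>+x. ennreal (cmod (u x) powr p) * indicator (A n) x \<partial>lborel) = ennreal I"
      unfolding I_def by (subst nn_integral_eq_integral[symmetric, OF i]) (auto simp: ennreal_mult' ennreal_indicator)
    ultimately show ?thesis by (simp add: ennreal_leI)
  qed
  moreover have "(\<integral>\<^sup>+x. ennreal (cmod (u x) powr p) \<partial>lborel) = (SUP n. \<integral>\<^sup>+x. ennreal (cmod (u x) powr p) * indicator (A n) x \<partial>lborel)"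
  proof -
    have "(SUP n. ennreal (cmod (u x) powr p) * indicator (A n) x) = ennreal (cmod (u x) powr p)" for x
    proof (rule antisym)
      show "(SUP n. ennreal (cmod (u x) powr p) * indicator (A n) x) \<le> ennreal (cmod (u x) powr p)"
        by (intro SUP_least) (auto simp: indicator_def)
      obtain n where "max (norm x) (cmod (u x)) \<le> real n" using real_arch_simple by blast
      then have "ennreal (cmod (u x) powr p) = ennreal (cmod (u x) powr p) * indicator (A n) x"
        by (auto simp: A_def indicator_def)
      also have "\<dots> \<le> (SUP n. ennreal (cmod (u x) powr p) * indicator (A n) x)" by (rule SUP_upper) simp
      finally show "ennreal (cmod (u x) powr p) \<le> (SUP n. ennreal (cmod (u x) powr p) * indicator (A n) x)" .
    qed
    moreover have "incseq (\<lambda>n x. ennreal (cmod (u x) powr p) * indicator (A n) x)"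
      by (auto simp: incseq_def le_fun_def A_def indicator_def)
    ultimately show ?thesis
      by (subst nn_integral_monotone_convergence_SUP[symmetric]) auto
  qed
  ultimately show ?thesis by (auto intro: SUP_least)
qed

end

section \<open>The integer lattice and its fundamental cube\<close>

text \<open>The one finiteness condition from which the interchanges of complex series and integrals
  below are drawn.\<close>

lemma sums_integral_suminf:
  fixes F :: "nat \<Rightarrow> 'a \<Rightarrow> complex"
  assumes [measurable]: "\<And>n. F n \<in> borel_measurable M"
    and fin: "(\<integral>\<^sup>+x. (\<Sum>n. ennreal (cmod (F n x))) \<partial>M) < \<infinity>"
  shows "AE x in M. summable (\<lambda>n. cmod (F n x))"
    and "integrable M (\<lambda>x. \<Sum>n. F n x)"
    and "integrable M (F n)"
    and "(\<lambda>n. LINT x|M. F n x) sums (LINT x|M. (\<Sum>n. F n x))"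
    and "summable (\<lambda>n. cmod (LINT x|M. F n x))"
proof -
  have s: "(\<Sum>n. \<integral>\<^sup>+x. ennreal (cmod (F n x)) \<partial>M) < \<infinity>"
    using fin by (subst nn_integral_suminf[symmetric]) auto
  have "(\<integral>\<^sup>+x. ennreal (cmod (F n x)) \<partial>M) \<le> (\<Sum>n. \<integral>\<^sup>+x. ennreal (cmod (F n x)) \<partial>M)" for n
    using sum_le_suminf[of "\<lambda>n. \<integral>\<^sup>+x. ennreal (cmod (F n x)) \<partial>M" "{n}"] by simp
  then have i: "integrable M (F n)" for n
    using s by (intro integrableI_bounded) (auto intro: le_less_trans)
  then show "integrable M (F n)" .
  have "AE x in M. (\<Sum>n. ennreal (cmod (F n x))) \<noteq> \<infinity>"
    using fin by (intro nn_integral_PInf_AE) auto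
  then show ae: "AE x in M. summable (\<lambda>n. cmod (F n x))"
    by eventually_elim (auto intro: summable_suminf_not_top)
  have e: "(\<integral>\<^sup>+x. ennreal (cmod (F n x)) \<partial>M) = ennreal (LINT x|M. cmod (F n x))" for n
    using i by (intro nn_integral_eq_integral) auto
  have sm: "summable (\<lambda>n. LINT x|M. norm (F n x))"
    using s unfolding e by (intro summable_suminf_not_top) (auto intro: Bochner_Integration.integral_nonneg)
  show "integrable M (\<lambda>x. \<Sum>n. F n x)" by (rule integrable_suminf[OF i ae sm])
  show "(\<lambda>n. LINT x|M. F n x) sums (LINT x|M. (\<Sum>n. F n x))" by (rule sums_integral[OF i ae sm])
  show "summable (\<lambda>n. cmod (LINT x|M. F n x))"
    by (rule summable_comparison_test[OF _ sm]) (auto intro!: exI[of _ 0] integral_norm_bound)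
qed

lemma Zd_0 [simp]: "0 \<in> Zd" and Zd_add: "k \<in> Zd \<Longrightarrow> l \<in> Zd \<Longrightarrow> k + l \<in> Zd"
  and Zd_minus: "k \<in> Zd \<Longrightarrow> - k \<in> Zd" and Zd_diff: "k \<in> Zd \<Longrightarrow> l \<in> Zd \<Longrightarrow> k - l \<in> Zd"
  by (auto simp: Zd_def)

lemma countable_Zd: "countable (Zd :: (real ^ 'n::finite) set)"
  unfolding Zd_def by (rule countable_vector) (simp add: Ints_def)

lemma infinite_Zd: "infinite (Zd :: (real ^ 'n::finite) set)"
proof
  assume fin: "finite (Zd :: (real ^ 'n) set)"
  have "range (\<lambda>n::nat. (\<chi> i. real n) :: real ^ 'n) \<subseteq> Zd" by (auto simp: Zd_def)
  then have "finite (range (\<lambda>n::nat. (\<chi> i. real n) :: real ^ 'n))" using fin finite_subset by blast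
  moreover have "inj (\<lambda>n::nat. (\<chi> i. real n) :: real ^ 'n)" by (auto simp: inj_def vec_eq_iff)
  ultimately show False using finite_imageD by blast
qed

text \<open>An enumeration turns lattice sums into ordinary series and lattice-indexed null sets
  into countable families.\<close>

definition lat :: "nat \<Rightarrow> real ^ 'n::finite" where
  "lat = from_nat_into Zd"

lemma bij_lat: "bij_betw lat UNIV (Zd :: (real ^ 'n::finite) set)"
  unfolding lat_def by (rule bij_betw_from_nat_into[OF countable_Zd infinite_Zd])

lemma lat_Zd [simp]: "lat n \<in> Zd"
  using bij_lat by (auto simp: bij_betw_def)

lemma lat_eq_iff [simp]: "lat m = lat n \<longleftrightarrow> m = n"
  using bij_lat by (auto simp: bij_betw_def dest: injD)

lemma obtain_lat:
  assumes "k \<in> Zd" obtains n where "k = lat n"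
  using assms bij_lat unfolding bij_betw_def by (metis imageE)

text \<open>Through counting measure on the lattice the value becomes independent of the
  enumeration.\<close>

lemma suminf_lat: "(\<Sum>n. F (lat n)) = (\<integral>\<^sup>+k. F k \<partial>count_space Zd)" for F :: "real ^ 'n::finite \<Rightarrow> ennreal"
  using nn_integral_bij_count_space[OF bij_lat, of F] by (simp add: nn_integral_count_space_nat)

lemma suminf_lat_minus:
  fixes F :: "real ^ 'n::finite \<Rightarrow> ennreal"
  shows "(\<Sum>n. F (- lat n)) = (\<Sum>n. F (lat n))"
proof -
  have "bij_betw (\<lambda>k::real^'n. - k) Zd Zd"
    by (rule bij_betw_byWitness[where f'="\<lambda>k. - k"]) (auto simp: Zd_minus)
  from nn_integral_bij_count_space[OF this, of F] show ?thesis by (simp add: suminf_lat suminf_lat[of "\<lambda>k. F (- k)"])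
qed

text \<open>Half open, so that every point has exactly one lattice translate in it;
  \<open>torus\<close> would count boundary points several times.\<close>

definition T0 :: "(real ^ 'n::finite) set" where
  "T0 = {x. \<forall>i. - 1 / 2 \<le> x $ i \<and> x $ i < 1 / 2}"

lemma T0_borel [measurable]: "(T0 :: (real ^ 'n::finite) set) \<in> sets borel"
proof -
  have "(T0 :: (real ^ 'n) set) = (\<Inter>i. {x. - 1 / 2 \<le> x $ i} \<inter> {x. x $ i < 1 / 2})" by (auto simp: T0_def)
  also have "\<dots> \<in> sets borel"
    by (intro sets.finite_INT sets.Int borel_closed borel_open closed_halfspace_component_ge_cart open_halfspace_component_lt_cart) auto
  finally show ?thesis .
qed

lemma T0_ex1:
  fixes x :: "real ^ 'n::finite"
  shows "\<exists>!k. k \<in> Zd \<and> x + k \<in> T0"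
proof
  define k :: "real ^ 'n" where "k = (\<chi> i. - of_int \<lfloor>x $ i + 1 / 2\<rfloor>)"
  show "k \<in> Zd \<and> x + k \<in> T0"
  proof
    show "k \<in> Zd" by (auto simp: k_def Zd_def)
    have "- 1 / 2 \<le> x $ i - of_int \<lfloor>x $ i + 1 / 2\<rfloor>" "x $ i - of_int \<lfloor>x $ i + 1 / 2\<rfloor> < 1 / 2" for i
      using floor_correct[of "x $ i + 1 / 2"] by linarith+
    then show "x + k \<in> T0" by (auto simp: k_def T0_def)
  qed
  fix l assume l: "l \<in> Zd \<and> x + l \<in> T0"
  show "l = k" unfolding vec_eq_iff
  proof
    fix i
    obtain m where m: "l $ i = of_int m" using l unfolding Zd_def by (auto elim: Ints_cases)
    have "- 1 / 2 \<le> (x + l) $ i \<and> (x + l) $ i < 1 / 2" using l unfolding T0_def by blast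
    then have "- 1 / 2 \<le> x $ i + of_int m" "x $ i + of_int m < 1 / 2" by (simp_all add: m)
    then have "\<lfloor>x $ i + 1 / 2\<rfloor> = - m" by (intro floor_unique) auto
    then show "l $ i = k $ i" using m by (simp add: k_def)
  qed
qed

lemma T0_single: "\<exists>n0. \<forall>n. x + lat n \<in> T0 \<longleftrightarrow> n = n0"
proof -
  obtain k where k: "k \<in> Zd" "\<And>l. l \<in> Zd \<Longrightarrow> x + l \<in> T0 \<longleftrightarrow> l = k" using T0_ex1[of x] by blast
  obtain n0 where "k = lat n0" using obtain_lat k(1) by blast
  then show ?thesis using k(2)[OF lat_Zd] by auto
qed

lemma T0_single_minus: "\<exists>n0. \<forall>n. x - lat n \<in> T0 \<longleftrightarrow> n = n0"
proof -
  obtain k where k: "k \<in> Zd" "\<And>l. l \<in> Zd \<Longrightarrow> x + l \<in> T0 \<longleftrightarrow> l = k" using T0_ex1[of x] by blast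
  obtain n0 where n0: "- k = lat n0" using obtain_lat Zd_minus k(1) by blast
  have "x - lat n \<in> T0 \<longleftrightarrow> n = n0" for n
  proof -
    have "x - lat n \<in> T0 \<longleftrightarrow> - lat n = k" using k(2)[of "- lat n"] Zd_minus[OF lat_Zd[of n]] by simp
    also have "\<dots> \<longleftrightarrow> lat n = - k" by auto
    also have "\<dots> \<longleftrightarrow> n = n0" by (simp add: n0)
    finally show ?thesis .
  qed
  then show ?thesis by blast
qed

text \<open>Translate the \<open>n\<close>-th term back by \<open>lat n\<close>: the cubes
  \<open>T0 + lat n\<close> cover every point exactly once.\<close>

lemma nn_integral_tiling:
  fixes F :: "real ^ 'n::finite \<Rightarrow> ennreal"
  assumes [measurable]: "F \<in> borel_measurable borel"
  shows "(\<integral>\<^sup>+x. F x \<partial>lborel) = (\<integral>\<^sup>+x. indicator T0 x * (\<Sum>n. F (x + lat n)) \<partial>lborel)"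
proof -
  have "(\<integral>\<^sup>+x. indicator T0 x * (\<Sum>n. F (x + lat n)) \<partial>lborel) = (\<integral>\<^sup>+x. (\<Sum>n. indicator T0 x * F (x + lat n)) \<partial>lborel)"
    by simp
  also have "\<dots> = (\<Sum>n. \<integral>\<^sup>+x. indicator T0 x * F (x + lat n) \<partial>lborel)"
    by (rule nn_integral_suminf) measurable
  also have "(\<lambda>n. \<integral>\<^sup>+x. indicator T0 x * F (x + lat n) \<partial>lborel) = (\<lambda>n. \<integral>\<^sup>+x. indicator T0 (x - lat n) * F x \<partial>lborel)"
  proof
    fix n
    show "(\<integral>\<^sup>+x. indicator T0 x * F (x + lat n) \<partial>lborel) = (\<integral>\<^sup>+x. indicator T0 (x - lat n) * F x \<partial>lborel)"
      using nn_integral_lborel_translate[of "\<lambda>x. indicator T0 (x - lat n) * F x" "lat n"] by (simp add: add.commute)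
  qed
  also have "(\<Sum>n. \<integral>\<^sup>+x. indicator T0 (x - lat n) * F x \<partial>lborel) = (\<integral>\<^sup>+x. (\<Sum>n. indicator T0 (x - lat n) * F x) \<partial>lborel)"
    by (rule nn_integral_suminf[symmetric]) measurable
  also have "\<dots> = (\<integral>\<^sup>+x. F x \<partial>lborel)"
  proof (intro nn_integral_cong)
    fix x :: "real ^ 'n"
    obtain n0 where n0: "\<And>n. x - lat n \<in> T0 \<longleftrightarrow> n = n0" using T0_single_minus[of x] by blast
    have "(\<Sum>n. indicator T0 (x - lat n) * F x) = (\<Sum>n\<in>{n0}. indicator T0 (x - lat n) * F x)"
      by (rule suminf_finite) (auto simp: n0)
    then show "(\<Sum>n. indicator T0 (x - lat n) * F x) = F x" by (simp add: n0)
  qed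
  finally show ?thesis by simp
qed

lemma integral_tiling:
  fixes F :: "real ^ 'n::finite \<Rightarrow> complex"
  assumes F: "integrable lborel F"
  shows "(LINT x|lborel. F x) = (LINT x|lborel. indicator T0 x * (\<Sum>n. F (x + lat n)))"
    and "integrable lborel (\<lambda>x. indicator T0 x * (\<Sum>n. F (x + lat n)))"
proof -
  have [measurable]: "F \<in> borel_measurable borel" using F by auto
  have finF: "(\<integral>\<^sup>+x. ennreal (cmod (F x)) \<partial>lborel) < \<infinity>" using F by (simp add: integrable_iff_bounded)
  \<comment> \<open>The \<open>n\<close>-th members of the two families differ by a translation by
    \<open>lat n\<close>. Summed over \<open>n\<close>, \<open>A\<close> gives the periodization on
    the cube and \<open>B\<close> gives back \<open>F\<close>.\<close>
  define A where "A n x = indicator T0 x * F (x + lat n)" for n x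
  define B where "B n x = indicator T0 (x - lat n) * F x" for n x
  have [measurable]: "A n \<in> borel_measurable borel" "B n \<in> borel_measurable borel" for n
    unfolding A_def B_def by measurable
  have fA: "(\<integral>\<^sup>+x. (\<Sum>n. ennreal (cmod (A n x))) \<partial>lborel) < \<infinity>"
  proof -
    have "(\<integral>\<^sup>+x. (\<Sum>n. ennreal (cmod (A n x))) \<partial>lborel) = (\<integral>\<^sup>+x. indicator T0 x * (\<Sum>n. ennreal (cmod (F (x + lat n)))) \<partial>lborel)"
    proof (intro nn_integral_cong)
      fix x show "(\<Sum>n. ennreal (cmod (A n x))) = indicator T0 x * (\<Sum>n. ennreal (cmod (F (x + lat n))))"
        by (cases "x \<in> T0") (simp_all add: A_def)
    qed
    also have "\<dots> = (\<integral>\<^sup>+x. ennreal (cmod (F x)) \<partial>lborel)"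
      by (rule nn_integral_tiling[symmetric]) measurable
    finally show ?thesis using finF by simp
  qed
  have Bx: "(\<Sum>n. B n x) = F x" "(\<Sum>n. ennreal (cmod (B n x))) = ennreal (cmod (F x))" for x
  proof -
    obtain n0 where n0: "\<And>n. x - lat n \<in> T0 \<longleftrightarrow> n = n0" using T0_single_minus[of x] by blast
    have "(\<Sum>n. B n x) = (\<Sum>n\<in>{n0}. B n x)"
      by (rule suminf_finite) (auto simp: n0 B_def)
    then show "(\<Sum>n. B n x) = F x" by (simp add: n0 B_def)
    have "(\<Sum>n. ennreal (cmod (B n x))) = (\<Sum>n\<in>{n0}. ennreal (cmod (B n x)))"
      by (rule suminf_finite) (auto simp: n0 B_def)
    then show "(\<Sum>n. ennreal (cmod (B n x))) = ennreal (cmod (F x))" by (simp add: n0 B_def)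
  qed
  have AB: "(LINT x|lborel. A n x) = (LINT x|lborel. B n x)" for n
    using integral_lborel_translate[of "B n" "lat n"] by (simp add: A_def B_def add.commute)
  have eA: "(\<Sum>n. A n x) = indicator T0 x * (\<Sum>n. F (x + lat n))" for x
    by (cases "x \<in> T0") (auto simp: A_def)
  have "(\<lambda>n. LINT x|lborel. A n x) sums (LINT x|lborel. (\<Sum>n. A n x))"
    by (rule sums_integral_suminf(4)[OF _ fA]) measurable
  moreover have "(\<lambda>n. LINT x|lborel. B n x) sums (LINT x|lborel. (\<Sum>n. B n x))"
    by (rule sums_integral_suminf(4)) (use finF in \<open>auto simp: Bx\<close>)
  ultimately show "(LINT x|lborel. F x) = (LINT x|lborel. indicator T0 x * (\<Sum>n. F (x + lat n)))"
    unfolding Bx AB eA using sums_unique2 by blast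
  show "integrable lborel (\<lambda>x. indicator T0 x * (\<Sum>n. F (x + lat n)))"
    unfolding eA[symmetric] by (rule sums_integral_suminf(2)[OF _ fA]) measurable
qed

lemma torus_cbox: "(torus :: (real ^ 'n::finite) set) = cbox (\<chi> i. - 1 / 2) (\<chi> i. 1 / 2)"
  by (auto simp: torus_def mem_box_cart)

lemma T0_subset_torus: "T0 \<subseteq> torus"
  by (auto simp: T0_def torus_def less_imp_le)

lemma emeasure_T0: "emeasure lborel (T0 :: (real ^ 'n::finite) set) = 1"
  and emeasure_torus: "emeasure lborel (torus :: (real ^ 'n::finite) set) = 1"
proof -
  let ?l = "(\<chi> i. - 1 / 2) :: real ^ 'n" and ?u = "(\<chi> i. 1 / 2) :: real ^ 'n"
  have c: "emeasure lborel (cbox ?l ?u) = 1" "emeasure lborel (box ?l ?u) = 1"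
  proof -
    have "?l \<bullet> b \<le> ?u \<bullet> b" "(?u - ?l) \<bullet> b = 1" if "b \<in> Basis" for b
      using that by (auto simp: Basis_vec_def inner_axis)
    then show "emeasure lborel (cbox ?l ?u) = 1" "emeasure lborel (box ?l ?u) = 1" by simp_all
  qed
  have "box ?l ?u \<subseteq> T0" by (auto simp: T0_def mem_box_cart less_imp_le)
  then have "1 \<le> emeasure lborel (T0 :: (real ^ 'n) set)" using c(2) by (metis emeasure_mono T0_borel sets_lborel)
  moreover have "emeasure lborel (T0 :: (real ^ 'n) set) \<le> 1"
    using c(1) T0_subset_torus unfolding torus_cbox by (metis emeasure_mono sets_lborel borel_closed closed_cbox)
  ultimately show "emeasure lborel (T0 :: (real ^ 'n) set) = 1" by simp
  show "emeasure lborel (torus :: (real ^ 'n) set) = 1" using c unfolding torus_cbox by simp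
qed

lemma norm_T0_le: "x \<in> T0 \<Longrightarrow> norm (x :: real ^ 'n::finite) \<le> CARD('n)"
proof -
  assume x: "x \<in> T0"
  have "\<bar>x $ i\<bar> \<le> 1" for i using x unfolding T0_def by (auto simp: abs_le_iff dest!: spec[of _ i])
  then have "(\<Sum>i\<in>UNIV. \<bar>x $ i\<bar>) \<le> (\<Sum>i\<in>(UNIV::'n set). 1)" by (intro sum_mono)
  then show ?thesis using norm_le_l1_cart[of x] by simp
qed

text \<open>Average over the cube, which has measure 1: the shifts \<open>x\<close> in
  \<open>T0\<close> spread the lattice sum into an integral, with a bound uniform in
  \<open>\<xi>\<close>.\<close>

lemma lattice_sum_le_integral:
  fixes F H :: "real ^ 'n::finite \<Rightarrow> ennreal"
  assumes [measurable]: "H \<in> borel_measurable borel" and le: "\<And>x y. x \<in> T0 \<Longrightarrow> F y \<le> H (y + x)"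
  shows "(\<Sum>n. F (\<xi> + lat n)) \<le> (\<integral>\<^sup>+x. H x \<partial>lborel)"
proof -
  have "(\<Sum>n. F (\<xi> + lat n)) = (\<integral>\<^sup>+x. indicator T0 (x :: real ^ 'n) * (\<Sum>n. F (\<xi> + lat n)) \<partial>lborel)"
    by (subst nn_integral_multc) (auto simp: emeasure_T0)
  also have "\<dots> \<le> (\<integral>\<^sup>+x. indicator T0 x * (\<Sum>n. H (\<xi> + (x + lat n))) \<partial>lborel)"
  proof (intro nn_integral_mono)
    fix x :: "real ^ 'n"
    show "indicator T0 x * (\<Sum>n. F (\<xi> + lat n)) \<le> indicator T0 x * (\<Sum>n. H (\<xi> + (x + lat n)))"
    proof (cases "x \<in> T0")
      case True
      have "F (\<xi> + lat n) \<le> H (\<xi> + (x + lat n))" for n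
        using le[OF True, of "\<xi> + lat n"] by (simp add: ac_simps)
      then show ?thesis using True by (simp add: suminf_le)
    qed simp
  qed
  also have "\<dots> = (\<integral>\<^sup>+x. H (\<xi> + x) \<partial>lborel)"
    by (rule nn_integral_tiling[of "\<lambda>x. H (\<xi> + x)", symmetric]) measurable
  also have "\<dots> = (\<integral>\<^sup>+x. H x \<partial>lborel)" by (rule nn_integral_lborel_translate) measurable
  finally show ?thesis .
qed

lemma ek_lattice: "k \<in> Zd \<Longrightarrow> l \<in> Zd \<Longrightarrow> ek k l = 1"
proof -
  assume "k \<in> Zd" "l \<in> Zd"
  then have "k \<bullet> l \<in> \<int>" unfolding inner_vec_def Zd_def by (intro Ints_sum) auto
  then obtain m where "k \<bullet> l = of_int m" by (auto elim: Ints_cases)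
  then have "ek k l = cis (2 * pi * of_int m)" by (simp add: ek_def)
  then show ?thesis by (simp add: cis_multiple_2pi)
qed

lemma ek_shift: "k \<in> Zd \<Longrightarrow> l \<in> Zd \<Longrightarrow> ek k (x + l) = ek k x"
  by (simp add: ek_add_right ek_lattice)

lemma integrable_T0:
  fixes f :: "real ^ 'n::finite \<Rightarrow> complex"
  assumes [measurable]: "f \<in> borel_measurable borel" and "\<And>x. cmod (f x) \<le> B"
  shows "integrable lborel (\<lambda>x. indicator T0 x * f x)"
proof -
  have "integrable lborel (indicat_real (T0 :: (real ^ 'n) set))"
    by (intro integrable_real_indicator) (auto simp: emeasure_T0)
  then have "integrable lborel (\<lambda>x. complex_of_real (indicat_real (T0 :: (real ^ 'n) set) x))" by (rule integrable_of_real)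
  then have "integrable lborel (\<lambda>x. complex_of_real (indicat_real (T0 :: (real ^ 'n) set) x) * f x)"
    by (rule integrable_times_bounded) (use assms in auto)
  moreover have "complex_of_real (indicat_real T0 x) = indicator T0 x" for x :: "real ^ 'n" by (simp add: indicator_def)
  ultimately show ?thesis by simp
qed

text \<open>A shift by half a period of the character reverses its sign but preserves its integral
  over a fundamental cube, so for \<open>k \<noteq> 0\<close> the integral equals its own
  negative.\<close>

lemma character_orthogonality:
  fixes k :: "real ^ 'n::finite"
  assumes k: "k \<in> Zd"
  shows "(LINT x|lborel. indicator T0 x * ek k x) = (if k = 0 then 1 else 0)"
proof (cases "k = 0")
  case True
  have "(LINT x|lborel. indicator (T0 :: (real ^ 'n) set) x :: complex) = (LINT x|lborel. complex_of_real (indicat_real (T0 :: (real ^ 'n) set) x))"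
    by (intro Bochner_Integration.integral_cong) (auto simp: indicator_def)
  then show ?thesis using True by (simp add: measure_def emeasure_T0)
next
  case False
  then obtain i where i: "k $ i \<noteq> 0" by (auto simp: vec_eq_iff)
  define a where "a = axis i (1 / (2 * k $ i))"
  have "k \<bullet> a = 1 / 2" using i by (simp add: a_def inner_axis)
  then have "2 * pi * (k \<bullet> a) = pi" by simp
  then have "ek k a = -1" by (simp only: ek_def cis_pi)
  then have ka: "ek k (a + x) = - ek k x" for x by (simp add: ek_add_right)
  let ?I = "LINT x|lborel. indicator T0 x * ek k x"
  have [measurable]: "ek k \<in> borel_measurable borel" by (simp add: measurable_ek)
  have i2: "integrable lborel (\<lambda>x. indicator T0 (a + x) * ek k x)"
  proof -
    have "integrable lborel (\<lambda>x. indicator T0 x * ek k x)" by (rule integrable_T0[where B=1]) auto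
    then have "integrable (distr lborel borel ((+) a)) (\<lambda>x. indicator T0 x * ek k x)" by (simp add: lborel_distr_plus)
    then have "integrable lborel (\<lambda>x. indicator T0 (a + x) * ek k (a + x))" by (subst (asm) integrable_distr_eq) auto
    then show ?thesis by (simp add: ka)
  qed
  have "?I = (LINT x|lborel. indicator T0 (a + x) * ek k (a + x))"
    by (rule integral_lborel_translate[symmetric]) measurable
  also have "\<dots> = - (LINT x|lborel. indicator T0 (a + x) * ek k x)" by (simp add: ka)
  \<comment> \<open>The shifted cube is again a fundamental domain; tiling folds it back to
    \<open>T0\<close>, the character being lattice periodic.\<close>
  also have "(LINT x|lborel. indicator T0 (a + x) * ek k x) = (LINT x|lborel. indicator T0 x * (\<Sum>n. indicator T0 (a + (x + lat n)) * ek k (x + lat n)))"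
    by (rule integral_tiling(1)[OF i2])
  also have "\<dots> = ?I"
  proof (intro Bochner_Integration.integral_cong refl)
    fix x :: "real ^ 'n"
    obtain n0 where n0: "\<And>n. a + x + lat n \<in> T0 \<longleftrightarrow> n = n0" using T0_single[of "a + x"] by blast
    have "(\<Sum>n. indicator T0 (a + (x + lat n)) * ek k (x + lat n)) = (\<Sum>n\<in>{n0}. indicator T0 (a + (x + lat n)) * ek k (x + lat n))"
      by (rule suminf_finite) (auto simp: n0 add.assoc[symmetric])
    then show "indicator T0 x * (\<Sum>n. indicator T0 (a + (x + lat n)) * ek k (x + lat n)) = indicator T0 x * ek k x"
      by (simp add: n0 add.assoc[symmetric] ek_shift k)
  qed
  finally have "?I = 0" by simp
  then show ?thesis using False by simp
qed

section \<open>Trigonometric approximation of periodic functions\<close>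

inductive trig :: "(real ^ 'n::finite \<Rightarrow> complex) \<Rightarrow> bool" where
  trig_char: "k \<in> Zd \<Longrightarrow> trig (\<lambda>x. c * ek k x)"
| trig_add: "trig f \<Longrightarrow> trig g \<Longrightarrow> trig (\<lambda>x. f x + g x)"

lemma trig_const: "trig (\<lambda>x. c)"
  using trig_char[of 0 c] by simp

lemma trig_mult:
  assumes "trig f" "trig g" shows "trig (\<lambda>x. f x * g x)"
  using assms(1)
proof induction
  case (trig_char k c)
  show ?case using assms(2)
  proof induction
    case (trig_char l d)
    have "(\<lambda>x. c * ek k x * (d * ek l x)) = (\<lambda>x. (c * d) * ek (k + l) x)" by (auto simp: ek_add mult_ac)
    then show ?case using trig.trig_char[OF Zd_add[OF \<open>k \<in> Zd\<close> \<open>l \<in> Zd\<close>]] by simp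
  next
    case (trig_add f g)
    then show ?case using trig.trig_add by (simp add: distrib_left)
  qed
next
  case (trig_add f1 f2)
  then show ?case using trig.trig_add by (simp add: distrib_right)
qed

lemma trig_sum:
  assumes "finite A" "\<And>a. a \<in> A \<Longrightarrow> trig (f a)" shows "trig (\<lambda>x. \<Sum>a\<in>A. f a x)"
  using assms
proof (induction A rule: finite_induct)
  case empty
  then show ?case using trig_const[of 0] by simp
next
  case (insert a A)
  then have "trig (\<lambda>x. f a x + (\<Sum>a\<in>A. f a x))" by (intro trig.trig_add) simp_all
  then show ?case using insert by simp
qed

(* emb identifies the torus with a compact set on which the Stone-Weierstrass theorem applies. *)
definition emb :: "real ^ 'n::finite \<Rightarrow> complex ^ 'n" where
  "emb x = (\<chi> i. cis (2 * pi * x $ i))"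

lemma continuous_on_emb: "continuous_on S emb"
  unfolding emb_def cis_conv_exp by (intro continuous_on_vec_lambda continuous_intros)

lemma emb_eq_iff: "emb x = emb y \<longleftrightarrow> x - y \<in> Zd"
proof -
  have "cis (2 * pi * a) = cis (2 * pi * b) \<longleftrightarrow> a - b \<in> \<int>" for a b :: real
  proof
    assume *: "cis (2 * pi * a) = cis (2 * pi * b)"
    have "cis (2 * pi * a) / cis (2 * pi * b) = 1" unfolding * by simp
    then have "cis (2 * pi * a - 2 * pi * b) = 1" by (simp only: cis_divide)
    then have "Re (cis (2 * pi * a - 2 * pi * b)) = 1" by simp
    then have "cos (2 * pi * a - 2 * pi * b) = 1" by (simp only: cis.sel)
    then obtain n :: int where "2 * pi * a - 2 * pi * b = of_int n * 2 * pi" by (auto simp only: cos_one_2pi_int)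
    then have "2 * pi * (a - b) = 2 * pi * of_int n" by (simp add: algebra_simps)
    then have "a - b = of_int n" by (simp only: mult_cancel_left) simp
    then show "a - b \<in> \<int>" by (simp only: Ints_of_int)
  next
    assume "a - b \<in> \<int>"
    then have "cis (2 * pi * (a - b)) = 1" by (rule cis_multiple_2pi)
    then have "cis (2 * pi * b + 2 * pi * (a - b)) = cis (2 * pi * b)" by (simp only: cis_mult[symmetric] mult_1_right)
    then show "cis (2 * pi * a) = cis (2 * pi * b)" by (simp add: right_diff_distrib)
  qed
  then show ?thesis by (simp add: emb_def vec_eq_iff Zd_def)
qed

text \<open>By Euler's formulas the real coordinates of \<open>emb\<close> are trigonometric
  polynomials, and these are closed under sums and products.\<close>

lemma trig_real_polynomial:
  fixes g :: "complex ^ 'n::finite \<Rightarrow> real"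
  assumes "real_polynomial_function g" shows "trig (\<lambda>x. of_real (g (emb x)))"
  using assms
proof induction
  case (linear f)
  have ax: "trig (\<lambda>x::real^'n. cis (2 * pi * x $ i))" "trig (\<lambda>x::real^'n. cis (- (2 * pi * x $ i)))" for i
  proof -
    have k: "axis i 1 \<in> (Zd :: (real ^ 'n) set)" "axis i (-1) \<in> (Zd :: (real ^ 'n) set)" by (auto simp: Zd_def axis_def)
    show "trig (\<lambda>x::real^'n. cis (2 * pi * x $ i))"
      using trig_char[OF k(1), of 1] by (simp add: ek_def inner_axis')
    show "trig (\<lambda>x::real^'n. cis (- (2 * pi * x $ i)))"
      using trig_char[OF k(2), of 1] by (simp add: ek_def inner_axis')
  qed
  have b: "trig (\<lambda>x. of_real (emb x \<bullet> b))" if "b \<in> Basis" for b :: "complex ^ 'n"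
  proof -
    obtain i u where b: "b = axis i u" "u = 1 \<or> u = \<i>" using \<open>b \<in> Basis\<close> by (auto simp: Basis_vec_def Basis_complex_def)
    have c: "complex_of_real (cos t) = (1 / 2) * (cis t + cis (- t))" "complex_of_real (sin t) = (- \<i> / 2) * (cis t + (-1) * cis (- t))" for t
      by (auto simp: complex_eq_iff)
    have "trig (\<lambda>x::real^'n. (1 / 2) * (cis (2 * pi * x $ i) + cis (- (2 * pi * x $ i))))"
      "trig (\<lambda>x::real^'n. (- \<i> / 2) * (cis (2 * pi * x $ i) + (-1) * cis (- (2 * pi * x $ i))))"
      by (rule trig_mult[OF trig_const trig_add[OF ax]],
          rule trig_mult[OF trig_const trig_add[OF ax(1) trig_mult[OF trig_const ax(2)]]])
    then have "trig (\<lambda>x::real^'n. of_real (cos (2 * pi * x $ i)))" "trig (\<lambda>x::real^'n. of_real (sin (2 * pi * x $ i)))"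
      unfolding c .
    then show ?thesis using b(2) unfolding b(1) by (auto simp: inner_axis emb_def inner_complex_def)
  qed
  interpret bounded_linear f by fact
  have fz: "f z = (\<Sum>b\<in>Basis. f b * (z \<bullet> b))" for z
    by (subst (1) euclidean_representation[of z, symmetric]) (simp add: sum scaleR mult.commute)
  have "(\<lambda>x. complex_of_real (f (emb x))) = (\<lambda>x. \<Sum>b\<in>Basis. of_real (f b) * of_real (emb x \<bullet> b))"
    by (rule ext, subst fz) simp
  moreover have "trig (\<lambda>x. \<Sum>b\<in>Basis. of_real (f b) * of_real (emb x \<bullet> b))" by (rule trig_sum[OF finite_Basis trig_mult[OF trig_const b]])
  ultimately show ?case by simp
next
  case (const c)
  then show ?case by (rule trig_const)
next
  case (add f g)
  then show ?case using trig_add by simp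
next
  case (mult f g)
  then show ?case using trig_mult by simp
qed

text \<open>A periodic \<open>p\<close> factors as \<open>H\<close> after \<open>emb\<close>. Since
  \<open>emb\<close> restricted to the compact \<open>torus\<close> is a closed map,
  \<open>H\<close> is continuous on the compact image, where the Stone-Weierstrass theorem supplies
  a real polynomial.\<close>

lemma periodic_trig_approx_real:
  fixes p :: "real ^ 'n::finite \<Rightarrow> real"
  assumes p: "continuous_on UNIV p" "\<And>x k. k \<in> Zd \<Longrightarrow> p (x + k) = p x" and e: "0 < e"
  shows "\<exists>\<tau>. trig \<tau> \<and> (\<forall>x. cmod (of_real (p x) - \<tau> x) < e)"
proof -
  define S where "S = emb ` (torus :: (real ^ 'n) set)"
  define H where "H z = p (SOME x. emb x = z)" for z
  have H: "H (emb x) = p x" for x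
  proof -
    define y where "y = (SOME y. emb y = emb x)"
    have "emb y = emb x" unfolding y_def by (rule someI[of _ x]) simp
    then have "y - x \<in> Zd" by (simp add: emb_eq_iff)
    then have "p (x + (y - x)) = p x" by (rule p(2))
    then show ?thesis by (simp add: H_def y_def)
  qed
  have S: "compact S" unfolding S_def torus_cbox by (intro compact_continuous_image continuous_on_emb compact_cbox)
  have embS: "emb x \<in> S" for x :: "real ^ 'n"
  proof -
    obtain k where k: "k \<in> Zd" "x + k \<in> T0" using T0_ex1[of x] by blast
    then have "emb x = emb (x + k)" by (simp add: emb_eq_iff Zd_minus)
    then show ?thesis unfolding S_def using k T0_subset_torus by blast
  qed
  have "continuous_on S H"
    unfolding continuous_on_closed_invariant
  proof (intro allI impI)
    fix B :: "real set" assume B: "closed B"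
    have "closed (p -` B)" using p(1) B by (simp add: continuous_on_eq_continuous_at continuous_closed_vimage)
    then have "compact (torus \<inter> p -` B)" unfolding torus_cbox by (intro compact_Int_closed compact_cbox)
    then have "closed (emb ` (torus \<inter> p -` B))" by (intro compact_imp_closed compact_continuous_image continuous_on_emb)
    moreover have "emb ` (torus \<inter> p -` B) \<inter> S = H -` B \<inter> S"
    proof (intro set_eqI iffI)
      fix z assume "z \<in> emb ` (torus \<inter> p -` B) \<inter> S"
      then obtain x where "z = emb x" "p x \<in> B" "z \<in> S" by blast
      then show "z \<in> H -` B \<inter> S" using H[of x] by simp
    next
      fix z assume "z \<in> H -` B \<inter> S"
      then obtain x where x: "z = emb x" "x \<in> torus" "H z \<in> B" "z \<in> S" unfolding S_def by blast
      then have "p x \<in> B" using H[of x] by simp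
      then show "z \<in> emb ` (torus \<inter> p -` B) \<inter> S" using x by blast
    qed
    ultimately show "\<exists>A. closed A \<and> A \<inter> S = H -` B \<inter> S" by blast
  qed
  from Stone_Weierstrass_real_polynomial_function[OF S this e]
  obtain g where g: "real_polynomial_function g" "\<And>z. z \<in> S \<Longrightarrow> \<bar>H z - g z\<bar> < e" by blast
  have "cmod (of_real (p x) - of_real (g (emb x))) < e" for x
    using g(2)[OF embS[of x]] unfolding H of_real_diff[symmetric] norm_of_real .
  then show ?thesis using trig_real_polynomial[OF g(1)] by blast
qed

lemma periodic_trig_approx:
  fixes p :: "real ^ 'n::finite \<Rightarrow> complex"
  assumes p: "continuous_on UNIV p" "\<And>x k. k \<in> Zd \<Longrightarrow> p (x + k) = p x" and e: "0 < e"
  shows "\<exists>\<tau>. trig \<tau> \<and> (\<forall>x. cmod (p x - \<tau> x) < e)"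
proof -
  obtain t1 where t1: "trig t1" "\<And>x. cmod (of_real (Re (p x)) - t1 x) < e / 2"
    using periodic_trig_approx_real[OF continuous_on_Re[OF p(1)], of "e / 2"] p(2) e
    by (metis half_gt_zero)
  obtain t2 where t2: "trig t2" "\<And>x. cmod (of_real (Im (p x)) - t2 x) < e / 2"
    using periodic_trig_approx_real[OF continuous_on_Im[OF p(1)], of "e / 2"] p(2) e
    by (metis half_gt_zero)
  have "cmod (p x - (t1 x + \<i> * t2 x)) < e" for x
  proof -
    have "p x - (t1 x + \<i> * t2 x) = (of_real (Re (p x)) - t1 x) + \<i> * (of_real (Im (p x)) - t2 x)"
      by (simp add: complex_eq_iff)
    also have "cmod \<dots> \<le> cmod (of_real (Re (p x)) - t1 x) + cmod (of_real (Im (p x)) - t2 x)"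
      by (rule order_trans[OF norm_triangle_ineq]) (simp add: norm_mult)
    finally show ?thesis using t1(2)[of x] t2(2)[of x] by simp
  qed
  moreover have "trig (\<lambda>x. t1 x + \<i> * t2 x)" by (rule trig_add[OF t1(1) trig_mult[OF trig_const t2(1)]])
  ultimately show ?thesis by blast
qed

lemma infsum_lat:
  fixes F :: "real ^ 'n::finite \<Rightarrow> complex"
  assumes "summable (\<lambda>n. cmod (F (lat n)))"
  shows "(F has_sum (\<Sum>n. F (lat n))) Zd"
proof -
  have "((F \<circ> lat) has_sum (\<Sum>n. F (lat n))) UNIV"
    unfolding o_def using assms by (intro norm_summable_imp_has_sum) (auto dest: summable_norm_cancel simp: summable_sums)
  then show ?thesis using bij_lat unfolding bij_betw_def by (metis has_sum_reindex)
qed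

text \<open>Periodization is symmetric under the integral pairing: translate each term by
  \<open>lat n\<close>, then replace the lattice by its negative.\<close>

lemma nn_integral_periodization_swap:
  fixes F G :: "real ^ 'n::finite \<Rightarrow> ennreal"
  assumes [measurable]: "F \<in> borel_measurable borel" "G \<in> borel_measurable borel"
  shows "(\<integral>\<^sup>+x. F x * (\<Sum>n. G (x + lat n)) \<partial>lborel) = (\<integral>\<^sup>+x. G x * (\<Sum>n. F (x + lat n)) \<partial>lborel)"
proof -
  have "(\<integral>\<^sup>+x. F x * (\<Sum>n. G (x + lat n)) \<partial>lborel) = (\<integral>\<^sup>+x. (\<Sum>n. F x * G (x + lat n)) \<partial>lborel)" by simp
  also have "\<dots> = (\<Sum>n. \<integral>\<^sup>+x. F x * G (x + lat n) \<partial>lborel)" by (rule nn_integral_suminf) measurable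
  also have "(\<lambda>n. \<integral>\<^sup>+x. F x * G (x + lat n) \<partial>lborel) = (\<lambda>n. \<integral>\<^sup>+x. G x * F (x + - lat n) \<partial>lborel)"
  proof
    fix n
    show "(\<integral>\<^sup>+x. F x * G (x + lat n) \<partial>lborel) = (\<integral>\<^sup>+x. G x * F (x + - lat n) \<partial>lborel)"
      using nn_integral_lborel_translate[of "\<lambda>x. G x * F (x + - lat n)" "lat n"] by (simp add: ac_simps)
  qed
  also have "(\<Sum>n. \<integral>\<^sup>+x. G x * F (x + - lat n) \<partial>lborel) = (\<integral>\<^sup>+x. (\<Sum>n. G x * F (x + - lat n)) \<partial>lborel)"
    by (rule nn_integral_suminf[symmetric]) measurable
  also have "\<dots> = (\<integral>\<^sup>+x. G x * (\<Sum>n. F (x + - lat n)) \<partial>lborel)" by simp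
  also have "\<dots> = (\<integral>\<^sup>+x. G x * (\<Sum>n. F (x + lat n)) \<partial>lborel)"
    by (intro nn_integral_cong arg_cong2[where f="(*)"] refl suminf_lat_minus[of "\<lambda>k. F (x + k)" for x])
  finally show ?thesis .
qed

text \<open>Uniform in \<open>\<xi>\<close> by averaging over the cube; the radius grows by
  \<open>CARD('n)\<close>, the bound on cube points from \<open>norm_T0_le\<close>.\<close>

lemma lattice_count_bound:
  fixes \<xi> :: "real ^ 'n::finite"
  shows "(\<Sum>n. indicator (cball 0 R) (\<xi> + lat n)) \<le> emeasure lborel (cball (0 :: real ^ 'n) (R + CARD('n)))"
proof -
  have "(\<Sum>n. indicator (cball 0 R) (\<xi> + lat n)) \<le> (\<integral>\<^sup>+x. indicator (cball (0 :: real ^ 'n) (R + CARD('n))) x \<partial>lborel)"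
  proof (rule lattice_sum_le_integral)
    fix x y :: "real ^ 'n" assume "x \<in> T0"
    then have "norm (y + x) \<le> norm y + CARD('n)" using norm_T0_le[of x] norm_triangle_ineq[of y x] by linarith
    then show "indicator (cball 0 R) y \<le> (indicator (cball 0 (R + CARD('n))) (y + x) :: ennreal)"
      by (auto simp: indicator_def)
  qed (intro borel_measurable_indicator borel_closed closed_cball)
  then show ?thesis by simp
qed

lemma emeasure_cball_finite: "emeasure lborel (cball (0::'a::euclidean_space) R) < \<infinity>"
  by (rule emeasure_bounded_finite[OF bounded_cball])

lemma finite_lattice_ball: "finite {n. norm (lat n :: real ^ 'n::finite) \<le> R}"
proof -
  have "emeasure (count_space Zd) {k \<in> Zd. norm (k :: real ^ 'n) \<le> R} = (\<integral>\<^sup>+k. indicator {k \<in> Zd. norm (k :: real ^ 'n) \<le> R} k \<partial>count_space Zd)"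
    by (subst nn_integral_indicator) auto
  also have "\<dots> = (\<integral>\<^sup>+k. indicator (cball (0 :: real ^ 'n) R) (0 + k) \<partial>count_space Zd)"
    by (intro nn_integral_cong) (auto simp: indicator_def)
  also have "\<dots> = (\<Sum>n. indicator (cball (0 :: real ^ 'n) R) (0 + lat n))" by (rule suminf_lat[symmetric])
  also have "\<dots> < \<infinity>" by (rule le_less_trans[OF lattice_count_bound emeasure_cball_finite])
  finally have "finite {k \<in> Zd. norm (k :: real ^ 'n) \<le> R}"
    by (cases "finite {k \<in> Zd. norm (k :: real ^ 'n) \<le> R}") auto
  then have "finite (lat -` {k \<in> Zd. norm (k :: real ^ 'n) \<le> R})"
    by (rule finite_vimageI) (simp add: inj_def)
  then show ?thesis by (rule rev_finite_subset) auto
qed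

section \<open>Poisson summation\<close>

lemma suminf_lat_bij:
  fixes F :: "real ^ 'n::finite \<Rightarrow> complex"
  assumes h: "bij_betw h Zd Zd"
    and s: "summable (\<lambda>n. cmod (F (lat n)))" "summable (\<lambda>n. cmod (F (h (lat n))))"
  shows "(\<Sum>n. F (h (lat n))) = (\<Sum>n. F (lat n))"
proof -
  have "((\<lambda>k. F (h k)) has_sum (\<Sum>n. F (h (lat n)))) Zd" by (rule infsum_lat[OF s(2)])
  then have "((F \<circ> h) has_sum (\<Sum>n. F (h (lat n)))) Zd" by (simp only: o_def)
  then have "(F has_sum (\<Sum>n. F (h (lat n)))) (h ` Zd)"
    using has_sum_reindex[of h Zd F] h by (simp only: bij_betw_def)
  then have "(F has_sum (\<Sum>n. F (h (lat n)))) Zd" using h by (simp only: bij_betw_def)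
  from has_sum_unique[OF this infsum_lat[OF s(1)]] show ?thesis .
qed

lemma trig_bounded: "trig \<tau> \<Longrightarrow> \<exists>B. \<forall>x. cmod (\<tau> x) \<le> B"
proof (induction rule: trig.induct)
  case (trig_char k c)
  show ?case by (rule exI[of _ "cmod c"]) (simp add: norm_mult)
next
  case (trig_add f g)
  then obtain A B where "\<And>x. cmod (f x) \<le> A" "\<And>x. cmod (g x) \<le> B" by blast
  then have "cmod (f x + g x) \<le> A + B" for x by (meson norm_triangle_le add_mono)
  then show ?case by blast
qed

lemma trig_measurable: "trig \<tau> \<Longrightarrow> \<tau> \<in> borel_measurable borel"
  by (induction rule: trig.induct) measurable

text \<open>Parseval's formula for a trigonometric polynomial: orthogonality leaves a single term
  per character, so no convergence question arises and integrability of \<open>D\<close>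
  suffices.\<close>

lemma trig_pairing:
  fixes D :: "real ^ 'n::finite \<Rightarrow> complex"
  assumes D: "integrable lborel D" and \<tau>: "trig \<tau>"
  shows "(\<lambda>n. (LINT x|lborel. D x * ek (lat n) x) * (LINT x|lborel. indicator T0 x * (\<tau> x * ek (- lat n) x))) sums (LINT x|lborel. D x * \<tau> x)"
  using \<tau>
proof induction
  case (trig_char k c)
  obtain m where m: "k = lat m" using obtain_lat trig_char by blast
  have "(LINT x|lborel. indicator T0 x * (c * ek k x * ek (- lat n) x)) = (if n = m then c else 0)" for n
  proof -
    have "(LINT x|lborel. indicator T0 x * (c * ek k x * ek (- lat n) x)) = c * (LINT x|lborel. indicator T0 x * ek (k - lat n) x)"
      by (subst integral_mult_right_zero[symmetric]) (simp add: ek_add[of k "- lat n", simplified] mult_ac)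
    also have "\<dots> = (if n = m then c else 0)"
      by (subst character_orthogonality) (auto simp: trig_char Zd_diff m)
    finally show ?thesis .
  qed
  moreover have "(\<lambda>n. (LINT x|lborel. D x * ek (lat n) x) * (if n = m then c else 0)) = (\<lambda>n. if n = m then (LINT x|lborel. D x * ek (lat m) x) * c else 0)"
    by auto
  moreover have "(\<lambda>n. if n = m then (LINT x|lborel. D x * ek (lat m) x) * c else 0) sums ((LINT x|lborel. D x * ek (lat m) x) * c)"
    using sums_single[of m "\<lambda>_. (LINT x|lborel. D x * ek (lat m) x) * c"] .
  moreover have "(LINT x|lborel. D x * ek (lat m) x) * c = (LINT x|lborel. D x * (c * ek k x))"
    by (subst integral_mult_left_zero[symmetric]) (simp add: m mult_ac)
  ultimately show ?case by simp
next
  case (trig_add f g)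
  obtain A B where AB: "\<And>x. cmod (f x) \<le> A" "\<And>x. cmod (g x) \<le> B"
    using trig_bounded[OF trig_add(1)] trig_bounded[OF trig_add(2)] by blast
  note [measurable] = trig_measurable[OF trig_add(1)] trig_measurable[OF trig_add(2)]
  have i: "integrable lborel (\<lambda>x. D x * f x)" "integrable lborel (\<lambda>x. D x * g x)"
    by (rule integrable_times_bounded[OF D]; (rule AB | measurable))+
  have j: "integrable lborel (\<lambda>x. indicator T0 x * (f x * ek (- lat n) x))" "integrable lborel (\<lambda>x. indicator T0 x * (g x * ek (- lat n) x))" for n
    by (rule integrable_T0[of _ A] integrable_T0[of _ B]; simp add: norm_mult AB)+
  have e: "(LINT x|lborel. indicator T0 x * ((f x + g x) * ek (- lat n) x)) =
    (LINT x|lborel. indicator T0 x * (f x * ek (- lat n) x)) + (LINT x|lborel. indicator T0 x * (g x * ek (- lat n) x))" for n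
    by (subst Bochner_Integration.integral_add[OF j, symmetric]) (simp add: algebra_simps)
  have e': "(LINT x|lborel. D x * (f x + g x)) = (LINT x|lborel. D x * f x) + (LINT x|lborel. D x * g x)"
    by (subst Bochner_Integration.integral_add[OF i, symmetric]) (simp add: algebra_simps)
  show ?case using sums_add[OF trig_add.IH] unfolding e e' by (simp only: distrib_left)
qed

section \<open>Periodization of a compactly supported continuous function\<close>

locale compact_test =
  fixes \<kappa> :: "real ^ 'n::finite \<Rightarrow> complex" and R :: real
  assumes cont: "continuous_on UNIV \<kappa>" and supp: "\<And>x. R < norm x \<Longrightarrow> \<kappa> x = 0"
begin

lemma measurable_chi [measurable]: "\<kappa> \<in> borel_measurable borel"
  using cont by (rule borel_measurable_continuous_onI)

lemma bounded_chi: "\<exists>B\<ge>0. \<forall>x. cmod (\<kappa> x) \<le> B"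
proof -
  have "compact (\<kappa> ` cball 0 R)" by (rule compact_continuous_image[OF continuous_on_subset[OF cont] compact_cball]) simp
  then have "bounded (\<kappa> ` cball 0 R)" by (rule compact_imp_bounded)
  then obtain B where B: "0 < B" "\<And>z. z \<in> \<kappa> ` cball 0 R \<Longrightarrow> cmod z \<le> B"
    unfolding bounded_pos by blast
  have "cmod (\<kappa> x) \<le> B" for x
  proof (cases "R < norm x")
    case False
    then have "\<kappa> x \<in> \<kappa> ` cball 0 R" by (intro imageI) simp
    then show ?thesis by (rule B(2))
  qed (use supp[of x] B(1) in simp)
  then show ?thesis using less_imp_le[OF B(1)] by blast
qed

lemma integrable_chi: "integrable lborel \<kappa>"
proof -
  obtain B where B: "0 \<le> B" "\<And>x. cmod (\<kappa> x) \<le> B" using bounded_chi by blast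
  show ?thesis
  proof (rule Bochner_Integration.integrable_bound)
    show "integrable lborel (\<lambda>x::real^'n. B * indicat_real (cball 0 R) x)"
      by (intro integrable_mult_right integrable_indicator_cball)
    show "AE x in lborel. cmod (\<kappa> x) \<le> norm (B * indicat_real (cball 0 R) x)"
    proof (rule AE_I2)
      fix x show "cmod (\<kappa> x) \<le> norm (B * indicat_real (cball 0 R) x)"
        using B(1) B(2)[of x] supp[of x] by (cases "R < norm x") simp_all
    qed
  qed measurable
qed

text \<open>The minus sign is the one that arises when an integral over
  \<open>D (x + lat n) * \<kappa> x\<close> is translated; \<open>per_plus\<close> gives the other
  sign.\<close>

definition per :: "real ^ 'n \<Rightarrow> complex" where "per x = (\<Sum>n. \<kappa> (x - lat n))"

lemma chi_lat_zero:
  assumes "norm x + R \<le> s" "\<not> norm (lat n :: real ^ 'n) \<le> s"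
  shows "\<kappa> (x - lat n) = 0" "\<kappa> (x + lat n) = 0"
proof -
  have "norm (lat n :: real ^ 'n) - norm x \<le> norm (x - lat n)" "norm (lat n :: real ^ 'n) - norm x \<le> norm (x + lat n)"
    using norm_triangle_ineq2[of "lat n" x] norm_triangle_ineq2[of "lat n" "- x"]
    by (simp_all add: norm_minus_commute add.commute)
  then show "\<kappa> (x - lat n) = 0" "\<kappa> (x + lat n) = 0"
    using assms by (auto intro!: supp)
qed

lemma summable_chi: "summable (\<lambda>n. cmod (\<kappa> (x - lat n)))" "summable (\<lambda>n. cmod (\<kappa> (x + lat n)))"
proof -
  have f: "finite {n. norm (lat n :: real ^ 'n) \<le> norm x + R}" by (rule finite_lattice_ball)
  show "summable (\<lambda>n. cmod (\<kappa> (x - lat n)))" "summable (\<lambda>n. cmod (\<kappa> (x + lat n)))"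
    by (rule summable_finite[OF f], simp add: chi_lat_zero[OF order_refl])+
qed

lemma per_finite: "norm x + R \<le> s \<Longrightarrow> per x = (\<Sum>n | norm (lat n :: real ^ 'n) \<le> s. \<kappa> (x - lat n))"
  unfolding per_def by (rule suminf_finite[OF finite_lattice_ball]) (simp add: chi_lat_zero)

text \<open>On a bounded set only finitely many shifts are nonzero, so locally this is a fixed
  finite sum.\<close>

lemma continuous_per: "continuous_on UNIV per"
proof -
  have "continuous (at x) per" for x
  proof -
    let ?s = "norm x + 1 + R"
    have "continuous_on (ball 0 (norm x + 1)) (\<lambda>x. \<Sum>n | norm (lat n :: real ^ 'n) \<le> ?s. \<kappa> (x - lat n))"
      by (intro continuous_intros continuous_on_compose2[OF cont]) auto
    moreover have "(\<Sum>n | norm (lat n :: real ^ 'n) \<le> ?s. \<kappa> (y - lat n)) = per y" if "y \<in> ball 0 (norm x + 1)" for y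
      by (rule per_finite[symmetric]) (use that in auto)
    ultimately have "continuous_on (ball 0 (norm x + 1)) per" by (rule continuous_on_eq)
    then show ?thesis by (rule continuous_on_interior) simp
  qed
  then show ?thesis by (simp add: continuous_at_imp_continuous_on)
qed

lemma per_plus: "per x = (\<Sum>n. \<kappa> (x + lat n))"
proof -
  have "bij_betw (\<lambda>k::real^'n. - k) Zd Zd"
    by (rule bij_betw_byWitness[where f'="\<lambda>k. - k"]) (auto simp: Zd_minus)
  from suminf_lat_bij[OF this, of "\<lambda>k. \<kappa> (x + k)"] show ?thesis
    using summable_chi[of x] by (simp add: per_def)
qed

lemma per_periodic: "k \<in> Zd \<Longrightarrow> per (x + k) = per x"
proof -
  assume k: "k \<in> Zd"
  have "bij_betw (\<lambda>l. l - k) Zd Zd"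
    by (rule bij_betw_byWitness[where f'="\<lambda>l. l + k"]) (auto simp: Zd_diff Zd_add k)
  from suminf_lat_bij[OF this, of "\<lambda>l. \<kappa> (x - l)"] show ?thesis
    using summable_chi[of x] summable_chi[of "x + k"] by (simp add: per_def algebra_simps)
qed

text \<open>Unfolding: the character is lattice periodic, so tiling folds the integral over the
  whole space into one over the cube.\<close>

lemma per_coefficient:
  assumes k: "k \<in> Zd"
  shows "fi \<kappa> (- k) = (LINT x|lborel. indicator T0 x * (per x * ek (- k) x))"
    and "integrable lborel (\<lambda>x. indicator T0 x * (per x * ek (- k) x))"
proof -
  have e: "(\<Sum>n. \<kappa> (x + lat n) * ek (x + lat n) (- k)) = per x * ek (- k) x" for x
  proof -
    have "ek (x + lat n) (- k) = ek (- k) x" for n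
      using ek_shift[OF Zd_minus[OF k] lat_Zd, of x n] by (simp add: ek_commute)
    then show ?thesis
      using summable_norm_cancel[OF summable_chi(2)] by (simp add: per_plus suminf_mult2[symmetric])
  qed
  have i: "integrable lborel (\<lambda>x. \<kappa> x * ek x (- k))" by (rule integrable_ek[OF integrable_chi])
  show "fi \<kappa> (- k) = (LINT x|lborel. indicator T0 x * (per x * ek (- k) x))"
    unfolding fi_def integral_tiling(1)[OF i] e ..
  show "integrable lborel (\<lambda>x. indicator T0 x * (per x * ek (- k) x))"
    using integral_tiling(2)[OF i] unfolding e .
qed

text \<open>The Fourier series of the merely continuous \<open>per\<close> need not converge to it.
  A uniform trigonometric approximation \<open>\<tau>\<close> takes its place, for which the pairing
  formula is exact; exchanging \<open>per\<close> for \<open>\<tau>\<close> costs at most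
  \<open>e\<close> times the \<open>L_1\<close> norm of \<open>D\<close> on the left and at most
  \<open>e\<close> times the sum of the moduli of the coefficients of \<open>D\<close> on the
  right.\<close>

lemma pairing_per:
  assumes D: "integrable lborel D" and b: "summable (\<lambda>n. cmod (LINT x|lborel. D x * ek (lat n) x))"
    and DP: "integrable lborel (\<lambda>x. D x * per x)"
  shows "(LINT x|lborel. D x * per x) = (\<Sum>n. (LINT x|lborel. D x * ek (lat n) x) * fi \<kappa> (- lat n))"
proof -
  define b where "b n = (LINT x|lborel. D x * ek (lat n) x)" for n
  define c where "c n = fi \<kappa> (- lat n)" for n
  have bc: "summable (\<lambda>n. b n * c n)"
  proof (rule summable_comparison_test)
    show "\<exists>N. \<forall>n\<ge>N. cmod (b n * c n) \<le> (LINT x|lborel. cmod (\<kappa> x)) * cmod (b n)"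
      by (auto simp: c_def norm_mult mult.commute intro!: mult_left_mono norm_fi_le)
    show "summable (\<lambda>n. (LINT x|lborel. cmod (\<kappa> x)) * cmod (b n))" using b unfolding b_def by (rule summable_mult)
  qed
  define M where "M = (LINT x|lborel. cmod (D x)) + (\<Sum>n. cmod (b n))"
  have M0: "0 \<le> M" unfolding M_def using b unfolding b_def[symmetric]
    by (intro add_nonneg_nonneg Bochner_Integration.integral_nonneg suminf_nonneg) auto
  have close: "cmod ((LINT x|lborel. D x * per x) - (\<Sum>n. b n * c n)) \<le> e * M" if e: "0 < e" for e
  proof -
    obtain \<tau> where \<tau>: "trig \<tau>" "\<And>x. cmod (per x - \<tau> x) < e"
      using periodic_trig_approx[OF continuous_per per_periodic e] by blast
    note [measurable] = trig_measurable[OF \<tau>(1)]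
    obtain B where B: "\<And>x. cmod (\<tau> x) \<le> B" using trig_bounded[OF \<tau>(1)] by blast
    define t where "t n = (LINT x|lborel. indicator T0 x * (\<tau> x * ek (- lat n) x))" for n
    have bt: "(\<lambda>n. b n * t n) sums (LINT x|lborel. D x * \<tau> x)"
      unfolding b_def t_def by (rule trig_pairing[OF D \<tau>(1)])
    have iD: "integrable lborel (\<lambda>x. D x * \<tau> x)" by (rule integrable_times_bounded[OF D _ B]) measurable
    have 1: "cmod ((LINT x|lborel. D x * per x) - (LINT x|lborel. D x * \<tau> x)) \<le> e * (LINT x|lborel. cmod (D x))"
    proof -
      have "cmod ((LINT x|lborel. D x * per x) - (LINT x|lborel. D x * \<tau> x)) = cmod (LINT x|lborel. D x * per x - D x * \<tau> x)"
        by (subst Bochner_Integration.integral_diff[OF DP iD]) simp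
      also have "\<dots> \<le> (LINT x|lborel. e * cmod (D x))"
      proof (rule Bochner_Integration.integral_norm_bound_integral)
        show "integrable lborel (\<lambda>x. D x * per x - D x * \<tau> x)" by (rule Bochner_Integration.integrable_diff[OF DP iD])
        show "integrable lborel (\<lambda>x. e * cmod (D x))" using D by auto
        show "cmod (D x * per x - D x * \<tau> x) \<le> e * cmod (D x)" for x
          using \<tau>(2)[of x] by (simp add: right_diff_distrib[symmetric] norm_mult mult.commute[of e] mult_left_mono)
      qed
      finally show ?thesis by simp
    qed
    \<comment> \<open>The uniform error is integrated over the cube, whose measure is 1.\<close>
    have ct: "cmod (t n - c n) \<le> e" for n
    proof -
      have it: "integrable lborel (\<lambda>x. indicator T0 x * (\<tau> x * ek (- lat n) x))"
        by (rule integrable_T0[of _ B]) (auto simp: norm_mult B)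
      note ic = per_coefficient[OF lat_Zd[of n]]
      have "t n - c n = (LINT x|lborel. indicator T0 x * (\<tau> x * ek (- lat n) x) - indicator T0 x * (per x * ek (- lat n) x))"
        unfolding t_def c_def ic(1) by (rule Bochner_Integration.integral_diff[OF it ic(2), symmetric])
      also have "cmod \<dots> \<le> (LINT x|lborel. e * indicat_real (T0 :: (real ^ 'n) set) x)"
      proof (rule Bochner_Integration.integral_norm_bound_integral)
        show "integrable lborel (\<lambda>x. indicator T0 x * (\<tau> x * ek (- lat n) x) - indicator T0 x * (per x * ek (- lat n) x))"
          by (rule Bochner_Integration.integrable_diff[OF it ic(2)])
        show "integrable lborel (\<lambda>x. e * indicat_real (T0 :: (real ^ 'n) set) x)"
          by (intro integrable_mult_right integrable_real_indicator) (auto simp: emeasure_T0)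
        show "cmod (indicator T0 x * (\<tau> x * ek (- lat n) x) - indicator T0 x * (per x * ek (- lat n) x)) \<le> e * indicat_real T0 x" for x
        proof -
          have "indicator T0 x * (\<tau> x * ek (- lat n) x) - indicator T0 x * (per x * ek (- lat n) x) = indicator T0 x * ((\<tau> x - per x) * ek (- lat n) x)"
            by (simp add: algebra_simps)
          then show ?thesis using \<tau>(2)[of x] by (simp add: norm_mult indicator_def norm_minus_commute)
        qed
      qed
      also have "\<dots> = e" by (simp add: measure_def emeasure_T0)
      finally show ?thesis .
    qed
    have 2: "cmod ((LINT x|lborel. D x * \<tau> x) - (\<Sum>n. b n * c n)) \<le> e * (\<Sum>n. cmod (b n))"
    proof -
      have s: "(\<lambda>n. b n * t n - b n * c n) sums ((LINT x|lborel. D x * \<tau> x) - (\<Sum>n. b n * c n))"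
        by (intro sums_diff bt summable_sums bc)
      have "cmod (suminf (\<lambda>n. b n * t n - b n * c n)) \<le> (\<Sum>n. e * cmod (b n))"
      proof (rule norm_suminf_le)
        show "summable (\<lambda>n. e * cmod (b n))" using b unfolding b_def by (rule summable_mult)
        show "cmod (b n * t n - b n * c n) \<le> e * cmod (b n)" for n
          using ct[of n] by (simp add: right_diff_distrib[symmetric] norm_mult mult.commute[of e] mult_left_mono)
      qed
      also have "\<dots> = e * (\<Sum>n. cmod (b n))" using b unfolding b_def by (rule suminf_mult)
      finally show ?thesis using sums_unique[OF s] by simp
    qed
    show ?thesis
      using norm_diff_triangle_le[OF 1 2] by (simp add: M_def distrib_left)
  qed
  have "cmod ((LINT x|lborel. D x * per x) - (\<Sum>n. b n * c n)) \<le> 0"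
  proof (rule field_le_epsilon)
    fix e :: real assume "0 < e"
    \<comment> \<open>The summand 1 keeps the quotient meaningful when \<open>M = 0\<close>.\<close>
    then have "0 < e / (M + 1)" using M0 by simp
    then have "cmod ((LINT x|lborel. D x * per x) - (\<Sum>n. b n * c n)) \<le> e / (M + 1) * M" by (rule close)
    also have "\<dots> \<le> e" using \<open>0 < e\<close> M0 by (simp add: field_simps)
    finally show "cmod ((LINT x|lborel. D x * per x) - (\<Sum>n. b n * c n)) \<le> 0 + e" by simp
  qed
  then show ?thesis by (simp add: b_def c_def)
qed

end

text \<open>Move the periodization from \<open>D\<close> to the indicator of the ball, where
  \<open>lattice_count_bound\<close> bounds it uniformly.\<close>

lemma lborel_integrable_local:
  fixes D :: "real ^ 'n::finite \<Rightarrow> complex"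
  assumes D: "integrable lborel D"
  shows "(\<integral>\<^sup>+x. indicator (cball 0 R) x * (\<Sum>n. ennreal (cmod (D (x + lat n)))) \<partial>lborel) < \<infinity>"
proof -
  have [measurable]: "D \<in> borel_measurable borel" using D by auto
  have "(\<integral>\<^sup>+x. indicator (cball 0 R) x * (\<Sum>n. ennreal (cmod (D (x + lat n)))) \<partial>lborel)
    = (\<integral>\<^sup>+x. ennreal (cmod (D x)) * (\<Sum>n. indicator (cball 0 R) (x + lat n)) \<partial>lborel)"
    by (rule nn_integral_periodization_swap[of "indicator (cball 0 R)" "\<lambda>x. ennreal (cmod (D x))"])
      (simp_all add: borel_measurable_indicator)
  also have "\<dots> \<le> (\<integral>\<^sup>+x. ennreal (cmod (D x)) * emeasure lborel (cball (0 :: real ^ 'n) (R + CARD('n))) \<partial>lborel)"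
    by (intro nn_integral_mono mult_left_mono lattice_count_bound) simp
  also have "\<dots> = (\<integral>\<^sup>+x. ennreal (cmod (D x)) \<partial>lborel) * emeasure lborel (cball (0 :: real ^ 'n) (R + CARD('n)))"
    by (rule nn_integral_multc) measurable
  also have "\<dots> < \<infinity>"
    using D emeasure_cball_finite[of "R + CARD('n)", where 'a="real ^ 'n"] by (simp add: integrable_iff_bounded ennreal_mult_less_top)
  finally show ?thesis .
qed

text \<open>Both sides are locally integrable. Against a continuous compactly supported
  \<open>\<psi>\<close> each of them becomes the pairing of \<open>D\<close> with the periodization
  of \<open>\<psi>\<close>: the left by translation, the right by \<open>pairing_per\<close>.
  Equality against all such \<open>\<psi>\<close> is equality almost everywhere.\<close>

lemma poisson_summation_AE:
  fixes D :: "real ^ 'n::finite \<Rightarrow> complex"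
  assumes D: "integrable lborel D" and b: "summable (\<lambda>n. cmod (LINT x|lborel. D x * ek (lat n) x))"
  shows "AE \<xi> in lborel. (\<Sum>n. D (\<xi> + lat n)) = (\<Sum>n. (LINT x|lborel. D x * ek (lat n) x) * ek (- lat n) \<xi>)"
proof -
  have [measurable]: "D \<in> borel_measurable borel" using D by auto
  define c where "c n = (LINT x|lborel. D x * ek (lat n) x)" for n
  define \<beta> where "\<beta> \<xi> = (\<Sum>n. c n * ek (- lat n) \<xi>)" for \<xi> :: "real ^ 'n"
  define \<gamma> where "\<gamma> \<xi> = (\<Sum>n. D (\<xi> + lat n))" for \<xi>
  have [measurable]: "\<beta> \<in> borel_measurable borel" "\<gamma> \<in> borel_measurable borel"
    unfolding \<beta>_def \<gamma>_def by measurable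
  have sc: "summable (\<lambda>n. cmod (c n))" using b by (simp only: c_def)
  have scs: "summable (\<lambda>n. cmod (c n * ek (- lat n) \<xi>))" for \<xi> :: "real ^ 'n" using sc by (simp add: norm_mult)
  have fin: "(\<integral>\<^sup>+x. (\<Sum>n. ennreal (cmod (D (x + lat n) * f x))) \<partial>lborel) < \<infinity>"
    if [measurable]: "f \<in> borel_measurable borel" and f: "\<And>x. cmod (f x) \<le> B * indicat_real (cball 0 R) x" "0 \<le> B"
    for f :: "real ^ 'n \<Rightarrow> complex" and B R
  proof -
    have "(\<integral>\<^sup>+x. (\<Sum>n. ennreal (cmod (D (x + lat n) * f x))) \<partial>lborel)
      \<le> (\<integral>\<^sup>+x. ennreal B * (indicator (cball 0 R) x * (\<Sum>n. ennreal (cmod (D (x + lat n))))) \<partial>lborel)"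
    proof (intro nn_integral_mono)
      fix x
      have "ennreal (cmod (D (x + lat n) * f x)) \<le> ennreal B * indicator (cball 0 R) x * ennreal (cmod (D (x + lat n)))" for n
      proof -
        have "cmod (D (x + lat n) * f x) \<le> B * indicat_real (cball 0 R) x * cmod (D (x + lat n))"
          using f(1)[of x] by (simp add: norm_mult mult.commute[of "cmod (D _)"] mult_right_mono)
        then have "ennreal (cmod (D (x + lat n) * f x)) \<le> ennreal (B * indicat_real (cball 0 R) x * cmod (D (x + lat n)))"
          by (rule ennreal_leI)
        then show ?thesis using f(2) by (simp add: ennreal_mult ennreal_indicator)
      qed
      then have "(\<Sum>n. ennreal (cmod (D (x + lat n) * f x))) \<le> (\<Sum>n. ennreal B * indicator (cball 0 R) x * ennreal (cmod (D (x + lat n))))"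
        by (intro suminf_le) auto
      then show "(\<Sum>n. ennreal (cmod (D (x + lat n) * f x))) \<le> ennreal B * (indicator (cball 0 R) x * (\<Sum>n. ennreal (cmod (D (x + lat n)))))"
        by (simp add: mult.assoc)
    qed
    also have "\<dots> = ennreal B * (\<integral>\<^sup>+x. indicator (cball 0 R) x * (\<Sum>n. ennreal (cmod (D (x + lat n)))) \<partial>lborel)"
      by (rule nn_integral_cmult) (measurable, auto)
    also have "\<dots> < \<infinity>" using lborel_integrable_local[OF D, of R] by (simp add: ennreal_mult_less_top)
    finally show ?thesis .
  qed
  \<comment> \<open>Local summability suffices, since countably many balls of integer radius cover
    the space.\<close>
  have sD: "AE x in lborel. summable (\<lambda>n. cmod (D (x + lat n)))"
  proof -
    have "AE x in lborel. norm x \<le> real m \<longrightarrow> summable (\<lambda>n. cmod (D (x + lat n)))" for m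
    proof -
      have "AE x in lborel. summable (\<lambda>n. cmod (D (x + lat n) * indicator (cball 0 (real m)) x))"
        by (rule sums_integral_suminf(1)[OF _ fin[of _ 1 "real m"]]) (auto simp: indicator_def)
      then show ?thesis by eventually_elim (auto simp: indicator_def)
    qed
    then have "AE x in lborel. \<forall>m. norm x \<le> real m \<longrightarrow> summable (\<lambda>n. cmod (D (x + lat n)))" unfolding AE_all_countable by blast
    then show ?thesis
    proof eventually_elim
      fix x :: "real ^ 'n" assume "\<forall>m. norm x \<le> real m \<longrightarrow> summable (\<lambda>n. cmod (D (x + lat n)))"
      moreover obtain m where "norm x \<le> real m" using real_arch_simple by blast
      ultimately show "summable (\<lambda>n. cmod (D (x + lat n)))" by blast
    qed
  qed
  have i\<gamma>: "integrable lborel (\<lambda>x. f x * \<gamma> x)"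
    "(\<lambda>n. LINT x|lborel. D (x + lat n) * f x) sums (LINT x|lborel. f x * \<gamma> x)"
    if [measurable]: "f \<in> borel_measurable borel" and f: "\<And>x. cmod (f x) \<le> B * indicat_real (cball 0 R) x" "0 \<le> B" for f B R
  proof -
    have e: "AE x in lborel. (\<Sum>n. D (x + lat n) * f x) = f x * \<gamma> x" using sD
    proof eventually_elim
      fix x assume "summable (\<lambda>n. cmod (D (x + lat n)))"
      then have "(\<Sum>n. D (x + lat n) * f x) = (\<Sum>n. D (x + lat n)) * f x"
        by (rule suminf_mult2[OF summable_norm_cancel, symmetric])
      then show "(\<Sum>n. D (x + lat n) * f x) = f x * \<gamma> x" by (simp add: \<gamma>_def mult.commute)
    qed
    have m: "\<And>n. (\<lambda>x. D (x + lat n) * f x) \<in> borel_measurable lborel" by measurable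
    note si = sums_integral_suminf[OF m fin[OF that]]
    show "integrable lborel (\<lambda>x. f x * \<gamma> x)"
      using integrable_cong_AE[OF _ _ e] si(2) by (simp add: borel_measurable_times)
    show "(\<lambda>n. LINT x|lborel. D (x + lat n) * f x) sums (LINT x|lborel. f x * \<gamma> x)"
      using si(4) integral_cong_AE[OF _ _ e] by simp
  qed
  have i\<beta>: "integrable lborel (\<lambda>x. f x * \<beta> x)" "(\<lambda>n. c n * fi f (- lat n)) sums (LINT x|lborel. f x * \<beta> x)"
    if f: "integrable lborel f" for f
  proof -
    have [measurable]: "f \<in> borel_measurable borel" using f by auto
    have e: "(\<Sum>n. c n * ek (- lat n) x * f x) = f x * \<beta> x" for x
      using suminf_mult2[OF summable_norm_cancel[OF scs], of x "f x"] by (simp add: \<beta>_def mult.commute)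
    have m: "\<And>n. (\<lambda>x. c n * ek (- lat n) x * f x) \<in> borel_measurable lborel" by measurable
    have t: "ennreal (cmod (c n * ek (- lat n) x * f x)) = ennreal (cmod (c n)) * ennreal (cmod (f x))" for n x
      by (simp add: norm_mult ennreal_mult)
    have "(\<integral>\<^sup>+x. (\<Sum>n. ennreal (cmod (c n * ek (- lat n) x * f x))) \<partial>lborel) = (\<integral>\<^sup>+x. (\<Sum>n. ennreal (cmod (c n))) * ennreal (cmod (f x)) \<partial>lborel)"
      by (simp only: t ennreal_suminf_multc)
    also have "\<dots> = (\<Sum>n. ennreal (cmod (c n))) * (\<integral>\<^sup>+x. ennreal (cmod (f x)) \<partial>lborel)" by (rule nn_integral_cmult) measurable
    also have "(\<Sum>n. ennreal (cmod (c n))) = ennreal (\<Sum>n. cmod (c n))" by (rule suminf_ennreal2[OF _ sc]) simp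
    also have "ennreal (\<Sum>n. cmod (c n)) * (\<integral>\<^sup>+x. ennreal (cmod (f x)) \<partial>lborel) < \<infinity>"
      using f unfolding integrable_iff_bounded by (simp add: ennreal_mult_less_top)
    finally have fn: "(\<integral>\<^sup>+x. (\<Sum>n. ennreal (cmod (c n * ek (- lat n) x * f x))) \<partial>lborel) < \<infinity>" .
    note si = sums_integral_suminf[OF m fn, unfolded e]
    show "integrable lborel (\<lambda>x. f x * \<beta> x)" by (rule si(2))
    have "(LINT x|lborel. c n * ek (- lat n) x * f x) = c n * fi f (- lat n)" for n
      unfolding fi_def by (subst integral_mult_right_zero[symmetric]) (simp add: ek_commute[of "- lat n"] mult_ac)
    then show "(\<lambda>n. c n * fi f (- lat n)) sums (LINT x|lborel. f x * \<beta> x)" using si(4) by simp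
  qed
  have test: "(LINT x|lborel. \<psi> x * \<gamma> x) = (LINT x|lborel. \<psi> x * \<beta> x)"
    if \<psi>: "continuous_on UNIV \<psi>" "\<And>x. R < norm x \<Longrightarrow> \<psi> x = 0" for \<psi> and R
  proof -
    interpret compact_test \<psi> R by standard (use \<psi> in auto)
    obtain B where B: "0 \<le> B" "\<And>x. cmod (\<psi> x) \<le> B" using bounded_chi by blast
    have B': "cmod (\<psi> x) \<le> B * indicat_real (cball 0 R) x" for x
      using B(2)[of x] \<psi>(2)[of x] by (cases "R < norm x") auto
    have e: "(\<Sum>n. D x * \<psi> (x - lat n)) = D x * per x" for x
      unfolding per_def by (rule suminf_mult[OF summable_norm_cancel[OF summable_chi(1)]])
    have s1: "(\<lambda>n. LINT x|lborel. D (x + lat n) * \<psi> x) sums (LINT x|lborel. \<psi> x * \<gamma> x)"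
      by (rule i\<gamma>(2)[OF measurable_chi B' B(1)])
    have f2: "(\<integral>\<^sup>+x. (\<Sum>n. ennreal (cmod (D x * \<psi> (x - lat n)))) \<partial>lborel) < \<infinity>"
    proof -
      have "(\<integral>\<^sup>+x. (\<Sum>n. ennreal (cmod (D x * \<psi> (x - lat n)))) \<partial>lborel) = (\<Sum>n. \<integral>\<^sup>+x. ennreal (cmod (D x * \<psi> (x - lat n))) \<partial>lborel)"
        by (rule nn_integral_suminf) measurable
      also have "(\<lambda>n. \<integral>\<^sup>+x. ennreal (cmod (D x * \<psi> (x - lat n))) \<partial>lborel) = (\<lambda>n. \<integral>\<^sup>+x. ennreal (cmod (D (x + lat n) * \<psi> x)) \<partial>lborel)"
      proof
        fix n
        show "(\<integral>\<^sup>+x. ennreal (cmod (D x * \<psi> (x - lat n))) \<partial>lborel) = (\<integral>\<^sup>+x. ennreal (cmod (D (x + lat n) * \<psi> x)) \<partial>lborel)"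
          using nn_integral_lborel_translate[of "\<lambda>x. ennreal (cmod (D x * \<psi> (x - lat n)))" "lat n"] by (simp add: add.commute)
      qed
      also have "(\<Sum>n. \<integral>\<^sup>+x. ennreal (cmod (D (x + lat n) * \<psi> x)) \<partial>lborel) = (\<integral>\<^sup>+x. (\<Sum>n. ennreal (cmod (D (x + lat n) * \<psi> x))) \<partial>lborel)"
        by (rule nn_integral_suminf[symmetric]) measurable
      also have "\<dots> < \<infinity>" by (rule fin[OF measurable_chi B' B(1)])
      finally show ?thesis .
    qed
    have m2: "\<And>n. (\<lambda>x. D x * \<psi> (x - lat n)) \<in> borel_measurable lborel" by measurable
    note s2 = sums_integral_suminf[OF m2 f2, unfolded e]
    have "(LINT x|lborel. D x * \<psi> (x - lat n)) = (LINT x|lborel. D (x + lat n) * \<psi> x)" for n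
      using integral_lborel_translate[of "\<lambda>x. D x * \<psi> (x - lat n)" "lat n"] by (simp add: add.commute)
    then have "(LINT x|lborel. \<psi> x * \<gamma> x) = (LINT x|lborel. D x * per x)"
      using sums_unique2[OF s1] s2(4) by simp
    also have "\<dots> = (\<Sum>n. c n * fi \<psi> (- lat n))"
      unfolding c_def by (rule pairing_per[OF D b s2(2)])
    also have "\<dots> = (LINT x|lborel. \<psi> x * \<beta> x)"
      by (rule sums_unique[OF i\<beta>(2)[OF integrable_chi], symmetric])
    finally show ?thesis .
  qed
  \<comment> \<open>With \<open>K = 0\<close> the locale says that the difference annihilates all
    test functions; \<open>Linfty_bound\<close> then makes it vanish.\<close>
  interpret continuous_test_bound "\<lambda>x. \<gamma> x - \<beta> x" 0 1
  proof
    show "(\<lambda>x. \<gamma> x - \<beta> x) \<in> borel_measurable borel" by measurable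
    show "integrable lborel (\<lambda>x. indicat_real (cball 0 R) x * cmod (\<gamma> x - \<beta> x))" for R
    proof -
      have g: "integrable lborel (\<lambda>x. indicator (cball 0 R) x * \<gamma> x)"
        by (rule i\<gamma>(1)[of _ 1 R]) (auto simp: indicator_def)
      have "integrable lborel (\<lambda>x::real^'n. complex_of_real (indicat_real (cball 0 R) x))"
        by (intro integrable_of_real integrable_indicator_cball)
      from i\<beta>(1)[OF this] have "integrable lborel (\<lambda>x. indicator (cball 0 R) x * \<beta> x)"
        by (simp add: indicator_def of_bool_def if_distrib cong: if_cong)
      from Bochner_Integration.integrable_diff[OF g this]
      have "integrable lborel (\<lambda>x. cmod (indicator (cball 0 R) x * \<gamma> x - indicator (cball 0 R) x * \<beta> x))" by (rule integrable_norm)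
      moreover have "cmod (indicator (cball 0 R) x * \<gamma> x - indicator (cball 0 R) x * \<beta> x) = indicat_real (cball 0 R) x * cmod (\<gamma> x - \<beta> x)" for x
        by (simp add: indicator_def)
      ultimately show ?thesis by simp
    qed
    fix \<psi> :: "real ^ 'n \<Rightarrow> complex" and R
    assume \<psi>: "continuous_on UNIV \<psi>" "\<And>x. R < norm x \<Longrightarrow> \<psi> x = 0"
    interpret t: compact_test \<psi> R by standard (use \<psi> in auto)
    obtain B where B: "0 \<le> B" "\<And>x. cmod (\<psi> x) \<le> B" using t.bounded_chi by blast
    have B': "cmod (\<psi> x) \<le> B * indicat_real (cball 0 R) x" for x
      using B(2)[of x] \<psi>(2)[of x] by (cases "R < norm x") auto
    have "(LINT x|lborel. (\<gamma> x - \<beta> x) * \<psi> x) = (LINT x|lborel. \<psi> x * \<gamma> x - \<psi> x * \<beta> x)"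
      by (simp add: algebra_simps)
    also have "\<dots> = (LINT x|lborel. \<psi> x * \<gamma> x) - (LINT x|lborel. \<psi> x * \<beta> x)"
      by (rule Bochner_Integration.integral_diff[OF i\<gamma>(1)[OF t.measurable_chi B' B(1)] i\<beta>(1)[OF t.integrable_chi]])
    also have "\<dots> = 0" using test[OF \<psi>] by simp
    finally show "cmod (LINT x|lborel. (\<gamma> x - \<beta> x) * \<psi> x) \<le> 0 * (LINT x|lborel. cmod (\<psi> x) powr 1) powr (1 / 1)" by simp
  qed simp_all
  have "AE x in lborel. cmod (\<gamma> x - \<beta> x) \<le> 0" by (rule Linfty_bound) simp
  then show ?thesis by eventually_elim (simp add: \<gamma>_def \<beta>_def c_def)
qed

section \<open>Parseval's identity by mollification\<close>

lemma gauss_kernel_scale: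
  fixes v :: "'a::euclidean_space"
  assumes "0 < s" shows "s ^ DIM('a) * gauss_kernel s (s *\<^sub>R v) = gauss_kernel 1 v"
proof -
  have "s * normal_density 0 s (s * y) = normal_density 0 1 y" for y
    using assms by (simp add: normal_density_def power_mult_distrib real_sqrt_mult)
  then have "(\<Prod>b\<in>(Basis::'a set). s * normal_density 0 s (s * (v \<bullet> b))) = gauss_kernel 1 v" by (simp add: gauss_kernel_def)
  then show ?thesis by (simp add: gauss_kernel_def prod.distrib)
qed

lemma integral_gauss_kernel_conv:
  fixes \<psi> :: "'a::euclidean_space \<Rightarrow> complex"
  assumes s: "0 < s" and [measurable]: "\<psi> \<in> borel_measurable borel"
  shows "(LINT z|lborel. \<psi> z * of_real (gauss_kernel s (x - z))) = (LINT v|lborel. \<psi> (x - s *\<^sub>R v) * of_real (gauss_kernel 1 v))"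
proof -
  define G where "G z = \<psi> z * of_real (gauss_kernel s (x - z))" for z
  have [measurable]: "G \<in> borel_measurable borel" unfolding G_def by measurable
  have "(LINT z|lborel. G z) = (LINT v|lborel. \<bar>- s\<bar> ^ DIM('a) *\<^sub>R G (x + (- s) *\<^sub>R v))"
    by (subst lborel_affine[of "- s" x]) (use s in \<open>auto simp: integral_density integral_distr\<close>)
  also have "\<dots> = (LINT v|lborel. \<psi> (x - s *\<^sub>R v) * of_real (gauss_kernel 1 v))"
  proof (intro Bochner_Integration.integral_cong refl)
    fix v :: 'a
    have "\<bar>- s\<bar> ^ DIM('a) *\<^sub>R G (x + (- s) *\<^sub>R v) = \<psi> (x - s *\<^sub>R v) * of_real (s ^ DIM('a) * gauss_kernel s (s *\<^sub>R v))"
      using s by (simp add: G_def scaleR_conv_of_real mult_ac)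
    then show "\<bar>- s\<bar> ^ DIM('a) *\<^sub>R G (x + (- s) *\<^sub>R v) = \<psi> (x - s *\<^sub>R v) * of_real (gauss_kernel 1 v)"
      by (simp only: gauss_kernel_scale[OF s])
  qed
  finally show ?thesis by (simp only: G_def)
qed

lemma integral_lborel_uminus:
  fixes f :: "'a::euclidean_space \<Rightarrow> complex"
  assumes [measurable]: "f \<in> borel_measurable borel"
  shows "(LINT x|lborel. f (- x)) = (LINT x|lborel. f x)"
  by (subst (2) lborel_distr_uminus_euclidean[symmetric], subst integral_distr) auto

text \<open>Let \<open>s\<close> tend to 0 in \<open>gaussian_parseval\<close>. On one side the
  weight tends to 1, dominated by the integrable product of the transforms; on the other
  \<open>\<psi>\<close> is averaged over Gaussians of shrinking width, which converges at every
  point since \<open>\<psi>\<close> is continuous and bounded.\<close>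

lemma parseval_bounded_continuous:
  fixes \<phi> \<psi> :: "'a::euclidean_space \<Rightarrow> complex"
  assumes \<phi>: "integrable lborel \<phi>" and \<psi>: "integrable lborel \<psi>" "continuous_on UNIV \<psi>" "\<And>x. cmod (\<psi> x) \<le> B"
    and D: "integrable lborel (\<lambda>\<xi>. fi \<phi> (- \<xi>) * fi \<psi> \<xi>)"
  shows "(LINT x|lborel. \<phi> x * \<psi> x) = (LINT \<xi>|lborel. fi \<phi> (- \<xi>) * fi \<psi> \<xi>)"
proof -
  have [measurable]: "\<phi> \<in> borel_measurable borel" "\<psi> \<in> borel_measurable borel" using \<phi> \<psi> by auto
  define s where "s n = inverse (real (Suc n))" for n
  have s: "0 < s n" for n by (simp add: s_def)
  have s0: "s \<longlonglongrightarrow> 0" unfolding s_def by (rule LIMSEQ_inverse_real_of_nat)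
  have B0: "0 \<le> B" using \<psi>(3)[of 0] norm_ge_zero order_trans by blast
  have ig: "integrable lborel (gauss_kernel 1 :: 'a \<Rightarrow> real)" by (rule integrable_gauss_kernel) simp
  have eq: "(LINT \<xi>|lborel. fi \<phi> (- \<xi>) * fi \<psi> \<xi> * of_real (gauss_weight (s n) \<xi>)) =
      (LINT x|lborel. \<phi> x * (LINT v|lborel. \<psi> (x - s n *\<^sub>R v) * of_real (gauss_kernel 1 v)))" for n
  proof -
    have "(LINT \<xi>|lborel. fi \<phi> (- \<xi>) * fi \<psi> (- (- \<xi>)) * of_real (gauss_weight (s n) (- \<xi>))) = (LINT \<xi>|lborel. fi \<phi> \<xi> * fi \<psi> (- \<xi>) * of_real (gauss_weight (s n) \<xi>))"
      by (rule integral_lborel_uminus) measurable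
    also have "\<dots> = (LINT x|lborel. \<phi> x * (LINT z|lborel. \<psi> z * of_real (gauss_kernel (s n) (x - z))))"
      by (rule gaussian_parseval[OF \<phi> \<psi>(1) s])
    finally show ?thesis by (simp add: integral_gauss_kernel_conv[OF s] gauss_weight_def)
  qed
  have "(\<lambda>n. LINT \<xi>|lborel. fi \<phi> (- \<xi>) * fi \<psi> \<xi> * of_real (gauss_weight (s n) \<xi>)) \<longlonglongrightarrow> (LINT \<xi>|lborel. fi \<phi> (- \<xi>) * fi \<psi> \<xi>)"
  proof (rule integral_dominated_convergence[where w="\<lambda>\<xi>. cmod (fi \<phi> (- \<xi>) * fi \<psi> \<xi>)"])
    show "integrable lborel (\<lambda>\<xi>. cmod (fi \<phi> (- \<xi>) * fi \<psi> \<xi>))" using D by (rule integrable_norm)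
    have "(\<lambda>n. gauss_weight (s n) \<xi>) \<longlonglongrightarrow> exp (- (2 * pi * 0)\<^sup>2 * (\<xi> \<bullet> \<xi>) / 2)" for \<xi> :: 'a
      unfolding gauss_weight_def by (intro tendsto_intros s0) simp_all
    then have "(\<lambda>n. fi \<phi> (- \<xi>) * fi \<psi> \<xi> * of_real (gauss_weight (s n) \<xi>)) \<longlonglongrightarrow> fi \<phi> (- \<xi>) * fi \<psi> \<xi> * of_real 1" for \<xi>
      by (intro tendsto_intros) simp
    then show "AE \<xi> in lborel. (\<lambda>n. fi \<phi> (- \<xi>) * fi \<psi> \<xi> * of_real (gauss_weight (s n) \<xi>)) \<longlonglongrightarrow> fi \<phi> (- \<xi>) * fi \<psi> \<xi>"
      by simp
    show "AE \<xi> in lborel. cmod (fi \<phi> (- \<xi>) * fi \<psi> \<xi> * of_real (gauss_weight (s n) \<xi>)) \<le> cmod (fi \<phi> (- \<xi>) * fi \<psi> \<xi>)" for n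
      by (intro AE_I2) (simp add: norm_mult gauss_weight_bounds mult_left_le)
  qed measurable
  moreover have "(\<lambda>n. LINT x|lborel. \<phi> x * (LINT v|lborel. \<psi> (x - s n *\<^sub>R v) * of_real (gauss_kernel 1 v))) \<longlonglongrightarrow> (LINT x|lborel. \<phi> x * \<psi> x)"
  proof (rule integral_dominated_convergence[where w="\<lambda>x. B * cmod (\<phi> x)"])
    show "integrable lborel (\<lambda>x. B * cmod (\<phi> x))" using \<phi> by auto
    have I1: "(LINT v|lborel. gauss_kernel 1 (v::'a)) = 1"
    proof -
      have "ennreal (LINT v|lborel. gauss_kernel 1 (v::'a)) = (\<integral>\<^sup>+v. ennreal (gauss_kernel 1 (v::'a)) \<partial>lborel)"
        by (rule nn_integral_eq_integral[OF ig, symmetric]) simp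
      then have "ennreal (LINT v|lborel. gauss_kernel 1 (v::'a)) = ennreal 1" by (simp add: nn_integral_gauss_kernel)
      then show ?thesis by (subst (asm) ennreal_inj) (auto intro: Bochner_Integration.integral_nonneg)
    qed
    have igc: "integrable lborel (\<lambda>v. complex_of_real (gauss_kernel 1 (v::'a)))" using ig by (rule integrable_of_real)
    show "AE x in lborel. (\<lambda>n. \<phi> x * (LINT v|lborel. \<psi> (x - s n *\<^sub>R v) * of_real (gauss_kernel 1 v))) \<longlonglongrightarrow> \<phi> x * \<psi> x"
    proof (intro AE_I2 tendsto_mult tendsto_const)
      fix x :: 'a
      have "(\<lambda>n. LINT v|lborel. \<psi> (x - s n *\<^sub>R v) * of_real (gauss_kernel 1 v)) \<longlonglongrightarrow> (LINT v|lborel. \<psi> x * of_real (gauss_kernel 1 (v::'a)))"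
      proof (rule integral_dominated_convergence[where w="\<lambda>v::'a. B * gauss_kernel 1 v"])
        show "integrable lborel (\<lambda>v::'a. B * gauss_kernel 1 v)" using ig by auto
        have "(\<lambda>n. \<psi> (x - s n *\<^sub>R v)) \<longlonglongrightarrow> \<psi> (x - 0 *\<^sub>R v)" for v
        proof (rule continuous_on_tendsto_compose[OF \<psi>(2)])
          show "(\<lambda>n. x - s n *\<^sub>R v) \<longlonglongrightarrow> x - 0 *\<^sub>R v" by (intro tendsto_intros s0)
        qed simp_all
        then show "AE v in lborel. (\<lambda>n. \<psi> (x - s n *\<^sub>R v) * of_real (gauss_kernel 1 v)) \<longlonglongrightarrow> \<psi> x * of_real (gauss_kernel 1 v)"
          by (intro AE_I2 tendsto_mult tendsto_const) simp
        show "AE v in lborel. cmod (\<psi> (x - s n *\<^sub>R v) * of_real (gauss_kernel 1 v)) \<le> B * gauss_kernel 1 v" for n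
          using \<psi>(3) by (intro AE_I2) (simp add: norm_mult mult_right_mono)
      qed measurable
      then show "(\<lambda>n. LINT v|lborel. \<psi> (x - s n *\<^sub>R v) * of_real (gauss_kernel 1 v)) \<longlonglongrightarrow> \<psi> x"
        by (simp add: I1)
    qed
    show "AE x in lborel. cmod (\<phi> x * (LINT v|lborel. \<psi> (x - s n *\<^sub>R v) * of_real (gauss_kernel 1 v))) \<le> B * cmod (\<phi> x)" for n
    proof (rule AE_I2)
      fix x
      have "cmod (LINT v|lborel. \<psi> (x - s n *\<^sub>R v) * of_real (gauss_kernel 1 v)) \<le> (LINT v|lborel. B * gauss_kernel 1 (v::'a))"
      proof (rule Bochner_Integration.integral_norm_bound_integral)
        show "integrable lborel (\<lambda>v. \<psi> (x - s n *\<^sub>R v) * of_real (gauss_kernel 1 v))"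
          using integrable_times_bounded[OF igc, of "\<lambda>v. \<psi> (x - s n *\<^sub>R v)" B] \<psi>(3) by (simp add: mult.commute)
        show "integrable lborel (\<lambda>v::'a. B * gauss_kernel 1 v)" using ig by auto
        show "cmod (\<psi> (x - s n *\<^sub>R v) * of_real (gauss_kernel 1 v)) \<le> B * gauss_kernel 1 v" for v
          using \<psi>(3) by (simp add: norm_mult mult_right_mono)
      qed
      then have "cmod (LINT v|lborel. \<psi> (x - s n *\<^sub>R v) * of_real (gauss_kernel 1 v)) \<le> B" by (simp add: I1)
      then show "cmod (\<phi> x * (LINT v|lborel. \<psi> (x - s n *\<^sub>R v) * of_real (gauss_kernel 1 v))) \<le> B * cmod (\<phi> x)"
        by (simp add: norm_mult mult.commute[of B] mult_left_mono)
    qed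
  qed measurable
  ultimately show ?thesis unfolding eq using LIMSEQ_unique by blast
qed

lemma fi_translate:
  fixes \<phi> :: "'a::euclidean_space \<Rightarrow> complex"
  assumes [measurable]: "\<phi> \<in> borel_measurable borel"
  shows "fi (\<lambda>x. \<phi> (x + k)) (- \<xi>) = ek k \<xi> * fi \<phi> (- \<xi>)"
proof -
  have "fi (\<lambda>x. \<phi> (x + k)) (- \<xi>) = (LINT x|lborel. \<phi> (k + x) * ek (k + x) (- \<xi>) * ek k \<xi>)"
    unfolding fi_def
    by (intro Bochner_Integration.integral_cong refl)
      (simp add: ek_add ek_minus_right[of k] add.commute mult.assoc mult.left_commute[of _ "ek (- k) \<xi>"] mult.commute[of "ek k \<xi>"] ek_minus_cancel)
  also have "\<dots> = (LINT x|lborel. \<phi> x * ek x (- \<xi>) * ek k \<xi>)"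
    by (rule integral_lborel_translate) measurable
  finally show ?thesis by (simp add: fi_def mult.commute)
qed

section \<open>Growth of matrix powers\<close>

lemma norm_vector_scalar_mult: "norm (c *s (v :: complex ^ 'n::finite)) = cmod c * norm v"
  by (simp add: norm_vec_def L2_set_def norm_mult power_mult_distrib sum_distrib_left[symmetric] real_sqrt_mult)

definition shifted :: "complex ^ 'n ^ 'n::finite \<Rightarrow> complex \<Rightarrow> complex ^ 'n \<Rightarrow> complex ^ 'n" where
  "shifted A l v = A *v v - l *s v"

text \<open>A polynomial in \<open>A\<close> that is split into factors \<open>A - l I\<close>; by
  \<open>shifted_commute\<close> the order in the list is immaterial.\<close>

primrec linear_factors :: "complex ^ 'n ^ 'n::finite \<Rightarrow> complex list \<Rightarrow> complex ^ 'n \<Rightarrow> complex ^ 'n" where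
  "linear_factors A [] v = v"
| "linear_factors A (l # ls) v = linear_factors A ls (shifted A l v)"

lemma shifted_commute: "shifted A l (shifted A m v) = shifted A m (shifted A l v)"
  by (simp add: shifted_def matrix_vector_mult_diff_distrib vector_scalar_commute vec_eq_iff algebra_simps)

lemma linear_factors_shifted: "linear_factors A ls (shifted A l v) = shifted A l (linear_factors A ls v)"
proof (induction ls arbitrary: v)
  case (Cons a ls)
  have "linear_factors A (a # ls) (shifted A l v) = linear_factors A ls (shifted A l (shifted A a v))"
    by (simp add: shifted_commute[of A a l])
  then show ?case by (simp add: Cons)
qed simp

lemma linear_factors_eigenvalues:
  assumes "linear_factors A ls v = 0"
  shows "\<exists>ls'. linear_factors A ls' v = 0 \<and> (\<forall>l\<in>set ls'. \<exists>u. u \<noteq> 0 \<and> A *v u = l *s u)"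
  using assms
proof (induction ls arbitrary: v)
  case Nil
  then show ?case by (intro exI[of _ "[]"]) simp
next
  case (Cons l ls)
  then obtain ls' where ls': "linear_factors A ls' (shifted A l v) = 0" "\<forall>l\<in>set ls'. \<exists>u. u \<noteq> 0 \<and> A *v u = l *s u" by force
  show ?case
  proof (cases "linear_factors A ls' v = 0")
    case True
    then show ?thesis using ls' by blast
  next
    case False
    moreover have "A *v linear_factors A ls' v = l *s linear_factors A ls' v" using ls'(1) by (simp add: linear_factors_shifted) (simp add: shifted_def)
    ultimately show ?thesis using ls' by (intro exI[of _ "l # ls'"]) auto
  qed
qed

lemma linear_factors_growth:
  assumes "linear_factors A ls v = 0" "\<forall>l\<in>set ls. cmod l < r" "0 < r"
  shows "\<exists>C. \<forall>j. norm (((*v) A ^^ j) v) \<le> C * r ^ j"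
  using assms(1,2)
proof (induction ls arbitrary: v)
  case Nil
  have "((*v) A ^^ j) v = 0" for j using Nil by (induction j) simp_all
  then show ?case by (intro exI[of _ 0]) simp
next
  case (Cons l ls)
  define w where "w = shifted A l v"
  have "linear_factors A ls w = 0" "\<forall>l\<in>set ls. cmod l < r" using Cons.prems by (simp_all add: w_def)
  then obtain C where C: "\<And>j. norm (((*v) A ^^ j) w) \<le> C * r ^ j" using Cons.IH by blast
  have l: "cmod l < r" using Cons.prems by simp
  have C0: "0 \<le> C" using order_trans[OF norm_ge_zero C[of 0]] by simp
  have lin: "((*v) A ^^ j) (x + y) = ((*v) A ^^ j) x + ((*v) A ^^ j) y" "((*v) A ^^ j) (c *s x) = c *s ((*v) A ^^ j) x" for j x y c
    by (induction j) (simp_all add: matrix_vector_right_distrib vector_scalar_commute)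
  have step: "((*v) A ^^ Suc j) v = l *s ((*v) A ^^ j) v + ((*v) A ^^ j) w" for j
  proof -
    have "((*v) A ^^ Suc j) v = ((*v) A ^^ j) (A *v v)" by (simp add: funpow_swap1)
    also have "A *v v = l *s v + w" by (simp add: w_def shifted_def)
    finally show ?thesis by (simp only: lin)
  qed
  \<comment> \<open>\<open>C / (r - cmod l)\<close> solves \<open>K * r = cmod l * K + C\<close>,
    the condition that lets the recursion reproduce the bound; \<open>norm v\<close> covers
    \<open>j = 0\<close>.\<close>
  define K where "K = norm v + C / (r - cmod l)"
  have K0: "0 \<le> K" using C0 l by (simp add: K_def)
  have K: "cmod l * K + C \<le> K * r"
  proof -
    have "(r - cmod l) * K = (r - cmod l) * norm v + C" using l by (simp add: K_def distrib_left)
    then have "C \<le> (r - cmod l) * K" using l by simp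
    then show ?thesis by (simp add: algebra_simps)
  qed
  have "norm (((*v) A ^^ j) v) \<le> K * r ^ j" for j
  proof (induction j)
    case 0
    then show ?case using C0 l by (simp add: K_def)
  next
    case (Suc j)
    have "norm (((*v) A ^^ Suc j) v) \<le> cmod l * norm (((*v) A ^^ j) v) + norm (((*v) A ^^ j) w)"
      unfolding step by (rule order_trans[OF norm_triangle_ineq]) (simp add: norm_vector_scalar_mult)
    also have "\<dots> \<le> cmod l * (K * r ^ j) + C * r ^ j" by (intro add_mono mult_left_mono Suc C) simp
    also have "\<dots> = (cmod l * K + C) * r ^ j" by (simp add: algebra_simps)
    also have "\<dots> \<le> K * r * r ^ j" using K assms(3) by (intro mult_right_mono) auto
    finally show ?case by (simp add: mult.assoc)
  qed
  then show ?case by blast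
qed

text \<open>This is \<open>p(A) v\<close>, written in terms of the orbit of
  \<open>v\<close>.\<close>

definition poly_matrix :: "complex ^ 'n ^ 'n::finite \<Rightarrow> complex poly \<Rightarrow> complex ^ 'n \<Rightarrow> complex ^ 'n" where
  "poly_matrix A p v = (\<Sum>i\<le>degree p. coeff p i *s ((*v) A ^^ i) v)"

lemma poly_matrix_bound:
  assumes "degree p \<le> n" shows "poly_matrix A p v = (\<Sum>i\<le>n. coeff p i *s ((*v) A ^^ i) v)"
  unfolding poly_matrix_def using assms
  by (intro sum.mono_neutral_left) (auto simp: coeff_eq_0)

lemma poly_matrix_linear_factor: "poly_matrix A ([:- z, 1:] * q) v = poly_matrix A q (shifted A z v)"
proof -
  define n where "n = Suc (degree q)"
  have lin: "((*v) A ^^ j) (x - y) = ((*v) A ^^ j) x - ((*v) A ^^ j) y" "((*v) A ^^ j) (c *s x) = c *s ((*v) A ^^ j) x" for j x y c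
    by (induction j) (simp_all add: matrix_vector_mult_diff_distrib vector_scalar_commute)
  have c: "coeff ([:- z, 1:] * q) i = coeff (pCons 0 q) i - z * coeff q i" for i by simp
  have "degree ([:- z, 1:] * q) \<le> n" unfolding n_def by (rule order_trans[OF degree_mult_le]) simp
  then have "poly_matrix A ([:- z, 1:] * q) v = (\<Sum>i\<le>n. coeff ([:- z, 1:] * q) i *s ((*v) A ^^ i) v)" by (rule poly_matrix_bound)
  also have "\<dots> = (\<Sum>i\<le>n. coeff (pCons 0 q) i *s ((*v) A ^^ i) v) - (\<Sum>i\<le>n. coeff q i *s (z *s ((*v) A ^^ i) v))"
    unfolding c sum_subtractf[symmetric] by (intro sum.cong refl) (simp add: vec_eq_iff algebra_simps)
  also have "(\<Sum>i\<le>n. coeff (pCons 0 q) i *s ((*v) A ^^ i) v) = (\<Sum>i\<le>degree q. coeff q i *s ((*v) A ^^ i) (A *v v))"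
    unfolding n_def sum.atMost_Suc_shift by (simp add: funpow_swap1)
  also have "(\<Sum>i\<le>n. coeff q i *s (z *s ((*v) A ^^ i) v)) = (\<Sum>i\<le>degree q. coeff q i *s (z *s ((*v) A ^^ i) v))"
    unfolding n_def by (simp add: coeff_eq_0)
  finally show ?thesis
    by (simp add: poly_matrix_def shifted_def lin sum_subtractf[symmetric] vec.scale_right_diff_distrib)
qed

text \<open>By the fundamental theorem of algebra roots are split off one after the other until a
  nonzero constant remains.\<close>

lemma poly_matrix_linear_factors: "p \<noteq> 0 \<Longrightarrow> poly_matrix A p v = 0 \<Longrightarrow> \<exists>ls. linear_factors A ls v = 0"
proof (induction "degree p" arbitrary: p v)
  case 0
  then obtain c where "p = [:c:]" using degree_eq_zeroE by metis
  then have "v = 0" using 0 by (simp add: poly_matrix_def)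
  then show ?case by (intro exI[of _ "[]"]) simp
next
  case (Suc n)
  then have "\<not> constant (poly p)" by (simp add: constant_degree)
  then obtain z where "poly p z = 0" using fundamental_theorem_of_algebra by blast
  then obtain q where q: "p = [:- z, 1:] * q" by (auto simp: poly_eq_0_iff_dvd)
  then have "q \<noteq> 0" "n = degree q" using Suc by (auto simp: degree_mult_eq simp del: mult_pCons_left)
  then obtain ls where "linear_factors A ls (shifted A z v) = 0"
    using Suc.hyps(1)[of q "shifted A z v"] Suc.prems(2) unfolding q poly_matrix_linear_factor by blast
  then show ?case by (intro exI[of _ "z # ls"]) simp
qed

text \<open>The \<open>CARD('n) + 1\<close> orbit vectors \<open>A^i v\<close> with
  \<open>i \<le> CARD('n)\<close> cannot be linearly independent; the coefficients of a dependence
  are those of \<open>p\<close>.\<close>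

lemma ex_poly_matrix: "\<exists>p. p \<noteq> 0 \<and> poly_matrix A p (v :: complex ^ 'n::finite) = 0"
proof -
  define f where "f i = ((*v) A ^^ i) v" for i
  show ?thesis
  proof (cases "inj_on f {..CARD('n)}")
    \<comment> \<open>Linear dependence speaks of sets, so coinciding orbit vectors are treated
      apart; here \<open>X^k - X^i\<close> annihilates \<open>v\<close>.\<close>
    case False
    then obtain i k where ik: "f i = f k" "i < k" unfolding inj_on_def by (metis linorder_neqE_nat)
    define p where "p = monom (1::complex) k - monom 1 i"
    have "degree p \<le> k" unfolding p_def using ik by (intro degree_diff_le) (auto simp: degree_monom_eq)
    then have "poly_matrix A p v = (\<Sum>j\<le>k. coeff p j *s f j)" unfolding f_def by (rule poly_matrix_bound)
    also have "\<dots> = (\<Sum>j\<le>k. (if j = k then f k else 0) - (if j = i then f i else 0))"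
      by (intro sum.cong refl) (simp add: p_def)
    also have "\<dots> = 0" using ik by (simp add: sum_subtractf)
    finally have "poly_matrix A p v = 0" .
    moreover have "coeff p k = 1" using ik by (simp add: p_def)
    ultimately show ?thesis by (metis coeff_0 zero_neq_one)
  next
    case True
    define S where "S = f ` {..CARD('n)}"
    have "finite S" "card S = Suc CARD('n)" using True by (auto simp: S_def card_image)
    then have "vec.dependent S" using vec.independent_bound_general[of S] vec.dim_subset_UNIV[of S]
      by (metis not_less_eq_eq order_trans vec.dimension_def vec.dim_UNIV vec_dim_card)
    then obtain u where u: "\<exists>w\<in>S. u w \<noteq> 0" "(\<Sum>w\<in>S. u w *s w) = 0"
      using vec.dependent_finite[OF \<open>finite S\<close>] by blast
    define p where "p = (\<Sum>i\<le>CARD('n). monom (u (f i)) i)"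
    have c: "coeff p j = (if j \<le> CARD('n) then u (f j) else 0)" for j
      unfolding p_def coeff_sum by (simp add: sum.delta)
    have "degree p \<le> CARD('n)" by (rule degree_le) (simp add: c)
    then have "poly_matrix A p v = (\<Sum>j\<le>CARD('n). coeff p j *s f j)" unfolding f_def by (rule poly_matrix_bound)
    also have "\<dots> = (\<Sum>j\<le>CARD('n). u (f j) *s f j)" by (intro sum.cong refl) (simp add: c)
    also have "\<dots> = (\<Sum>w\<in>S. u w *s w)" unfolding S_def by (subst sum.reindex[OF True]) simp
    finally have "poly_matrix A p v = 0" using u by simp
    moreover obtain i where "i \<le> CARD('n)" "u (f i) \<noteq> 0" using u(1) unfolding S_def by auto
    then have "coeff p i \<noteq> 0" by (simp add: c)
    then have "p \<noteq> 0" by auto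
    ultimately show ?thesis by blast
  qed
qed

(* Replaces the Jordan form: v is annihilated by a product of factors A - l I with eigenvalues l, and
   every factor contributes one first-order linear recursion for the orbit. *)
lemma matrix_orbit_growth:
  fixes A :: "complex ^ 'n ^ 'n::finite"
  assumes r: "0 < r" and ev: "\<And>u l. u \<noteq> 0 \<Longrightarrow> A *v u = l *s u \<Longrightarrow> cmod l < r"
  shows "\<exists>C. \<forall>j. norm (((*v) A ^^ j) v) \<le> C * r ^ j"
proof -
  obtain ls where "linear_factors A ls v = 0" using ex_poly_matrix[of A v] poly_matrix_linear_factors by blast
  then obtain ls' where "linear_factors A ls' v = 0" "\<forall>l\<in>set ls'. \<exists>u. u \<noteq> 0 \<and> A *v u = l *s u" using linear_factors_eigenvalues by blast
  then show ?thesis using ev by (intro linear_factors_growth[OF _ _ r]) blast+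
qed

section \<open>Powers of the inverse dilation matrix\<close>

definition cmat :: "real ^ 'n ^ 'm \<Rightarrow> complex ^ 'n ^ 'm" where
  "cmat A = (\<chi> i j. complex_of_real (A $ i $ j))"

definition cvec :: "real ^ 'n \<Rightarrow> complex ^ 'n" where
  "cvec x = (\<chi> i. complex_of_real (x $ i))"

lemma cvec_mult: "cvec (A *v x) = cmat A *v cvec (x :: real ^ 'n::finite)"
  by (simp add: cvec_def cmat_def matrix_vector_mult_def vec_eq_iff)

lemma cmat_mult: "cmat (A ** B) = cmat A ** cmat (B :: real ^ 'k ^ 'n::finite)"
  by (simp add: cmat_def matrix_matrix_mult_def vec_eq_iff)

lemma cmat_1: "cmat (mat 1) = mat 1"
  by (simp add: cmat_def mat_def vec_eq_iff)

lemma norm_cvec: "norm (cvec (x :: real ^ 'n::finite)) = norm x"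
  by (simp add: norm_vec_def cvec_def L2_set_def)

lemma matrix_inv_inverse:
  fixes M :: "real ^ 'n ^ 'n::finite"
  assumes "invertible M" shows "M ** matrix_inv M = mat 1 \<and> matrix_inv M ** M = mat 1"
  using assms unfolding invertible_def matrix_inv_def by (rule someI_ex)

text \<open>A kernel vector would make 0 an eigenvalue, against the modulus being greater than
  1.\<close>

lemma dilation_invertible:
  fixes M :: "real ^ 'n ^ 'n::finite"
  assumes M: "dilation_matrix M" shows "invertible M"
proof -
  have "x = 0" if x: "M *v x = 0" for x
  proof (rule ccontr)
    assume "x \<noteq> 0"
    then have "cvec x \<noteq> 0" by (simp add: cvec_def vec_eq_iff)
    moreover have "cmat M *v cvec x = 0 *s cvec x" unfolding cvec_mult[symmetric] x by (simp add: cvec_def vec_eq_iff)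
    ultimately have "complex_eigenvalue M 0" unfolding complex_eigenvalue_def cmat_def by blast
    then show False using M unfolding dilation_matrix_def by force
  qed
  then show ?thesis unfolding invertible_left_inverse matrix_left_invertible_ker by blast
qed

lemma matpow_inverse:
  fixes M :: "real ^ 'n ^ 'n::finite"
  assumes "invertible M"
  shows "matpow M j ** matpow (matrix_inv M) j = mat 1" "matpow (matrix_inv M) j ** matpow M j = mat 1"
proof -
  have inv: "M ** matrix_inv M = mat 1" "matrix_inv M ** M = mat 1"
    using matrix_inv_inverse[OF assms] by auto
  have comm: "matpow A j ** A = A ** matpow A j" for j and A :: "real ^ 'n ^ 'n"
    by (induction j) (simp_all add: matrix_mul_assoc[symmetric])
  show "matpow M j ** matpow (matrix_inv M) j = mat 1"
  proof (induction j)
    case (Suc j)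
    have "matpow M (Suc j) ** matpow (matrix_inv M) (Suc j) = matpow M j ** (M ** matrix_inv M) ** matpow (matrix_inv M) j"
      by (simp add: comm[where A=M] matrix_mul_assoc)
    then show ?case by (simp add: inv Suc)
  qed simp
  then show "matpow (matrix_inv M) j ** matpow M j = mat 1" by (simp add: matrix_left_right_inverse)
qed

lemma det_matpow: "det (matpow M j) = det M ^ j" for M :: "real ^ 'n ^ 'n::finite"
  by (induction j) (simp_all add: det_mul)

text \<open>The eigenvalues of the inverse are reciprocals of eigenvalues of \<open>M\<close>, hence
  smaller than \<open>1 / \<theta>\<close> in modulus. Orbit growth is a statement about a single
  starting vector; applying it to the unit vectors and adding the constants makes it uniform in
  \<open>x\<close>.\<close>

lemma matpow_growth:
  fixes M :: "real ^ 'n ^ 'n::finite"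
  assumes M: "invertible M" and \<theta>: "0 < \<theta>" "\<And>\<mu>. complex_eigenvalue M \<mu> \<Longrightarrow> \<theta> < cmod \<mu>"
  shows "\<exists>C\<ge>0. \<forall>j x. norm (matpow (matrix_inv M) j *v x) \<le> C * (1 / \<theta>) ^ j * norm x"
proof -
  define A where "A = matrix_inv M"
  have MA: "M ** A = mat 1" using matrix_inv_inverse[OF M] by (simp add: A_def)
  have ev: "cmod l < 1 / \<theta>" if u: "u \<noteq> 0" "cmat A *v u = l *s u" for u l
  proof -
    have "u = (cmat M ** cmat A) *v u" by (simp add: cmat_mult[symmetric] MA cmat_1)
    also have "\<dots> = l *s (cmat M *v u)" by (simp add: matrix_vector_mul_assoc[symmetric] u(2) vector_scalar_commute)
    finally have e: "u = l *s (cmat M *v u)" .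
    then have l: "l \<noteq> 0" using u(1) by auto
    have "(1 / l) *s u = (1 / l) *s (l *s (cmat M *v u))" using e by simp
    then have "cmat M *v u = (1 / l) *s u" using l by simp
    then have "complex_eigenvalue M (1 / l)" unfolding complex_eigenvalue_def cmat_def using u(1) by blast
    then have "\<theta> < 1 / cmod l" using \<theta>(2) by (fastforce simp: norm_divide)
    then show ?thesis using l \<theta>(1) by (simp add: field_simps)
  qed
  have pow: "cvec (matpow A j *v x) = ((*v) (cmat A) ^^ j) (cvec x)" for j x
    by (induction j) (simp_all add: matrix_vector_mul_assoc[symmetric] cvec_mult)
  have "\<forall>i. \<exists>C. \<forall>j. norm (matpow A j *v axis i 1) \<le> C * (1 / \<theta>) ^ j"
    using matrix_orbit_growth[of "1 / \<theta>" "cmat A"] ev \<theta>(1) by (simp add: norm_cvec[symmetric] pow)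
  then obtain C where C: "\<And>i j. norm (matpow A j *v axis i 1) \<le> C i * (1 / \<theta>) ^ j" by metis
  have C0: "0 \<le> C i" for i using C[of 0 i] by (auto intro: order_trans[OF norm_ge_zero])
  show ?thesis
  proof (intro exI[of _ "\<Sum>i\<in>UNIV. C i"] conjI allI)
    show "0 \<le> (\<Sum>i\<in>UNIV. C i)" by (intro sum_nonneg C0)
    fix j x
    have "matpow A j *v x = (\<Sum>i\<in>UNIV. x $ i *s (matpow A j *v axis i 1))"
      by (simp only: matrix_vector_mult_basis matrix_mult_sum[of "matpow A j" x])
    also have "norm \<dots> \<le> (\<Sum>i\<in>UNIV. norm x * (C i * (1 / \<theta>) ^ j))"
    proof (rule sum_norm_le)
      fix i
      have "norm (x $ i *s (matpow A j *v axis i 1)) = \<bar>x $ i\<bar> * norm (matpow A j *v axis i 1)"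
        by (simp add: scalar_mult_eq_scaleR)
      also have "\<dots> \<le> norm x * (C i * (1 / \<theta>) ^ j)" by (intro mult_mono C component_le_norm_cart) auto
      finally show "norm (x $ i *s (matpow A j *v axis i 1)) \<le> norm x * (C i * (1 / \<theta>) ^ j)" .
    qed
    also have "\<dots> = (\<Sum>i\<in>UNIV. C i) * (1 / \<theta>) ^ j * norm x" by (simp add: sum_distrib_right sum_distrib_left mult_ac)
    finally show "norm (matpow (matrix_inv M) j *v x) \<le> (\<Sum>i\<in>UNIV. C i) * (1 / \<theta>) ^ j * norm x" unfolding A_def .
  qed
qed

text \<open>Pair \<open>transpose A *v y\<close> with itself and move one transpose across the inner
  product. The frequency side is dilated by the transposed matrix, to which the growth bound is
  carried over in this way.\<close>

lemma norm_transpose_le: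
  fixes A :: "real ^ 'n ^ 'n::finite"
  assumes "\<And>x. norm (A *v x) \<le> c * norm x"
  shows "norm (transpose A *v y) \<le> c * norm y"
proof (cases "transpose A *v y = 0")
  case True
  have "0 \<le> c * norm y" using assms[of y] norm_ge_zero order_trans by blast
  then show ?thesis using True by simp
next
  case False
  define z where "z = transpose A *v y"
  have "norm z * norm z = z \<bullet> z" by (simp add: dot_square_norm power2_eq_square)
  also have "\<dots> = y \<bullet> (A *v z)" unfolding z_def by (simp add: dot_lmul_matrix inner_commute)
  also have "\<dots> \<le> norm y * norm (A *v z)" by (rule norm_cauchy_schwarz)
  also have "\<dots> \<le> norm y * (c * norm z)" by (intro mult_left_mono assms) simp
  finally have "norm z * norm z \<le> (c * norm y) * norm z" by (simp add: mult_ac)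
  then show ?thesis using False by (simp add: z_def)
qed

section \<open>Taylor expansion of the ball mean\<close>

text \<open>Level sets of the total degree, over a variable index set so that
  \<open>sum_exponents\<close> can be proved by induction on \<open>I\<close>.\<close>

definition exponents :: "'i set \<Rightarrow> nat \<Rightarrow> ('i \<Rightarrow> nat) set" where
  "exponents I n = {\<beta>. (\<forall>i. i \<notin> I \<longrightarrow> \<beta> i = 0) \<and> (\<Sum>i\<in>I. \<beta> i) = n}"

lemma finite_exponents: "finite I \<Longrightarrow> finite (exponents I n)"
proof -
  assume I: "finite I"
  have "finite {\<beta>. \<forall>i. (i \<in> I \<longrightarrow> \<beta> i \<in> {..n}) \<and> (i \<notin> I \<longrightarrow> \<beta> i = (0::nat))}"
    by (rule finite_set_of_finite_funs[OF I finite_atMost])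
  moreover have "exponents I n \<subseteq> {\<beta>. \<forall>i. (i \<in> I \<longrightarrow> \<beta> i \<in> {..n}) \<and> (i \<notin> I \<longrightarrow> \<beta> i = 0)}"
    unfolding exponents_def using I by (auto intro: member_le_sum)
  ultimately show ?thesis by (rule rev_finite_subset)
qed

text \<open>The multinomial theorem in divided form; splitting off the exponent at \<open>a\<close>
  reduces the induction step to the binomial theorem.\<close>

lemma sum_exponents:
  fixes x :: "'i \<Rightarrow> 'a::field_char_0"
  assumes "finite I"
  shows "(\<Sum>\<beta>\<in>exponents I n. \<Prod>i\<in>I. x i ^ \<beta> i / fact (\<beta> i)) = (\<Sum>i\<in>I. x i) ^ n / fact n"
  using assms
proof (induction I arbitrary: n rule: finite_induct)
  case empty
  have "exponents ({} :: 'i set) n = (if n = 0 then {\<lambda>_. 0} else {})" by (auto simp: exponents_def fun_eq_iff)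
  then show ?case by (simp add: power_0_left)
next
  case (insert a I)
  have u: "(\<Sum>i\<in>I. (\<beta>(a := k)) i) = (\<Sum>i\<in>I. \<beta> i)" for \<beta> :: "'i \<Rightarrow> nat" and k
    using insert(2) by (intro sum.cong) auto
  have "(\<Sum>\<beta>\<in>exponents (insert a I) n. \<Prod>i\<in>insert a I. x i ^ \<beta> i / fact (\<beta> i)) =
    (\<Sum>(k, \<beta>)\<in>Sigma {..n} (\<lambda>k. exponents I (n - k)). x a ^ k / fact k * (\<Prod>i\<in>I. x i ^ \<beta> i / fact (\<beta> i)))"
  proof (rule sum.reindex_bij_witness[of _ "\<lambda>(k, \<beta>). \<beta>(a := k)" "\<lambda>\<beta>. (\<beta> a, \<beta>(a := 0))"])
    fix \<beta> assume b: "\<beta> \<in> exponents (insert a I) n"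
    show "(case (\<beta> a, \<beta>(a := 0)) of (k, \<beta>) \<Rightarrow> \<beta>(a := k)) = \<beta>" by simp
    show "(\<beta> a, \<beta>(a := 0)) \<in> Sigma {..n} (\<lambda>k. exponents I (n - k))"
      using b insert u[of \<beta> 0] by (auto simp: exponents_def)
    have "(\<Prod>i\<in>I. x i ^ (\<beta>(a := 0)) i / fact ((\<beta>(a := 0)) i)) = (\<Prod>i\<in>I. x i ^ \<beta> i / fact (\<beta> i))"
      using insert(2) by (intro prod.cong) auto
    then show "(case (\<beta> a, \<beta>(a := 0)) of (k, \<beta>) \<Rightarrow> x a ^ k / fact k * (\<Prod>i\<in>I. x i ^ \<beta> i / fact (\<beta> i))) = (\<Prod>i\<in>insert a I. x i ^ \<beta> i / fact (\<beta> i))"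
      using insert by simp
  next
    fix z assume z: "z \<in> Sigma {..n} (\<lambda>k. exponents I (n - k))"
    obtain k \<beta> where kb: "z = (k, \<beta>)" by (cases z)
    have "\<beta> a = 0" using z insert kb by (auto simp: exponents_def)
    then show "((case z of (k, \<beta>) \<Rightarrow> \<beta>(a := k)) a, (case z of (k, \<beta>) \<Rightarrow> \<beta>(a := k))(a := 0)) = z"
      by (simp add: kb fun_upd_idem)
    show "(case z of (k, \<beta>) \<Rightarrow> \<beta>(a := k)) \<in> exponents (insert a I) n"
      using z insert kb u[of \<beta> k] by (auto simp: exponents_def)
  qed
  also have "\<dots> = (\<Sum>k\<le>n. \<Sum>\<beta>\<in>exponents I (n - k). x a ^ k / fact k * (\<Prod>i\<in>I. x i ^ \<beta> i / fact (\<beta> i)))"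
    by (rule sum.Sigma[symmetric]) (auto intro: finite_exponents insert)
  also have "\<dots> = (\<Sum>k\<le>n. x a ^ k / fact k * ((\<Sum>i\<in>I. x i) ^ (n - k) / fact (n - k)))"
    by (simp only: sum_distrib_left[symmetric] insert.IH)
  also have "\<dots> = (\<Sum>k\<le>n. of_nat (n choose k) * x a ^ k * (\<Sum>i\<in>I. x i) ^ (n - k) / fact n)"
    by (intro sum.cong refl) (simp add: binomial_fact)
  also have "\<dots> = (x a + (\<Sum>i\<in>I. x i)) ^ n / fact n"
    by (simp add: binomial_ring sum_divide_distrib)
  finally show ?case using insert by simp
qed

text \<open>Grouped by total degree, the multi-indices of each degree contribute one power of
  \<open>t \<bullet> \<eta>\<close> by the multinomial theorem; what results is a partial sum of the
  exponential series.\<close>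

lemma sum_Delta_exp_partial:
  fixes t \<eta> :: "real ^ 'n::finite"
  shows "(\<Sum>\<beta>\<in>Delta (N + 1). of_real (mi_pow t \<beta> / mi_fact \<beta>) * (2 * of_real pi * \<i>) ^ mi_abs \<beta> * of_real (mi_pow \<eta> \<beta>))
    = (\<Sum>n\<le>N. (\<i> * of_real (2 * pi * (t \<bullet> \<eta>))) ^ n / fact n)" (is "?L = ?R")
proof -
  define x where "x i = \<i> * of_real (2 * pi * (t $ i * \<eta> $ i))" for i
  have sx: "(\<Sum>i\<in>UNIV. x i) = \<i> * of_real (2 * pi * (t \<bullet> \<eta>))"
    by (simp add: x_def inner_vec_def sum_distrib_left)
  have tm: "of_real (mi_pow t \<beta> / mi_fact \<beta>) * (2 * of_real pi * \<i>) ^ mi_abs \<beta> * of_real (mi_pow \<eta> \<beta>) = (\<Prod>i\<in>UNIV. x i ^ \<beta> i / fact (\<beta> i))" for \<beta>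
  proof -
    have "x i ^ \<beta> i / fact (\<beta> i) = of_real ((t $ i) ^ \<beta> i) / fact (\<beta> i) * (2 * of_real pi * \<i>) ^ \<beta> i * of_real ((\<eta> $ i) ^ \<beta> i)" for i
      by (simp add: x_def power_mult_distrib mult_ac)
    then show ?thesis
      by (simp add: prod.distrib mi_pow_def mi_fact_def mi_abs_def power_sum prod_dividef)
  qed
  have "?L = (\<Sum>n\<le>N. \<Sum>\<beta>\<in>{\<beta> \<in> Delta (N + 1). mi_abs \<beta> = n}. \<Prod>i\<in>UNIV. x i ^ \<beta> i / fact (\<beta> i))"
    unfolding tm by (rule sum.group[symmetric, OF finite_Delta finite_atMost]) (auto simp: Delta_def)
  also have "\<dots> = (\<Sum>n\<le>N. \<Sum>\<beta>\<in>exponents UNIV n. \<Prod>i\<in>UNIV. x i ^ \<beta> i / fact (\<beta> i))"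
    by (intro sum.cong refl) (auto simp: exponents_def Delta_def mi_abs_def)
  also have "\<dots> = ?R" by (simp only: sum_exponents[OF finite] sx)
  finally show ?thesis .
qed

definition ball_mean :: "real \<Rightarrow> real ^ 'n::finite \<Rightarrow> complex" where
  "ball_mean h \<eta> = fi (indicator (cball 0 h)) \<eta> / of_real (measure lborel (cball (0 :: real ^ 'n) h))"

text \<open>Taylor polynomial of \<open>ball_mean h\<close> at 0, and at the same time the conjugate
  of the transform of \<open>phi_tilde h N\<close>, see
  \<open>dist_fourier_fun_phi_tilde_taylor\<close>.\<close>

definition ball_mean_taylor :: "real \<Rightarrow> nat \<Rightarrow> real ^ 'n::finite \<Rightarrow> complex" where
  "ball_mean_taylor h N \<eta> = (\<Sum>\<beta>\<in>Delta (N + 1). a_coeff h \<beta> * (2 * of_real pi * \<i>) ^ mi_abs \<beta> * of_real (mi_pow \<eta> \<beta>))"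

lemma integrable_continuous_cball:
  fixes f :: "'a::euclidean_space \<Rightarrow> 'b::{banach, second_countable_topology}"
  assumes "continuous_on UNIV f"
  shows "integrable lborel (\<lambda>t. indicat_real (cball 0 h) t *\<^sub>R f t)"
proof -
  have "integrable lborel (\<lambda>t. indicator (cball 0 h) t *\<^sub>R f t)"
    by (rule borel_integrable_compact[OF compact_cball continuous_on_subset[OF assms subset_UNIV]])
  then show ?thesis .
qed

lemma measure_cball_lebesgue: "measure lebesgue (cball (0::'a::euclidean_space) h) = measure lborel (cball (0::'a) h)"
  by simp

lemma continuous_mi_pow: "continuous_on UNIV (\<lambda>t :: real ^ 'n::finite. mi_pow t \<beta>)"
  unfolding mi_pow_def by (intro continuous_intros)

lemma a_coeff_lborel:
  "a_coeff h \<beta> = of_real ((LINT t|lborel. indicat_real (cball (0 :: real ^ 'n::finite) h) t *\<^sub>R (mi_pow t \<beta> / mi_fact \<beta>)) / measure lborel (cball (0 :: real ^ 'n) h))"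
proof -
  have [measurable]: "(\<lambda>t :: real ^ 'n. mi_pow t \<beta>) \<in> borel_measurable borel"
    using continuous_mi_pow by (rule borel_measurable_continuous_onI)
  have "(LINT t : cball (0 :: real ^ 'n) h | lebesgue. mi_pow t \<beta>) = (LINT t|lborel. indicat_real (cball 0 h) t *\<^sub>R mi_pow t \<beta>)"
    unfolding set_lebesgue_integral_def by (rule integral_completion) (intro borel_measurable_scaleR borel_measurable_indicator; simp add: \<open>_ \<in> borel_measurable borel\<close>)
  also have "\<dots> / mi_fact \<beta> = (LINT t|lborel. indicat_real (cball 0 h) t *\<^sub>R (mi_pow t \<beta> / mi_fact \<beta>))"
    by (subst integral_divide_zero[symmetric]) simp
  finally have e: "(LINT t : cball (0 :: real ^ 'n) h | lebesgue. mi_pow t \<beta>) / mi_fact \<beta> = (LINT t|lborel. indicat_real (cball 0 h) t *\<^sub>R (mi_pow t \<beta> / mi_fact \<beta>))" .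
  have "1 / (a * b) * c = c / a / b" for a b c :: real by simp
  then show ?thesis unfolding a_coeff_def measure_cball_lebesgue e[symmetric] by (simp only:)
qed

text \<open>Both quantities are averages over the ball, one of the exponential and one of its
  partial sum of degree \<open>N\<close>, so the remainder estimate for the exponential applies
  under the integral, with argument at most \<open>2 * pi * h * norm \<eta>\<close>.\<close>

lemma ball_mean_taylor_error:
  fixes \<eta> :: "real ^ 'n::finite"
  assumes h: "0 < h"
  shows "cmod (ball_mean_taylor h N \<eta> - ball_mean h \<eta>) \<le> (2 * pi * h) ^ (N + 1) / fact (N + 1) * norm \<eta> ^ (N + 1)"
proof -
  define V where "V = measure lborel (cball (0 :: real ^ 'n) h)"
  have V: "0 < V" using content_cball_pos[OF h, of "0 :: real ^ 'n"] by (simp add: V_def)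
  let ?I = "\<lambda>t :: real ^ 'n. indicat_real (cball 0 h) t"
  define T where "T t = (\<Sum>n\<le>N. (\<i> * of_real (2 * pi * (t \<bullet> \<eta>))) ^ n / fact n)" for t :: "real ^ 'n"
  have cT: "continuous_on UNIV T" unfolding T_def by (intro continuous_intros) auto
  define w where "w \<beta> = (2 * of_real pi * \<i>) ^ mi_abs \<beta> * complex_of_real (mi_pow \<eta> \<beta>)" for \<beta>
  have ib: "integrable lborel (\<lambda>t. ?I t *\<^sub>R (mi_pow t \<beta> / mi_fact \<beta>))" for \<beta>
    by (intro integrable_continuous_cball continuous_intros continuous_mi_pow) (simp add: mi_fact_def)
  have "ball_mean_taylor h N \<eta> = (\<Sum>\<beta>\<in>Delta (N + 1). (LINT t|lborel. of_real (?I t *\<^sub>R (mi_pow t \<beta> / mi_fact \<beta>)) * w \<beta>) / of_real V)"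
  proof -
    have "(LINT t|lborel. complex_of_real (g t) * z) = of_real (LINT t|lborel. g t) * z" for g :: "real ^ 'n \<Rightarrow> real" and z by simp
    then show ?thesis
      unfolding ball_mean_taylor_def a_coeff_lborel V_def[symmetric] w_def by (simp only: of_real_divide times_divide_eq_left mult.assoc)
  qed
  also have "\<dots> = (\<Sum>\<beta>\<in>Delta (N + 1). (LINT t|lborel. of_real (?I t *\<^sub>R (mi_pow t \<beta> / mi_fact \<beta>)) * w \<beta>)) / of_real V"
    by (simp only: sum_divide_distrib)
  also have "(\<Sum>\<beta>\<in>Delta (N + 1). (LINT t|lborel. of_real (?I t *\<^sub>R (mi_pow t \<beta> / mi_fact \<beta>)) * w \<beta>))
     = (LINT t|lborel. (\<Sum>\<beta>\<in>Delta (N + 1). of_real (?I t *\<^sub>R (mi_pow t \<beta> / mi_fact \<beta>)) * w \<beta>))"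
    by (rule Bochner_Integration.integral_sum[symmetric]) (intro integrable_mult_left integrable_of_real ib)
  also have "\<dots> = (LINT t|lborel. ?I t *\<^sub>R T t)"
  proof (intro Bochner_Integration.integral_cong refl)
    fix t :: "real ^ 'n"
    have "(\<Sum>\<beta>\<in>Delta (N + 1). of_real (?I t *\<^sub>R (mi_pow t \<beta> / mi_fact \<beta>)) * w \<beta>) =
      ?I t *\<^sub>R (\<Sum>\<beta>\<in>Delta (N + 1). of_real (mi_pow t \<beta> / mi_fact \<beta>) * (2 * of_real pi * \<i>) ^ mi_abs \<beta> * of_real (mi_pow \<eta> \<beta>))"
      unfolding scaleR_sum_right by (intro sum.cong refl) (simp add: w_def scaleR_conv_of_real mult.assoc)
    then show "(\<Sum>\<beta>\<in>Delta (N + 1). of_real (?I t *\<^sub>R (mi_pow t \<beta> / mi_fact \<beta>)) * w \<beta>) = ?I t *\<^sub>R T t"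
      unfolding T_def sum_Delta_exp_partial .
  qed
  finally have P: "ball_mean_taylor h N \<eta> = (LINT t|lborel. ?I t *\<^sub>R T t) / of_real V" .
  have A: "ball_mean h \<eta> = (LINT t|lborel. ?I t *\<^sub>R ek t \<eta>) / of_real V"
    unfolding ball_mean_def fi_def V_def by (intro arg_cong2[where f="(/)"] Bochner_Integration.integral_cong refl) (simp add: indicator_def)
  have iT: "integrable lborel (\<lambda>t. ?I t *\<^sub>R T t)" by (rule integrable_continuous_cball[OF cT])
  have iA: "integrable lborel (\<lambda>t. ?I t *\<^sub>R ek t \<eta>)" by (rule integrable_continuous_cball) (intro continuous_intros)
  define K where "K = (2 * pi * h * norm \<eta>) ^ (N + 1) / fact (N + 1)"
  have "cmod ((LINT t|lborel. ?I t *\<^sub>R T t) - (LINT t|lborel. ?I t *\<^sub>R ek t \<eta>)) = cmod (LINT t|lborel. ?I t *\<^sub>R T t - ?I t *\<^sub>R ek t \<eta>)"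
    by (subst Bochner_Integration.integral_diff[OF iT iA]) simp
  also have "\<dots> \<le> (LINT t|lborel. K * ?I t)"
  proof (rule Bochner_Integration.integral_norm_bound_integral)
    show "integrable lborel (\<lambda>t. ?I t *\<^sub>R T t - ?I t *\<^sub>R ek t \<eta>)" by (rule Bochner_Integration.integrable_diff[OF iT iA])
    show "integrable lborel (\<lambda>t. K * ?I t)"
      using integrable_continuous_cball[of "\<lambda>_::real^'n. K" h] by (simp add: mult.commute)
    fix t :: "real ^ 'n"
    show "cmod (?I t *\<^sub>R T t - ?I t *\<^sub>R ek t \<eta>) \<le> K * ?I t"
    proof (cases "t \<in> cball 0 h")
      case True
      define y where "y = 2 * pi * (t \<bullet> \<eta>)"
      have "\<bar>t \<bullet> \<eta>\<bar> \<le> norm t * norm \<eta>" by (rule Cauchy_Schwarz_ineq2)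
      also have "\<dots> \<le> h * norm \<eta>" using True by (intro mult_right_mono) auto
      finally have y: "\<bar>y\<bar> \<le> 2 * pi * h * norm \<eta>" by (simp add: y_def abs_mult)
      have "cmod (T t - ek t \<eta>) = cmod (iexp y - (\<Sum>n\<le>N. (\<i> * y) ^ n / fact n))"
        by (simp add: T_def ek_def y_def cis_conv_exp norm_minus_commute)
      also have "\<dots> \<le> \<bar>y\<bar> ^ Suc N / fact (Suc N)" by (rule iexp_approx1)
      also have "\<dots> \<le> K" using power_mono[OF y, of "Suc N"] by (simp add: K_def divide_right_mono)
      finally show ?thesis using True by simp
    qed simp
  qed
  also have "\<dots> = K * V" by (simp add: V_def)
  finally have "cmod ((LINT t|lborel. ?I t *\<^sub>R T t) - (LINT t|lborel. ?I t *\<^sub>R ek t \<eta>)) \<le> K * V" .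
  then have "cmod (ball_mean_taylor h N \<eta> - ball_mean h \<eta>) \<le> K"
    unfolding P A diff_divide_distrib[symmetric] using V by (simp add: norm_divide field_simps)
  then show ?thesis by (simp only: K_def power_mult_distrib times_divide_eq_left)
qed

lemma norm_ball_mean_le:
  assumes h: "0 < h" shows "cmod (ball_mean h (\<eta> :: real ^ 'n::finite)) \<le> 1"
proof -
  have V: "0 < measure lborel (cball (0 :: real ^ 'n) h)" using content_cball_pos[OF h, of "0 :: real ^ 'n"] by simp
  have "cmod (fi (indicator (cball (0 :: real ^ 'n) h)) \<eta>) \<le> (LINT x|lborel. cmod (indicator (cball (0 :: real ^ 'n) h) x))" by (rule norm_fi_le)
  also have "\<dots> = (LINT x|lborel. indicat_real (cball (0 :: real ^ 'n) h) x)"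
    by (intro Bochner_Integration.integral_cong refl) (simp add: indicator_def)
  also have "\<dots> = measure lborel (cball (0 :: real ^ 'n) h)" by simp
  finally show ?thesis using V by (simp add: ball_mean_def norm_divide)
qed

text \<open>Conjugating the \<open>k\<close>-th power of \<open>2 * pi * \<i>\<close> produces the
  sign \<open>(- 1) ^ k\<close>, which cancels the sign built into \<open>phi_tilde\<close>.\<close>

lemma dist_fourier_fun_phi_tilde_taylor:
  "cnj (dist_fourier_fun (phi_tilde h N) \<xi>) = ball_mean_taylor h N (\<xi> :: real ^ 'n::finite)"
proof -
  define z where "z = 2 * of_real pi * \<i>"
  have c: "cnj z = (- 1) * z" by (simp add: z_def)
  have e: "cnj (z ^ m) = (- 1) ^ m * z ^ m" for m
    unfolding complex_cnj_power c by (rule power_mult_distrib)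
  have s: "(- 1) ^ m * ((- 1) ^ m * w) = w" "cnj ((- 1) ^ m) = (- 1) ^ m" for m and w :: complex
    by (simp_all add: mult.assoc[symmetric] power_mult_distrib[symmetric])
  show ?thesis
    unfolding dist_fourier_fun_phi_tilde ball_mean_taylor_def cnj_sum z_def[symmetric]
    by (simp only: complex_cnj_mult complex_cnj_cnj e s complex_cnj_complex_of_real mult.assoc)
qed

section \<open>Decaying functions on the lattice\<close>

lemma nn_integral_decay_real:
  assumes a: "1 < a"
  shows "(\<integral>\<^sup>+x. ennreal ((1 + \<bar>x :: real\<bar>) powr (- a)) \<partial>lborel) < \<infinity>"
proof -
  define f where "f x = ennreal ((1 + \<bar>x :: real\<bar>) powr (- a)) * indicator {0..} x" for x
  have [measurable]: "f \<in> borel_measurable borel" unfolding f_def by measurable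
  have "(\<integral>\<^sup>+x. ennreal ((1 + x) powr (- a)) * indicator {0..} x \<partial>lborel) = ennreal (0 - (1 + 0) powr (1 - a) / (1 - a))"
  proof (rule nn_integral_FTC_atLeast)
    show "(\<lambda>x::real. (1 + x) powr (- a)) \<in> borel_measurable borel" by measurable
    show "((\<lambda>x. (1 + x) powr (1 - a) / (1 - a)) has_real_derivative (1 + x) powr (- a)) (at x)" if "0 \<le> x" for x
      using that a by (auto intro!: derivative_eq_intros)
    show "((\<lambda>x. (1 + x) powr (1 - a) / (1 - a)) \<longlongrightarrow> 0) at_top"
      using a by real_asymp
  qed simp
  also have "(\<lambda>x. ennreal ((1 + x) powr (- a)) * indicator {0..} x) = f"
    by (auto simp: f_def fun_eq_iff split: split_indicator)
  finally have f1: "(\<integral>\<^sup>+x. f x \<partial>lborel) < \<infinity>" by simp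
  have "(\<integral>\<^sup>+x. ennreal ((1 + \<bar>x :: real\<bar>) powr (- a)) \<partial>lborel) \<le> (\<integral>\<^sup>+x. f x + f (- x) \<partial>lborel)"
    by (intro nn_integral_mono) (auto simp: f_def split: split_indicator)
  also have "\<dots> = (\<integral>\<^sup>+x. f x \<partial>lborel) + (\<integral>\<^sup>+x. f (- x) \<partial>lborel)" by (rule nn_integral_add) measurable
  also have "(\<integral>\<^sup>+x. f (- x) \<partial>lborel) = (\<integral>\<^sup>+x. f x \<partial>lborel)" by (rule nn_integral_lborel_uminus) measurable
  finally show ?thesis using f1 by (simp add: order_le_less_trans)
qed

text \<open>Each \<open>1 + |x \<bullet> b|\<close> is at most \<open>1 + norm x\<close>. Sharing
  the exponent evenly, \<open>s / DIM('a) > 1\<close> per coordinate, bounds the integrand by a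
  product with convergent one-dimensional integrals.\<close>

lemma nn_integral_decay:
  assumes s: "real DIM('a::euclidean_space) < s"
  shows "(\<integral>\<^sup>+x. ennreal ((1 + norm (x :: 'a)) powr (- s)) \<partial>lborel) < \<infinity>"
proof -
  define a where "a = s / DIM('a)"
  have a: "1 < a" "a * DIM('a) = s" using s by (auto simp: a_def)
  have le: "(1 + norm x) powr (- s) \<le> (\<Prod>b\<in>Basis. (1 + \<bar>x \<bullet> b\<bar>) powr (- a))" for x :: 'a
  proof -
    have "(1 + norm x) powr (- s) = ((1 + norm x) powr (- a)) powr (real DIM('a))"
      using a(2) by (simp add: powr_powr)
    also have "\<dots> = (\<Prod>b\<in>(Basis :: 'a set). (1 + norm x) powr (- a))"
    proof -
      have "0 < 1 + norm x" using norm_ge_zero[of x] by linarith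
      then show ?thesis by (subst powr_realpow) simp_all
    qed
    also have "\<dots> \<le> (\<Prod>b\<in>Basis. (1 + \<bar>x \<bullet> b\<bar>) powr (- a))"
    proof (rule prod_mono)
      fix b :: 'a assume "b \<in> Basis"
      then have "\<bar>x \<bullet> b\<bar> \<le> norm x" by (rule Basis_le_norm)
      then show "0 \<le> (1 + norm x) powr (- a) \<and> (1 + norm x) powr (- a) \<le> (1 + \<bar>x \<bullet> b\<bar>) powr (- a)"
        using a(1) by (intro conjI powr_mono2') auto
    qed
    finally show ?thesis .
  qed
  have "(\<integral>\<^sup>+x. ennreal ((1 + norm (x :: 'a)) powr (- s)) \<partial>lborel) \<le> (\<integral>\<^sup>+x. (\<Prod>b\<in>(Basis :: 'a set). ennreal ((1 + \<bar>x \<bullet> b\<bar>) powr (- a))) \<partial>lborel)"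
    by (intro nn_integral_mono, subst prod_ennreal) (auto intro!: ennreal_leI le)
  also have "\<dots> = (\<Prod>b\<in>(Basis :: 'a set). (\<integral>\<^sup>+x. ennreal ((1 + \<bar>x\<bar>) powr (- a)) \<partial>lborel))"
    by (rule nn_integral_lborel_prod) auto
  also have "\<dots> < \<infinity>" using nn_integral_decay_real[OF a(1)] by (simp add: power_less_top_ennreal)
  finally show ?thesis .
qed

lemma lattice_decay_sum:
  assumes s: "real CARD('n::finite) < s" and \<delta>: "0 < \<delta>"
  shows "\<exists>C\<ge>0. \<forall>\<xi> :: real ^ 'n. (\<Sum>n. ennreal (if \<delta> \<le> norm (\<xi> + lat n) then norm (\<xi> + lat n) powr (- s) else 0)) \<le> ennreal C"
proof -
  \<comment> \<open>Chosen so that \<open>1 + norm (y + x) \<le> c * norm y\<close> for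
    \<open>norm y \<ge> \<delta>\<close> and \<open>x\<close> in the cube; this is what the
    comparison of the lattice sum with the integral of \<open>H\<close> asks for.\<close>
  define c where "c = 1 + (1 + CARD('n)) / \<delta>"
  have c: "0 < c" using \<delta> by (simp add: c_def add_pos_nonneg)
  have s0: "0 < s" using s by (simp add: order_le_less_trans[OF of_nat_0_le_iff])
  define H where "H x = ennreal (c powr s * (1 + norm (x :: real ^ 'n)) powr (- s))" for x
  have [measurable]: "H \<in> borel_measurable borel" unfolding H_def by measurable
  have "(\<integral>\<^sup>+x. H x \<partial>lborel) = ennreal (c powr s) * (\<integral>\<^sup>+x. ennreal ((1 + norm (x :: real ^ 'n)) powr (- s)) \<partial>lborel)"
    unfolding H_def by (subst nn_integral_cmult[symmetric]) (auto simp: ennreal_mult)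
  also have "\<dots> < \<infinity>" using nn_integral_decay[of s, where 'a="real ^ 'n"] s by (simp add: ennreal_mult_less_top)
  finally have H: "(\<integral>\<^sup>+x. H x \<partial>lborel) < \<infinity>" .
  define F where "F y = ennreal (if \<delta> \<le> norm y then norm y powr (- s) else 0)" for y :: "real ^ 'n"
  have le: "F y \<le> H (y + x)" if "x \<in> T0" for x y :: "real ^ 'n"
  proof (cases "\<delta> \<le> norm y")
    case True
    then have y: "0 < norm y" using \<delta> by linarith
    have "1 + norm (y + x) \<le> norm y + (1 + CARD('n))"
      using norm_T0_le[OF that] norm_triangle_ineq[of y x] by linarith
    also have "\<dots> \<le> norm y + (1 + CARD('n)) / \<delta> * norm y"
    proof -
      have "(1 + CARD('n)) / \<delta> * \<delta> \<le> (1 + CARD('n)) / \<delta> * norm y" using True \<delta> by (intro mult_left_mono) auto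
      then show ?thesis using \<delta> by simp
    qed
    also have "\<dots> = c * norm y" by (simp add: c_def algebra_simps)
    finally have *: "1 + norm (y + x) \<le> c * norm y" .
    have "(c * norm y) powr (- s) \<le> (1 + norm (y + x)) powr (- s)"
      using * s0 by (intro powr_mono2') (auto intro: add_pos_nonneg)
    then have "c powr s * (c * norm y) powr (- s) \<le> c powr s * (1 + norm (y + x)) powr (- s)" by (intro mult_left_mono) auto
    moreover have "c powr s * (c * norm y) powr (- s) = norm y powr (- s)"
      using c y by (simp add: powr_mult powr_minus field_simps)
    ultimately show ?thesis using True by (simp add: F_def H_def ennreal_leI)
  qed (simp add: F_def)
  show ?thesis
  proof (intro exI[of _ "enn2real (\<integral>\<^sup>+x. H x \<partial>lborel)"] conjI allI)
    fix \<xi> :: "real ^ 'n"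
    have "(\<Sum>n. F (\<xi> + lat n)) \<le> (\<integral>\<^sup>+x. H x \<partial>lborel)" by (rule lattice_sum_le_integral[where F=F and H=H, OF _ le]) measurable
    then show "(\<Sum>n. ennreal (if \<delta> \<le> norm (\<xi> + lat n) then norm (\<xi> + lat n) powr (- s) else 0)) \<le> ennreal (enn2real (\<integral>\<^sup>+x. H x \<partial>lborel))"
    proof -
      have e: "ennreal (enn2real (\<integral>\<^sup>+x. H x \<partial>lborel)) = (\<integral>\<^sup>+x. H x \<partial>lborel)" using H by simp
      assume "(\<Sum>n. F (\<xi> + lat n)) \<le> (\<integral>\<^sup>+x. H x \<partial>lborel)"
      then show ?thesis unfolding e F_def .
    qed
  qed simp
qed

text \<open>Write \<open>G\<close> as the weighted function times the inverse weight and apply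
  Hoelder's inequality along the points \<open>\<xi> + lat n\<close>. For \<open>q = 1\<close> the
  inverse weight is bounded by \<open>1 / \<delta> ^ (N + 1)\<close> instead of being summed. The
  constant does not depend on \<open>\<xi>\<close>.\<close>

lemma lattice_tail_Holder:
  assumes q: "1 \<le> q" and p: "1 < q \<Longrightarrow> 1 / p + 1 / q = 1 \<and> real CARD('n::finite) < p" and \<delta>: "0 < \<delta>"
  shows "\<exists>C\<ge>0. \<forall>(G :: real ^ 'n \<Rightarrow> real) \<xi> v. (\<forall>x. 0 \<le> G x) \<longrightarrow> 0 \<le> v \<longrightarrow>
    (\<Sum>n. ennreal ((norm (\<xi> + lat n) ^ (N + 1) * G (\<xi> + lat n)) powr q)) \<le> ennreal (v powr q) \<longrightarrow>
    (\<Sum>n. ennreal (if \<delta> \<le> norm (\<xi> + lat n) then G (\<xi> + lat n) else 0)) \<le> ennreal (C * v)"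
proof (cases "q = 1")
  case True
  show ?thesis
  proof (intro exI[of _ "1 / \<delta> ^ (N + 1)"] conjI allI impI)
    fix G :: "real ^ 'n \<Rightarrow> real" and \<xi> v
    assume G: "\<forall>x. 0 \<le> G x" and v: "0 \<le> v" and le: "(\<Sum>n. ennreal ((norm (\<xi> + lat n) ^ (N + 1) * G (\<xi> + lat n)) powr q)) \<le> ennreal (v powr q)"
    have "(\<Sum>n. ennreal (if \<delta> \<le> norm (\<xi> + lat n) then G (\<xi> + lat n) else 0)) \<le> (\<Sum>n. ennreal (1 / \<delta> ^ (N + 1)) * ennreal ((norm (\<xi> + lat n) ^ (N + 1) * G (\<xi> + lat n)) powr q))"
    proof (intro suminf_le allI)
      fix n
      have "1 * G (\<xi> + lat n) \<le> (norm (\<xi> + lat n) / \<delta>) ^ (N + 1) * G (\<xi> + lat n)" if "\<delta> \<le> norm (\<xi> + lat n)"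
        using that \<delta> G by (intro mult_right_mono one_le_power) auto
      then have "(if \<delta> \<le> norm (\<xi> + lat n) then G (\<xi> + lat n) else 0) \<le> 1 / \<delta> ^ (N + 1) * (norm (\<xi> + lat n) ^ (N + 1) * G (\<xi> + lat n)) powr q"
        using G \<delta> True by (auto simp: power_divide)
      then show "ennreal (if \<delta> \<le> norm (\<xi> + lat n) then G (\<xi> + lat n) else 0) \<le> ennreal (1 / \<delta> ^ (N + 1)) * ennreal ((norm (\<xi> + lat n) ^ (N + 1) * G (\<xi> + lat n)) powr q)"
        using \<delta> by (subst ennreal_mult[symmetric]) (auto intro: ennreal_leI)
    qed auto
    also have "\<dots> = ennreal (1 / \<delta> ^ (N + 1)) * (\<Sum>n. ennreal ((norm (\<xi> + lat n) ^ (N + 1) * G (\<xi> + lat n)) powr q))" by simp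
    also have "\<dots> \<le> ennreal (1 / \<delta> ^ (N + 1)) * ennreal (v powr q)" by (intro mult_left_mono le) simp
    also have "\<dots> = ennreal (1 / \<delta> ^ (N + 1) * v)" using True v \<delta> by (subst ennreal_mult[symmetric]) auto
    finally show "(\<Sum>n. ennreal (if \<delta> \<le> norm (\<xi> + lat n) then G (\<xi> + lat n) else 0)) \<le> ennreal (1 / \<delta> ^ (N + 1) * v)" .
  qed (use \<delta> in simp)
next
  case False
  then have q1: "1 < q" using q by simp
  then have pq: "1 / p + 1 / q = 1" "real CARD('n) < p" using p by auto
  have p1: "1 < p"
  proof -
    have "1 \<le> real CARD('n)" by (simp add: Suc_le_eq)
    then show ?thesis using pq(2) by linarith
  qed
  \<comment> \<open>Since \<open>N + 1 \<ge> 1\<close>, the exponent \<open>(N + 1) * p\<close> of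
    the inverse weight exceeds the dimension as soon as \<open>p\<close> does.\<close>
  have "1 * p \<le> real (N + 1) * p" using p1 by (intro mult_right_mono) auto
  then have "real CARD('n) < real (N + 1) * p" using pq(2) by linarith
  from lattice_decay_sum[OF this \<delta>] obtain C where C: "0 \<le> C"
    "\<And>\<xi> :: real ^ 'n. (\<Sum>n. ennreal (if \<delta> \<le> norm (\<xi> + lat n) then norm (\<xi> + lat n) powr (- (real (N + 1) * p)) else 0)) \<le> ennreal C" by blast
  show ?thesis
  proof (intro exI[of _ "C powr (1 / p)"] conjI allI impI)
    fix G :: "real ^ 'n \<Rightarrow> real" and \<xi> v
    assume G: "\<forall>x. 0 \<le> G x" and v: "0 \<le> v" and le: "(\<Sum>n. ennreal ((norm (\<xi> + lat n) ^ (N + 1) * G (\<xi> + lat n)) powr q)) \<le> ennreal (v powr q)"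
    define m where "m = real (N + 1)"
    define f where "f n = (if \<delta> \<le> norm (\<xi> + lat n) then norm (\<xi> + lat n) powr (- m) else 0)" for n
    define V where "V n = norm (\<xi> + lat n) ^ (N + 1) * G (\<xi> + lat n)" for n
    have "(\<integral>\<^sup>+n. ennreal (f n * V n) \<partial>count_space UNIV) \<le> ennreal (C powr (1 / p) * v)"
    proof (rule nn_integral_Holder[OF p1 q1 pq(1)])
      have "f n powr p = (if \<delta> \<le> norm (\<xi> + lat n) then norm (\<xi> + lat n) powr (- (m * p)) else 0)" for n
        using p1 by (simp add: f_def powr_powr)
      then show "(\<integral>\<^sup>+n. ennreal (f n powr p) \<partial>count_space UNIV) \<le> ennreal ((C powr (1 / p)) powr p)"
        unfolding nn_integral_count_space_nat using C(2)[of \<xi>, folded m_def] C(1) p1 by (simp add: powr_powr)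
      show "(\<integral>\<^sup>+n. ennreal (V n powr q) \<partial>count_space UNIV) \<le> ennreal (v powr q)"
        unfolding nn_integral_count_space_nat V_def by (rule le)
    qed (use G v in \<open>auto simp: f_def V_def\<close>)
    moreover have "f n * V n = (if \<delta> \<le> norm (\<xi> + lat n) then G (\<xi> + lat n) else 0)" for n
    proof (cases "\<delta> \<le> norm (\<xi> + lat n)")
      case True
      then have y: "0 < norm (\<xi> + lat n)" using \<delta> by linarith
      have "norm (\<xi> + lat n) powr (- m) * norm (\<xi> + lat n) ^ (N + 1) = 1"
        using y by (simp only: powr_realpow[OF y, symmetric] powr_add[symmetric] m_def) simp
      then show ?thesis using True by (simp only: f_def V_def mult.assoc[symmetric]) simp
    qed (simp add: f_def)
    ultimately show "(\<Sum>n. ennreal (if \<delta> \<le> norm (\<xi> + lat n) then G (\<xi> + lat n) else 0)) \<le> ennreal (C powr (1 / p) * v)"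
      unfolding nn_integral_count_space_nat by simp
  qed simp
qed

section \<open>Approximation by integer shifts\<close>

lemma ball_mean_measurable [measurable]: "ball_mean h \<in> borel_measurable borel"
proof -
  have "(indicator (cball 0 h) :: real ^ 'n \<Rightarrow> complex) \<in> borel_measurable borel"
    by (intro borel_measurable_indicator borel_closed closed_cball)
  note [measurable] = fi_measurable[OF this]
  show ?thesis unfolding ball_mean_def[abs_def] by measurable
qed

text \<open>The hypotheses on the generator in terms of \<open>fi\<close>: its kernel has the
  opposite sign, so \<open>fi \<phi> (- \<xi>)\<close> is the usual transform, and
  \<open>phi_hat_0\<close> is the conjugate of the given normalisation. A real \<open>p\<close> is
  demanded for \<open>1 < q\<close>; for \<open>q = 1\<close> the dual exponent is infinite.\<close>

locale shift_approximation =
  fixes \<phi> :: "real ^ 'n::finite \<Rightarrow> complex" and h \<delta> B q p :: real and N :: nat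
  assumes phi: "integrable lborel \<phi>"
    and h: "0 < h" and delta: "0 < \<delta>" and q: "1 \<le> q" "q \<le> 2"
    and p: "1 < q \<Longrightarrow> 1 / p + 1 / q = 1 \<and> real CARD('n) < p"
    and B: "0 \<le> B" "\<And>\<xi>. (\<Sum>n. ennreal (cmod (fi \<phi> (- (\<xi> + lat n))) powr q)) \<le> ennreal B"
    and phi_hat_0: "AE \<xi> in lborel. norm \<xi> < \<delta> \<longrightarrow> fi \<phi> (- \<xi>) * ball_mean_taylor h N \<xi> = 1"
    and phi_hat_lat: "\<And>n. lat n \<noteq> (0 :: real ^ 'n) \<Longrightarrow> AE \<xi> in lborel. norm (lat n - \<xi>) < \<delta> \<longrightarrow> fi \<phi> (- \<xi>) = 0"
begin

definition F :: "real ^ 'n \<Rightarrow> complex" where "F \<xi> = fi \<phi> (- \<xi>)"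

lemma phi_measurable [measurable]: "\<phi> \<in> borel_measurable borel" using phi by auto

lemma F_measurable [measurable]: "F \<in> borel_measurable borel" unfolding F_def by measurable

text \<open>Integrate the bounded periodization over the cube of measure 1.\<close>

lemma F_Lq: "(\<integral>\<^sup>+\<xi>. ennreal (cmod (F \<xi>) powr q) \<partial>lborel) \<le> ennreal ((B powr (1 / q)) powr q)"
proof -
  have "(\<integral>\<^sup>+\<xi>. ennreal (cmod (F \<xi>) powr q) \<partial>lborel) = (\<integral>\<^sup>+\<xi>. indicator T0 \<xi> * (\<Sum>n. ennreal (cmod (F (\<xi> + lat n)) powr q)) \<partial>lborel)"
    by (rule nn_integral_tiling) measurable
  also have "\<dots> \<le> (\<integral>\<^sup>+\<xi>. indicator (T0 :: (real ^ 'n) set) \<xi> * ennreal B \<partial>lborel)"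
    unfolding F_def by (intro nn_integral_mono mult_left_mono B) simp
  also have "\<dots> = ennreal B" by (subst nn_integral_multc) (auto simp: emeasure_T0)
  finally show ?thesis using q B by (simp add: powr_powr)
qed

text \<open>The mean of \<open>fi G\<close> over the ball of radius \<open>h\<close> around
  \<open>- k\<close>, read off on the frequency side; \<open>ball_average_dilate\<close> makes the
  connection.\<close>

definition coef :: "(real ^ 'n \<Rightarrow> complex) \<Rightarrow> real ^ 'n \<Rightarrow> complex" where
  "coef G k = fi (\<lambda>\<xi>. G \<xi> * ball_mean h \<xi>) (- k)"

definition quasi :: "(real ^ 'n \<Rightarrow> complex) \<Rightarrow> real ^ 'n \<Rightarrow> complex" where
  "quasi G x = (\<Sum>n. coef G (lat n) * \<phi> (x + lat n))"

definition hat_product :: "(real ^ 'n \<Rightarrow> complex) \<Rightarrow> real ^ 'n \<Rightarrow> complex" where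
  "hat_product \<psi> \<xi> = F \<xi> * fi \<psi> \<xi>"

definition lattice_pairing :: "(real ^ 'n \<Rightarrow> complex) \<Rightarrow> nat \<Rightarrow> complex" where
  "lattice_pairing \<psi> n = (LINT x|lborel. hat_product \<psi> x * ek (lat n) x)"

definition hat_periodization :: "(real ^ 'n \<Rightarrow> complex) \<Rightarrow> real ^ 'n \<Rightarrow> complex" where
  "hat_periodization \<psi> \<xi> = (\<Sum>n. hat_product \<psi> (\<xi> + lat n))"

context
  fixes G :: "real ^ 'n \<Rightarrow> complex"
  assumes G: "integrable lborel G"
begin

lemma G_measurable [measurable]: "G \<in> borel_measurable borel" using G by auto

lemma integrable_G_mean: "integrable lborel (\<lambda>\<xi>. G \<xi> * ball_mean h \<xi>)"
  by (rule integrable_times_bounded[OF G _ norm_ball_mean_le[OF h]]) measurable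

lemma coef_bound: "cmod (coef G k) \<le> (LINT \<xi>|lborel. cmod (G \<xi>))"
proof -
  have "cmod (coef G k) \<le> (LINT \<xi>|lborel. cmod (G \<xi> * ball_mean h \<xi>))" unfolding coef_def by (rule norm_fi_le)
  also have "\<dots> \<le> (LINT \<xi>|lborel. cmod (G \<xi>))"
  proof (rule integral_mono)
    show "integrable lborel (\<lambda>\<xi>. cmod (G \<xi> * ball_mean h \<xi>))" using integrable_G_mean by (rule integrable_norm)
    show "integrable lborel (\<lambda>\<xi>. cmod (G \<xi>))" using G by (rule integrable_norm)
    show "cmod (G \<xi> * ball_mean h \<xi>) \<le> cmod (G \<xi>)" for \<xi>
      using norm_ball_mean_le[OF h, of \<xi>] by (simp add: norm_mult mult_left_le)
  qed
  finally show ?thesis .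
qed

text \<open>The coefficients are bounded, so the series is controlled by the periodization of
  \<open>|\<phi>|\<close>, which is locally integrable. Convergence almost everywhere
  follows.\<close>

lemma quasi_local:
  "(\<integral>\<^sup>+x. indicator (cball 0 R) x * (\<Sum>n. ennreal (cmod (coef G (lat n) * \<phi> (x + lat n)))) \<partial>lborel) < \<infinity>"
proof -
  let ?c = "LINT \<xi>|lborel. cmod (G \<xi>)"
  have "(\<integral>\<^sup>+x. indicator (cball 0 R) x * (\<Sum>n. ennreal (cmod (coef G (lat n) * \<phi> (x + lat n)))) \<partial>lborel)
    \<le> (\<integral>\<^sup>+x. ennreal ?c * (indicator (cball 0 R) x * (\<Sum>n. ennreal (cmod (\<phi> (x + lat n))))) \<partial>lborel)"
  proof (intro nn_integral_mono)
    fix x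
    have "ennreal (cmod (coef G (lat n) * \<phi> (x + lat n))) \<le> ennreal ?c * ennreal (cmod (\<phi> (x + lat n)))" for n
      by (subst ennreal_mult[symmetric]) (auto simp: norm_mult intro!: ennreal_leI mult_right_mono coef_bound Bochner_Integration.integral_nonneg)
    then have "(\<Sum>n. ennreal (cmod (coef G (lat n) * \<phi> (x + lat n)))) \<le> (\<Sum>n. ennreal ?c * ennreal (cmod (\<phi> (x + lat n))))"
      by (intro suminf_le) auto
    then have "indicator (cball 0 R) x * (\<Sum>n. ennreal (cmod (coef G (lat n) * \<phi> (x + lat n)))) \<le> indicator (cball 0 R) x * (ennreal ?c * (\<Sum>n. ennreal (cmod (\<phi> (x + lat n)))))"
      unfolding ennreal_suminf_cmult by (intro mult_left_mono) auto
    then show "indicator (cball 0 R) x * (\<Sum>n. ennreal (cmod (coef G (lat n) * \<phi> (x + lat n)))) \<le> ennreal ?c * (indicator (cball 0 R) x * (\<Sum>n. ennreal (cmod (\<phi> (x + lat n)))))"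
      by (simp add: mult.left_commute)
  qed
  also have "\<dots> = ennreal ?c * (\<integral>\<^sup>+x. indicator (cball 0 R) x * (\<Sum>n. ennreal (cmod (\<phi> (x + lat n)))) \<partial>lborel)"
    by (rule nn_integral_cmult) (intro borel_measurable_times_ennreal borel_measurable_indicator, simp, measurable)
  also have "\<dots> < \<infinity>" using lborel_integrable_local[OF phi, of R] by (simp add: ennreal_mult_less_top)
  finally show ?thesis .
qed

lemma quasi_summable: "AE x in lborel. summable (\<lambda>n. cmod (coef G (lat n) * \<phi> (x + lat n)))"
proof -
  have "AE x in lborel. norm x \<le> real m \<longrightarrow> summable (\<lambda>n. cmod (coef G (lat n) * \<phi> (x + lat n)))" for m
  proof -
    have "AE x in lborel. indicator (cball 0 (real m)) x * (\<Sum>n. ennreal (cmod (coef G (lat n) * \<phi> (x + lat n)))) \<noteq> \<infinity>"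
      by (rule nn_integral_PInf_AE) (use quasi_local[of "real m"] in \<open>auto intro!: borel_measurable_times_ennreal borel_measurable_indicator\<close>)
    then show ?thesis
    proof eventually_elim
      fix x assume *: "indicator (cball 0 (real m)) x * (\<Sum>n. ennreal (cmod (coef G (lat n) * \<phi> (x + lat n)))) \<noteq> \<infinity>"
      show "norm x \<le> real m \<longrightarrow> summable (\<lambda>n. cmod (coef G (lat n) * \<phi> (x + lat n)))"
      proof
        assume "norm x \<le> real m"
        then have "(\<Sum>n. ennreal (cmod (coef G (lat n) * \<phi> (x + lat n)))) \<noteq> \<infinity>" using * by (simp del: infinity_ennreal_def)
        then show "summable (\<lambda>n. cmod (coef G (lat n) * \<phi> (x + lat n)))" by (intro summable_suminf_not_top) auto
      qed
    qed
  qed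
  then have "AE x in lborel. \<forall>m. norm x \<le> real m \<longrightarrow> summable (\<lambda>n. cmod (coef G (lat n) * \<phi> (x + lat n)))" unfolding AE_all_countable by blast
  then show ?thesis
  proof eventually_elim
    fix x :: "real ^ 'n" assume *: "\<forall>m. norm x \<le> real m \<longrightarrow> summable (\<lambda>n. cmod (coef G (lat n) * \<phi> (x + lat n)))"
    obtain m where "norm x \<le> real m" using real_arch_simple by blast
    then show "summable (\<lambda>n. cmod (coef G (lat n) * \<phi> (x + lat n)))" using * by blast
  qed
qed

lemma quasi_measurable [measurable]: "quasi G \<in> borel_measurable borel"
  unfolding quasi_def[abs_def] by measurable

text \<open>A fixed test function together with its Hausdorff-Young bound, the norm of
  \<open>\<psi>\<close> being absorbed in \<open>CH\<close>.\<close>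

context
  fixes \<psi> :: "real ^ 'n \<Rightarrow> complex" and R :: real and CH :: real
  assumes psi: "compact_test \<psi> R"
    and CH: "\<And>w W. w \<in> borel_measurable borel \<Longrightarrow> (\<And>\<xi>. 0 \<le> w \<xi>) \<Longrightarrow> 0 \<le> W \<Longrightarrow>
      (\<integral>\<^sup>+\<xi>. ennreal (w \<xi> powr q) \<partial>lborel) \<le> ennreal (W powr q) \<Longrightarrow>
      (\<integral>\<^sup>+\<xi>. ennreal (w \<xi> * cmod (fi \<psi> \<xi>)) \<partial>lborel) \<le> ennreal (CH * W)"
begin

interpretation compact_test \<psi> R by (rule psi)

abbreviation "D \<equiv> hat_product \<psi>"

lemma hat_product_measurable [measurable]: "D \<in> borel_measurable borel" unfolding hat_product_def by measurable

text \<open>The Hausdorff-Young bound with \<open>|F|\<close> as weight.\<close>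

lemma integrable_D: "integrable lborel D"
proof (rule integrableI_bounded)
  have "(\<integral>\<^sup>+\<xi>. ennreal (cmod (F \<xi>) * cmod (fi \<psi> \<xi>)) \<partial>lborel) \<le> ennreal (CH * B powr (1 / q))"
    by (rule CH[OF _ _ _ F_Lq]) auto
  then show "(\<integral>\<^sup>+\<xi>. ennreal (cmod (D \<xi>)) \<partial>lborel) < \<infinity>"
    unfolding hat_product_def norm_mult by (rule le_less_trans) simp
qed measurable

abbreviation "b \<equiv> lattice_pairing \<psi>"

text \<open>Parseval's identity brings the Fourier coefficients of \<open>D\<close> back to the
  space side, where the compact support of \<open>\<psi>\<close> makes them absolutely summable;
  Poisson summation depends on that.\<close>

lemma lattice_pairing_eq: "b n = (LINT x|lborel. \<phi> (x + lat n) * \<psi> x)"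
proof -
  obtain Bp where Bp: "\<And>x. cmod (\<psi> x) \<le> Bp" using bounded_chi by blast
  have i: "integrable lborel (\<lambda>x. \<phi> (x + lat n))"
  proof -
    have "integrable (distr lborel borel ((+) (lat n))) \<phi>" using phi by (simp add: lborel_distr_plus)
    then have "integrable lborel (\<lambda>x. \<phi> (lat n + x))" by (subst (asm) integrable_distr_eq) auto
    then show ?thesis by (simp add: add.commute)
  qed
  have e: "fi (\<lambda>x. \<phi> (x + lat n)) (- \<xi>) * fi \<psi> \<xi> = D \<xi> * ek (lat n) \<xi>" for \<xi>
    by (simp add: fi_translate hat_product_def F_def)
  have "(LINT x|lborel. \<phi> (x + lat n) * \<psi> x) = (LINT \<xi>|lborel. fi (\<lambda>x. \<phi> (x + lat n)) (- \<xi>) * fi \<psi> \<xi>)"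
    by (rule parseval_bounded_continuous[OF i integrable_chi cont Bp])
      (unfold e, rule integrable_times_bounded[OF integrable_D, where B=1], simp_all)
  then show ?thesis unfolding e lattice_pairing_def by simp
qed

text \<open>The support of \<open>\<psi>\<close> lies in a ball, so local integrability of the
  series of shifts justifies summation under the integral.\<close>

lemma lattice_pairing_sums:
  "summable (\<lambda>n. cmod (b n))" "integrable lborel (\<lambda>x. quasi G x * \<psi> x)"
  "(\<lambda>n. coef G (lat n) * b n) sums (LINT x|lborel. quasi G x * \<psi> x)"
proof -
  obtain Bp where Bp: "0 \<le> Bp" "\<And>x. cmod (\<psi> x) \<le> Bp" using bounded_chi by blast
  have B': "cmod (\<psi> x) \<le> Bp * indicat_real (cball 0 R) x" for x
    using Bp(2)[of x] supp[of x] by (cases "R < norm x") auto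
  have fin: "(\<integral>\<^sup>+x. (\<Sum>n. ennreal (cmod (a n x * \<psi> x))) \<partial>lborel) < \<infinity>"
    if a: "(\<integral>\<^sup>+x. indicator (cball 0 R) x * (\<Sum>n. ennreal (cmod (a n x))) \<partial>lborel) < \<infinity>"
      and [measurable]: "\<And>n. a n \<in> borel_measurable borel" for a :: "nat \<Rightarrow> real ^ 'n \<Rightarrow> complex"
  proof -
    have "(\<integral>\<^sup>+x. (\<Sum>n. ennreal (cmod (a n x * \<psi> x))) \<partial>lborel) \<le> (\<integral>\<^sup>+x. ennreal Bp * (indicator (cball 0 R) x * (\<Sum>n. ennreal (cmod (a n x)))) \<partial>lborel)"
    proof (intro nn_integral_mono)
      fix x
      have e: "ennreal (cmod (a n x * \<psi> x)) = ennreal (cmod (\<psi> x)) * ennreal (cmod (a n x))" for n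
        by (simp add: norm_mult ennreal_mult mult.commute)
      have "ennreal (cmod (\<psi> x)) * (\<Sum>n. ennreal (cmod (a n x))) \<le> ennreal Bp * indicator (cball 0 R) x * (\<Sum>n. ennreal (cmod (a n x)))"
        using ennreal_leI[OF B'[of x]] Bp(1) by (intro mult_right_mono) (auto simp: ennreal_mult ennreal_indicator)
      then show "(\<Sum>n. ennreal (cmod (a n x * \<psi> x))) \<le> ennreal Bp * (indicator (cball 0 R) x * (\<Sum>n. ennreal (cmod (a n x))))"
        unfolding e ennreal_suminf_cmult by (simp only: mult.assoc)
    qed
    also have "\<dots> = ennreal Bp * (\<integral>\<^sup>+x. indicator (cball 0 R) x * (\<Sum>n. ennreal (cmod (a n x))) \<partial>lborel)"
      by (rule nn_integral_cmult) (intro borel_measurable_times_ennreal borel_measurable_indicator, simp, measurable)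
    also have "\<dots> < \<infinity>" using a by (simp add: ennreal_mult_less_top)
    finally show ?thesis .
  qed
  have m1: "\<And>n. (\<lambda>x. \<phi> (x + lat n) * \<psi> x) \<in> borel_measurable lborel"
    and m2: "\<And>n. (\<lambda>x. coef G (lat n) * \<phi> (x + lat n) * \<psi> x) \<in> borel_measurable lborel" by measurable
  have f1: "(\<integral>\<^sup>+x. (\<Sum>n. ennreal (cmod (\<phi> (x + lat n) * \<psi> x))) \<partial>lborel) < \<infinity>"
    by (rule fin[OF lborel_integrable_local[OF phi]]) measurable
  have f2: "(\<integral>\<^sup>+x. (\<Sum>n. ennreal (cmod (coef G (lat n) * \<phi> (x + lat n) * \<psi> x))) \<partial>lborel) < \<infinity>"
    by (rule fin[OF quasi_local]) measurable
  show "summable (\<lambda>n. cmod (b n))" unfolding lattice_pairing_eq by (rule sums_integral_suminf(5)[OF m1 f1])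
  have ae: "AE x in lborel. (\<Sum>n. coef G (lat n) * \<phi> (x + lat n) * \<psi> x) = quasi G x * \<psi> x"
    using quasi_summable
  proof eventually_elim
    fix x assume "summable (\<lambda>n. cmod (coef G (lat n) * \<phi> (x + lat n)))"
    then show "(\<Sum>n. coef G (lat n) * \<phi> (x + lat n) * \<psi> x) = quasi G x * \<psi> x"
      unfolding quasi_def by (rule suminf_mult2[OF summable_norm_cancel, symmetric])
  qed
  have m3: "(\<lambda>x. quasi G x * \<psi> x) \<in> borel_measurable lborel"
    and m4: "(\<lambda>x. \<Sum>n. coef G (lat n) * \<phi> (x + lat n) * \<psi> x) \<in> borel_measurable lborel" by measurable
  note s = sums_integral_suminf[OF m2 f2]
  show "integrable lborel (\<lambda>x. quasi G x * \<psi> x)"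
    using integrable_cong_AE[OF m4 m3 ae] s(2) by blast
  have "(LINT x|lborel. coef G (lat n) * \<phi> (x + lat n) * \<psi> x) = coef G (lat n) * b n" for n
    unfolding lattice_pairing_eq by (subst integral_mult_right_zero[symmetric]) (simp only: mult.assoc)
  then show "(\<lambda>n. coef G (lat n) * b n) sums (LINT x|lborel. quasi G x * \<psi> x)"
    using s(4) integral_cong_AE[OF m4 m3 ae] by simp
qed

abbreviation "\<gamma> \<equiv> hat_periodization \<psi>"

lemma hat_periodization_measurable [measurable]: "\<gamma> \<in> borel_measurable borel"
  unfolding hat_periodization_def[abs_def] by measurable

text \<open>Poisson summation replaces \<open>\<gamma>\<close> almost everywhere by a series with
  absolutely summable coefficients and characters of modulus 1, so its product with the integrable
  \<open>G * ball_mean h\<close> may be integrated term by term.\<close>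

lemma hat_periodization_sums:
  "integrable lborel (\<lambda>\<xi>. G \<xi> * ball_mean h \<xi> * \<gamma> \<xi>)"
  "(\<lambda>n. coef G (lat n) * b n) sums (LINT \<xi>|lborel. G \<xi> * ball_mean h \<xi> * \<gamma> \<xi>)"
proof -
  define G' where "G' \<xi> = G \<xi> * ball_mean h \<xi>" for \<xi>
  have iG': "integrable lborel G'" unfolding G'_def by (rule integrable_G_mean)
  then have [measurable]: "G' \<in> borel_measurable borel" by auto
  have t: "ennreal (cmod (b n * ek (- lat n) \<xi> * G' \<xi>)) = ennreal (cmod (b n)) * ennreal (cmod (G' \<xi>))" for n \<xi>
    by (simp add: norm_mult ennreal_mult)
  have "(\<integral>\<^sup>+\<xi>. (\<Sum>n. ennreal (cmod (b n * ek (- lat n) \<xi> * G' \<xi>))) \<partial>lborel) = (\<integral>\<^sup>+\<xi>. (\<Sum>n. ennreal (cmod (b n))) * ennreal (cmod (G' \<xi>)) \<partial>lborel)"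
    by (simp only: t ennreal_suminf_multc)
  also have "\<dots> = (\<Sum>n. ennreal (cmod (b n))) * (\<integral>\<^sup>+\<xi>. ennreal (cmod (G' \<xi>)) \<partial>lborel)" by (rule nn_integral_cmult) measurable
  also have "(\<Sum>n. ennreal (cmod (b n))) = ennreal (\<Sum>n. cmod (b n))" by (rule suminf_ennreal2[OF _ lattice_pairing_sums(1)]) simp
  also have "ennreal (\<Sum>n. cmod (b n)) * (\<integral>\<^sup>+\<xi>. ennreal (cmod (G' \<xi>)) \<partial>lborel) < \<infinity>"
    using iG' unfolding integrable_iff_bounded by (simp add: ennreal_mult_less_top)
  finally have f: "(\<integral>\<^sup>+\<xi>. (\<Sum>n. ennreal (cmod (b n * ek (- lat n) \<xi> * G' \<xi>))) \<partial>lborel) < \<infinity>" .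
  have m: "\<And>n. (\<lambda>\<xi>. b n * ek (- lat n) \<xi> * G' \<xi>) \<in> borel_measurable lborel" by measurable
  note s = sums_integral_suminf[OF m f]
  have ae: "AE \<xi> in lborel. (\<Sum>n. b n * ek (- lat n) \<xi> * G' \<xi>) = G' \<xi> * \<gamma> \<xi>"
    using poisson_summation_AE[OF integrable_D lattice_pairing_sums(1)[unfolded lattice_pairing_def]]
  proof eventually_elim
    fix \<xi> assume "(\<Sum>n. D (\<xi> + lat n)) = (\<Sum>n. (LINT x|lborel. D x * ek (lat n) x) * ek (- lat n) \<xi>)"
    then have g: "\<gamma> \<xi> = (\<Sum>n. b n * ek (- lat n) \<xi>)" by (simp only: hat_periodization_def lattice_pairing_def)
    have "summable (\<lambda>n. cmod (b n * ek (- lat n) \<xi>))" using lattice_pairing_sums(1) by (simp add: norm_mult)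
    from suminf_mult2[OF summable_norm_cancel[OF this], of "G' \<xi>"]
    show "(\<Sum>n. b n * ek (- lat n) \<xi> * G' \<xi>) = G' \<xi> * \<gamma> \<xi>" unfolding g by (simp add: mult.commute)
  qed
  have m3: "(\<lambda>\<xi>. G' \<xi> * \<gamma> \<xi>) \<in> borel_measurable lborel"
    and m4: "(\<lambda>\<xi>. \<Sum>n. b n * ek (- lat n) \<xi> * G' \<xi>) \<in> borel_measurable lborel" by measurable
  show "integrable lborel (\<lambda>\<xi>. G \<xi> * ball_mean h \<xi> * \<gamma> \<xi>)"
    using integrable_cong_AE[OF m4 m3 ae] s(2) unfolding G'_def by blast
  have "(LINT \<xi>|lborel. b n * ek (- lat n) \<xi> * G' \<xi>) = coef G (lat n) * b n" for n
  proof -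
    have "(LINT \<xi>|lborel. b n * ek (- lat n) \<xi> * G' \<xi>) = (LINT \<xi>|lborel. b n * (G' \<xi> * ek \<xi> (- lat n)))"
      by (intro Bochner_Integration.integral_cong refl) (simp add: ek_commute mult_ac)
    then show ?thesis by (simp add: coef_def fi_def G'_def mult.commute)
  qed
  then show "(\<lambda>n. coef G (lat n) * b n) sums (LINT \<xi>|lborel. G \<xi> * ball_mean h \<xi> * \<gamma> \<xi>)"
    using s(4) integral_cong_AE[OF m4 m3 ae] by (simp add: G'_def)
qed

(* Both sides of the error are moved to the frequency side: quasi G turns into the periodization of
   F * fi psi by Poisson summation. *)
lemma pairing_error:
  "(LINT x|lborel. (fi G x - quasi G x) * \<psi> x) = (LINT \<xi>|lborel. G \<xi> * fi \<psi> \<xi> - G \<xi> * ball_mean h \<xi> * \<gamma> \<xi>)"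
proof -
  have i1: "integrable lborel (\<lambda>x. fi G x * \<psi> x)"
    using integrable_times_bounded[OF integrable_chi _ norm_fi_le[of G]] by (simp add: mult.commute)
  have i2: "integrable lborel (\<lambda>\<xi>. G \<xi> * fi \<psi> \<xi>)"
    by (rule integrable_times_bounded[OF G _ norm_fi_le[of \<psi>]]) measurable
  have "(LINT x|lborel. (fi G x - quasi G x) * \<psi> x) = (LINT x|lborel. fi G x * \<psi> x) - (LINT x|lborel. quasi G x * \<psi> x)"
    unfolding left_diff_distrib by (rule Bochner_Integration.integral_diff[OF i1 lattice_pairing_sums(2)])
  also have "(LINT x|lborel. fi G x * \<psi> x) = (LINT \<xi>|lborel. G \<xi> * fi \<psi> \<xi>)"
    using fi_multiplication[OF integrable_chi G, of 1] by (simp add: mult.commute)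
  also have "(LINT x|lborel. quasi G x * \<psi> x) = (LINT \<xi>|lborel. G \<xi> * ball_mean h \<xi> * \<gamma> \<xi>)"
    by (rule sums_unique2[OF lattice_pairing_sums(3) hat_periodization_sums(2)])
  also have "(LINT \<xi>|lborel. G \<xi> * fi \<psi> \<xi>) - (LINT \<xi>|lborel. G \<xi> * ball_mean h \<xi> * \<gamma> \<xi>) = (LINT \<xi>|lborel. G \<xi> * fi \<psi> \<xi> - G \<xi> * ball_mean h \<xi> * \<gamma> \<xi>)"
    by (rule Bochner_Integration.integral_diff[OF i2 hat_periodization_sums(1), symmetric])
  finally show ?thesis .
qed

end

end

end

section \<open>Estimate of the error on the frequency side\<close>

lemma AE_lborel_translate:
  fixes a :: "'a::euclidean_space"
  assumes "AE x in lborel. P x" shows "AE x in lborel. P (a + x)"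
proof -
  have "AE x in distr lborel borel ((+) a). P x" unfolding lborel_distr_plus by (rule assms)
  then show ?thesis by (rule AE_distrD[rotated]) measurable
qed

lemma ennreal_norm_suminf_le:
  fixes f :: "nat \<Rightarrow> complex"
  shows "ennreal (cmod (\<Sum>n. f n)) \<le> (\<Sum>n. ennreal (cmod (f n)))"
proof (cases "(\<Sum>n. ennreal (cmod (f n))) = \<top>")
  case False
  then have s: "summable (\<lambda>n. cmod (f n))" by (intro summable_suminf_not_top) auto
  have "ennreal (cmod (\<Sum>n. f n)) \<le> ennreal (\<Sum>n. cmod (f n))" by (intro ennreal_leI summable_norm s)
  also have "\<dots> = (\<Sum>n. ennreal (cmod (f n)))" by (rule suminf_ennreal2[symmetric, OF _ s]) simp
  finally show ?thesis .
qed simp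

lemma AE_periodization_finite:
  fixes D :: "real ^ 'n::finite \<Rightarrow> complex"
  assumes D: "integrable lborel D"
  shows "AE x in lborel. (\<Sum>n. ennreal (cmod (D (x + lat n)))) < \<top>"
proof -
  have [measurable]: "D \<in> borel_measurable borel" using D by auto
  have "AE x in lborel. norm x \<le> real m \<longrightarrow> (\<Sum>n. ennreal (cmod (D (x + lat n)))) < \<top>" for m
  proof -
    have "AE x in lborel. indicator (cball 0 (real m)) x * (\<Sum>n. ennreal (cmod (D (x + lat n)))) \<noteq> \<infinity>"
      by (rule nn_integral_PInf_AE) (use lborel_integrable_local[OF D, of "real m"] in \<open>auto intro!: borel_measurable_times_ennreal borel_measurable_indicator\<close>)
    then show ?thesis
    proof eventually_elim
      fix x assume *: "indicator (cball 0 (real m)) x * (\<Sum>n. ennreal (cmod (D (x + lat n)))) \<noteq> \<infinity>"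
      show "norm x \<le> real m \<longrightarrow> (\<Sum>n. ennreal (cmod (D (x + lat n)))) < \<top>"
        using * by (auto simp: less_top)
    qed
  qed
  then have "AE x in lborel. \<forall>m. norm x \<le> real m \<longrightarrow> (\<Sum>n. ennreal (cmod (D (x + lat n)))) < \<top>" unfolding AE_all_countable by blast
  then show ?thesis
  proof eventually_elim
    fix x :: "real ^ 'n" assume *: "\<forall>m. norm x \<le> real m \<longrightarrow> (\<Sum>n. ennreal (cmod (D (x + lat n)))) < \<top>"
    obtain m where "norm x \<le> real m" using real_arch_simple by blast
    then show "(\<Sum>n. ennreal (cmod (D (x + lat n)))) < \<top>" using * by blast
  qed
qed

context shift_approximation begin

declare G_measurable [measurable del] quasi_measurable [measurable del]
  hat_product_measurable [measurable del] hat_periodization_measurable [measurable del]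

(* The first summand is the Taylor error of the ball mean on |xi| < delta; the second comes from
   1 <= (|xi| / delta)^(N + 1) elsewhere. *)
definition error_const :: real where
  "error_const = (LINT x|lborel. cmod (\<phi> x)) * ((2 * pi * h) ^ (N + 1) / fact (N + 1)) + 1 / \<delta> ^ (N + 1)"

lemma error_const_nonneg: "0 \<le> error_const"
  using h delta by (auto simp: error_const_def intro!: add_nonneg_nonneg mult_nonneg_nonneg Bochner_Integration.integral_nonneg)

text \<open>Stated in \<open>ennreal\<close> because the periodization may diverge at individual
  points. On \<open>|\<xi>| < \<delta>\<close> the points \<open>\<xi> + l\<close> with
  \<open>l \<noteq> 0\<close> lie within \<open>\<delta>\<close> of \<open>l\<close>, where
  \<open>F\<close> vanishes.\<close>

lemma pointwise_error:
  "AE \<xi> in lborel. ennreal (cmod (G \<xi> * fi \<psi> \<xi> - G \<xi> * ball_mean h \<xi> * hat_periodization \<psi> \<xi>)) \<le>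
    ennreal error_const * ennreal (norm \<xi> ^ (N + 1) * cmod (G \<xi>) * cmod (fi \<psi> \<xi>)) +
    ennreal (if \<delta> \<le> norm \<xi> then cmod (G \<xi>) else 0) * (\<Sum>n. ennreal (cmod (hat_product \<psi> (\<xi> + lat n))))"
proof -
  have "AE \<xi> in lborel. lat n \<noteq> (0 :: real ^ 'n) \<longrightarrow> norm \<xi> < \<delta> \<longrightarrow> F (\<xi> + lat n) = 0" for n
  proof (cases "lat n = (0 :: real ^ 'n)")
    case False
    from AE_lborel_translate[OF phi_hat_lat[OF False], of "lat n"] show ?thesis
      by eventually_elim (simp add: F_def add.commute)
  qed simp
  then have "AE \<xi> in lborel. \<forall>n. lat n \<noteq> (0 :: real ^ 'n) \<longrightarrow> norm \<xi> < \<delta> \<longrightarrow> F (\<xi> + lat n) = 0" unfolding AE_all_countable by blast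
  then show ?thesis using phi_hat_0
  proof eventually_elim
    fix \<xi> :: "real ^ 'n"
    assume lat: "\<forall>n. lat n \<noteq> (0 :: real ^ 'n) \<longrightarrow> norm \<xi> < \<delta> \<longrightarrow> F (\<xi> + lat n) = 0"
      and F1: "norm \<xi> < \<delta> \<longrightarrow> fi \<phi> (- \<xi>) * ball_mean_taylor h N \<xi> = 1"
    let ?A = "ball_mean h \<xi>" and ?g = "cmod (G \<xi>)" and ?f = "cmod (fi \<psi> \<xi>)"
    let ?M = "LINT x|lborel. cmod (\<phi> x)" and ?T = "(2 * pi * h) ^ (N + 1) / fact (N + 1)"
    have M0: "0 \<le> ?M" by (intro Bochner_Integration.integral_nonneg) auto
    have T0: "0 \<le> ?T" using h by simp
    show "ennreal (cmod (G \<xi> * fi \<psi> \<xi> - G \<xi> * ?A * hat_periodization \<psi> \<xi>)) \<le>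
      ennreal error_const * ennreal (norm \<xi> ^ (N + 1) * ?g * ?f) + ennreal (if \<delta> \<le> norm \<xi> then ?g else 0) * (\<Sum>n. ennreal (cmod (hat_product \<psi> (\<xi> + lat n))))"
    proof (cases "norm \<xi> < \<delta>")
      case True
      obtain n0 where n0: "(0 :: real ^ 'n) = lat n0" using obtain_lat Zd_0 by blast
      have z: "hat_product \<psi> (\<xi> + lat n) = 0" if "n \<noteq> n0" for n
        using lat True that by (simp add: hat_product_def n0)
      have "hat_periodization \<psi> \<xi> = (\<Sum>n\<in>{n0}. hat_product \<psi> (\<xi> + lat n))" unfolding hat_periodization_def by (rule suminf_finite) (auto simp: z)
      then have g: "hat_periodization \<psi> \<xi> = F \<xi> * fi \<psi> \<xi>" by (simp add: n0[symmetric] hat_product_def)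
      have "F \<xi> * ball_mean_taylor h N \<xi> = 1" using F1 True by (simp add: F_def)
      \<comment> \<open>Multiplying the first term by
        \<open>F \<xi> * ball_mean_taylor h N \<xi> = 1\<close> turns the difference into the Taylor
        error.\<close>
      then have "G \<xi> * fi \<psi> \<xi> - G \<xi> * ?A * hat_periodization \<psi> \<xi> = G \<xi> * fi \<psi> \<xi> * (F \<xi> * ball_mean_taylor h N \<xi>) - G \<xi> * ?A * hat_periodization \<psi> \<xi>" by simp
      also have "\<dots> = G \<xi> * fi \<psi> \<xi> * (F \<xi> * (ball_mean_taylor h N \<xi> - ?A))" unfolding g by (simp add: algebra_simps)
      finally have "cmod (G \<xi> * fi \<psi> \<xi> - G \<xi> * ?A * hat_periodization \<psi> \<xi>) = ?g * ?f * (cmod (F \<xi>) * cmod (ball_mean_taylor h N \<xi> - ?A))"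
        by (simp add: norm_mult)
      also have "\<dots> \<le> ?g * ?f * (?M * (?T * norm \<xi> ^ (N + 1)))"
        unfolding F_def by (intro mult_left_mono mult_mono norm_fi_le ball_mean_taylor_error h M0) auto
      also have "\<dots> = ?M * ?T * (norm \<xi> ^ (N + 1) * ?g * ?f)" by (simp only: mult_ac)
      also have "\<dots> \<le> error_const * (norm \<xi> ^ (N + 1) * ?g * ?f)" unfolding error_const_def using delta by (intro mult_right_mono) auto
      finally have "ennreal (cmod (G \<xi> * fi \<psi> \<xi> - G \<xi> * ?A * hat_periodization \<psi> \<xi>)) \<le> ennreal (error_const * (norm \<xi> ^ (N + 1) * ?g * ?f))" by (rule ennreal_leI)
      also have "\<dots> = ennreal error_const * ennreal (norm \<xi> ^ (N + 1) * ?g * ?f)" by (rule ennreal_mult[OF error_const_nonneg]) simp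
      finally show ?thesis by (rule order_trans) simp
    next
      case False
      then have d: "\<delta> \<le> norm \<xi>" by simp
      have "cmod (G \<xi> * fi \<psi> \<xi> - G \<xi> * ?A * hat_periodization \<psi> \<xi>) \<le> ?g * ?f + ?g * (cmod ?A * cmod (hat_periodization \<psi> \<xi>))"
        by (rule order_trans[OF norm_triangle_ineq4]) (simp add: norm_mult)
      also have "\<dots> \<le> error_const * (norm \<xi> ^ (N + 1) * ?g * ?f) + ?g * cmod (hat_periodization \<psi> \<xi>)"
      proof (rule add_mono)
        have "1 \<le> (norm \<xi> / \<delta>) ^ (N + 1)" using d delta by (intro one_le_power) simp
        also have "\<dots> = 1 / \<delta> ^ (N + 1) * norm \<xi> ^ (N + 1)" by (simp add: power_divide)
        also have "\<dots> \<le> error_const * norm \<xi> ^ (N + 1)" unfolding error_const_def using mult_nonneg_nonneg[OF M0 T0] by (intro mult_right_mono, linarith, simp)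
        finally have "1 * (?g * ?f) \<le> error_const * norm \<xi> ^ (N + 1) * (?g * ?f)" by (intro mult_right_mono) auto
        then show "?g * ?f \<le> error_const * (norm \<xi> ^ (N + 1) * ?g * ?f)" by (simp only: mult_1_left mult.assoc)
        show "?g * (cmod ?A * cmod (hat_periodization \<psi> \<xi>)) \<le> ?g * cmod (hat_periodization \<psi> \<xi>)"
          using norm_ball_mean_le[OF h, of \<xi>] by (intro mult_left_mono mult_left_le_one_le) auto
      qed
      finally have "ennreal (cmod (G \<xi> * fi \<psi> \<xi> - G \<xi> * ?A * hat_periodization \<psi> \<xi>)) \<le> ennreal (error_const * (norm \<xi> ^ (N + 1) * ?g * ?f) + ?g * cmod (hat_periodization \<psi> \<xi>))"
        by (rule ennreal_leI)
      also have "\<dots> = ennreal error_const * ennreal (norm \<xi> ^ (N + 1) * ?g * ?f) + ennreal ?g * ennreal (cmod (hat_periodization \<psi> \<xi>))"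
        using error_const_nonneg by (simp add: ennreal_mult ennreal_plus)
      also have "\<dots> \<le> ennreal error_const * ennreal (norm \<xi> ^ (N + 1) * ?g * ?f) + ennreal ?g * (\<Sum>n. ennreal (cmod (hat_product \<psi> (\<xi> + lat n))))"
        unfolding hat_periodization_def by (intro add_left_mono mult_left_mono ennreal_norm_suminf_le) simp
      finally show ?thesis using d by simp
    qed
  qed
qed

text \<open>\<open>r\<close> collects the tail of \<open>G\<close> along the lattice. Hoelder's
  inequality bounds \<open>r powr q\<close> by the periodization of the \<open>q\<close>-th power of
  the weighted \<open>G\<close>; swapping that periodization onto \<open>|F| powr q\<close> brings
  in the bound \<open>B\<close>.\<close>

lemma tail_weight:
  fixes G :: "real ^ 'n \<Rightarrow> complex"
  assumes G: "integrable lborel G" and W: "0 \<le> W"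
    "(\<integral>\<^sup>+\<xi>. ennreal ((norm \<xi> ^ (N + 1) * cmod (G \<xi>)) powr q) \<partial>lborel) \<le> ennreal (W powr q)"
    and Cs: "0 < Cs" "\<And>(g :: real ^ 'n \<Rightarrow> real) \<xi> v. (\<And>x. 0 \<le> g x) \<Longrightarrow> 0 \<le> v \<Longrightarrow>
      (\<Sum>n. ennreal ((norm (\<xi> + lat n) ^ (N + 1) * g (\<xi> + lat n)) powr q)) \<le> ennreal (v powr q) \<Longrightarrow>
      (\<Sum>n. ennreal (if \<delta> \<le> norm (\<xi> + lat n) then g (\<xi> + lat n) else 0)) \<le> ennreal (Cs * v)"
  defines "r \<equiv> \<lambda>\<xi>. enn2real (\<Sum>n. ennreal (if \<delta> \<le> norm (\<xi> + lat n) then cmod (G (\<xi> + lat n)) else 0))"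
  shows "(\<integral>\<^sup>+\<xi>. ennreal ((cmod (F \<xi>) * r \<xi>) powr q) \<partial>lborel) \<le> ennreal ((Cs * B powr (1 / q) * W) powr q)"
proof -
  have [measurable]: "G \<in> borel_measurable borel" using G by auto
  define V where "V \<xi> = ennreal ((norm \<xi> ^ (N + 1) * cmod (G \<xi>)) powr q)" for \<xi>
  have [measurable]: "V \<in> borel_measurable borel" unfolding V_def by measurable
  have pt: "ennreal (r \<xi> powr q) \<le> ennreal (Cs powr q) * (\<Sum>n. V (\<xi> + lat n))" for \<xi>
  proof (cases "(\<Sum>n. V (\<xi> + lat n)) = \<top>")
    \<comment> \<open>A divergent sum makes the right side infinite; this uses
      \<open>Cs > 0\<close>, since \<open>0 * \<top> = 0\<close>.\<close>
    case True
    then show ?thesis using Cs(1) by (simp add: ennreal_mult_top)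
  next
    case False
    define v where "v = enn2real (\<Sum>n. V (\<xi> + lat n)) powr (1 / q)"
    have v: "ennreal (v powr q) = (\<Sum>n. V (\<xi> + lat n))"
      using q False by (simp add: v_def powr_powr less_top)
    have "(\<Sum>n. ennreal (if \<delta> \<le> norm (\<xi> + lat n) then cmod (G (\<xi> + lat n)) else 0)) \<le> ennreal (Cs * v)"
      by (rule Cs(2)) (simp, simp add: v_def, use v[unfolded V_def] in simp)
    then have "r \<xi> \<le> Cs * v"
      unfolding r_def using Cs(1) by (intro enn2real_leI) (auto simp: v_def)
    then have "r \<xi> powr q \<le> (Cs * v) powr q" using q by (intro powr_mono2) (auto simp: r_def)
    also have "\<dots> = Cs powr q * v powr q" by (simp add: powr_mult)
    finally have "ennreal (r \<xi> powr q) \<le> ennreal (Cs powr q * v powr q)" by (rule ennreal_leI)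
    then show ?thesis by (simp add: ennreal_mult v)
  qed
  have "(\<integral>\<^sup>+\<xi>. ennreal ((cmod (F \<xi>) * r \<xi>) powr q) \<partial>lborel) \<le> (\<integral>\<^sup>+\<xi>. ennreal (Cs powr q) * (ennreal (cmod (F \<xi>) powr q) * (\<Sum>n. V (\<xi> + lat n))) \<partial>lborel)"
  proof (intro nn_integral_mono)
    fix \<xi>
    have "ennreal ((cmod (F \<xi>) * r \<xi>) powr q) = ennreal (cmod (F \<xi>) powr q) * ennreal (r \<xi> powr q)"
      by (simp add: powr_mult ennreal_mult)
    also have "\<dots> \<le> ennreal (cmod (F \<xi>) powr q) * (ennreal (Cs powr q) * (\<Sum>n. V (\<xi> + lat n)))"
      by (intro mult_left_mono pt) simp
    finally show "ennreal ((cmod (F \<xi>) * r \<xi>) powr q) \<le> ennreal (Cs powr q) * (ennreal (cmod (F \<xi>) powr q) * (\<Sum>n. V (\<xi> + lat n)))"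
      by (simp only: mult.left_commute)
  qed
  also have "\<dots> = ennreal (Cs powr q) * (\<integral>\<^sup>+\<xi>. ennreal (cmod (F \<xi>) powr q) * (\<Sum>n. V (\<xi> + lat n)) \<partial>lborel)"
    by (rule nn_integral_cmult) measurable
  also have "(\<integral>\<^sup>+\<xi>. ennreal (cmod (F \<xi>) powr q) * (\<Sum>n. V (\<xi> + lat n)) \<partial>lborel) = (\<integral>\<^sup>+\<xi>. V \<xi> * (\<Sum>n. ennreal (cmod (F (\<xi> + lat n)) powr q)) \<partial>lborel)"
    by (rule nn_integral_periodization_swap[of "\<lambda>\<xi>. ennreal (cmod (F \<xi>) powr q)" V]) measurable
  also have "\<dots> \<le> (\<integral>\<^sup>+\<xi>. V \<xi> * ennreal B \<partial>lborel)"
    unfolding F_def by (intro nn_integral_mono mult_left_mono B) simp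
  also have "\<dots> = (\<integral>\<^sup>+\<xi>. V \<xi> \<partial>lborel) * ennreal B" by (rule nn_integral_multc) measurable
  also have "ennreal (Cs powr q) * \<dots> \<le> ennreal (Cs powr q) * (ennreal (W powr q) * ennreal B)"
    unfolding V_def by (intro mult_left_mono mult_right_mono W) auto
  also have "\<dots> = ennreal (Cs powr q * (W powr q * B))" using B(1) by (simp add: ennreal_mult)
  also have "Cs powr q * (W powr q * B) = (Cs * B powr (1 / q) * W) powr q"
    using q B(1) by (simp add: powr_mult powr_powr mult_ac)
  finally show ?thesis by (simp add: mult_left_mono)
qed

text \<open>\<open>K\<close> is fixed before \<open>G\<close> and \<open>W\<close>. The scale will
  enter through \<open>W\<close> alone, which is why the final constant does not depend on
  \<open>j\<close>.\<close>

theorem lattice_approximation_test_bound: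
  "\<exists>K\<ge>0. \<forall>(G :: real ^ 'n \<Rightarrow> complex) W. integrable lborel G \<longrightarrow> 0 \<le> W \<longrightarrow>
    (\<integral>\<^sup>+\<xi>. ennreal ((norm \<xi> ^ (N + 1) * cmod (G \<xi>)) powr q) \<partial>lborel) \<le> ennreal (W powr q) \<longrightarrow>
    continuous_test_bound (\<lambda>x. fi G x - quasi G x) (K * W) q"
proof -
  obtain CH where CH: "0 \<le> CH" "\<And>(\<psi> :: real ^ 'n \<Rightarrow> complex) w W B. integrable lborel \<psi> \<Longrightarrow> (\<And>x. cmod (\<psi> x) \<le> B) \<Longrightarrow>
    w \<in> borel_measurable borel \<Longrightarrow> (\<And>\<xi>. 0 \<le> w \<xi>) \<Longrightarrow> 0 \<le> W \<Longrightarrow>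
    (\<integral>\<^sup>+\<xi>. ennreal (w \<xi> powr q) \<partial>lborel) \<le> ennreal (W powr q) \<Longrightarrow>
    (\<integral>\<^sup>+\<xi>. ennreal (w \<xi> * cmod (fi \<psi> \<xi>)) \<partial>lborel)
      \<le> ennreal (CH * W * (LINT x|lborel. cmod (\<psi> x) powr q) powr (1 / q))"
    using hausdorff_young_dual[OF q, where 'a="real ^ 'n"] by blast
  obtain Cs0 where Cs0: "0 \<le> Cs0" "\<And>(g :: real ^ 'n \<Rightarrow> real) \<xi> v. (\<And>x. 0 \<le> g x) \<Longrightarrow> 0 \<le> v \<Longrightarrow>
      (\<Sum>n. ennreal ((norm (\<xi> + lat n) ^ (N + 1) * g (\<xi> + lat n)) powr q)) \<le> ennreal (v powr q) \<Longrightarrow>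
      (\<Sum>n. ennreal (if \<delta> \<le> norm (\<xi> + lat n) then g (\<xi> + lat n) else 0)) \<le> ennreal (Cs0 * v)"
    using lattice_tail_Holder[OF q(1) p delta, of N] by blast
  \<comment> \<open>Raised by 1 to be strictly positive, as \<open>tail_weight\<close>
    demands.\<close>
  define Cs where "Cs = Cs0 + 1"
  have Cs: "0 < Cs" "\<And>(g :: real ^ 'n \<Rightarrow> real) \<xi> v. (\<And>x. 0 \<le> g x) \<Longrightarrow> 0 \<le> v \<Longrightarrow>
      (\<Sum>n. ennreal ((norm (\<xi> + lat n) ^ (N + 1) * g (\<xi> + lat n)) powr q)) \<le> ennreal (v powr q) \<Longrightarrow>
      (\<Sum>n. ennreal (if \<delta> \<le> norm (\<xi> + lat n) then g (\<xi> + lat n) else 0)) \<le> ennreal (Cs * v)"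
  proof -
    show "0 < Cs" using Cs0(1) by (simp add: Cs_def)
    fix g :: "real ^ 'n \<Rightarrow> real" and \<xi> v
    assume *: "\<And>x. 0 \<le> g x" "0 \<le> v" "(\<Sum>n. ennreal ((norm (\<xi> + lat n) ^ (N + 1) * g (\<xi> + lat n)) powr q)) \<le> ennreal (v powr q)"
    have "ennreal (Cs0 * v) \<le> ennreal (Cs * v)" using *(2) by (intro ennreal_leI mult_right_mono) (simp_all add: Cs_def)
    with Cs0(2)[OF *] show "(\<Sum>n. ennreal (if \<delta> \<le> norm (\<xi> + lat n) then g (\<xi> + lat n) else 0)) \<le> ennreal (Cs * v)"
      by (rule order_trans)
  qed
  \<comment> \<open>The two summands belong to the two terms of \<open>pointwise_error\<close>, each
    integrated against the transform of \<open>\<psi>\<close> at the cost \<open>CH\<close>.\<close>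
  define K where "K = CH * (error_const + Cs * B powr (1 / q))"
  have K0: "0 \<le> K" unfolding K_def using CH(1) error_const_nonneg Cs(1) by (intro mult_nonneg_nonneg add_nonneg_nonneg) auto
  show ?thesis
  proof (intro exI[of _ K] conjI allI impI K0)
    fix G :: "real ^ 'n \<Rightarrow> complex" and W
    assume G: "integrable lborel G" and W: "0 \<le> W"
      "(\<integral>\<^sup>+\<xi>. ennreal ((norm \<xi> ^ (N + 1) * cmod (G \<xi>)) powr q) \<partial>lborel) \<le> ennreal (W powr q)"
    have [measurable]: "G \<in> borel_measurable borel" using G by auto
    note [measurable] = quasi_measurable[OF G]
    show "continuous_test_bound (\<lambda>x. fi G x - quasi G x) (K * W) q"
    proof
      show "(\<lambda>x. fi G x - quasi G x) \<in> borel_measurable borel" by measurable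
      show "0 \<le> K * W" "1 \<le> q" using K0 W q by auto
      \<comment> \<open>\<open>fi G\<close> is bounded and the series of shifts is locally
        integrable by \<open>quasi_local\<close>.\<close>
      show "integrable lborel (\<lambda>x. indicat_real (cball 0 R) x * cmod (fi G x - quasi G x))" for R
      proof (rule integrableI_bounded)
        show "(\<lambda>x. indicat_real (cball 0 R) x * cmod (fi G x - quasi G x)) \<in> borel_measurable lborel"
          by (intro borel_measurable_times borel_measurable_indicator) (simp, measurable)
        let ?c = "LINT \<xi>|lborel. cmod (G \<xi>)"
        let ?S = "\<lambda>x. \<Sum>n. ennreal (cmod (coef G (lat n) * \<phi> (x + lat n)))"
        have "(\<integral>\<^sup>+x. ennreal (norm (indicat_real (cball 0 R) x * cmod (fi G x - quasi G x))) \<partial>lborel)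
          \<le> (\<integral>\<^sup>+x. ennreal ?c * indicator (cball 0 R) x + indicator (cball 0 R) x * ?S x \<partial>lborel)"
        proof (intro nn_integral_mono)
          fix x :: "real ^ 'n"
          have "ennreal (cmod (fi G x - quasi G x)) \<le> ennreal (cmod (fi G x) + cmod (quasi G x))"
            by (intro ennreal_leI norm_triangle_ineq4)
          also have "\<dots> = ennreal (cmod (fi G x)) + ennreal (cmod (quasi G x))" by simp
          also have "\<dots> \<le> ennreal ?c + ?S x"
            unfolding quasi_def by (intro add_mono ennreal_leI norm_fi_le ennreal_norm_suminf_le)
          finally show "ennreal (norm (indicat_real (cball 0 R) x * cmod (fi G x - quasi G x))) \<le> ennreal ?c * indicator (cball 0 R) x + indicator (cball 0 R) x * ?S x"
            by (cases "x \<in> cball 0 R") simp_all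
        qed
        also have "\<dots> = (\<integral>\<^sup>+x. ennreal ?c * indicator (cball (0 :: real ^ 'n) R) x \<partial>lborel) + (\<integral>\<^sup>+x. indicator (cball 0 R) x * ?S x \<partial>lborel)"
          by (rule nn_integral_add; intro borel_measurable_times_ennreal borel_measurable_indicator; measurable?; simp)
        also have "(\<integral>\<^sup>+x. ennreal ?c * indicator (cball (0 :: real ^ 'n) R) x \<partial>lborel) = ennreal ?c * emeasure lborel (cball (0 :: real ^ 'n) R)"
          by (rule nn_integral_cmult_indicator) simp
        also have "\<dots> + (\<integral>\<^sup>+x. indicator (cball 0 R) x * ?S x \<partial>lborel) < \<infinity>"
          using quasi_local[OF G, of R] emeasure_cball_finite[of R, where 'a="real ^ 'n"] by (simp add: ennreal_mult_less_top)
        finally show "(\<integral>\<^sup>+x. ennreal (norm (indicat_real (cball 0 R) x * cmod (fi G x - quasi G x))) \<partial>lborel) < \<infinity>" .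
      qed
      fix \<psi> :: "real ^ 'n \<Rightarrow> complex" and R
      assume \<psi>: "continuous_on UNIV \<psi>" "\<And>x. R < norm x \<Longrightarrow> \<psi> x = 0"
      interpret t: compact_test \<psi> R by standard (use \<psi> in auto)
      obtain Bp where Bp: "\<And>x. cmod (\<psi> x) \<le> Bp" using t.bounded_chi by blast
      define Y where "Y = (LINT x|lborel. cmod (\<psi> x) powr q) powr (1 / q)"
      have Y0: "0 \<le> Y" by (simp add: Y_def)
      have CHY: "(\<integral>\<^sup>+\<xi>. ennreal (w \<xi> * cmod (fi \<psi> \<xi>)) \<partial>lborel) \<le> ennreal (CH * Y * W')"
        if "w \<in> borel_measurable borel" "\<And>\<xi>. 0 \<le> w \<xi>" "0 \<le> W'" "(\<integral>\<^sup>+\<xi>. ennreal (w \<xi> powr q) \<partial>lborel) \<le> ennreal (W' powr q)" for w W'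
        using CH(2)[OF t.integrable_chi Bp that] unfolding Y_def by (simp only: mult_ac)
      note [measurable] = t.measurable_chi
      have [measurable]: "hat_product \<psi> \<in> borel_measurable borel" "hat_periodization \<psi> \<in> borel_measurable borel"
        unfolding hat_periodization_def[abs_def] hat_product_def[abs_def] by measurable
      define r where "r \<xi> = (\<Sum>n. ennreal (if \<delta> \<le> norm (\<xi> + lat n) then cmod (G (\<xi> + lat n)) else 0))" for \<xi>
      have [measurable]: "r \<in> borel_measurable borel" unfolding r_def by measurable
      define G1 where "G1 \<xi> = ennreal (if \<delta> \<le> norm \<xi> then cmod (G \<xi>) else 0)" for \<xi>
      have [measurable]: "G1 \<in> borel_measurable borel" unfolding G1_def by measurable
      have "ennreal (cmod (LINT x|lborel. (fi G x - quasi G x) * \<psi> x))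
        \<le> (\<integral>\<^sup>+\<xi>. ennreal (cmod (G \<xi> * fi \<psi> \<xi> - G \<xi> * ball_mean h \<xi> * hat_periodization \<psi> \<xi>)) \<partial>lborel)"
      proof -
        have "(LINT x|lborel. (fi G x - quasi G x) * \<psi> x) = (LINT \<xi>|lborel. G \<xi> * fi \<psi> \<xi> - G \<xi> * ball_mean h \<xi> * hat_periodization \<psi> \<xi>)"
          by (rule pairing_error[OF G t.compact_test_axioms, of "CH * Y"]) (rule CHY)
        then show ?thesis by (simp only: norm_integral_le_nn_integral)
      qed
      also have "\<dots> \<le> (\<integral>\<^sup>+\<xi>. ennreal error_const * ennreal (norm \<xi> ^ (N + 1) * cmod (G \<xi>) * cmod (fi \<psi> \<xi>)) + G1 \<xi> * (\<Sum>n. ennreal (cmod (hat_product \<psi> (\<xi> + lat n)))) \<partial>lborel)"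
        unfolding G1_def by (rule nn_integral_mono_AE[OF pointwise_error])
      also have "\<dots> = (\<integral>\<^sup>+\<xi>. ennreal error_const * ennreal (norm \<xi> ^ (N + 1) * cmod (G \<xi>) * cmod (fi \<psi> \<xi>)) \<partial>lborel) + (\<integral>\<^sup>+\<xi>. G1 \<xi> * (\<Sum>n. ennreal (cmod (hat_product \<psi> (\<xi> + lat n)))) \<partial>lborel)"
        by (rule nn_integral_add) measurable
      also have "\<dots> \<le> ennreal error_const * ennreal (CH * Y * W) + ennreal (CH * Y * (Cs * B powr (1 / q) * W))"
      proof (rule add_mono)
        have "(\<integral>\<^sup>+\<xi>. ennreal error_const * ennreal (norm \<xi> ^ (N + 1) * cmod (G \<xi>) * cmod (fi \<psi> \<xi>)) \<partial>lborel) = ennreal error_const * (\<integral>\<^sup>+\<xi>. ennreal (norm \<xi> ^ (N + 1) * cmod (G \<xi>) * cmod (fi \<psi> \<xi>)) \<partial>lborel)"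
          by (rule nn_integral_cmult) measurable
        also have "\<dots> \<le> ennreal error_const * ennreal (CH * Y * W)"
          by (intro mult_left_mono CHY W) auto
        finally show "(\<integral>\<^sup>+\<xi>. ennreal error_const * ennreal (norm \<xi> ^ (N + 1) * cmod (G \<xi>) * cmod (fi \<psi> \<xi>)) \<partial>lborel) \<le> ennreal error_const * ennreal (CH * Y * W)" .
        \<comment> \<open>The sum over shifts is moved from the transform of \<open>\<psi>\<close>
          to the tail of \<open>G\<close>, so that the Hausdorff-Young bound applies with the single
          weight \<open>|F| * r\<close>.\<close>
        have "(\<integral>\<^sup>+\<xi>. G1 \<xi> * (\<Sum>n. ennreal (cmod (hat_product \<psi> (\<xi> + lat n)))) \<partial>lborel) = (\<integral>\<^sup>+\<xi>. ennreal (cmod (hat_product \<psi> \<xi>)) * (\<Sum>n. G1 (\<xi> + lat n)) \<partial>lborel)"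
          by (rule nn_integral_periodization_swap[of G1 "\<lambda>\<xi>. ennreal (cmod (hat_product \<psi> \<xi>))"]) measurable
        also have "\<dots> = (\<integral>\<^sup>+\<xi>. ennreal (cmod (F \<xi>) * enn2real (r \<xi>) * cmod (fi \<psi> \<xi>)) \<partial>lborel)"
        \<comment> \<open>\<open>r\<close> is finite almost everywhere because \<open>G\<close> is
          integrable, so \<open>enn2real\<close> loses nothing.\<close>
        proof (rule nn_integral_cong_AE, use AE_periodization_finite[OF G] in eventually_elim)
          fix \<xi> :: "real ^ 'n" assume fin: "(\<Sum>n. ennreal (cmod (G (\<xi> + lat n)))) < \<top>"
          have "r \<xi> \<le> (\<Sum>n. ennreal (cmod (G (\<xi> + lat n))))"
            unfolding r_def by (intro suminf_le) auto
          then have "r \<xi> < \<top>" using fin by (rule le_less_trans)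
          then have "(\<Sum>n. G1 (\<xi> + lat n)) = ennreal (enn2real (r \<xi>))" unfolding G1_def r_def by simp
          then have "ennreal (cmod (hat_product \<psi> \<xi>)) * (\<Sum>n. G1 (\<xi> + lat n)) = ennreal (cmod (hat_product \<psi> \<xi>) * enn2real (r \<xi>))"
            by (simp add: ennreal_mult)
          then show "ennreal (cmod (hat_product \<psi> \<xi>)) * (\<Sum>n. G1 (\<xi> + lat n)) = ennreal (cmod (F \<xi>) * enn2real (r \<xi>) * cmod (fi \<psi> \<xi>))"
            by (simp only: hat_product_def norm_mult mult_ac)
        qed
        also have "\<dots> \<le> ennreal (CH * Y * (Cs * B powr (1 / q) * W))"
        proof (rule CHY)
          show "(\<integral>\<^sup>+\<xi>. ennreal ((cmod (F \<xi>) * enn2real (r \<xi>)) powr q) \<partial>lborel) \<le> ennreal ((Cs * B powr (1 / q) * W) powr q)"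
            unfolding r_def by (rule tail_weight[OF G W Cs])
        qed (use Cs(1) W in auto)
        finally show "(\<integral>\<^sup>+\<xi>. G1 \<xi> * (\<Sum>n. ennreal (cmod (hat_product \<psi> (\<xi> + lat n)))) \<partial>lborel) \<le> ennreal (CH * Y * (Cs * B powr (1 / q) * W))" .
      qed
      also have "\<dots> = ennreal (K * W * Y)"
        using error_const_nonneg CH(1) Y0 W(1) Cs(1)
        by (simp add: K_def ennreal_mult[symmetric] ennreal_plus[symmetric] algebra_simps del: ennreal_plus)
      finally show "cmod (LINT x|lborel. (fi G x - quasi G x) * \<psi> x) \<le> K * W * (LINT x|lborel. cmod (\<psi> x) powr q) powr (1 / q)"
        unfolding Y_def[symmetric] using K0 W(1) Y0 by (subst (asm) ennreal_le_iff) auto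
    qed
  qed
qed

end

section \<open>Linear changes of variables\<close>

lemma Basis_axis: "(Basis :: (real ^ 'n::finite) set) = range (\<lambda>i. axis i 1)"
  by (auto simp: Basis_vec_def)

lemma prod_Basis_axis: "(\<Prod>b\<in>(Basis :: (real ^ 'n::finite) set). F b) = (\<Prod>i\<in>UNIV. F (axis i 1))"
  unfolding Basis_axis by (subst prod.reindex) (auto intro!: injI simp: axis_eq_axis)

lemma matrix_vector_measurable [measurable]: "(\<lambda>x. (A :: real ^ 'n ^ 'm) *v x) \<in> borel_measurable borel"
  by (intro borel_measurable_continuous_onI matrix_vector_mult_linear_continuous_on)

(* Translation invariance in the m-th coordinate, the others being fixed by Tonelli. *)
lemma nn_integral_shear:
  fixes f :: "real ^ 'n::finite \<Rightarrow> ennreal"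
  assumes f [measurable]: "f \<in> borel_measurable borel" and mn: "m \<noteq> n"
  shows "(\<integral>\<^sup>+x. f (x + (x $ n) *\<^sub>R axis m 1) \<partial>lborel) = (\<integral>\<^sup>+x. f x \<partial>lborel)"
proof -
  interpret product_sigma_finite "\<lambda>_::real ^ 'n. lborel :: real measure" ..
  define e where "e = (axis m 1 :: real ^ 'n)"
  define I where "I = (Basis :: (real ^ 'n) set) - {e}"
  have BI: "Basis = insert e I" and eI: "e \<notin> I" and fI: "finite I"
    unfolding I_def e_def Basis_axis by auto
  \<comment> \<open>The right side is free of \<open>c\<close>; comparing \<open>c = 1\<close> with
    \<open>c = 0\<close> gives the claim.\<close>
  have key: "(\<integral>\<^sup>+x. f (x + (c * (x $ n)) *\<^sub>R e) \<partial>lborel)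
      = (\<integral>\<^sup>+u. (\<integral>\<^sup>+y. f ((\<Sum>b\<in>I. u b *\<^sub>R b) + y *\<^sub>R e) \<partial>lborel) \<partial>Pi\<^sub>M I (\<lambda>_. lborel))" for c :: real
  proof -
    have [measurable]: "(\<lambda>u. \<Sum>b\<in>Basis. u b *\<^sub>R b) \<in> borel_measurable (Pi\<^sub>M (Basis :: (real ^ 'n) set) (\<lambda>_. lborel))"
      by measurable
    have "(\<lambda>x. x + (c * (x $ n)) *\<^sub>R e) \<in> borel_measurable borel"
      by (intro borel_measurable_continuous_onI continuous_intros)
    from measurable_compose[OF this f]
    have H [measurable]: "(\<lambda>x. f (x + (c * (x $ n)) *\<^sub>R e)) \<in> borel_measurable borel" .
    have "(\<integral>\<^sup>+x. f (x + (c * (x $ n)) *\<^sub>R e) \<partial>lborel)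
        = (\<integral>\<^sup>+u. f ((\<Sum>b\<in>Basis. u b *\<^sub>R b) + (c * ((\<Sum>b\<in>Basis. u b *\<^sub>R b) $ n)) *\<^sub>R e) \<partial>Pi\<^sub>M Basis (\<lambda>_. lborel))"
      by (subst lborel_eq, subst nn_integral_distr) simp_all
    also have "\<dots> = (\<integral>\<^sup>+u. (\<integral>\<^sup>+y. f ((\<Sum>b\<in>Basis. (u(e := y)) b *\<^sub>R b) + (c * ((\<Sum>b\<in>Basis. (u(e := y)) b *\<^sub>R b) $ n)) *\<^sub>R e) \<partial>lborel) \<partial>Pi\<^sub>M I (\<lambda>_. lborel))"
    proof -
      have "(\<lambda>u. f ((\<Sum>b\<in>Basis. u b *\<^sub>R b) + (c * ((\<Sum>b\<in>Basis. u b *\<^sub>R b) $ n)) *\<^sub>R e)) \<in> borel_measurable (Pi\<^sub>M Basis (\<lambda>_. lborel))"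
        by (rule measurable_compose[OF _ H]) measurable
      from product_nn_integral_insert[OF fI eI, folded BI, OF this] show ?thesis .
    qed
    also have "\<dots> = (\<integral>\<^sup>+u. (\<integral>\<^sup>+y. f ((\<Sum>b\<in>I. u b *\<^sub>R b) + y *\<^sub>R e) \<partial>lborel) \<partial>Pi\<^sub>M I (\<lambda>_. lborel))"
    proof (rule nn_integral_cong)
      fix u :: "real ^ 'n \<Rightarrow> real"
      define s where "s = (\<Sum>b\<in>I. u b *\<^sub>R b)"
      have s: "(\<Sum>b\<in>Basis. (u(e := y)) b *\<^sub>R b) = s + y *\<^sub>R e" for y
      proof -
        have "(\<Sum>b\<in>I. (u(e := y)) b *\<^sub>R b) = s" unfolding s_def by (rule sum.cong) (use eI in auto)
        then show ?thesis unfolding BI using eI fI by (simp add: add.commute)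
      qed
      \<comment> \<open>\<open>m \<noteq> n\<close> makes the displacement independent of the
        coordinate being integrated.\<close>
      have en: "e $ n = 0" using mn by (simp add: e_def axis_def)
      have "(\<integral>\<^sup>+y. f (s + y *\<^sub>R e + (c * ((s + y *\<^sub>R e) $ n)) *\<^sub>R e) \<partial>lborel)
          = (\<integral>\<^sup>+y. f (s + (c * s $ n + 1 * y) *\<^sub>R e) \<partial>lborel)"
        by (simp add: en algebra_simps)
      also have "\<dots> = (\<integral>\<^sup>+y. f (s + y *\<^sub>R e) \<partial>lborel)"
        using nn_integral_real_affine[of "\<lambda>y. f (s + y *\<^sub>R e)" 1 "c * s $ n"] by simp
      finally show "(\<integral>\<^sup>+y. f ((\<Sum>b\<in>Basis. (u(e := y)) b *\<^sub>R b) + (c * ((\<Sum>b\<in>Basis. (u(e := y)) b *\<^sub>R b) $ n)) *\<^sub>R e) \<partial>lborel)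
          = (\<integral>\<^sup>+y. f ((\<Sum>b\<in>I. u b *\<^sub>R b) + y *\<^sub>R e) \<partial>lborel)"
        unfolding s by (simp only: s_def)
    qed
    finally show ?thesis .
  qed
  from key[of 1] key[of 0] show ?thesis by (simp add: e_def)
qed

text \<open>Preimages of boxes are boxes with permuted side lengths, and Lebesgue measure is
  determined by its values on boxes.\<close>

lemma nn_integral_coordinate_permutation:
  fixes f :: "real ^ 'n::finite \<Rightarrow> ennreal"
  assumes f [measurable]: "f \<in> borel_measurable borel" and \<tau>: "bij (\<tau> :: 'n \<Rightarrow> 'n)"
  shows "(\<integral>\<^sup>+x. f (\<chi> i. x $ \<tau> i) \<partial>lborel) = (\<integral>\<^sup>+x. f x \<partial>lborel)"
proof -
  define P :: "real ^ 'n \<Rightarrow> real ^ 'n" where "P x = (\<chi> i. x $ \<tau> i)" for x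
  define R :: "real ^ 'n \<Rightarrow> real ^ 'n" where "R x = (\<chi> i. x $ inv \<tau> i)" for x
  have "continuous_on UNIV P" unfolding P_def by (intro continuous_intros)
  then have [measurable]: "P \<in> borel_measurable borel" by (rule borel_measurable_continuous_onI)
  have "lborel = distr lborel borel P"
  proof (rule lborel_eqI)
    fix l u :: "real ^ 'n" assume lu: "\<And>b. b \<in> Basis \<Longrightarrow> l \<bullet> b \<le> u \<bullet> b"
    have le: "l $ i \<le> u $ i" for i using lu[of "axis i 1"] by (simp add: Basis_axis inner_axis)
    have pre: "P -` box l u = box (R l) (R u)"
    proof (intro set_eqI iffI)
      fix x assume "x \<in> P -` box l u"
      then have "l $ i < x $ \<tau> i \<and> x $ \<tau> i < u $ i" for i by (simp add: P_def mem_box_cart)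
      from this[of "inv \<tau> i" for i] show "x \<in> box (R l) (R u)"
        using \<tau> by (simp add: R_def mem_box_cart bij_is_surj surj_f_inv_f)
    next
      fix x assume "x \<in> box (R l) (R u)"
      then have "l $ inv \<tau> i < x $ i \<and> x $ i < u $ inv \<tau> i" for i by (simp add: R_def mem_box_cart)
      from this[of "\<tau> i" for i] show "x \<in> P -` box l u"
        using \<tau> by (simp add: P_def mem_box_cart bij_is_inj inv_f_f)
    qed
    have "emeasure (distr lborel borel P) (box l u) = emeasure lborel (box (R l) (R u))"
      by (subst emeasure_distr) (auto simp: pre)
    also have "\<dots> = ennreal (\<Prod>b\<in>Basis. (R u - R l) \<bullet> b)"
      by (rule emeasure_lborel_box) (auto simp: Basis_axis inner_axis R_def le)
    also have "(\<Prod>b\<in>Basis. (R u - R l) \<bullet> b) = (\<Prod>i\<in>UNIV. u $ inv \<tau> i - l $ inv \<tau> i)"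
      unfolding prod_Basis_axis by (simp add: inner_axis R_def)
    also have "\<dots> = (\<Prod>i\<in>UNIV. u $ i - l $ i)"
      by (rule prod.reindex_bij_betw[OF bij_imp_bij_inv[OF \<tau>]])
    also have "\<dots> = (\<Prod>b\<in>Basis. (u - l) \<bullet> b)"
      unfolding prod_Basis_axis by (simp add: inner_axis)
    finally show "emeasure (distr lborel borel P) (box l u) = ennreal (\<Prod>b\<in>Basis. (u - l) \<bullet> b)" .
  qed simp
  then have "(\<integral>\<^sup>+x. f x \<partial>lborel) = (\<integral>\<^sup>+x. f x \<partial>distr lborel borel P)" by (rule arg_cong)
  also have "\<dots> = (\<integral>\<^sup>+x. f (P x) \<partial>lborel)" by (rule nn_integral_distr) measurable
  finally show ?thesis by (simp add: P_def)
qed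

lemma nn_integral_diagonal:
  fixes A :: "real ^ 'n ^ 'n::finite"
  assumes f [measurable]: "f \<in> borel_measurable borel" and A: "\<And>i j. i \<noteq> j \<Longrightarrow> A $ i $ j = 0" and det: "det A \<noteq> 0"
  shows "(\<integral>\<^sup>+x. f x \<partial>lborel) = ennreal \<bar>det A\<bar> * (\<integral>\<^sup>+x. f (A *v x) \<partial>lborel)"
proof -
  have dA: "det A = (\<Prod>i\<in>UNIV. A $ i $ i)" using A by (rule det_diagonal)
  then have nz: "A $ i $ i \<noteq> 0" for i using det by simp
  define c :: "real ^ 'n \<Rightarrow> real" where "c b = (A *v b) \<bullet> b" for b
  have c: "c (axis i 1) = A $ i $ i" for i
    by (simp add: c_def inner_axis matrix_vector_mult_basis column_def)
  have Av: "(A *v x) $ i = A $ i $ i * x $ i" for x i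
  proof -
    have "(A *v x) $ i = (\<Sum>j\<in>UNIV. if j = i then A $ i $ i * x $ i else 0)"
      unfolding matrix_vector_mult_def vec_lambda_beta by (rule sum.cong) (simp_all add: A)
    then show ?thesis by simp
  qed
  have T: "0 + (\<Sum>b\<in>Basis. (c b * (x \<bullet> b)) *\<^sub>R b) = A *v x" for x
  proof (rule euclidean_eqI)
    fix b :: "real ^ 'n" assume b: "b \<in> Basis"
    then obtain i where bi: "b = axis i 1" by (auto simp: Basis_axis)
    have "(0 + (\<Sum>b\<in>Basis. (c b * (x \<bullet> b)) *\<^sub>R b)) \<bullet> b = c b * (x \<bullet> b)"
      using b by simp
    then show "(0 + (\<Sum>b\<in>Basis. (c b * (x \<bullet> b)) *\<^sub>R b)) \<bullet> b = (A *v x) \<bullet> b"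
      by (simp add: bi c inner_axis Av)
  qed
  have "lborel = density (distr lborel borel (\<lambda>x. 0 + (\<Sum>b\<in>Basis. (c b * (x \<bullet> b)) *\<^sub>R b))) (\<lambda>_. (\<Prod>b\<in>Basis. \<bar>c b\<bar>))"
    by (rule lborel_affine_euclidean) (auto simp: Basis_axis c nz)
  then have L: "lborel = density (distr lborel borel (\<lambda>x. A *v x)) (\<lambda>_. ennreal \<bar>det A\<bar>)"
    unfolding T prod_Basis_axis c dA abs_prod .
  from L have "(\<integral>\<^sup>+x. f x \<partial>lborel) = (\<integral>\<^sup>+x. f x \<partial>density (distr lborel borel (\<lambda>x. A *v x)) (\<lambda>_. ennreal \<bar>det A\<bar>))"
    by (rule arg_cong)
  also have "\<dots> = (\<integral>\<^sup>+x. ennreal \<bar>det A\<bar> * f (A *v x) \<partial>lborel)"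
    by (subst nn_integral_density) (auto simp: nn_integral_distr)
  also have "\<dots> = ennreal \<bar>det A\<bar> * (\<integral>\<^sup>+x. f (A *v x) \<partial>lborel)" by (rule nn_integral_cmult) measurable
  finally show ?thesis .
qed

(* The change of variables theorem of HOL-Analysis requires a well-ordered index type, hence the
   decomposition into elementary matrices here. *)
lemma nn_integral_invertible_matrix:
  fixes A :: "real ^ 'n ^ 'n::finite"
  shows "det A \<noteq> 0 \<Longrightarrow> f \<in> borel_measurable borel \<Longrightarrow>
    (\<integral>\<^sup>+x. f x \<partial>lborel) = ennreal \<bar>det A\<bar> * (\<integral>\<^sup>+x. f (A *v x) \<partial>lborel)"
proof (induction A arbitrary: f rule: induct_matrix_elementary_alt)
  case (1 A B)
  note [measurable] = 1(4)
  have AB: "det A \<noteq> 0" "det B \<noteq> 0" using 1(3) by (auto simp: det_mul)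
  have "(\<integral>\<^sup>+x. f x \<partial>lborel) = ennreal \<bar>det A\<bar> * (ennreal \<bar>det B\<bar> * (\<integral>\<^sup>+x. f (A *v (B *v x)) \<partial>lborel))"
    unfolding 1(1)[OF AB(1) 1(4)] by (subst 1(2)[OF AB(2)]) simp_all
  then show ?case
    by (simp add: det_mul abs_mult ennreal_mult matrix_vector_mul_assoc mult.assoc)
next
  case (2 A i)
  then show ?case using det_zero_row(2) by metis
next
  case (3 A)
  then show ?case by (intro nn_integral_diagonal)
next
  \<comment> \<open>The identity with two columns exchanged: determinant of modulus 1, acting as a
    permutation of coordinates.\<close>
  case (4 m n)
  define P :: "real ^ 'n ^ 'n" where "P = (\<chi> i j. mat 1 $ i $ Transposition.transpose m n j)"
  have "P = (\<chi> i j. (mat 1 :: real ^ 'n ^ 'n) $ i $ Transposition.transpose m n j)" by (simp add: P_def)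
  then have "det P = of_int (sign (Transposition.transpose m n)) * det (mat 1 :: real ^ 'n ^ 'n)"
    by (simp only:) (rule det_permute_columns[OF permutes_swap_id], auto)
  then have dP: "\<bar>det P\<bar> = 1" by (simp add: sign_def)
  have Pv: "P *v x = (\<chi> i. x $ Transposition.transpose m n i)" for x
  proof (rule vec_eq_iff[THEN iffD2, rule_format])
    fix i
    have "(P *v x) $ i = (\<Sum>j\<in>UNIV. if j = Transposition.transpose m n i then x $ j else 0)"
      unfolding matrix_vector_mult_def P_def mat_def vec_lambda_beta
      by (intro sum.cong refl) (auto simp: Transposition.transpose_def split: if_splits)
    then show "(P *v x) $ i = (\<chi> i. x $ Transposition.transpose m n i) $ i" by simp
  qed
  show ?case
    unfolding P_def[symmetric] dP Pv
    using nn_integral_coordinate_permutation[OF 4(3) permutes_bij[OF permutes_swap_id[OF UNIV_I UNIV_I, of m n]]] by simp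
next
  \<comment> \<open>The identity with row \<open>n\<close> added to row \<open>m\<close>:
    determinant 1, acting as a shear.\<close>
  case (5 m n)
  define P :: "real ^ 'n ^ 'n" where "P = (\<chi> i j. of_bool (i = m \<and> j = n \<or> i = j))"
  have "P = (\<chi> k. if k = m then row m (mat 1) + 1 *s row n (mat 1) else row k (mat 1))"
    using 5(1) by (auto simp: P_def vec_eq_iff row_def mat_def)
  then have "det P = det (mat 1 :: real ^ 'n ^ 'n)" by (simp only:) (rule det_row_operation[OF 5(1)])
  then have dP: "det P = 1" by simp
  have Pv: "P *v x = x + (x $ n) *\<^sub>R axis m 1" for x
  proof (rule vec_eq_iff[THEN iffD2, rule_format])
    fix i
    have "(P *v x) $ i = (\<Sum>j\<in>UNIV. (if j = i then x $ j else 0) + (if j = n then if i = m then x $ j else 0 else 0))"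
      unfolding matrix_vector_mult_def P_def vec_lambda_beta using 5(1) by (intro sum.cong) auto
    then show "(P *v x) $ i = (x + (x $ n) *\<^sub>R axis m 1) $ i"
      by (simp add: sum.distrib axis_def)
  qed
  show ?case
    unfolding P_def[symmetric] dP Pv
    using nn_integral_shear[OF 5(3) 5(1)] by simp
qed

section \<open>Representatives, exponents and dilates\<close>

text \<open>Fubini arguments and substitutions run on Borel functions; this replaces the Lebesgue
  measurable data by Borel ones up to null sets.\<close>

lemma lebesgue_borel_representative:
  fixes f :: "'a::euclidean_space \<Rightarrow> complex"
  assumes f: "f \<in> borel_measurable lebesgue"
  shows "\<exists>f0 \<in> borel_measurable borel. AE x in lborel. f x = f0 x"
proof -
  have "(\<lambda>x. Re (f x)) \<in> borel_measurable lebesgue" "(\<lambda>x. Im (f x)) \<in> borel_measurable lebesgue"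
    using f by (auto intro: borel_measurable_Re borel_measurable_Im measurable_compose[OF f])
  then obtain a b where ab: "a \<in> borel_measurable lborel" "b \<in> borel_measurable lborel"
    "AE x in lborel. Re (f x) = a x" "AE x in lborel. Im (f x) = b x"
    using completion_ex_borel_measurable_real by metis
  have [measurable]: "a \<in> borel_measurable borel" "b \<in> borel_measurable borel" using ab by auto
  show ?thesis
  proof (rule bexI)
    show "AE x in lborel. f x = of_real (a x) + \<i> * of_real (b x)"
      using ab(3,4) by eventually_elim (simp add: complex_eq_iff)
    show "(\<lambda>x. of_real (a x) + \<i> * of_real (b x)) \<in> borel_measurable borel" by measurable
  qed
qed

text \<open>Completeness of \<open>lebesgue\<close>: on the exceptional set every preimage is a
  subset of a null set.\<close>

lemma lebesgue_measurable_AE_eq: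
  fixes f g :: "'a::euclidean_space \<Rightarrow> complex"
  assumes f: "f \<in> borel_measurable borel" and ae: "AE x in lborel. f x = g x"
  shows "g \<in> borel_measurable lebesgue"
proof (rule measurableI)
  have "AE x in lebesgue. f x = g x" using ae by (simp add: AE_completion_iff)
  then obtain N where N: "{x \<in> space lebesgue. f x \<noteq> g x} \<subseteq> N" "N \<in> null_sets lebesgue"
    by (auto elim!: AE_E simp: null_sets_def)
  fix A :: "complex set" assume A: "A \<in> sets borel"
  have fg: "f x = g x" if "x \<notin> N" for x using subsetD[OF N(1), of x] that by (cases "f x = g x") simp_all
  have "g -` A = (f -` A - N) \<union> (g -` A \<inter> N)" 
    by (intro set_eqI) (simp, metis fg)
  moreover have "(f -` A - N) \<union> (g -` A \<inter> N) \<in> sets lebesgue"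
  proof (rule sets.Un[OF sets.Diff negligible_imp_sets])
    show "f -` A \<in> sets lebesgue" using measurable_sets[OF borel_lebesgue[OF f] A] by simp
    show "N \<in> sets lebesgue" using N(2) by (rule null_setsD2)
    show "negligible (g -` A \<inter> N)"
      by (rule negligible_subset[OF N(2)[folded negligible_iff_null_sets]]) simp
  qed
  ultimately show "g -` A \<inter> space lebesgue \<in> sets lebesgue" by simp
qed simp

lemma fourier_eq_fi:
  fixes f :: "real ^ 'n::finite \<Rightarrow> complex"
  assumes f0: "f0 \<in> borel_measurable borel" and ae: "AE x in lborel. f x = f0 x"
  shows "fourier f \<xi> = fi f0 (- \<xi>)"
proof -
  have e: "exp (- 2 * of_real pi * \<i> * of_real (x \<bullet> \<xi>)) = ek x (- \<xi>)" for x
    by (simp add: ek_def cis_conv_exp mult_ac)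
  have m: "f \<in> borel_measurable lebesgue"
    using ae by (intro lebesgue_measurable_AE_eq[OF f0]) (auto elim: eventually_mono)
  have k: "(\<lambda>x. ek x (- \<xi>)) \<in> borel_measurable borel" by measurable
  have "fourier f \<xi> = (LINT x|lebesgue. f0 x * ek x (- \<xi>))"
    unfolding fourier_def e
  proof (rule integral_cong_AE)
    show "(\<lambda>x. f x * ek x (- \<xi>)) \<in> borel_measurable lebesgue"
      by (intro borel_measurable_times m borel_lebesgue[OF k])
    show "(\<lambda>x. f0 x * ek x (- \<xi>)) \<in> borel_measurable lebesgue"
      by (intro borel_measurable_times borel_lebesgue f0 k)
    show "AE x in lebesgue. f x * ek x (- \<xi>) = f0 x * ek x (- \<xi>)"
      unfolding AE_completion_iff using ae by eventually_elim simp
  qed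
  also have "\<dots> = fi f0 (- \<xi>)"
    unfolding fi_def by (rule integral_completion) (use f0 k in \<open>auto intro: borel_measurable_times\<close>)
  finally show ?thesis .
qed

text \<open>To be used with \<open>Q\<close> the power \<open>matpow M j\<close> and
  \<open>S\<close> its inverse; the transposed pair acts on the frequency side.\<close>

locale invertible_pair =
  fixes Q S :: "real ^ 'n ^ 'n::finite"
  assumes inv: "Q ** S = mat 1" "S ** Q = mat 1"
begin

lemma det_inv: "\<bar>det Q\<bar> * \<bar>det S\<bar> = 1" "0 < \<bar>det Q\<bar>"
proof -
  have dd: "det Q * det S = 1" using arg_cong[OF inv(1), of det] by (simp add: det_mul)
  then show "\<bar>det Q\<bar> * \<bar>det S\<bar> = 1" by (simp add: abs_mult[symmetric])
  show "0 < \<bar>det Q\<bar>" using dd by auto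
qed

lemma nn_integral_matrix:
  assumes "f \<in> borel_measurable borel"
  shows "(\<integral>\<^sup>+x. f x \<partial>lborel) = ennreal \<bar>det Q\<bar> * (\<integral>\<^sup>+x. f (Q *v x) \<partial>lborel)"
  by (rule nn_integral_invertible_matrix[OF _ assms]) (use det_inv(2) in simp)

lemma lborel_matrix_image: "lborel = density (distr lborel borel (\<lambda>x. Q *v x)) (\<lambda>_. ennreal \<bar>det Q\<bar>)"
proof (rule measure_eqI)
  fix A :: "(real ^ 'n) set" assume "A \<in> sets lborel"
  then have [measurable]: "A \<in> sets borel" by simp
  have "emeasure lborel A = (\<integral>\<^sup>+x. indicator A x \<partial>lborel)" by simp
  also have "\<dots> = ennreal \<bar>det Q\<bar> * (\<integral>\<^sup>+x. indicator A (Q *v x) \<partial>lborel)"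
    by (rule nn_integral_matrix) measurable
  also have "\<dots> = (\<integral>\<^sup>+x. ennreal \<bar>det Q\<bar> * indicator A x \<partial>distr lborel borel (\<lambda>x. Q *v x))"
    by (subst nn_integral_distr, measurable) (simp add: nn_integral_cmult)
  also have "\<dots> = emeasure (density (distr lborel borel (\<lambda>x. Q *v x)) (\<lambda>_. ennreal \<bar>det Q\<bar>)) A"
    by (subst emeasure_density) simp_all
  finally show "emeasure lborel A = emeasure (density (distr lborel borel (\<lambda>x. Q *v x)) (\<lambda>_. ennreal \<bar>det Q\<bar>)) A" .
qed simp

lemma integral_matrix:
  fixes f :: "real ^ 'n \<Rightarrow> complex"
  assumes [measurable]: "f \<in> borel_measurable borel"
  shows "(LINT x|lborel. f x) = of_real \<bar>det Q\<bar> * (LINT x|lborel. f (Q *v x))"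
proof -
  have "(LINT x|lborel. f x) = (LINT x|density (distr lborel borel (\<lambda>x. Q *v x)) (\<lambda>_. ennreal \<bar>det Q\<bar>). f x)"
    by (rule arg_cong[OF lborel_matrix_image])
  also have "\<dots> = (LINT x|distr lborel borel (\<lambda>x. Q *v x). \<bar>det Q\<bar> *\<^sub>R f x)"
    by (rule integral_density) simp_all
  also have "\<dots> = (LINT x|lborel. \<bar>det Q\<bar> *\<^sub>R f (Q *v x))"
    by (rule integral_distr) simp_all
  finally show ?thesis by (simp add: scaleR_conv_of_real)
qed

lemma integrable_matrix:
  fixes f :: "real ^ 'n \<Rightarrow> complex"
  assumes f: "integrable lborel f" shows "integrable lborel (\<lambda>x. f (Q *v x))"
proof (rule integrableI_bounded)
  have [measurable]: "f \<in> borel_measurable borel" using f by auto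
  show "(\<lambda>x. f (Q *v x)) \<in> borel_measurable lborel" by measurable
  have "ennreal \<bar>det Q\<bar> * (\<integral>\<^sup>+x. ennreal (cmod (f (Q *v x))) \<partial>lborel) < \<infinity>"
    using f nn_integral_matrix[of "\<lambda>x. ennreal (cmod (f x))"] by (simp add: integrable_iff_bounded)
  then show "(\<integral>\<^sup>+x. ennreal (cmod (f (Q *v x))) \<partial>lborel) < \<infinity>"
    using det_inv(2) by (auto simp: ennreal_mult_less_top)
qed

lemma AE_matrix:
  assumes "AE x in lborel. P x" shows "AE x in lborel. P (Q *v x)"
proof -
  have "AE x in density (distr lborel borel (\<lambda>x. Q *v x)) (\<lambda>_. ennreal \<bar>det Q\<bar>). P x"
    using assms unfolding lborel_matrix_image[symmetric] .
  then have "AE x in distr lborel borel (\<lambda>x. Q *v x). P x"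
    using det_inv(2) by (subst (asm) AE_density) auto
  then show ?thesis by (rule AE_distrD[rotated]) measurable
qed

lemma transpose_pair: "invertible_pair (transpose Q) (transpose S)"
  by standard (simp_all add: matrix_transpose_mul[symmetric] inv transpose_mat)

end

section \<open>Integrability of the data and conjugate exponents\<close>

lemma suminf_Zd_ennreal:
  fixes F :: "real ^ 'n::finite \<Rightarrow> ennreal"
  shows "(\<Sum>\<^sub>\<infinity>k\<in>Zd. F k) = (\<Sum>n. F (lat n))"
proof -
  have "(\<Sum>\<^sub>\<infinity>k\<in>Zd. F k) = (\<Sum>\<^sub>\<infinity>n\<in>UNIV. F (lat n))" by (rule infsum_reindex_bij_betw[OF bij_lat, symmetric])
  moreover have "(\<lambda>n. F (lat n)) summable_on UNIV" by (rule nonneg_summable_on_complete) simp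
  then have "((\<lambda>n. F (lat n)) has_sum (\<Sum>\<^sub>\<infinity>n\<in>UNIV. F (lat n))) UNIV" by (rule has_sum_infsum)
  then have "(\<lambda>n. F (lat n)) sums (\<Sum>\<^sub>\<infinity>n\<in>UNIV. F (lat n))" by (rule has_sum_imp_sums)
  ultimately show ?thesis using sums_unique by metis
qed

lemma epowr_finite: "epowr x r < \<infinity> \<Longrightarrow> x < \<infinity>"
  unfolding epowr_def by (auto split: if_splits simp: less_top)

lemma epowr_ennreal: "0 \<le> a \<Longrightarrow> epowr (ennreal a) r = ennreal (a powr r)"
  by (simp add: epowr_def)

lemma le_epowr_plus_1: "1 \<le> r \<Longrightarrow> x \<le> 1 + epowr x r"
proof -
  assume r: "1 \<le> r"
  show ?thesis
  proof (cases x)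
    case (real a)
    have "a \<le> 1 + a powr r"
    proof (cases "1 \<le> a")
      case True
      then have "a powr 1 \<le> a powr r" using r by (intro powr_mono) auto
      then show ?thesis using True by simp
    qed (use real in \<open>auto intro: add_increasing2\<close>)
    then have "ennreal a \<le> ennreal (1 + a powr r)" by (rule ennreal_leI)
    then show ?thesis using real by (simp add: epowr_ennreal ennreal_plus)
  qed (simp add: epowr_def)
qed

text \<open>On the torus, of measure 1, \<open>L_p\<close> control of the periodization gives
  \<open>L_1\<close> control, and by tiling the \<open>L_1\<close> norm of \<open>\<phi>0\<close> is
  the integral of its periodization over a fundamental cube.\<close>

lemma calLp_integrable:
  fixes \<phi> \<phi>0 :: "real ^ 'n::finite \<Rightarrow> complex"
  assumes phi: "\<phi> \<in> calLp p" and p: "1 \<le> p"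
    and phi0 [measurable]: "\<phi>0 \<in> borel_measurable borel" and ae: "AE x in lborel. \<phi> x = \<phi>0 x"
  shows "integrable lborel \<phi>0"
proof -
  define \<Phi> where "\<Phi> x = (\<Sum>n. ennreal (cmod (\<phi>0 (x + lat n))))" for x
  have [measurable]: "\<Phi> \<in> borel_measurable borel" unfolding \<Phi>_def by measurable
  have "AE x in lborel. \<phi> (x + lat n) = \<phi>0 (x + lat n)" for n
    using AE_lborel_translate[OF ae, of "lat n"] by (simp add: add.commute)
  then have "AE x in lborel. \<forall>n. \<phi> (x + lat n) = \<phi>0 (x + lat n)" unfolding AE_all_countable by blast
  then have ae\<Phi>: "AE x in lborel. (\<Sum>\<^sub>\<infinity>k\<in>Zd. ennreal (cmod (\<phi> (x + k)))) = \<Phi> x"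
    by eventually_elim (simp add: suminf_Zd_ennreal \<Phi>_def)
  have tor: "torus \<inter> space lebesgue \<in> sets lebesgue" unfolding torus_cbox by simp
  have torb [measurable]: "(torus :: (real ^ 'n) set) \<in> sets borel" unfolding torus_cbox by simp
  have fin: "eLp_norm (lebesgue_on torus) p (\<lambda>x. \<Sum>\<^sub>\<infinity>k\<in>Zd. ennreal (cmod (\<phi> (x + k)))) < \<infinity>"
    using phi by (simp add: calLp_def)
  have "(\<integral>\<^sup>+x. \<Phi> x * indicator torus x \<partial>lborel) < \<infinity>"
  proof (cases "p = \<infinity>")
    case True
    define c where "c = esssup (lebesgue_on (torus :: (real ^ 'n) set)) (\<lambda>x. \<Sum>\<^sub>\<infinity>k\<in>Zd. ennreal (cmod (\<phi> (x + k))))"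
    have c: "c < \<infinity>" using fin True by (simp add: eLp_norm_def c_def)
    have "AE x in lebesgue_on torus. (\<Sum>\<^sub>\<infinity>k\<in>Zd. ennreal (cmod (\<phi> (x + k)))) \<le> c" unfolding c_def by (rule esssup_AE)
    then have "AE x in lebesgue. x \<in> torus \<longrightarrow> (\<Sum>\<^sub>\<infinity>k\<in>Zd. ennreal (cmod (\<phi> (x + k)))) \<le> c"
      by (subst (asm) AE_restrict_space_iff[OF tor]) simp
    then have "AE x in lborel. x \<in> torus \<longrightarrow> (\<Sum>\<^sub>\<infinity>k\<in>Zd. ennreal (cmod (\<phi> (x + k)))) \<le> c" unfolding AE_completion_iff .
    then have "AE x in lborel. \<Phi> x * indicator torus x \<le> c * indicator torus x"
      using ae\<Phi> by eventually_elim (auto split: split_indicator)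
    then have "(\<integral>\<^sup>+x. \<Phi> x * indicator torus x \<partial>lborel) \<le> (\<integral>\<^sup>+x. c * indicator (torus :: (real ^ 'n) set) x \<partial>lborel)"
      by (rule nn_integral_mono_AE)
    also have "\<dots> = c" by (simp add: nn_integral_cmult_indicator emeasure_torus)
    finally show ?thesis using c by (rule le_less_trans)
  next
    case False
    define P where "P = enn2real p"
    have P: "1 \<le> P" unfolding P_def using enn2real_mono[OF p] False by (simp add: less_top)
    have "(\<integral>\<^sup>+x. epowr (\<Sum>\<^sub>\<infinity>k\<in>Zd. ennreal (cmod (\<phi> (x + k)))) P \<partial>lebesgue_on torus) < \<infinity>"
      using fin False epowr_finite by (simp add: eLp_norm_def P_def)
    then have "(\<integral>\<^sup>+x. epowr (\<Sum>\<^sub>\<infinity>k\<in>Zd. ennreal (cmod (\<phi> (x + k)))) P * indicator torus x \<partial>lborel) < \<infinity>"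
      by (subst (asm) nn_integral_restrict_space[OF tor]) (simp only: nn_integral_completion)
    also have "(\<integral>\<^sup>+x. epowr (\<Sum>\<^sub>\<infinity>k\<in>Zd. ennreal (cmod (\<phi> (x + k)))) P * indicator torus x \<partial>lborel) = (\<integral>\<^sup>+x. epowr (\<Phi> x) P * indicator torus x \<partial>lborel)"
      by (rule nn_integral_cong_AE) (use ae\<Phi> in \<open>eventually_elim, simp\<close>)
    finally have f2: "(\<integral>\<^sup>+x. epowr (\<Phi> x) P * indicator torus x \<partial>lborel) < \<infinity>" .
    have [measurable]: "(\<lambda>x. epowr (\<Phi> x) P) \<in> borel_measurable borel" unfolding epowr_def by measurable
    have "(\<integral>\<^sup>+x. \<Phi> x * indicator torus x \<partial>lborel) \<le> (\<integral>\<^sup>+x. indicator torus x + epowr (\<Phi> x) P * indicator torus x \<partial>lborel)"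
    proof (intro nn_integral_mono)
      fix x show "\<Phi> x * indicator torus x \<le> indicator torus x + epowr (\<Phi> x) P * indicator torus x"
        using le_epowr_plus_1[OF P, of "\<Phi> x"] by (cases "x \<in> torus") simp_all
    qed
    also have "\<dots> = (\<integral>\<^sup>+x. indicator (torus :: (real ^ 'n) set) x \<partial>lborel) + (\<integral>\<^sup>+x. epowr (\<Phi> x) P * indicator torus x \<partial>lborel)"
      by (rule nn_integral_add) measurable
    also have "\<dots> < \<infinity>" using f2 by (simp add: emeasure_torus)
    finally show ?thesis .
  qed
  moreover have "(\<integral>\<^sup>+x. ennreal (cmod (\<phi>0 x)) \<partial>lborel) = (\<integral>\<^sup>+x. indicator T0 x * \<Phi> x \<partial>lborel)"
    unfolding \<Phi>_def by (rule nn_integral_tiling) measurable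
  moreover have "(\<integral>\<^sup>+x. indicator T0 x * \<Phi> x \<partial>lborel) \<le> (\<integral>\<^sup>+x. \<Phi> x * indicator torus x \<partial>lborel)"
    using T0_subset_torus by (intro nn_integral_mono) (auto split: split_indicator)
  ultimately show ?thesis by (intro integrableI_bounded) auto
qed

lemma conjugate_exponents:
  fixes p :: ennreal and q :: real
  assumes "2 \<le> p" "1 / p + 1 / ennreal q = 1"
  shows "(p = \<infinity> \<and> q = 1) \<or> (\<exists>P. p = ennreal P \<and> 2 \<le> P \<and> 1 / P + 1 / q = 1 \<and> 1 < q \<and> q \<le> 2)"
proof (cases p)
  case top
  then have "1 / ennreal q = 1" using assms(2) by simp
  moreover have "0 < q"
  \<comment> \<open>A nonpositive \<open>q\<close> would make \<open>ennreal q = 0\<close> and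
    \<open>1 / ennreal q\<close> infinite.\<close>
  proof (rule ccontr)
    assume "\<not> 0 < q"
    then have "ennreal q = 0" by (simp add: ennreal_eq_0_iff)
    then show False using \<open>1 / ennreal q = 1\<close> by (simp add: ennreal_divide_zero)
  qed
  then have "1 / ennreal q = ennreal (1 / q)" by (metis divide_ennreal ennreal_1 zero_le_one)
  ultimately have "ennreal (1 / q) = ennreal 1" by simp
  then have "1 / q = 1" using \<open>0 < q\<close> by (subst (asm) ennreal_inj) auto
  then show ?thesis using top by simp
next
  case (real P)
  have P: "2 \<le> P" using assms(1) real by (metis ennreal_le_iff ennreal_numeral)
  have q0: "0 < q"
  proof (rule ccontr)
    assume "\<not> 0 < q"
    then have "ennreal q = 0" by (simp add: ennreal_eq_0_iff)
    then show False using assms(2) by (simp add: ennreal_divide_zero)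
  qed
  have "1 / p = ennreal (1 / P)" "1 / ennreal q = ennreal (1 / q)"
    using P q0 real by (metis divide_ennreal ennreal_1 zero_le_one less_le_trans zero_less_numeral)+
  then have "ennreal (1 / P + 1 / q) = ennreal 1" using assms(2) P q0 by (simp add: ennreal_plus)
  then have e: "1 / P + 1 / q = 1" using P q0 by (subst (asm) ennreal_inj) auto
  have "0 < 1 / P" "1 / P \<le> 1 / 2" using P by (auto simp: field_simps)
  then have "1 / q < 1" "1 / 2 \<le> 1 / q" using e by linarith+
  then have "1 < q" "q \<le> 2" using q0 by (auto simp: field_simps)
  then show ?thesis using real P e by blast
qed

text \<open>Inside the ball of radius \<open>R\<close> the power \<open>r \<le> q\<close> is
  dominated by 1 plus the \<open>q\<close>-th power; outside, the decay exponent \<open>s\<close>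
  exceeds the dimension. With \<open>n = 0\<close> and \<open>r = 1\<close> it makes
  \<open>g\<close> integrable, with \<open>n = N + 1\<close> and \<open>r = q\<close> it makes the
  moment finite.\<close>

lemma nn_integral_weighted_decay:
  fixes g :: "real ^ 'n::finite \<Rightarrow> complex"
  assumes g [measurable]: "g \<in> borel_measurable borel" and q: "1 \<le> q"
    and Lq: "(\<integral>\<^sup>+x. ennreal (cmod (g x) powr q) \<partial>lborel) < \<infinity>"
    and R: "1 \<le> R" and c: "0 \<le> c" and s: "real CARD('n) < s"
    and decay: "AE x in lborel. R \<le> norm x \<longrightarrow> norm x ^ n * cmod (g x) \<le> c * norm x powr (- s)"
    and r: "1 \<le> r" "r \<le> q"
  shows "(\<integral>\<^sup>+x. ennreal ((norm x ^ n * cmod (g x)) powr r) \<partial>lborel) < \<infinity>"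
proof -
  define A where "A = (R ^ n) powr r"
  \<comment> \<open>\<open>2 powr s\<close> comes from \<open>1 + norm x \<le> 2 * norm x\<close>
    where \<open>norm x \<ge> 1\<close>.\<close>
  define D where "D = c powr r * 2 powr s"
  have A: "0 \<le> A" and D: "0 \<le> D" by (simp_all add: A_def D_def)
  have "AE x in lborel. ennreal ((norm x ^ n * cmod (g x)) powr r)
      \<le> ennreal A * indicator (cball 0 R) x + (ennreal A * ennreal (cmod (g x) powr q) + ennreal D * ennreal ((1 + norm x) powr (- s)))"
    using decay
  proof eventually_elim
    fix x :: "real ^ 'n"
    assume dx: "R \<le> norm x \<longrightarrow> norm x ^ n * cmod (g x) \<le> c * norm x powr (- s)"
    show "ennreal ((norm x ^ n * cmod (g x)) powr r)
      \<le> ennreal A * indicator (cball 0 R) x + (ennreal A * ennreal (cmod (g x) powr q) + ennreal D * ennreal ((1 + norm x) powr (- s)))"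
    proof (cases "R \<le> norm x")
      case False
      have "(norm x ^ n * cmod (g x)) powr r \<le> (R ^ n * cmod (g x)) powr r"
        using False R r by (intro powr_mono2 mult_right_mono power_mono) auto
      also have "\<dots> = A * cmod (g x) powr r" using R by (simp add: powr_mult A_def)
      also have "cmod (g x) powr r \<le> 1 + cmod (g x) powr q"
      proof (cases "1 \<le> cmod (g x)")
        case True
        then have "cmod (g x) powr r \<le> cmod (g x) powr q" using r by (intro powr_mono) auto
        then show ?thesis by simp
      next
        case False
        then have "cmod (g x) powr r \<le> 1 powr r" using r by (intro powr_mono2) auto
        then have "cmod (g x) powr r \<le> 1" by simp
        moreover have "0 \<le> cmod (g x) powr q" by simp
        ultimately show ?thesis by linarith
      qed
      finally have "(norm x ^ n * cmod (g x)) powr r \<le> A * 1 + A * cmod (g x) powr q"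
        using A by (simp add: mult_left_mono distrib_left)
      then have "ennreal ((norm x ^ n * cmod (g x)) powr r) \<le> ennreal (A * 1 + A * cmod (g x) powr q)" by (rule ennreal_leI)
      also have "\<dots> = ennreal A * indicator (cball 0 R) x + ennreal A * ennreal (cmod (g x) powr q)"
        using False A by (simp add: ennreal_plus ennreal_mult)
      also have "\<dots> \<le> ennreal A * indicator (cball 0 R) x + (ennreal A * ennreal (cmod (g x) powr q) + ennreal D * ennreal ((1 + norm x) powr (- s)))"
        by (intro add_left_mono) simp
      finally show ?thesis .
    next
      case True
      have n1: "1 \<le> norm x" using True R by linarith
      have "(norm x ^ n * cmod (g x)) powr r \<le> (c * norm x powr (- s)) powr r"
        using dx True r by (intro powr_mono2) auto
      also have "\<dots> = c powr r * norm x powr (- s * r)" using c by (simp add: powr_mult powr_powr)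
      also have "\<dots> \<le> c powr r * norm x powr (- s)"
      proof (intro mult_left_mono powr_mono n1)
        have "s * 1 \<le> s * r" using s r by (intro mult_left_mono) auto
        then show "- s * r \<le> - s" by simp
      qed simp
      also have "norm x powr (- s) \<le> ((1 + norm x) / 2) powr (- s)"
        using n1 s by (intro powr_mono2') auto
      also have "((1 + norm x) / 2) powr (- s) = 2 powr s * (1 + norm x) powr (- s)"
        by (simp add: powr_divide powr_minus field_simps)
      finally have "(norm x ^ n * cmod (g x)) powr r \<le> D * (1 + norm x) powr (- s)"
        by (simp add: D_def mult_left_mono mult.assoc)
      then have "ennreal ((norm x ^ n * cmod (g x)) powr r) \<le> ennreal D * ennreal ((1 + norm x) powr (- s))"
        using D by (simp add: ennreal_mult[symmetric] ennreal_leI)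
      then show ?thesis by (meson add_increasing zero_le)
    qed
  qed
  then have "(\<integral>\<^sup>+x. ennreal ((norm x ^ n * cmod (g x)) powr r) \<partial>lborel)
      \<le> (\<integral>\<^sup>+x. ennreal A * indicator (cball 0 R) x + (ennreal A * ennreal (cmod (g x) powr q) + ennreal D * ennreal ((1 + norm x) powr (- s))) \<partial>lborel)"
    by (rule nn_integral_mono_AE)
  also have "\<dots> = ennreal A * emeasure lborel (cball (0 :: real ^ 'n) R)
      + (ennreal A * (\<integral>\<^sup>+x. ennreal (cmod (g x) powr q) \<partial>lborel)
      + ennreal D * (\<integral>\<^sup>+x. ennreal ((1 + norm (x :: real ^ 'n)) powr (- s)) \<partial>lborel))"
  proof -
    have m: "(\<lambda>x. ennreal (cmod (g x) powr q)) \<in> borel_measurable lborel"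
      "(\<lambda>x :: real ^ 'n. ennreal ((1 + norm x) powr (- s))) \<in> borel_measurable lborel"
      "(\<lambda>x. ennreal A * indicator (cball (0 :: real ^ 'n) R) x) \<in> borel_measurable lborel"
      by (measurable, simp_all)
    have m2: "(\<lambda>x. ennreal A * ennreal (cmod (g x) powr q)) \<in> borel_measurable lborel"
      "(\<lambda>x :: real ^ 'n. ennreal D * ennreal ((1 + norm x) powr (- s))) \<in> borel_measurable lborel" by measurable
    show ?thesis
      by (simp only: nn_integral_add[OF m(3) borel_measurable_add[OF m2]] nn_integral_add[OF m2]
            nn_integral_cmult[OF m(1)] nn_integral_cmult[OF m(2)]) (simp add: nn_integral_cmult_indicator)
  qed
  also have "\<dots> < \<infinity>"
    using Lq nn_integral_decay[where 'a = "real ^ 'n" and s = s] s emeasure_cball_finite[where 'a = "real ^ 'n" and R = R]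
    by (simp add: ennreal_mult_less_top less_top[symmetric] ennreal_add_eq_top ennreal_mult_eq_top_iff)
  finally show ?thesis .
qed

lemma finite_power_integral:
  assumes q: "1 \<le> q" and fin: "(\<integral>\<^sup>+x. F x \<partial>M) < \<infinity>"
  shows "\<exists>\<Gamma>\<ge>0. (\<integral>\<^sup>+x. F x \<partial>M) \<le> ennreal (\<Gamma> powr q)"
proof (intro exI conjI)
  define I where "I = enn2real (\<integral>\<^sup>+x. F x \<partial>M)"
  have "0 \<le> I" by (simp add: I_def)
  then have "(I powr (1 / q)) powr q = I" using q by (simp add: powr_powr)
  then show "(\<integral>\<^sup>+x. F x \<partial>M) \<le> ennreal ((enn2real (\<integral>\<^sup>+x. F x \<partial>M) powr (1 / q)) powr q)"
    unfolding I_def using fin by simp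
qed simp

lemma inner_transpose_matrix: "(transpose (A :: real ^ 'n ^ 'm) *v x) \<bullet> y = x \<bullet> (A *v y)"
  by (simp add: dot_lmul_matrix)

section \<open>Dilates of the transform and of the error\<close>

context invertible_pair
begin

definition dilate :: "(real ^ 'n \<Rightarrow> complex) \<Rightarrow> real ^ 'n \<Rightarrow> complex" where
  "dilate g \<eta> = of_real \<bar>det Q\<bar> * g (transpose Q *v \<eta>)"

lemma integrable_dilate: "integrable lborel g \<Longrightarrow> integrable lborel (dilate g)"
  unfolding dilate_def by (intro integrable_mult_right invertible_pair.integrable_matrix[OF transpose_pair])

text \<open>Substitution by \<open>transpose Q\<close>, which passes to \<open>Q\<close> in the
  other argument of the kernel; the factor \<open>|det Q|\<close> in \<open>dilate\<close> is the
  Jacobian.\<close>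

lemma fi_dilate:
  assumes g: "integrable lborel g"
  shows "fi (dilate g) (Q *v x) = fi g x"
proof -
  interpret T: invertible_pair "transpose Q" "transpose S" by (rule transpose_pair)
  have [measurable]: "g \<in> borel_measurable borel" using g by auto
  have "fi g x = of_real \<bar>det (transpose Q)\<bar> * (LINT \<eta>|lborel. g (transpose Q *v \<eta>) * ek (transpose Q *v \<eta>) x)"
    unfolding fi_def by (rule T.integral_matrix) measurable
  also have "\<dots> = (LINT \<eta>|lborel. of_real \<bar>det Q\<bar> * (g (transpose Q *v \<eta>) * ek (transpose Q *v \<eta>) x))"
    by (simp only: det_transpose integral_mult_right_zero)
  also have "\<dots> = fi (dilate g) (Q *v x)"
    unfolding fi_def dilate_def ek_def inner_transpose_matrix by (simp only: mult.assoc)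
  finally show ?thesis by simp
qed

text \<open>The substitution by \<open>transpose Q\<close> uses up one of the \<open>q\<close>
  determinant factors and leaves \<open>|det Q| powr (q - 1)\<close>; the weight costs
  \<open>\<kappa> ^ n\<close> because
  \<open>norm \<xi> \<le> \<kappa> * norm (transpose Q *v \<xi>)\<close>.\<close>

lemma nn_integral_dilate:
  assumes [measurable]: "g \<in> borel_measurable borel" and q: "1 \<le> q" and \<kappa>: "0 \<le> \<kappa>"
    and S: "\<And>x. norm (S *v x) \<le> \<kappa> * norm x" and \<Gamma>: "0 \<le> \<Gamma>"
    and b: "(\<integral>\<^sup>+\<xi>. ennreal ((norm \<xi> ^ n * cmod (g \<xi>)) powr q) \<partial>lborel) \<le> ennreal (\<Gamma> powr q)"
  shows "(\<integral>\<^sup>+\<xi>. ennreal ((norm \<xi> ^ n * cmod (dilate g \<xi>)) powr q) \<partial>lborel)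
    \<le> ennreal ((\<bar>det Q\<bar> powr (1 - 1 / q) * \<kappa> ^ n * \<Gamma>) powr q)"
proof -
  interpret T: invertible_pair "transpose Q" "transpose S" by (rule transpose_pair)
  define D where "D = \<bar>det Q\<bar>"
  have D: "0 < D" using det_inv(2) by (simp add: D_def)
  define F where "F \<xi> = (norm \<xi> ^ n * cmod (g \<xi>)) powr q" for \<xi>
  have F0: "0 \<le> F \<xi>" for \<xi> by (simp add: F_def)
  have Fm [measurable]: "(\<lambda>\<xi>. ennreal (F \<xi>)) \<in> borel_measurable borel" unfolding F_def by measurable
  define E where "E = (\<kappa> ^ n) powr q * D powr (q - 1)"
  have E: "0 \<le> E" by (simp add: E_def)
  have le: "(norm \<xi> ^ n * cmod (dilate g \<xi>)) powr q \<le> E * (D * F (transpose Q *v \<xi>))" for \<xi>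
  proof -
    have "\<xi> = transpose S *v (transpose Q *v \<xi>)" by (simp only: matrix_vector_mul_assoc T.inv matrix_vector_mul_lid)
    then have "norm \<xi> \<le> \<kappa> * norm (transpose Q *v \<xi>)"
      using norm_transpose_le[OF S, of "transpose Q *v \<xi>"] by simp
    then have "norm \<xi> ^ n \<le> (\<kappa> * norm (transpose Q *v \<xi>)) ^ n" by (intro power_mono) auto
    then have "norm \<xi> ^ n * cmod (dilate g \<xi>) \<le> (\<kappa> * norm (transpose Q *v \<xi>)) ^ n * cmod (dilate g \<xi>)"
      by (rule mult_right_mono) simp
    also have "\<dots> = \<kappa> ^ n * (D * (norm (transpose Q *v \<xi>) ^ n * cmod (g (transpose Q *v \<xi>))))"
      by (simp add: dilate_def norm_mult power_mult_distrib D_def)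
    finally have "(norm \<xi> ^ n * cmod (dilate g \<xi>)) powr q
        \<le> (\<kappa> ^ n * (D * (norm (transpose Q *v \<xi>) ^ n * cmod (g (transpose Q *v \<xi>))))) powr q"
      using q by (intro powr_mono2) auto
    also have "\<dots> = (\<kappa> ^ n) powr q * (D powr q * F (transpose Q *v \<xi>))"
      using D \<kappa> by (simp add: powr_mult F_def)
    also have "D powr q = D powr (q - 1) * D" using D by (simp add: powr_diff)
    finally show ?thesis by (simp only: E_def mult.assoc)
  qed
  have "(\<integral>\<^sup>+\<xi>. ennreal ((norm \<xi> ^ n * cmod (dilate g \<xi>)) powr q) \<partial>lborel)
      \<le> (\<integral>\<^sup>+\<xi>. ennreal E * (ennreal D * ennreal (F (transpose Q *v \<xi>))) \<partial>lborel)"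
    using E D F0 by (intro nn_integral_mono) (simp add: ennreal_mult[symmetric] ennreal_leI le del: transpose_matrix_vector)
  also have "\<dots> = ennreal E * (ennreal D * (\<integral>\<^sup>+\<xi>. ennreal (F (transpose Q *v \<xi>)) \<partial>lborel))"
    by (simp add: nn_integral_cmult del: transpose_matrix_vector)
  also have "ennreal D * (\<integral>\<^sup>+\<xi>. ennreal (F (transpose Q *v \<xi>)) \<partial>lborel) = (\<integral>\<^sup>+\<xi>. ennreal (F \<xi>) \<partial>lborel)"
    using T.nn_integral_matrix[OF Fm] by (simp only: D_def det_transpose)
  also have "ennreal E * \<dots> \<le> ennreal E * ennreal (\<Gamma> powr q)"
    using b by (intro mult_left_mono) (simp_all add: F_def)
  also have "\<dots> = ennreal (E * \<Gamma> powr q)" using E by (simp add: ennreal_mult)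
  also have "E * \<Gamma> powr q = (D powr (1 - 1 / q) * \<kappa> ^ n * \<Gamma>) powr q"
  proof -
    have "(1 - 1 / q) * q = q - 1" using q by (simp add: field_simps)
    then have "(D powr (1 - 1 / q)) powr q = D powr (q - 1)" by (simp add: powr_powr)
    then show ?thesis using \<kappa> \<Gamma> by (simp add: E_def powr_mult)
  qed
  finally show ?thesis by (simp only: D_def)
qed

text \<open>The substitution \<open>t = S *v s\<close> maps the round ball onto the dilated one and
  turns \<open>f\<close> into \<open>fi (dilate g)\<close> at \<open>s - k\<close>; the
  multiplication formula then moves the integral over the ball to the frequency side, where the ball
  mean appears.\<close>

lemma ball_average_dilate:
  assumes g: "integrable lborel g" and ae: "AE x in lborel. f x = fi g x" and h: "0 < h"
  shows "of_real (\<bar>det Q\<bar> / measure lebesgue (cball (0 :: real ^ 'n) h)) *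
      (LINT t : ((\<lambda>x. S *v x) ` cball 0 h) | lebesgue. f (- (S *v k) + t))
    = fi (\<lambda>\<xi>. dilate g \<xi> * ball_mean h \<xi>) (- k)"
proof -
  interpret I: invertible_pair S Q by standard (rule inv)+
  have cfi: "continuous_on UNIV (fi g)" by (rule continuous_fi[OF g])
  have fim [measurable]: "fi g \<in> borel_measurable borel" using cfi by (rule borel_measurable_continuous_onI)
  define B where "B = (\<lambda>x. S *v x) ` cball (0 :: real ^ 'n) h"
  have mem: "S *v s \<in> B \<longleftrightarrow> s \<in> cball 0 h" for s
  proof
    assume "S *v s \<in> B"
    then obtain y where y: "y \<in> cball 0 h" "S *v s = S *v y" by (auto simp: B_def)
    have "Q *v (S *v s) = Q *v (S *v y)" using y(2) by simp
    then have "s = y" by (simp add: matrix_vector_mul_assoc inv)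
    then show "s \<in> cball 0 h" using y(1) by simp
  qed (simp add: B_def)
  have "(indicator (cball 0 h) :: real ^ 'n \<Rightarrow> complex) = (\<lambda>x. of_real (indicat_real (cball 0 h) x))"
    by (auto simp: indicator_def)
  then have ii: "integrable lborel (indicator (cball 0 h) :: real ^ 'n \<Rightarrow> complex)"
    using integrable_of_real[OF integrable_indicator_cball[of h]] by simp
  have "compact B" unfolding B_def
    by (intro compact_continuous_image matrix_vector_mult_linear_continuous_on compact_cball)
  then have [measurable]: "B \<in> sets borel" by (intro borel_compact)
  define J where "J t = indicator B t * fi g (- (S *v k) + t)" for t
  have Jm [measurable]: "J \<in> borel_measurable borel" unfolding J_def by measurable
  have aet: "AE t in lborel. f (- (S *v k) + t) = fi g (- (S *v k) + t)"
    by (rule AE_lborel_translate[OF ae])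
  have "(LINT t : B | lebesgue. f (- (S *v k) + t)) = (LINT t|lebesgue. J t)"
    unfolding set_lebesgue_integral_def
  proof (rule integral_cong_AE)
    show 1: "J \<in> borel_measurable lebesgue" by (rule borel_lebesgue[OF Jm])
    have ae2: "AE t in lborel. J t = indicator B t *\<^sub>R f (- (S *v k) + t)"
      using aet by eventually_elim (simp add: J_def indicator_def)
    show "(\<lambda>t. indicator B t *\<^sub>R f (- (S *v k) + t)) \<in> borel_measurable lebesgue"
      by (rule lebesgue_measurable_AE_eq[OF Jm ae2])
    show "AE t in lebesgue. indicator B t *\<^sub>R f (- (S *v k) + t) = J t"
      unfolding AE_completion_iff using ae2 by eventually_elim simp
  qed
  also have "\<dots> = (LINT t|lborel. J t)" by (rule integral_completion) measurable
  also have "\<dots> = of_real \<bar>det S\<bar> * (LINT s|lborel. J (S *v s))" by (rule I.integral_matrix) measurable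
  also have "(\<lambda>s. J (S *v s)) = (\<lambda>s. indicator (cball 0 h) s * fi (\<lambda>\<xi>. dilate g \<xi> * ek \<xi> (- k)) (1 *\<^sub>R s))"
  proof
    fix s
    have "- (S *v k) + S *v s = S *v (s - k)" by (simp add: matrix_vector_mult_diff_distrib)
    then have "fi g (- (S *v k) + S *v s) = fi (dilate g) (Q *v (S *v (s - k)))" by (simp only: fi_dilate[OF g])
    also have "\<dots> = fi (dilate g) (s - k)" by (simp add: matrix_vector_mul_assoc inv)
    also have "\<dots> = fi (\<lambda>\<xi>. dilate g \<xi> * ek \<xi> (- k)) s"
      unfolding fi_def ek_def by (simp add: mult.assoc cis_mult inner_diff_right algebra_simps)
    finally have "fi g (- (S *v k) + S *v s) = fi (\<lambda>\<xi>. dilate g \<xi> * ek \<xi> (- k)) s" .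
    then show "J (S *v s) = indicator (cball 0 h) s * fi (\<lambda>\<xi>. dilate g \<xi> * ek \<xi> (- k)) (1 *\<^sub>R s)"
      unfolding J_def by (simp add: indicator_def mem)
  qed
  also have "(LINT s|lborel. indicator (cball 0 h) s * fi (\<lambda>\<xi>. dilate g \<xi> * ek \<xi> (- k)) (1 *\<^sub>R s))
      = (LINT z|lborel. dilate g z * ek z (- k) * fi (indicator (cball 0 h)) (1 *\<^sub>R z))"
    by (rule fi_multiplication[OF ii integrable_ek[OF integrable_dilate[OF g]]])
  finally have e: "(LINT t : B | lebesgue. f (- (S *v k) + t))
      = of_real \<bar>det S\<bar> * (LINT z|lborel. dilate g z * ek z (- k) * fi (indicator (cball 0 h)) z)" by simp
  define V where "V = measure lborel (cball (0 :: real ^ 'n) h)"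
  have "fi (\<lambda>\<xi>. dilate g \<xi> * ball_mean h \<xi>) (- k)
      = (LINT z|lborel. (dilate g z * ek z (- k) * fi (indicator (cball 0 h)) z) / of_real V)"
    unfolding fi_def[of "\<lambda>\<xi>. dilate g \<xi> * ball_mean h \<xi>"] unfolding ball_mean_def V_def
    by (rule Bochner_Integration.integral_cong) simp_all
  also have "\<dots> = (LINT z|lborel. dilate g z * ek z (- k) * fi (indicator (cball 0 h)) z) / of_real V" by simp
  finally have e2: "fi (\<lambda>\<xi>. dilate g \<xi> * ball_mean h \<xi>) (- k) = \<dots>" .
  have d: "complex_of_real \<bar>det Q\<bar> * of_real \<bar>det S\<bar> = 1"
    using det_inv(1) by (metis of_real_1 of_real_mult)
  have "of_real (\<bar>det Q\<bar> / V) * (LINT t : B | lebesgue. f (- (S *v k) + t))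
     = (complex_of_real \<bar>det Q\<bar> * of_real \<bar>det S\<bar>) * ((LINT z|lborel. dilate g z * ek z (- k) * fi (indicator (cball 0 h)) z) / of_real V)"
    unfolding e by simp
  then show ?thesis unfolding d e2 by (simp add: V_def B_def measure_cball_lebesgue)
qed

text \<open>The substitution contributes \<open>|det Q|\<close> to the power \<open>- 1 / p\<close>,
  written with \<open>1 / p = 1 - 1 / q\<close> so that \<open>p = \<infinity>\<close> is included;
  it cancels the factor from \<open>nn_integral_dilate\<close>.\<close>

lemma Lp_norm_dilated_le:
  assumes u: "continuous_test_bound u K q"
    and pq: "(p = \<infinity> \<and> q = 1) \<or> (\<exists>P. p = ennreal P \<and> 2 \<le> P \<and> 1 / P + 1 / q = 1 \<and> 1 < q \<and> q \<le> 2)"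
    and e: "AE x in lborel. e x = u (Q *v x)"
  shows "Lp_norm p e \<le> ennreal (K * \<bar>det Q\<bar> powr (- (1 - 1 / q)))"
proof -
  interpret u: continuous_test_bound u K q by (rule u)
  have K: "0 \<le> K" by (rule u.K_nonneg)
  show ?thesis
    using pq
  proof (elim disjE conjE exE)
    assume p: "p = \<infinity>" and q: "q = 1"
    have "AE x in lborel. cmod (u (Q *v x)) \<le> K" by (rule AE_matrix[OF u.Linfty_bound[OF q]])
    then have "AE x in lborel. ennreal (cmod (e x)) \<le> ennreal K"
      using e by eventually_elim (simp add: ennreal_leI)
    then have ae: "AE x in lebesgue. ennreal (cmod (e x)) \<le> ennreal K" unfolding AE_completion_iff .
    have "(\<lambda>x. u (Q *v x)) \<in> borel_measurable borel" by measurable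
    moreover have "AE x in lborel. u (Q *v x) = e x" using e by eventually_elim simp
    ultimately have "e \<in> borel_measurable lebesgue" by (rule lebesgue_measurable_AE_eq)
    then have "(\<lambda>x. ennreal (cmod (e x))) \<in> borel_measurable lebesgue" by measurable
    from esssup_I[OF this ae] show ?thesis
      using det_inv(2) by (simp add: Lp_norm_def eLp_norm_def p q)
  next
    fix P assume p: "p = ennreal P" and P: "2 \<le> P" "1 / P + 1 / q = 1" and q: "1 < q" "q \<le> 2"
    have ub: "(\<integral>\<^sup>+x. ennreal (cmod (u x) powr P) \<partial>lborel) \<le> ennreal (K powr P)"
      using u.Lp_bound[of P] P q by simp
    define D where "D = \<bar>det Q\<bar>"
    have D: "0 < D" using det_inv(2) by (simp add: D_def)
    have "ennreal D * (\<integral>\<^sup>+x. epowr (ennreal (cmod (e x))) P \<partial>lebesgue)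
        = ennreal D * (\<integral>\<^sup>+x. ennreal (cmod (u (Q *v x)) powr P) \<partial>lborel)"
      unfolding nn_integral_completion
      by (rule arg_cong, rule nn_integral_cong_AE, use e in eventually_elim) (simp add: epowr_ennreal)
    also have "\<dots> = (\<integral>\<^sup>+x. ennreal (cmod (u x) powr P) \<partial>lborel)"
      unfolding D_def by (rule nn_integral_matrix[symmetric]) measurable
    also note ub
    finally have le: "ennreal D * (\<integral>\<^sup>+x. epowr (ennreal (cmod (e x))) P \<partial>lebesgue) \<le> ennreal (K powr P)" .
    define I where "I = (\<integral>\<^sup>+x. epowr (ennreal (cmod (e x))) P \<partial>lebesgue)"
    have "ennreal D * I < \<infinity>" using le unfolding I_def by (rule le_less_trans) simp
    then have "I \<noteq> \<infinity>" using D by (auto simp: ennreal_mult_less_top)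
    then obtain i where i: "I = ennreal i" "0 \<le> i" by (cases I) auto
    have "D * i \<le> K powr P" using le D i unfolding I_def[symmetric] by (simp add: ennreal_mult[symmetric])
    then have "i \<le> K powr P / D" using D by (simp add: field_simps)
    then have "i powr (1 / P) \<le> (K powr P / D) powr (1 / P)" using i P by (intro powr_mono2) auto
    also have "\<dots> = K * D powr (- (1 / P))"
      using K D P by (simp add: powr_divide powr_powr powr_minus field_simps)
    finally have "epowr I (1 / P) \<le> ennreal (K * D powr (- (1 / P)))"
      unfolding i(1) epowr_ennreal[OF i(2)] by (rule ennreal_leI)
    moreover have "1 / P = 1 - 1 / q" using P by linarith
    ultimately have "epowr I (1 / P) \<le> ennreal (K * D powr (- (1 - 1 / q)))" by simp
    then show ?thesis using P unfolding Lp_norm_def eLp_norm_def p I_def D_def by simp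
  qed
qed

end

section \<open>The estimate at scale \<open>j\<close>\<close>

lemma Lp_ennreal_finite:
  assumes "g \<in> Lp (ennreal q)" "0 < q"
  shows "(\<integral>\<^sup>+x. ennreal (cmod (g x) powr q) \<partial>lborel) < \<infinity>"
proof -
  have "epowr (\<integral>\<^sup>+x. epowr (ennreal (cmod (g x))) q \<partial>lebesgue) (1 / q) < \<infinity>"
    using assms by (simp add: Lp_def Lp_norm_def eLp_norm_def)
  from epowr_finite[OF this] show ?thesis by (simp add: nn_integral_completion epowr_ennreal)
qed

text \<open>Up to \<open>N + 1\<close> powers of \<open>norm \<xi>\<close> are traded against the
  decay of \<open>g\<close>; the remaining order \<open>CARD('n) + \<epsilon> - 1\<close> lies
  beyond the dimension once \<open>\<epsilon> > 1\<close>.\<close>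

lemma bigo_weighted_decay:
  fixes g :: "real ^ 'n::finite \<Rightarrow> complex"
  assumes "(\<lambda>\<xi>. cmod (g \<xi>)) \<in> O[at_infinity](\<lambda>\<xi>. norm \<xi> powr (- real N - real CARD('n) - \<epsilon>))"
  shows "\<exists>R\<ge>1. \<exists>c\<ge>0. \<forall>\<xi> n. R \<le> norm \<xi> \<longrightarrow> n \<le> N + 1 \<longrightarrow>
    norm \<xi> ^ n * cmod (g \<xi>) \<le> c * norm \<xi> powr (- (real CARD('n) + \<epsilon> - 1))"
proof -
  obtain c where c: "0 < c" "\<forall>\<^sub>F \<xi> in at_infinity. norm (cmod (g \<xi>)) \<le> c * norm (norm \<xi> powr (- real N - real CARD('n) - \<epsilon>))"
    using landau_o.bigE[OF assms] by blast
  from c(2) obtain b where b: "\<And>\<xi>. b \<le> norm \<xi> \<Longrightarrow> cmod (g \<xi>) \<le> c * norm \<xi> powr (- real N - real CARD('n) - \<epsilon>)"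
    unfolding eventually_at_infinity by auto
  show ?thesis
  proof (rule exI[of _ "max b 1"], rule conjI[OF _ exI[of _ c]], simp, intro conjI allI impI)
    fix \<xi> :: "real ^ 'n" and n assume x: "max b 1 \<le> norm \<xi>" and n: "n \<le> N + 1"
    have "norm \<xi> ^ n \<le> norm \<xi> ^ (N + 1)" using x n by (intro power_increasing) auto
    moreover have "cmod (g \<xi>) \<le> c * norm \<xi> powr (- real N - real CARD('n) - \<epsilon>)" using x by (intro b) simp
    ultimately have "norm \<xi> ^ n * cmod (g \<xi>) \<le> norm \<xi> ^ (N + 1) * (c * norm \<xi> powr (- real N - real CARD('n) - \<epsilon>))"
      by (intro mult_mono) auto
    also have "norm \<xi> ^ (N + 1) = norm \<xi> powr (real N + 1)"
      using x by (subst powr_realpow[symmetric]) (auto simp: add.commute)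
    also have "norm \<xi> powr (real N + 1) * (c * norm \<xi> powr (- real N - real CARD('n) - \<epsilon>))
        = c * norm \<xi> powr ((real N + 1) + (- real N - real CARD('n) - \<epsilon>))"
      by (simp only: powr_add mult_ac)
    also have "(real N + 1) + (- real N - real CARD('n) - \<epsilon>) = - (real CARD('n) + \<epsilon> - 1)" by simp
    finally show "norm \<xi> ^ n * cmod (g \<xi>) \<le> c * norm \<xi> powr (- (real CARD('n) + \<epsilon> - 1))" .
  qed (use c(1) in auto)
qed

theorem theorem14:
  fixes M :: "real ^ 'n ^ 'n::finite"
    and p :: ennreal and q h \<delta> \<epsilon> :: real and N :: nat
    and \<phi> f g :: "real ^ 'n \<Rightarrow> complex"
  assumes p: "of_nat CARD('n) < p" "2 \<le> p" "1 / p + 1 / ennreal q = 1"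
    and h: "0 < h"
    and M: "dilation_matrix M"
    and phi: "\<phi> \<in> calLp p"
    and phi_hat_bounded:
      "\<exists>B::real. \<forall>\<xi>. (\<Sum>\<^sub>\<infinity>k\<in>Zd. ennreal (cmod (fourier \<phi> (\<xi> + k)) powr q)) \<le> ennreal B"
    and delta: "0 < \<delta>" "\<delta> < 1 / 2"
    and phi_hat_0:
      "AE \<xi> in lebesgue. norm \<xi> < \<delta> \<longrightarrow>
         cnj (fourier \<phi> \<xi>) * dist_fourier_fun (phi_tilde h N) \<xi> = 1"
    and phi_hat_l:
      "\<forall>l\<in>Zd - {0}. AE \<xi> in lebesgue. norm (l - \<xi>) < \<delta> \<longrightarrow> fourier \<phi> \<xi> = 0"
    and g: "g \<in> Lp (ennreal q)"
    and eps: "1 < \<epsilon>"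
    and g_decay:
      "(\<lambda>\<xi>. cmod (g \<xi>)) \<in> O[at_infinity](\<lambda>\<xi>. norm \<xi> powr (- real N - real CARD('n) - \<epsilon>))"
    and f: "AE x in lebesgue. f x = fourier g (- x)"
  shows "\<forall>\<theta>>0. (\<forall>\<mu>. complex_eigenvalue M \<mu> \<longrightarrow> \<theta> < cmod \<mu>) \<longrightarrow>
    (\<exists>C::real. \<forall>j::nat.
       (AE x in lebesgue.
          (\<lambda>k. Av M h j f (- (matpow (matrix_inv M) j *v k)) * dil_shift M j k \<phi> x) summable_on Zd) \<and>
       Lp_norm p (\<lambda>x. f x - of_real (\<bar>det M\<bar> powr (- real j / 2)) *
          (\<Sum>\<^sub>\<infinity>k\<in>Zd. Av M h j f (- (matpow (matrix_inv M) j *v k)) * dil_shift M j k \<phi> x))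
       \<le> ennreal (C * \<theta> powr (- real j * (real N + 1))))"
proof (intro allI impI)
  fix \<theta> :: real assume \<theta>: "0 < \<theta>" and ev: "\<forall>\<mu>. complex_eigenvalue M \<mu> \<longrightarrow> \<theta> < cmod \<mu>"
  have pq: "(p = \<infinity> \<and> q = 1) \<or> (\<exists>P. p = ennreal P \<and> 2 \<le> P \<and> 1 / P + 1 / q = 1 \<and> 1 < q \<and> q \<le> 2)"
    by (rule conjugate_exponents[OF p(2,3)])
  then have q: "1 \<le> q" "q \<le> 2" by auto
  \<comment> \<open>For \<open>q = 1\<close>, the case \<open>p = \<infinity>\<close>, the condition
    on \<open>P\<close> is void.\<close>
  obtain P where P: "1 < q \<Longrightarrow> 1 / P + 1 / q = 1 \<and> real CARD('n) < P"
  proof -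
    have "\<exists>P. 1 < q \<longrightarrow> 1 / P + 1 / q = 1 \<and> real CARD('n) < P"
      using pq p(1) by (auto simp: ennreal_of_nat_eq_real_of_nat ennreal_less_iff)
    then show ?thesis using that by blast
  qed
  have \<phi>m: "\<phi> \<in> borel_measurable lebesgue" and gm: "g \<in> borel_measurable lebesgue"
    using phi g by (auto simp: calLp_def Lp_def)
  obtain \<phi>0 where \<phi>0 [measurable]: "\<phi>0 \<in> borel_measurable borel" and \<phi>_ae: "AE x in lborel. \<phi> x = \<phi>0 x"
    using lebesgue_borel_representative[OF \<phi>m] by blast
  obtain g0 where g0 [measurable]: "g0 \<in> borel_measurable borel" and g_ae: "AE x in lborel. g x = g0 x"
    using lebesgue_borel_representative[OF gm] by blast
  have \<phi>hat: "fourier \<phi> \<xi> = fi \<phi>0 (- \<xi>)" for \<xi> by (rule fourier_eq_fi[OF \<phi>0 \<phi>_ae])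
  have ghat: "fourier g (- x) = fi g0 x" for x using fourier_eq_fi[OF g0 g_ae, of "- x"] by simp
  have f_ae: "AE x in lborel. f x = fi g0 x" using f unfolding AE_completion_iff ghat .
  have "(1 :: ennreal) \<le> 2" by simp
  then have "1 \<le> p" using p(2) by (rule order_trans)
  from calLp_integrable[OF phi this \<phi>0 \<phi>_ae] have \<phi>i: "integrable lborel \<phi>0" .
  obtain B where B: "\<And>\<xi>. (\<Sum>\<^sub>\<infinity>k\<in>Zd. ennreal (cmod (fourier \<phi> (\<xi> + k)) powr q)) \<le> ennreal B"
    using phi_hat_bounded by blast
  \<comment> \<open>\<open>max B 0\<close> because the locale asks for a nonnegative bound, while
    \<open>ennreal B\<close> does not see the size of a negative \<open>B\<close>.\<close>
  interpret A: shift_approximation \<phi>0 h \<delta> "max B 0" q P N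
  proof (unfold_locales)
    show "(\<Sum>n. ennreal (cmod (fi \<phi>0 (- (\<xi> + lat n))) powr q)) \<le> ennreal (max B 0)" for \<xi>
      using B[of \<xi>] unfolding suminf_Zd_ennreal \<phi>hat by (rule order_trans) (simp add: ennreal_leI)
    show "AE \<xi> in lborel. norm \<xi> < \<delta> \<longrightarrow> fi \<phi>0 (- \<xi>) * ball_mean_taylor h N \<xi> = 1"
      using phi_hat_0 unfolding AE_completion_iff
    proof eventually_elim
      fix \<xi> :: "real ^ 'n"
      assume a: "norm \<xi> < \<delta> \<longrightarrow> cnj (fourier \<phi> \<xi>) * dist_fourier_fun (phi_tilde h N) \<xi> = 1"
      show "norm \<xi> < \<delta> \<longrightarrow> fi \<phi>0 (- \<xi>) * ball_mean_taylor h N \<xi> = 1"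
      proof
        assume "norm \<xi> < \<delta>"
        then have "cnj (cnj (fourier \<phi> \<xi>) * dist_fourier_fun (phi_tilde h N) \<xi>) = 1" using a by simp
        then show "fi \<phi>0 (- \<xi>) * ball_mean_taylor h N \<xi> = 1"
          by (simp only: complex_cnj_mult complex_cnj_cnj dist_fourier_fun_phi_tilde_taylor \<phi>hat)
      qed
    qed
    show "AE \<xi> in lborel. norm (lat n - \<xi>) < \<delta> \<longrightarrow> fi \<phi>0 (- \<xi>) = 0" if "lat n \<noteq> (0 :: real ^ 'n)" for n
      using bspec[OF phi_hat_l, of "lat n"] that unfolding AE_completion_iff \<phi>hat by simp
  qed (use \<phi>i h delta q P in auto)
  obtain R c where R: "1 \<le> R" and c: "0 \<le> c" and dec: "\<And>\<xi> n. R \<le> norm \<xi> \<Longrightarrow> n \<le> N + 1 \<Longrightarrow>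
      norm \<xi> ^ n * cmod (g \<xi>) \<le> c * norm \<xi> powr (- (real CARD('n) + \<epsilon> - 1))"
    using bigo_weighted_decay[OF g_decay] by blast
  have dec0: "AE x in lborel. R \<le> norm x \<longrightarrow> norm x ^ n * cmod (g0 x) \<le> c * norm x powr (- (real CARD('n) + \<epsilon> - 1))"
    if "n \<le> N + 1" for n
    using g_ae
  proof eventually_elim
    fix x assume "g x = g0 x"
    then show "R \<le> norm x \<longrightarrow> norm x ^ n * cmod (g0 x) \<le> c * norm x powr (- (real CARD('n) + \<epsilon> - 1))"
      using dec[OF _ that, of x] by simp
  qed
  have s: "real CARD('n) < real CARD('n) + \<epsilon> - 1" using eps by simp
  have "(\<integral>\<^sup>+x. ennreal (cmod (g x) powr q) \<partial>lborel) = (\<integral>\<^sup>+x. ennreal (cmod (g0 x) powr q) \<partial>lborel)"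
    by (rule nn_integral_cong_AE, use g_ae in eventually_elim) simp
  then have g0q: "(\<integral>\<^sup>+x. ennreal (cmod (g0 x) powr q) \<partial>lborel) < \<infinity>"
    using Lp_ennreal_finite[OF g] q by simp
  have gi: "integrable lborel g0"
  proof (rule integrableI_bounded)
    show "(\<integral>\<^sup>+x. ennreal (norm (g0 x)) \<partial>lborel) < \<infinity>"
      using nn_integral_weighted_decay[OF g0 q(1) g0q R c s dec0[of 0], of 1] q by simp
  qed simp
  obtain \<Gamma> where \<Gamma>: "0 \<le> \<Gamma>" "(\<integral>\<^sup>+\<xi>. ennreal ((norm \<xi> ^ (N + 1) * cmod (g0 \<xi>)) powr q) \<partial>lborel) \<le> ennreal (\<Gamma> powr q)"
    using finite_power_integral[OF q(1) nn_integral_weighted_decay[OF g0 q(1) g0q R c s dec0[of "N + 1"], of q]] q by auto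
  obtain K where K: "0 \<le> K" "\<And>(G :: real ^ 'n \<Rightarrow> complex) W. integrable lborel G \<Longrightarrow> 0 \<le> W \<Longrightarrow>
      (\<integral>\<^sup>+\<xi>. ennreal ((norm \<xi> ^ (N + 1) * cmod (G \<xi>)) powr q) \<partial>lborel) \<le> ennreal (W powr q) \<Longrightarrow>
      continuous_test_bound (\<lambda>x. fi G x - A.quasi G x) (K * W) q"
    using A.lattice_approximation_test_bound by blast
  have Minv: "invertible M" by (rule dilation_invertible[OF M])
  obtain L where L: "0 \<le> L" "\<And>j x. norm (matpow (matrix_inv M) j *v x) \<le> L * (1 / \<theta>) ^ j * norm x"
    using matpow_growth[OF Minv \<theta>] ev by blast
  show "\<exists>C::real. \<forall>j::nat.
       (AE x in lebesgue.
          (\<lambda>k. Av M h j f (- (matpow (matrix_inv M) j *v k)) * dil_shift M j k \<phi> x) summable_on Zd) \<and>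
       Lp_norm p (\<lambda>x. f x - of_real (\<bar>det M\<bar> powr (- real j / 2)) *
          (\<Sum>\<^sub>\<infinity>k\<in>Zd. Av M h j f (- (matpow (matrix_inv M) j *v k)) * dil_shift M j k \<phi> x))
       \<le> ennreal (C * \<theta> powr (- real j * (real N + 1)))"
  \<comment> \<open>\<open>K\<close> comes from the test bound, \<open>L ^ (N + 1)\<close> from the
    growth of the inverse powers, and \<open>\<Gamma>\<close> bounds the moment of \<open>g\<close>;
    none of them involves \<open>j\<close>.\<close>
  proof (intro exI[of _ "K * L ^ (N + 1) * \<Gamma>"] allI)
    fix j :: nat
    define Q where "Q = matpow M j"
    define S where "S = matpow (matrix_inv M) j"
    interpret Q: invertible_pair Q S
      by standard (simp_all add: Q_def S_def matpow_inverse[OF Minv])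
    define G where "G = Q.dilate g0"
    define \<kappa> where "\<kappa> = L * (1 / \<theta>) ^ j"
    have \<kappa>: "0 \<le> \<kappa>" using L \<theta> by (simp add: \<kappa>_def)
    have S: "norm (S *v x) \<le> \<kappa> * norm x" for x using L(2) by (simp add: S_def \<kappa>_def)
    have dQ: "\<bar>det Q\<bar> = \<bar>det M\<bar> ^ j" by (simp add: Q_def det_matpow power_abs)
    have dM: "0 < \<bar>det M\<bar>" using Minv by (simp add: invertible_det_nz)
    have Gi: "integrable lborel G" unfolding G_def by (rule Q.integrable_dilate[OF gi])
    \<comment> \<open>The moment bound for the dilated \<open>G\<close>; its determinant factor is
      cancelled by the change of variables in the \<open>L_p\<close> norm.\<close>
    define W where "W = \<bar>det Q\<bar> powr (1 - 1 / q) * \<kappa> ^ (N + 1) * \<Gamma>"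
    have W: "0 \<le> W" using \<kappa> \<Gamma> by (simp add: W_def)
    have test: "continuous_test_bound (\<lambda>x. fi G x - A.quasi G x) (K * W) q"
    proof (rule K(2)[OF Gi W])
      show "(\<integral>\<^sup>+\<xi>. ennreal ((norm \<xi> ^ (N + 1) * cmod (G \<xi>)) powr q) \<partial>lborel) \<le> ennreal (W powr q)"
        unfolding G_def W_def by (rule Q.nn_integral_dilate[OF g0 q(1) \<kappa> S \<Gamma>])
    qed
    have Av: "Av M h j f (- (S *v k)) = A.coef G k" for k
      using Q.ball_average_dilate[OF gi f_ae h, of k]
      unfolding Av_def A.coef_def G_def dQ by (simp only: S_def)
    \<comment> \<open>The factor \<open>m^(j/2)\<close> of the dilated shifts, which the factor
      \<open>m^(-j/2)\<close> in front of the sum cancels.\<close>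
    define m where "m = complex_of_real (\<bar>det M\<bar> powr (real j / 2))"
    have mm: "of_real (\<bar>det M\<bar> powr (- real j / 2)) * m = 1"
      using dM by (simp add: m_def powr_add[symmetric] flip: of_real_mult)
    define T where "T x k = Av M h j f (- (S *v k)) * dil_shift M j k \<phi> x" for x k
    have T: "T x k = m * (A.coef G k * \<phi> (Q *v x + k))" for x k
      by (simp add: T_def Av dil_shift_def m_def Q_def)
    have "AE y in lborel. \<phi> (y + lat n) = \<phi>0 (y + lat n)" for n
      using AE_lborel_translate[OF \<phi>_ae, of "lat n"] by (simp add: add.commute)
    then have "AE y in lborel. \<forall>n. \<phi> (y + lat n) = \<phi>0 (y + lat n)" unfolding AE_all_countable by blast
    then have "AE y in lborel. (\<forall>n. \<phi> (y + lat n) = \<phi>0 (y + lat n)) \<and> summable (\<lambda>n. cmod (A.coef G (lat n) * \<phi>0 (y + lat n)))"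
      using A.quasi_summable[OF Gi] by eventually_elim simp
    \<comment> \<open>The exceptional null set lives in the variable \<open>y = Q *v x\<close>, and
      linear bijections preserve null sets. Absolute convergence along the enumeration then gives
      unconditional summability over the lattice.\<close>
    from Q.AE_matrix[OF this]
    have sums: "AE x in lborel. (T x has_sum (m * A.quasi G (Q *v x))) Zd"
    proof eventually_elim
      fix x assume a: "(\<forall>n. \<phi> (Q *v x + lat n) = \<phi>0 (Q *v x + lat n)) \<and> summable (\<lambda>n. cmod (A.coef G (lat n) * \<phi>0 (Q *v x + lat n)))"
      have e: "T x (lat n) = m * (A.coef G (lat n) * \<phi>0 (Q *v x + lat n))" for n using a by (simp add: T)
      have "summable (\<lambda>n. cmod (T x (lat n)))"
        unfolding e norm_mult[of m] by (intro summable_mult) (use a in simp)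
      from infsum_lat[OF this] have "(T x has_sum (\<Sum>n. T x (lat n))) Zd" .
      also have "(\<Sum>n. T x (lat n)) = m * A.quasi G (Q *v x)"
        unfolding e A.quasi_def by (rule suminf_mult) (use a in \<open>auto intro: summable_norm_cancel\<close>)
      finally show "(T x has_sum (m * A.quasi G (Q *v x))) Zd" .
    qed
    have "AE x in lebesgue. T x summable_on Zd"
      unfolding AE_completion_iff using sums by eventually_elim (rule has_sum_imp_summable)
    moreover have "Lp_norm p (\<lambda>x. f x - of_real (\<bar>det M\<bar> powr (- real j / 2)) * (\<Sum>\<^sub>\<infinity>k\<in>Zd. T x k))
       \<le> ennreal (K * L ^ (N + 1) * \<Gamma> * \<theta> powr (- real j * (real N + 1)))"
    proof -
      have "AE x in lborel. f x - of_real (\<bar>det M\<bar> powr (- real j / 2)) * (\<Sum>\<^sub>\<infinity>k\<in>Zd. T x k)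
          = fi G (Q *v x) - A.quasi G (Q *v x)"
        using f_ae sums
      proof eventually_elim
        fix x assume fx: "f x = fi g0 x" and "(T x has_sum (m * A.quasi G (Q *v x))) Zd"
        then have "(\<Sum>\<^sub>\<infinity>k\<in>Zd. T x k) = m * A.quasi G (Q *v x)" by (intro infsumI)
        then show "f x - of_real (\<bar>det M\<bar> powr (- real j / 2)) * (\<Sum>\<^sub>\<infinity>k\<in>Zd. T x k) = fi G (Q *v x) - A.quasi G (Q *v x)"
          using mm by (simp only: mult.assoc[symmetric] G_def Q.fi_dilate[OF gi] fx mult_1)
      qed
      from Q.Lp_norm_dilated_le[OF test pq this]
      have "Lp_norm p (\<lambda>x. f x - of_real (\<bar>det M\<bar> powr (- real j / 2)) * (\<Sum>\<^sub>\<infinity>k\<in>Zd. T x k))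
          \<le> ennreal (K * W * \<bar>det Q\<bar> powr (- (1 - 1 / q)))" .
      also have "K * W * \<bar>det Q\<bar> powr (- (1 - 1 / q))
          = K * \<kappa> ^ (N + 1) * \<Gamma> * (\<bar>det Q\<bar> powr (1 - 1 / q) * \<bar>det Q\<bar> powr (- (1 - 1 / q)))"
        by (simp only: W_def mult_ac)
      also have "\<bar>det Q\<bar> powr (1 - 1 / q) * \<bar>det Q\<bar> powr (- (1 - 1 / q)) = 1"
        using Q.det_inv(2) by (simp add: powr_add[symmetric])
      also have "\<kappa> ^ (N + 1) = L ^ (N + 1) * ((1 / \<theta>) ^ j) ^ (N + 1)" by (simp only: \<kappa>_def power_mult_distrib)
      also have "((1 / \<theta>) ^ j) ^ (N + 1) = \<theta> powr (- real j * (real N + 1))"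
      proof -
        have "- real j * (real N + 1) = - real (j * (N + 1))" by (simp add: distrib_left)
        then have "\<theta> powr (- real j * (real N + 1)) = inverse (\<theta> powr (real (j * (N + 1))))"
          by (simp only: powr_minus)
        also have "\<dots> = inverse (\<theta> ^ (j * (N + 1)))" using \<theta> by (simp only: powr_realpow)
        finally show ?thesis by (simp only: power_mult power_one_over inverse_eq_divide)
      qed
      finally show ?thesis by (simp only: mult_1_left mult_1_right mult.assoc mult.commute mult.left_commute)
    qed
    ultimately show "(AE x in lebesgue.
          (\<lambda>k. Av M h j f (- (matpow (matrix_inv M) j *v k)) * dil_shift M j k \<phi> x) summable_on Zd) \<and>
       Lp_norm p (\<lambda>x. f x - of_real (\<bar>det M\<bar> powr (- real j / 2)) *
          (\<Sum>\<^sub>\<infinity>k\<in>Zd. Av M h j f (- (matpow (matrix_inv M) j *v k)) * dil_shift M j k \<phi> x))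
       \<le> ennreal (K * L ^ (N + 1) * \<Gamma> * \<theta> powr (- real j * (real N + 1)))"
      unfolding T_def S_def by (intro conjI)
  qed
qed

end
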